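(* Let $M\ge1$ be an integer, $N\ge 0$ and $G>1$, and let $\mathcal A_G$ be the single-mode quantum-limited amplifier channel of gain $G$. For the $M$-mode coherent-state probe $|\sqrt{N_1}\rangle\otimes\cdots\otimes|\sqrt{N_M}\rangle$ with $N_m\ge0$, $\sum_{m=1}^MN_m=N$, the quantum Fisher information on $G$ of the output state of $\mathcal A_G^{\otimes M}$ is $$\mathcal K_G^{\rm coh}=\frac{N}{G(2G-1)}+\frac{M}{G(G-1)} .$$ Moreover, for every classical probe with $M$ signal modes and average total signal photon number $N$, i.e. every state $$\rho_{AS}=\int d^{2M'}\boldsymbol\alpha\int d^{2M}\boldsymbol\beta\;P(\boldsymbol\alpha,\boldsymbol\beta)\,|\boldsymbol\alpha\rangle\langle\boldsymbol\alpha|_A\otimes|\boldsymbol\beta\rangle\langle\boldsymbol\beta|_S$$ with any number $M'$ of ancilla modes, $P\ge0$ a probability density on $\mathbb C^{M'}\times\mathbb C^{M}$ and $\int\int P(\boldsymbol\alpha,\boldsymbol\beta)\sum_{m=1}^M|\beta^{(m)}|^2=N$, the quantum Fisher information on $G$ of the output $(\mathrm{id}_A\otimes\mathcal A_G^{\otimes M})(\rho_{AS})$ is at most $\mathcal K_G^{\rm coh}$.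
   Context: $|\boldsymbol\alpha\rangle$, $|\boldsymbol\beta\rangle$ denote multimode coherent states, and $|\sqrt{N_m}\rangle$ is the single-mode coherent state with amplitude $\sqrt{N_m}$. The quantum-limited amplifier channel $\mathcal A_G$, $G\ge1$, maps a mode as $\hat a_{out}=\sqrt G\,\hat a_{in}+\sqrt{G-1}\,\hat e_{in}^\dagger$ with environment mode $\hat e_{in}$ in vacuum and the environment output traced out. The quantum Fisher information of a family $\rho_G$ is $\mathcal K_G=\mathrm{Tr}[\rho_G\hat L_G^2]$ with $\partial_G\rho_G=\frac12(\hat L_G\rho_G+\rho_G\hat L_G)$, equivalently $-4\,\partial^2_{G'}\mathcal F(\rho_G,\rho_{G'})|_{G'=G}$ with $\mathcal F(\rho,\sigma)=\mathrm{Tr}\sqrt{\sqrt\rho\,\sigma\sqrt\rho}$. *)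

theory Defs
  imports "HOL-Analysis.Analysis"
begin

section \<open>Square-summable vectors and operators in a fixed orthonormal basis\<close>

text \<open>
  The Hilbert space with orthonormal basis indexed by a type is the space of square-summable
  complex functions on that type.  A bounded operator is given by its matrix
  \<open>A x y = \<langle>x|A|y\<rangle>\<close>.  Inner products are antilinear in the first argument.
\<close>

type_synonym 'x vec = "'x \<Rightarrow> complex"
type_synonym 'x mat = "'x \<Rightarrow> 'x \<Rightarrow> complex"

definition ell2 :: "'x vec \<Rightarrow> bool" where
  "ell2 v \<longleftrightarrow> (\<lambda>x. (cmod (v x))\<^sup>2) summable_on UNIV"

definition inner2 :: "'x vec \<Rightarrow> 'x vec \<Rightarrow> complex" where
  "inner2 u v = (\<Sum>\<^sub>\<infinity>x. cnj (u x) * v x)"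

definition norm2 :: "'x vec \<Rightarrow> real" where
  "norm2 v = sqrt (\<Sum>\<^sub>\<infinity>x. (cmod (v x))\<^sup>2)"

definition app :: "'x mat \<Rightarrow> 'x vec \<Rightarrow> 'x vec" where
  "app A v = (\<lambda>x. \<Sum>\<^sub>\<infinity>y. A x y * v y)"

definition mult :: "'x mat \<Rightarrow> 'x mat \<Rightarrow> 'x mat" where
  "mult A B = (\<lambda>x z. \<Sum>\<^sub>\<infinity>y. A x y * B y z)"

definition adj :: "'x mat \<Rightarrow> 'x mat" where
  "adj A = (\<lambda>x y. cnj (A y x))"

definition one_mat :: "'x mat" where
  "one_mat = (\<lambda>x y. of_bool (x = y))"

definition unitary :: "'x mat \<Rightarrow> bool" where
  "unitary U \<longleftrightarrow> mult (adj U) U = one_mat \<and> mult U (adj U) = one_mat"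

definition hilbert_schmidt :: "'x mat \<Rightarrow> bool" where
  "hilbert_schmidt A \<longleftrightarrow> (\<lambda>(x, y). (cmod (A x y))\<^sup>2) summable_on UNIV"

definition tensor :: "'x mat \<Rightarrow> 'y mat \<Rightarrow> ('x \<times> 'y) mat" where
  "tensor A B = (\<lambda>(x, y) (x', y'). A x x' * B y y')"

definition trace_snd :: "('x \<times> 'y) mat \<Rightarrow> 'x mat" where
  "trace_snd A = (\<lambda>x x'. \<Sum>\<^sub>\<infinity>y. A (x, y) (x', y))"


section \<open>Quantum Fisher information\<close>

text \<open>\<open>\<rho> = \<Sum>\<^sub>k p\<^sub>k |\<psi>\<^sub>k\<rangle>\<langle>\<psi>\<^sub>k|\<close> with \<open>p\<^sub>k > 0\<close>, \<open>\<Sum>\<^sub>k p\<^sub>k = 1\<close> and orthonormal \<open>\<psi>\<^sub>k\<close>; in particular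
  \<open>\<rho>\<close> is a density operator.  Indexing the eigenvectors by a subset of the basis type is no
  restriction, since an orthonormal family is never larger than the basis.\<close>

definition spectral_decomposition ::
    "'x mat \<Rightarrow> 'x set \<Rightarrow> ('x \<Rightarrow> real) \<Rightarrow> ('x \<Rightarrow> 'x vec) \<Rightarrow> bool" where
  "spectral_decomposition \<rho> I p \<psi> \<longleftrightarrow>
     (\<forall>k\<in>I. p k > 0 \<and> ell2 (\<psi> k)) \<and>
     (\<forall>j\<in>I. \<forall>k\<in>I. inner2 (\<psi> j) (\<psi> k) = of_bool (j = k)) \<and>
     (p has_sum 1) I \<and>
     (\<forall>x y. ((\<lambda>k. complex_of_real (p k) * \<psi> k x * cnj (\<psi> k y)) has_sum \<rho> x y) I)"

text \<open>Symmetric, possibly unbounded operators \<open>L\<close> with domain \<open>D\<close>.\<close>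

definition symmetric_operator :: "'x vec set \<Rightarrow> ('x vec \<Rightarrow> 'x vec) \<Rightarrow> bool" where
  "symmetric_operator D L \<longleftrightarrow>
     D \<subseteq> Collect ell2 \<and> L ` D \<subseteq> Collect ell2 \<and>
     (\<forall>u\<in>D. \<forall>v\<in>D. \<forall>c. (\<lambda>x. u x + c * v x) \<in> D \<and>
        L (\<lambda>x. u x + c * v x) = (\<lambda>x. L u x + c * L v x)) \<and>
     (\<forall>u\<in>D. \<forall>v\<in>D. inner2 (L u) v = inner2 u (L v))"

text \<open>
  \<open>\<rho>' = (L\<rho> + \<rho>L) / 2\<close> for an operator \<open>L\<close> that may be unbounded.  The domain of \<open>L\<close> contains the range
  of \<open>\<rho>\<close>, so that \<open>L\<rho>\<close> is everywhere defined; \<open>X\<close> is its matrix and \<open>adj X\<close> that of \<open>\<rho>L\<close>.  Requiring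
  \<open>L\<rho>\<close> to be Hilbert-Schmidt is no restriction when \<open>Tr[\<rho>L\<^sup>2]\<close> is finite, since then \<open>L\<surd>\<rho>\<close> is
  Hilbert-Schmidt and \<open>L\<rho> = (L\<surd>\<rho>)\<surd>\<rho>\<close>.
\<close>

definition is_SLD :: "'x mat \<Rightarrow> 'x mat \<Rightarrow> 'x vec set \<Rightarrow> ('x vec \<Rightarrow> 'x vec) \<Rightarrow> bool" where
  "is_SLD \<rho> \<rho>' D L \<longleftrightarrow>
     symmetric_operator D L \<and> (\<forall>v. ell2 v \<longrightarrow> app \<rho> v \<in> D) \<and>
     (\<exists>X. hilbert_schmidt X \<and> (\<forall>v. ell2 v \<longrightarrow> L (app \<rho> v) = app X v) \<and>
          (\<forall>x y. \<rho>' x y = (X x y + adj X x y) / 2))"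

text \<open>\<open>Tr[\<rho>L\<^sup>2] = \<Sum>\<^sub>k p\<^sub>k \<parallel>L\<psi>\<^sub>k\<parallel>\<^sup>2\<close> in an eigenbasis of \<open>\<rho>\<close>.\<close>

definition has_trace_square :: "'x mat \<Rightarrow> ('x vec \<Rightarrow> 'x vec) \<Rightarrow> real \<Rightarrow> bool" where
  "has_trace_square \<rho> L K \<longleftrightarrow>
     (\<exists>I p \<psi>. spectral_decomposition \<rho> I p \<psi> \<and> ((\<lambda>k. p k * (norm2 (L (\<psi> k)))\<^sup>2) has_sum K) I)"

text \<open>The quantum Fisher information of the family \<open>\<rho>\<close> at \<open>G\<close> exists and equals \<open>K\<close>; the derivative
  of the family is taken matrix element by matrix element.\<close>

definition has_QFI :: "(real \<Rightarrow> 'x mat) \<Rightarrow> real \<Rightarrow> real \<Rightarrow> bool" where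
  "has_QFI \<rho> G K \<longleftrightarrow>
     (\<exists>\<rho>' D L. (\<forall>x y. ((\<lambda>g. \<rho> g x y) has_vector_derivative \<rho>' x y) (at G)) \<and>
        is_SLD (\<rho> G) \<rho>' D L \<and> has_trace_square (\<rho> G) L K)"


subsection \<open>Uniqueness of the quantum Fisher information\<close>

lemma ell2_cmult_abs_summable:
  assumes "ell2 u" "ell2 v"
  shows "(\<lambda>x. norm (cnj (u x) * v x)) summable_on UNIV"
    and "(\<Sum>\<^sub>\<infinity>x. norm (cnj (u x) * v x)) \<le> (norm2 u)\<^sup>2 + (norm2 v)\<^sup>2"
proof -
  have s: "(\<lambda>x. (cmod (u x))\<^sup>2 + (cmod (v x))\<^sup>2) summable_on UNIV"
    using assms unfolding ell2_def by (rule summable_on_add)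
  have b: "norm (cnj (u x) * v x) \<le> (cmod (u x))\<^sup>2 + (cmod (v x))\<^sup>2" for x
  proof -
    have "norm (cnj (u x) * v x) \<le> 2 * cmod (u x) * cmod (v x)"
      by (simp add: norm_mult)
    then show ?thesis
      using sum_squares_bound[of "cmod (u x)" "cmod (v x)"] by linarith
  qed
  show 1: "(\<lambda>x. norm (cnj (u x) * v x)) summable_on UNIV"
    by (rule Infinite_Sum.abs_summable_on_comparison_test'[OF s]) (use b in auto)
  have "(\<Sum>\<^sub>\<infinity>x. norm (cnj (u x) * v x)) \<le> (\<Sum>\<^sub>\<infinity>x. (cmod (u x))\<^sup>2 + (cmod (v x))\<^sup>2)"
    by (rule infsum_mono[OF 1 s]) (use b in auto)
  also have "\<dots> = (norm2 u)\<^sup>2 + (norm2 v)\<^sup>2"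
    using assms by (simp add: infsum_add ell2_def norm2_def infsum_nonneg)
  finally show "(\<Sum>\<^sub>\<infinity>x. norm (cnj (u x) * v x)) \<le> (norm2 u)\<^sup>2 + (norm2 v)\<^sup>2" .
qed

lemma ell2_scale: "ell2 v \<Longrightarrow> ell2 (\<lambda>x. c * v x)"
  unfolding ell2_def norm_mult power_mult_distrib by (rule summable_on_cmult_right)

lemma ell2_lin:
  assumes "ell2 u" "ell2 v"
  shows "ell2 (\<lambda>x. u x - v x)"
proof -
  have s: "(\<lambda>x. 2 * (cmod (u x))\<^sup>2 + 2 * (cmod (v x))\<^sup>2) summable_on UNIV"
    using assms unfolding ell2_def by (intro summable_on_add summable_on_cmult_right)
  have "(cmod (u x - v x))\<^sup>2 \<le> 2 * (cmod (u x))\<^sup>2 + 2 * (cmod (v x))\<^sup>2" for x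
  proof -
    have "(cmod (u x - v x))\<^sup>2 \<le> (cmod (u x) + cmod (v x))\<^sup>2"
      by (intro power_mono norm_triangle_ineq4) auto
    also have "\<dots> \<le> 2 * (cmod (u x))\<^sup>2 + 2 * (cmod (v x))\<^sup>2"
      using sum_squares_bound[of "cmod (u x)" "cmod (v x)"] by (simp add: power2_sum)
    finally show ?thesis .
  qed
  then show ?thesis
    unfolding ell2_def by (intro summable_on_comparison_test[OF s]) auto
qed

definition ket :: "'x \<Rightarrow> 'x vec" where
  "ket a = (\<lambda>x. of_bool (x = a))"

lemma infsum_single: "(\<And>x. x \<noteq> a \<Longrightarrow> f x = 0) \<Longrightarrow> (\<Sum>\<^sub>\<infinity>x. f x) = (f a :: complex)"
  by (rule infsumI, rule has_sum_finite_neutralI[of "{a}"]) auto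

lemma ell2_ket: "ell2 (ket a)"
  unfolding ell2_def ket_def
  by (rule has_sum_imp_summable, rule has_sum_finite_neutralI[of "{a}"]) auto

lemma inner2_ket: "inner2 (ket a) v = v a"
  unfolding inner2_def by (subst infsum_single[of a]) (auto simp: ket_def)

lemma app_ket: "app A (ket a) = (\<lambda>x. A x a)"
  unfolding app_def by (rule ext, subst infsum_single[of a]) (auto simp: ket_def)

lemma inner2_cnj: "inner2 u v = cnj (inner2 v u)"
  unfolding inner2_def infsum_cnj[symmetric] by (simp add: mult.commute)

lemma inner2_self: 
  assumes "ell2 v" shows "inner2 v v = complex_of_real ((norm2 v)\<^sup>2)"
proof -
  have "((\<lambda>x. (cmod (v x))\<^sup>2) has_sum (norm2 v)\<^sup>2) UNIV"
    using assms by (simp add: norm2_def ell2_def infsum_nonneg)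
  then have "((\<lambda>x. complex_of_real ((cmod (v x))\<^sup>2)) has_sum complex_of_real ((norm2 v)\<^sup>2)) UNIV"
    by (rule has_sum_of_real)
  then show ?thesis
    unfolding inner2_def by (intro infsumI) (simp add: complex_norm_square[symmetric] mult.commute)
qed

lemma norm2_0_iff:
  assumes "ell2 v" "norm2 v = 0" shows "v x = 0"
proof -
  have "(\<lambda>x. (cmod (v x))\<^sup>2) summable_on UNIV" "(\<Sum>\<^sub>\<infinity>x. (cmod (v x))\<^sup>2) = 0"
    using assms by (auto simp: ell2_def norm2_def)
  then have "(cmod (v x))\<^sup>2 = 0"
    using nonneg_infsum_le_0D[of "\<lambda>x. (cmod (v x))\<^sup>2" UNIV x] by simp
  then show ?thesis by simp
qed

lemma inner2_scale: "inner2 u (\<lambda>x. c * v x) = c * inner2 u v"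
  unfolding inner2_def by (simp add: infsum_cmult_right' mult.left_commute)

lemma weighted_swap:
  fixes f :: "'k \<Rightarrow> 'x \<Rightarrow> complex" and p :: "'k \<Rightarrow> real"
  assumes p: "p summable_on I" "\<And>k. k \<in> I \<Longrightarrow> p k \<ge> 0"
    and f: "\<And>k. k \<in> I \<Longrightarrow> (\<lambda>x. norm (f k x)) summable_on UNIV"
      "\<And>k. k \<in> I \<Longrightarrow> (\<Sum>\<^sub>\<infinity>x. norm (f k x)) \<le> C"
  shows "((\<lambda>k. complex_of_real (p k) * (\<Sum>\<^sub>\<infinity>x. f k x)) has_sum
      (\<Sum>\<^sub>\<infinity>x. \<Sum>\<^sub>\<infinity>k\<in>I. complex_of_real (p k) * f k x)) I"
proof -
  have pp: "(\<lambda>k. C * p k) summable_on I"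
    by (rule summable_on_cmult_right[OF p(1)])
  have 1: "(\<lambda>kx. norm (case kx of (k, x) \<Rightarrow> complex_of_real (p k) * f k x)) summable_on I \<times> UNIV"
    unfolding Infinite_Sum.abs_summable_on_Sigma_iff
  proof (intro conjI ballI)
    fix k assume k: "k \<in> I"
    show "(\<lambda>y. norm (case (k, y) of (k, x) \<Rightarrow> complex_of_real (p k) * f k x)) summable_on UNIV"
      using f(1)[OF k] by (simp add: norm_mult summable_on_cmult_right)
  next
    show "(\<lambda>k. norm (\<Sum>\<^sub>\<infinity>y. norm (case (k, y) of (k, x) \<Rightarrow> complex_of_real (p k) * f k x))) summable_on I"
    proof (rule Infinite_Sum.abs_summable_on_comparison_test'[OF pp])
      fix k assume k: "k \<in> I"
      have "(\<Sum>\<^sub>\<infinity>y. norm (complex_of_real (p k) * f k y)) = p k * (\<Sum>\<^sub>\<infinity>y. norm (f k y))"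
        using p(2)[OF k] by (simp add: norm_mult infsum_cmult_right')
      also have "\<dots> \<le> C * p k"
        using f(2)[OF k] p(2)[OF k] by (metis mult.commute mult_left_mono)
      finally show "norm (\<Sum>\<^sub>\<infinity>y. norm (case (k, y) of (k, x) \<Rightarrow> complex_of_real (p k) * f k x)) \<le> C * p k"
        by (simp add: infsum_nonneg)
    qed
  qed
  then have s: "(\<lambda>(k, x). complex_of_real (p k) * f k x) summable_on I \<times> UNIV"
    by (rule abs_summable_summable)
  have "(\<lambda>k. \<Sum>\<^sub>\<infinity>x. complex_of_real (p k) * f k x) summable_on I"
    using summable_on_Sigma_banach[OF s] by simp
  moreover have "(\<Sum>\<^sub>\<infinity>k\<in>I. \<Sum>\<^sub>\<infinity>x. complex_of_real (p k) * f k x) =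
      (\<Sum>\<^sub>\<infinity>x. \<Sum>\<^sub>\<infinity>k\<in>I. complex_of_real (p k) * f k x)"
    by (rule infsum_swap_banach[OF s])
  ultimately show ?thesis
    by (simp add: has_sum_iff infsum_cmult_right')
qed

context
  fixes \<rho> :: "'x mat" and I :: "'x set" and p :: "'x \<Rightarrow> real" and \<psi> :: "'x \<Rightarrow> 'x vec"
  assumes sd: "spectral_decomposition \<rho> I p \<psi>"
begin

lemma sd_pos: "k \<in> I \<Longrightarrow> p k > 0"
  and sd_ell2: "k \<in> I \<Longrightarrow> ell2 (\<psi> k)"
  and sd_orth: "j \<in> I \<Longrightarrow> k \<in> I \<Longrightarrow> inner2 (\<psi> j) (\<psi> k) = of_bool (j = k)"
  and sd_summable: "p summable_on I"
  and sd_has_sum: "((\<lambda>k. complex_of_real (p k) * \<psi> k x * cnj (\<psi> k y)) has_sum \<rho> x y) I"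
  using sd unfolding spectral_decomposition_def by (auto dest: has_sum_imp_summable)

lemma sd_norm: "k \<in> I \<Longrightarrow> norm2 (\<psi> k) = 1"
proof -
  assume k: "k \<in> I"
  have "complex_of_real ((norm2 (\<psi> k))\<^sup>2) = 1"
    using inner2_self[OF sd_ell2[OF k]] sd_orth[OF k k] by simp
  then have "(norm2 (\<psi> k))\<^sup>2 = 1" using of_real_eq_1_iff by blast
  moreover have "norm2 (\<psi> k) \<ge> 0" by (simp add: norm2_def infsum_nonneg)
  ultimately show ?thesis by (metis power2_eq_1_iff not_one_le_zero neg_0_le_iff_le) 
qed

lemma sd_hermitian: "\<rho> x y = cnj (\<rho> y x)"
proof -
  have "((\<lambda>k. cnj (complex_of_real (p k) * \<psi> k y * cnj (\<psi> k x))) has_sum cnj (\<rho> y x)) I"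
    unfolding has_sum_cnj_iff by (rule sd_has_sum)
  also have "(\<lambda>k. cnj (complex_of_real (p k) * \<psi> k y * cnj (\<psi> k x))) =
      (\<lambda>k. complex_of_real (p k) * \<psi> k x * cnj (\<psi> k y))"
    by (simp add: fun_eq_iff mult_ac)
  finally show ?thesis using sd_has_sum has_sum_unique by blast
qed

lemma sd_inner_bound: 
  assumes "ell2 v" "k \<in> I" shows "norm (inner2 (\<psi> k) v) \<le> 1 + (norm2 v)\<^sup>2"
proof -
  have "norm (inner2 (\<psi> k) v) \<le> (\<Sum>\<^sub>\<infinity>x. norm (cnj (\<psi> k x) * v x))"
    unfolding inner2_def
    by (rule norm_infsum_bound) (use ell2_cmult_abs_summable(1)[OF sd_ell2 assms(1)] assms in auto)
  then show ?thesis
    using ell2_cmult_abs_summable(2)[OF sd_ell2 assms(1)] assms sd_norm by fastforce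
qed

lemma sd_app:
  assumes v: "ell2 v"
  shows "((\<lambda>k. complex_of_real (p k) * (\<psi> k x * inner2 (\<psi> k) v)) has_sum app \<rho> v x) I"
proof -
  have le1: "norm (\<psi> k x) \<le> 2" if "k \<in> I" for k
    using sd_inner_bound[OF ell2_ket[of x] that] inner2_cnj[of "\<psi> k" "ket x"]
      inner2_self[OF ell2_ket[of x]]
    by (simp add: inner2_ket) (simp add: ket_def del: of_real_power flip: of_real_power)
  have ab: "(\<lambda>y. norm (cnj (\<psi> k y) * v y)) summable_on UNIV" if "k \<in> I" for k
    using ell2_cmult_abs_summable(1)[OF sd_ell2[OF that] v] .
  have "((\<lambda>k. complex_of_real (p k) * (\<Sum>\<^sub>\<infinity>y. \<psi> k x * (cnj (\<psi> k y) * v y))) has_sum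
      (\<Sum>\<^sub>\<infinity>y. \<Sum>\<^sub>\<infinity>k\<in>I. complex_of_real (p k) * (\<psi> k x * (cnj (\<psi> k y) * v y)))) I"
  proof (rule weighted_swap[where C = "2 * (1 + (norm2 v)\<^sup>2)"])
    fix k assume k: "k \<in> I"
    show "(\<lambda>y. norm (\<psi> k x * (cnj (\<psi> k y) * v y))) summable_on UNIV"
      using ab[OF k] by (simp only: norm_mult[of "\<psi> k x"] summable_on_cmult_right)
    have "(\<Sum>\<^sub>\<infinity>y. norm (\<psi> k x * (cnj (\<psi> k y) * v y))) = norm (\<psi> k x) * (\<Sum>\<^sub>\<infinity>y. norm (cnj (\<psi> k y) * v y))"
      by (simp only: norm_mult[of "\<psi> k x"] infsum_cmult_right')
    also have "\<dots> \<le> 2 * (1 + (norm2 v)\<^sup>2)"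
      using ell2_cmult_abs_summable(2)[OF sd_ell2[OF k] v] sd_norm[OF k] le1[OF k]
      by (intro mult_mono) (auto simp: infsum_nonneg)
    finally show "(\<Sum>\<^sub>\<infinity>y. norm (\<psi> k x * (cnj (\<psi> k y) * v y))) \<le> 2 * (1 + (norm2 v)\<^sup>2)" .
  qed (use sd_summable sd_pos in \<open>auto intro: less_imp_le\<close>)
  moreover have "(\<Sum>\<^sub>\<infinity>k\<in>I. complex_of_real (p k) * (\<psi> k x * (cnj (\<psi> k y) * v y))) = \<rho> x y * v y" for y
    using has_sum_cmult_left[OF sd_has_sum[of x y], of "v y"] by (intro infsumI) (simp add: mult_ac)
  ultimately show ?thesis
    by (simp add: app_def inner2_def infsum_cmult_right')
qed

lemma sd_form:
  assumes u: "ell2 u" and v: "ell2 v"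
  shows "((\<lambda>k. complex_of_real (p k) * (inner2 u (\<psi> k) * inner2 (\<psi> k) v)) has_sum inner2 u (app \<rho> v)) I"
proof -
  have ab: "(\<lambda>y. norm (cnj (u y) * \<psi> k y)) summable_on UNIV" if "k \<in> I" for k
    using ell2_cmult_abs_summable(1)[OF u sd_ell2[OF that]] .
  define C where "C = (1 + (norm2 v)\<^sup>2) * ((norm2 u)\<^sup>2 + 1)"
  have "((\<lambda>k. complex_of_real (p k) * (\<Sum>\<^sub>\<infinity>y. inner2 (\<psi> k) v * (cnj (u y) * \<psi> k y))) has_sum
      (\<Sum>\<^sub>\<infinity>y. \<Sum>\<^sub>\<infinity>k\<in>I. complex_of_real (p k) * (inner2 (\<psi> k) v * (cnj (u y) * \<psi> k y)))) I"
  proof (rule weighted_swap[where C = C])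
    fix k assume k: "k \<in> I"
    show "(\<lambda>y. norm (inner2 (\<psi> k) v * (cnj (u y) * \<psi> k y))) summable_on UNIV"
      using ab[OF k] by (simp only: norm_mult[of "inner2 _ _"] summable_on_cmult_right)
    have "(\<Sum>\<^sub>\<infinity>y. norm (inner2 (\<psi> k) v * (cnj (u y) * \<psi> k y))) =
        norm (inner2 (\<psi> k) v) * (\<Sum>\<^sub>\<infinity>y. norm (cnj (u y) * \<psi> k y))"
      by (simp only: norm_mult[of "inner2 _ _"] infsum_cmult_right')
    also have "\<dots> \<le> C"
      using ell2_cmult_abs_summable(2)[OF u sd_ell2[OF k]] sd_norm[OF k] sd_inner_bound[OF v k]
      unfolding C_def by (intro mult_mono) (auto simp: infsum_nonneg)
    finally show "(\<Sum>\<^sub>\<infinity>y. norm (inner2 (\<psi> k) v * (cnj (u y) * \<psi> k y))) \<le> C" .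
  qed (use sd_summable sd_pos in \<open>auto intro: less_imp_le\<close>)
  moreover have "(\<Sum>\<^sub>\<infinity>k\<in>I. complex_of_real (p k) * (inner2 (\<psi> k) v * (cnj (u y) * \<psi> k y))) = cnj (u y) * app \<rho> v y" for y
    using has_sum_cmult_right[OF sd_app[OF v, of y], of "cnj (u y)"] by (intro infsumI) (simp add: mult_ac)
  ultimately have "((\<lambda>k. complex_of_real (p k) * (inner2 (\<psi> k) v * inner2 u (\<psi> k))) has_sum inner2 u (app \<rho> v)) I"
    unfolding infsum_cmult_right' inner2_def[of u, symmetric] by (simp add: inner2_def[of u])
  then show ?thesis by (simp only: mult.commute[of "inner2 (\<psi> _) v"])
qed

lemma sd_eigen:
  assumes k: "k \<in> I" shows "app \<rho> (\<psi> k) = (\<lambda>x. complex_of_real (p k) * \<psi> k x)"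
proof
  fix x
  have "((\<lambda>j. complex_of_real (p j) * (\<psi> j x * inner2 (\<psi> j) (\<psi> k))) has_sum complex_of_real (p k) * \<psi> k x) I"
    by (rule has_sum_finite_neutralI[of "{k}"]) (use k sd_orth in auto)
  then show "app \<rho> (\<psi> k) x = complex_of_real (p k) * \<psi> k x"
    using sd_app[OF sd_ell2[OF k]] has_sum_unique by blast
qed

end


lemma hilbert_schmidt_rows:
  assumes "hilbert_schmidt A"
  shows "ell2 (\<lambda>y. cnj (A x y))" "ell2 (\<lambda>x. A x y)"
proof -
  have s: "(\<lambda>(x, y). (cmod (A x y))\<^sup>2) summable_on UNIV \<times> UNIV"
    using assms by (simp add: hilbert_schmidt_def)
  show "ell2 (\<lambda>y. cnj (A x y))"
    using summable_on_SigmaD1[OF s, of x] by (simp add: ell2_def)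
  have "(\<lambda>(y, x). (cmod (A x y))\<^sup>2) summable_on UNIV \<times> UNIV"
    using summable_on_swap[of "\<lambda>(x, y). (cmod (A x y))\<^sup>2" UNIV UNIV] s by simp
  then show "ell2 (\<lambda>x. A x y)"
    using summable_on_SigmaD1[of "\<lambda>y x. (cmod (A x y))\<^sup>2" UNIV "\<lambda>_. UNIV" y] by (simp add: ell2_def)
qed

lemma summable_minus:
  fixes f g :: "'x \<Rightarrow> complex"
  assumes "f summable_on A" "g summable_on A"
  shows "(\<lambda>x. f x - g x) summable_on A"
  using summable_on_add[OF assms(1) summable_on_uminus[THEN iffD2, OF assms(2)]] by simp

lemma infsum_minus:
  fixes f g :: "'x \<Rightarrow> complex"
  assumes "f summable_on A" "g summable_on A"
  shows "(\<Sum>\<^sub>\<infinity>x\<in>A. f x - g x) = infsum f A - infsum g A"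
  using infsum_add[OF assms(1) summable_on_uminus[THEN iffD2, OF assms(2)]]
  by (simp add: infsum_uminus)

lemma app_summable:
  assumes "hilbert_schmidt A" "ell2 v"
  shows "(\<lambda>y. A x y * v y) summable_on UNIV"
  using abs_summable_summable[OF ell2_cmult_abs_summable(1)[OF hilbert_schmidt_rows(1)[OF assms(1), of x] assms(2)]]
  by simp

lemma SLD_eigenvector:
  assumes sd: "spectral_decomposition \<rho> I p \<psi>" and k: "k \<in> I"
    and L: "symmetric_operator D L" "\<forall>v. ell2 v \<longrightarrow> app \<rho> v \<in> D"
    and X: "\<forall>v. ell2 v \<longrightarrow> L (app \<rho> v) = app X v"
  shows "\<psi> k \<in> D" and "L (\<psi> k) = (\<lambda>x. app X (\<psi> k) x / complex_of_real (p k))"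
    and "ell2 (L (\<psi> k))"
    and "app (adj X) (\<psi> k) = app \<rho> (L (\<psi> k))"
proof -
  define v where "v = (\<lambda>x. inverse (complex_of_real (p k)) * \<psi> k x)"
  have pk: "p k \<noteq> 0" using sd_pos[OF sd k] by simp
  have ell: "ell2 (\<psi> k)" by (rule sd_ell2[OF sd k])
  then have v: "ell2 v" unfolding v_def by (rule ell2_scale)
  have lin: "app A v = (\<lambda>x. app A (\<psi> k) x / complex_of_real (p k))" for A
    unfolding app_def v_def mult.left_commute[of _ "inverse _"] infsum_cmult_right'
    by (simp add: divide_inverse mult.commute)
  have *: "app \<rho> v = \<psi> k"
    unfolding lin sd_eigen[OF sd k] using pk by simp
  show D: "\<psi> k \<in> D" using L(2) v * by metis
  show "L (\<psi> k) = (\<lambda>x. app X (\<psi> k) x / complex_of_real (p k))"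
    using X v * lin[of X] by metis
  show "ell2 (L (\<psi> k))" using L(1) D unfolding symmetric_operator_def by blast
  show "app (adj X) (\<psi> k) = app \<rho> (L (\<psi> k))"
  proof
    fix a
    have "inner2 (L (app \<rho> (ket a))) (\<psi> k) = inner2 (app \<rho> (ket a)) (L (\<psi> k))"
      using L D ell2_ket[of a] unfolding symmetric_operator_def by blast
    then have "inner2 (\<lambda>x. X x a) (\<psi> k) = inner2 (\<lambda>x. \<rho> x a) (L (\<psi> k))"
      using X[rule_format, OF ell2_ket[of a]] by (simp add: app_ket)
    then show "app (adj X) (\<psi> k) a = app \<rho> (L (\<psi> k)) a"
      unfolding inner2_def app_def adj_def sd_hermitian[OF sd, of a, symmetric] .
  qed
qed

lemma SLD_unique_on_eigenvectors:
  assumes sd: "spectral_decomposition \<rho> I p \<psi>" and k: "k \<in> I"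
    and 1: "is_SLD \<rho> \<rho>' D L" and 2: "is_SLD \<rho> \<rho>' D' L'"
  shows "L (\<psi> k) = L' (\<psi> k)"
proof -
  obtain X where L: "symmetric_operator D L" "\<forall>v. ell2 v \<longrightarrow> app \<rho> v \<in> D"
    and X: "\<forall>v. ell2 v \<longrightarrow> L (app \<rho> v) = app X v"
    and hX: "hilbert_schmidt X" and rX: "\<And>x y. \<rho>' x y = (X x y + adj X x y) / 2"
    using 1 unfolding is_SLD_def by blast
  obtain Y where L': "symmetric_operator D' L'" "\<forall>v. ell2 v \<longrightarrow> app \<rho> v \<in> D'"
    and Y: "\<forall>v. ell2 v \<longrightarrow> L' (app \<rho> v) = app Y v"
    and hY: "hilbert_schmidt Y" and rY: "\<And>x y. \<rho>' x y = (Y x y + adj Y x y) / 2"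
    using 2 unfolding is_SLD_def by blast
  note e = SLD_eigenvector[OF sd k L X]
  note e' = SLD_eigenvector[OF sd k L' Y]
  define d where "d = (\<lambda>x. L (\<psi> k) x - L' (\<psi> k) x)"
  have d: "ell2 d" unfolding d_def using e(3) e'(3) by (rule ell2_lin)
  have pk: "p k > 0" by (rule sd_pos[OF sd k])
  have ell: "ell2 (\<psi> k)" by (rule sd_ell2[OF sd k])
  have adjX: "adj X x y = adj Y x y - (X x y - Y x y)" for x y
  proof -
    have "X x y + adj X x y = Y x y + adj Y x y"
    proof -
      have "(X x y + adj X x y) / 2 = (Y x y + adj Y x y) / 2"
        using rX[of x y] rY[of x y] by (rule trans[OF sym])
      then show ?thesis by (simp only: divide_cancel_right) simp
    qed
    then show ?thesis by (simp add: algebra_simps)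
  qed
  have "hilbert_schmidt (adj Y)"
    using hY summable_on_swap[of "\<lambda>(x, y). (cmod (Y x y))\<^sup>2" UNIV UNIV]
    by (simp add: hilbert_schmidt_def adj_def)
  note s = app_summable[OF this ell] app_summable[OF hX ell] app_summable[OF hY ell]
  have appX: "app (adj X) (\<psi> k) x = app (adj Y) (\<psi> k) x - (app X (\<psi> k) x - app Y (\<psi> k) x)" for x
    unfolding app_def adjX left_diff_distrib
    by (simp only: infsum_minus[OF s(1) summable_minus[OF s(2,3)]] infsum_minus[OF s(2,3)])
  have rs: "app \<rho> d x = app \<rho> (L (\<psi> k)) x - app \<rho> (L' (\<psi> k)) x" for x
  proof -
    have "(\<lambda>y. cnj (cnj (\<rho> x y)) * v y) summable_on UNIV" if "ell2 v" for v
    proof (rule abs_summable_summable, rule ell2_cmult_abs_summable(1)[OF _ that])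
      show "ell2 (\<lambda>y. cnj (\<rho> x y))"
        using L(1) L(2)[rule_format, OF ell2_ket[of x]] unfolding symmetric_operator_def
        by (auto simp: app_ket sd_hermitian[OF sd, symmetric])
    qed
    then show ?thesis
      unfolding app_def d_def right_diff_distrib using e(3) e'(3) by (simp add: infsum_minus)
  qed
  have "app \<rho> d = (\<lambda>x. - complex_of_real (p k) * d x)"
  proof
    fix x
    have dx: "d x = (app X (\<psi> k) x - app Y (\<psi> k) x) / complex_of_real (p k)"
      unfolding d_def e(2) e'(2) by (simp add: diff_divide_distrib)
    have "app \<rho> d x = - (app X (\<psi> k) x - app Y (\<psi> k) x)"
      unfolding rs e(4)[symmetric] e'(4)[symmetric] appX by simp
    then show "app \<rho> d x = - complex_of_real (p k) * d x"
      unfolding dx using pk by simp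
  qed
  then have "inner2 d (app \<rho> d) = complex_of_real (- p k * (norm2 d)\<^sup>2)"
    by (simp only: inner2_scale inner2_self[OF d]) simp
  with sd_form[OF sd d d]
  have "((\<lambda>j. complex_of_real (p j) * (inner2 d (\<psi> j) * inner2 (\<psi> j) d)) has_sum
      complex_of_real (- p k * (norm2 d)\<^sup>2)) I" by simp
  then have "((\<lambda>j. Re (complex_of_real (p j) * (inner2 d (\<psi> j) * inner2 (\<psi> j) d))) has_sum
      Re (complex_of_real (- p k * (norm2 d)\<^sup>2))) I" by (rule has_sum_Re)
  then have "Re (complex_of_real (- p k * (norm2 d)\<^sup>2)) \<ge> 0"
  proof (rule has_sum_nonneg)
    fix j assume j: "j \<in> I"
    have "complex_of_real (p j) * (inner2 d (\<psi> j) * inner2 (\<psi> j) d) =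
        complex_of_real (p j * (cmod (inner2 (\<psi> j) d))\<^sup>2)"
      by (subst inner2_cnj[of d]) (simp add: complex_norm_square[symmetric] mult.commute)
    then show "Re (complex_of_real (p j) * (inner2 d (\<psi> j) * inner2 (\<psi> j) d)) \<ge> 0"
      using sd_pos[OF sd j] by (simp only: Re_complex_of_real) simp
  qed
  then have "p k * (norm2 d)\<^sup>2 \<le> 0" by (simp only: Re_complex_of_real)
  then have "(norm2 d)\<^sup>2 \<le> 0"
    using pk by (simp add: mult_le_0_iff)
  then have "norm2 d = 0" by simp
  then show ?thesis
    using norm2_0_iff[OF d] unfolding d_def by (auto simp: fun_eq_iff)
qed

lemma finite_eigenspace:
  assumes sd: "spectral_decomposition \<rho> I p \<psi>" and l: "l > 0"
  shows "finite {k \<in> I. p k = l}"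
proof -
  have "p summable_on {k \<in> I. p k = l}"
    by (rule summable_on_subset_banach[OF sd_summable[OF sd]]) auto
  then have "(\<lambda>_. l) summable_on {k \<in> I. p k = l}"
    by (rule summable_on_cong[THEN iffD1, rotated]) auto
  then show ?thesis using l infsum_diverge_constant[of _ l] by auto
qed

lemma eigenvector_expansion:
  assumes sd: "spectral_decomposition \<rho> I p \<psi>" and sd': "spectral_decomposition \<rho> J q \<phi>"
    and k: "k \<in> I"
  shows "\<psi> k x = (\<Sum>j\<in>{j \<in> J. q j = p k}. inner2 (\<phi> j) (\<psi> k) * \<phi> j x)"
proof -
  have pk: "p k > 0" by (rule sd_pos[OF sd k])
  have z: "inner2 (\<phi> j) (\<psi> k) = 0" if j: "j \<in> J" "q j \<noteq> p k" for j
  proof -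
    have "((\<lambda>i. complex_of_real (q i) * (inner2 (\<phi> j) (\<phi> i) * inner2 (\<phi> i) (\<psi> k))) has_sum
        complex_of_real (q j) * inner2 (\<phi> j) (\<psi> k)) J"
      by (rule has_sum_finite_neutralI[of "{j}"]) (use j sd_orth[OF sd'] in auto)
    then have "inner2 (\<phi> j) (app \<rho> (\<psi> k)) = complex_of_real (q j) * inner2 (\<phi> j) (\<psi> k)"
      using sd_form[OF sd' sd_ell2[OF sd' j(1)] sd_ell2[OF sd k]] has_sum_unique by blast
    then have "complex_of_real (p k) * inner2 (\<phi> j) (\<psi> k) = complex_of_real (q j) * inner2 (\<phi> j) (\<psi> k)"
      by (simp add: sd_eigen[OF sd k] inner2_scale)
    then show ?thesis using j(2) by auto
  qed
  have "((\<lambda>j. complex_of_real (q j) * (\<phi> j x * inner2 (\<phi> j) (\<psi> k))) has_sum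
      (\<Sum>j\<in>{j \<in> J. q j = p k}. complex_of_real (q j) * (\<phi> j x * inner2 (\<phi> j) (\<psi> k)))) J"
    by (rule has_sum_finite_neutralI[OF finite_eigenspace[OF sd' pk]]) (use z in auto)
  then have "app \<rho> (\<psi> k) x = (\<Sum>j\<in>{j \<in> J. q j = p k}. complex_of_real (q j) * (\<phi> j x * inner2 (\<phi> j) (\<psi> k)))"
    using sd_app[OF sd' sd_ell2[OF sd k]] has_sum_unique by blast
  also have "\<dots> = complex_of_real (p k) * (\<Sum>j\<in>{j \<in> J. q j = p k}. inner2 (\<phi> j) (\<psi> k) * \<phi> j x)"
    unfolding sum_distrib_left by (rule sum.cong) (auto simp: mult_ac)
  finally show ?thesis
    using pk by (simp add: sd_eigen[OF sd k])
qed

lemma infsum_finite_sum: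
  fixes f :: "'j \<Rightarrow> 'x \<Rightarrow> 'b::{topological_comm_monoid_add, t2_space}"
  assumes "\<And>j. j \<in> F \<Longrightarrow> f j summable_on A"
  shows "(\<Sum>\<^sub>\<infinity>x\<in>A. \<Sum>j\<in>F. f j x) = (\<Sum>j\<in>F. \<Sum>\<^sub>\<infinity>x\<in>A. f j x)"
proof (rule infsumI)
  show "((\<lambda>x. \<Sum>j\<in>F. f j x) has_sum (\<Sum>j\<in>F. \<Sum>\<^sub>\<infinity>x\<in>A. f j x)) A"
    using assms
  proof (induction F rule: infinite_finite_induct)
    case (insert j F)
    have "((\<lambda>x. f j x + (\<Sum>j\<in>F. f j x)) has_sum (\<Sum>\<^sub>\<infinity>x\<in>A. f j x) + (\<Sum>j\<in>F. \<Sum>\<^sub>\<infinity>x\<in>A. f j x)) A"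
      using insert by (intro has_sum_add has_sum_infsum) auto
    then show ?case using insert.hyps by simp
  qed simp_all
qed

lemma inner2_sum:
  assumes "ell2 u" "\<And>j. j \<in> F \<Longrightarrow> ell2 (v j)"
  shows "inner2 u (\<lambda>x. \<Sum>j\<in>F. c j * v j x) = (\<Sum>j\<in>F. c j * inner2 u (v j))"
proof -
  have "inner2 u (\<lambda>x. \<Sum>j\<in>F. c j * v j x) = (\<Sum>\<^sub>\<infinity>x. \<Sum>j\<in>F. c j * (cnj (u x) * v j x))"
    unfolding inner2_def sum_distrib_left mult.left_commute[of "cnj _"] ..
  also have "\<dots> = (\<Sum>j\<in>F. \<Sum>\<^sub>\<infinity>x. c j * (cnj (u x) * v j x))"
    by (rule infsum_finite_sum, rule summable_on_cmult_right, rule abs_summable_summable,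
        rule ell2_cmult_abs_summable(1)) (use assms in auto)
  finally show ?thesis by (simp add: inner2_def infsum_cmult_right')
qed

lemma trace_square_block:
  assumes sd: "spectral_decomposition \<rho> I p \<psi>" and sd': "spectral_decomposition \<rho> J q \<phi>"
    and l: "l > 0"
    and X: "hilbert_schmidt X"
  defines "A \<equiv> {k \<in> I. p k = l}" and "B \<equiv> {j \<in> J. q j = l}"
  assumes T: "\<And>k. k \<in> A \<Longrightarrow> ell2 (app X (\<psi> k))" "\<And>j. j \<in> B \<Longrightarrow> ell2 (app X (\<phi> j))"
  shows "(\<Sum>k\<in>A. (norm2 (app X (\<psi> k)))\<^sup>2) = (\<Sum>j\<in>B. (norm2 (app X (\<phi> j)))\<^sup>2)"
proof -
  have fin: "finite A" "finite B"
    unfolding A_def B_def using finite_eigenspace[OF sd l] finite_eigenspace[OF sd' l] .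
  define c where "c k j = inner2 (\<phi> j) (\<psi> k)" for k j
  have ex: "app X (\<psi> k) x = (\<Sum>j\<in>B. c k j * app X (\<phi> j) x)" if k: "k \<in> A" for k x
  proof -
    have B: "B = {j \<in> J. q j = p k}" using k unfolding A_def B_def by auto
    have kI: "k \<in> I" using k unfolding A_def by auto
    have "app X (\<psi> k) x = (\<Sum>\<^sub>\<infinity>y. \<Sum>j\<in>B. c k j * (X x y * \<phi> j y))"
      unfolding app_def
      by (subst eigenvector_expansion[OF sd sd' kI, folded B])
        (simp only: c_def sum_distrib_left mult.left_commute[of "X _ _"])
    also have "\<dots> = (\<Sum>j\<in>B. \<Sum>\<^sub>\<infinity>y. c k j * (X x y * \<phi> j y))"
      using sd_ell2[OF sd'] by (intro infsum_finite_sum summable_on_cmult_right app_summable[OF X]) (auto simp: B_def)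
    finally show ?thesis by (simp add: app_def infsum_cmult_right')
  qed
  have orth: "(\<Sum>k\<in>A. c k j * cnj (c k j')) = of_bool (j = j')" if j: "j \<in> B" "j' \<in> B" for j j'
  proof -
    have jJ: "j \<in> J" "j' \<in> J" "q j' = l" using j unfolding B_def by auto
    have "inner2 (\<phi> j) (\<phi> j') = inner2 (\<phi> j) (\<lambda>x. \<Sum>k\<in>A. inner2 (\<psi> k) (\<phi> j') * \<psi> k x)"
      using eigenvector_expansion[OF sd' sd jJ(2)] unfolding A_def jJ(3)
      by (intro arg_cong[of _ _ "inner2 (\<phi> j)"] ext)
    also have "\<dots> = (\<Sum>k\<in>A. inner2 (\<psi> k) (\<phi> j') * inner2 (\<phi> j) (\<psi> k))"
      by (rule inner2_sum) (use sd_ell2[OF sd] sd_ell2[OF sd'] jJ in \<open>auto simp: A_def\<close>)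
    also have "\<dots> = (\<Sum>k\<in>A. c k j * cnj (c k j'))"
      unfolding c_def by (intro sum.cong refl) (subst inner2_cnj, simp only: mult.commute)
    finally show ?thesis using sd_orth[OF sd' jJ(1,2)] by simp
  qed
  have pt: "(\<Sum>k\<in>A. (cmod (app X (\<psi> k) x))\<^sup>2) = (\<Sum>j\<in>B. (cmod (app X (\<phi> j) x))\<^sup>2)" for x
  proof -
    define z where "z j = app X (\<phi> j) x" for j
    have "complex_of_real (\<Sum>k\<in>A. (cmod (app X (\<psi> k) x))\<^sup>2) =
        (\<Sum>k\<in>A. (\<Sum>j\<in>B. c k j * z j) * cnj (\<Sum>j'\<in>B. c k j' * z j'))"
      unfolding of_real_sum z_def by (intro sum.cong refl) (simp only: ex complex_norm_square)
    also have "\<dots> = (\<Sum>k\<in>A. \<Sum>j\<in>B. \<Sum>j'\<in>B. (z j * cnj (z j')) * (c k j * cnj (c k j')))"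
      unfolding cnj_sum sum_product by (intro sum.cong refl) (simp only: complex_cnj_mult mult_ac)
    also have "\<dots> = (\<Sum>j\<in>B. \<Sum>j'\<in>B. (z j * cnj (z j')) * (\<Sum>k\<in>A. c k j * cnj (c k j')))"
      unfolding sum_distrib_left by (rule trans[OF sum.swap]) (rule sum.cong[OF refl], rule sum.swap)
    also have "\<dots> = (\<Sum>j\<in>B. \<Sum>j'\<in>B. (z j * cnj (z j')) * of_bool (j = j'))"
      using orth by (intro sum.cong refl) simp
    also have "\<dots> = (\<Sum>j\<in>B. z j * cnj (z j))"
    proof (rule sum.cong[OF refl])
      fix j assume j: "j \<in> B"
      have "(\<Sum>j'\<in>B. (z j * cnj (z j')) * of_bool (j = j')) = (\<Sum>j'\<in>B. if j = j' then z j * cnj (z j) else 0)"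
        by (rule sum.cong) auto
      then show "(\<Sum>j'\<in>B. (z j * cnj (z j')) * of_bool (j = j')) = z j * cnj (z j)"
        using fin(2) j by simp
    qed
    also have "\<dots> = complex_of_real (\<Sum>j\<in>B. (cmod (app X (\<phi> j) x))\<^sup>2)"
      by (simp only: z_def of_real_sum complex_norm_square)
    finally show ?thesis by (simp only: of_real_eq_iff)
  qed
  have n: "(norm2 v)\<^sup>2 = (\<Sum>\<^sub>\<infinity>x. (cmod (v x))\<^sup>2)" for v :: "'a vec"
    by (simp add: norm2_def infsum_nonneg)
  show ?thesis
    unfolding n using T unfolding ell2_def
    by (simp add: infsum_finite_sum[symmetric] pt)
qed

lemma trace_square_le:
  assumes 1: "is_SLD \<rho> \<rho>' D L"
    and sd: "spectral_decomposition \<rho> I p \<psi>" and sd': "spectral_decomposition \<rho> J q \<phi>"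
    and K: "((\<lambda>k. p k * (norm2 (L (\<psi> k)))\<^sup>2) has_sum K) I"
    and K': "((\<lambda>j. q j * (norm2 (L (\<phi> j)))\<^sup>2) has_sum K') J"
  shows "K \<le> K'"
proof (rule has_sum_le_finite_sums[OF K])
  obtain X where L: "symmetric_operator D L" "\<forall>v. ell2 v \<longrightarrow> app \<rho> v \<in> D"
    and X: "\<forall>v. ell2 v \<longrightarrow> L (app \<rho> v) = app X v"
    and hX: "hilbert_schmidt X"
    using 1 unfolding is_SLD_def by blast
  have n: "(norm2 (\<lambda>x. v x / complex_of_real s))\<^sup>2 = (norm2 v)\<^sup>2 / s\<^sup>2" for v :: "'a vec" and s
    by (simp add: norm2_def infsum_nonneg norm_divide power_divide)
      (simp add: divide_inverse infsum_cmult_left')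
  have ellX: "ell2 (app X (\<psi>' k))"
    if sd': "spectral_decomposition \<rho> I' p' \<psi>'" "k \<in> I'" for I' p' \<psi>' k
    using ell2_scale[OF SLD_eigenvector(3)[OF that L X], of "complex_of_real (p' k)"]
      SLD_eigenvector(2)[OF that L X] sd_pos[OF that] by simp
  have e: "p' k * (norm2 (L (\<psi>' k)))\<^sup>2 = (norm2 (app X (\<psi>' k)))\<^sup>2 / p' k"
    if sd': "spectral_decomposition \<rho> I' p' \<psi>'" "k \<in> I'" for I' p' \<psi>' k
    unfolding SLD_eigenvector(2)[OF that L X] n using sd_pos[OF that] by (simp add: power2_eq_square)
  have block: "(\<Sum>k\<in>{k \<in> I. p k = l}. p k * (norm2 (L (\<psi> k)))\<^sup>2) = (\<Sum>j\<in>{j \<in> J. q j = l}. q j * (norm2 (L (\<phi> j)))\<^sup>2)"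
    if l: "l > 0" for l
  proof -
    have "(\<Sum>k\<in>{k \<in> I. p k = l}. p k * (norm2 (L (\<psi> k)))\<^sup>2) = (\<Sum>k\<in>{k \<in> I. p k = l}. (norm2 (app X (\<psi> k)))\<^sup>2) / l"
      unfolding sum_divide_distrib by (rule sum.cong) (auto simp: e[OF sd])
    also have "\<dots> = (\<Sum>j\<in>{j \<in> J. q j = l}. (norm2 (app X (\<phi> j)))\<^sup>2) / l"
      using trace_square_block[OF sd sd' l hX] ellX[OF sd] ellX[OF sd'] by simp
    also have "\<dots> = (\<Sum>j\<in>{j \<in> J. q j = l}. q j * (norm2 (L (\<phi> j)))\<^sup>2)"
      unfolding sum_divide_distrib by (rule sum.cong) (auto simp: e[OF sd'])
    finally show ?thesis .
  qed
  fix F assume F: "finite F" "F \<subseteq> I"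
  define F1 where "F1 = (\<Union>l\<in>p ` F. {k \<in> I. p k = l})"
  define F2 where "F2 = (\<Union>l\<in>p ` F. {j \<in> J. q j = l})"
  have pos: "l > 0" if "l \<in> p ` F" for l using that F(2) sd_pos[OF sd] by auto
  have fin: "finite F1" "finite F2"
    unfolding F1_def F2_def using F(1) finite_eigenspace[OF sd pos] finite_eigenspace[OF sd' pos] by auto
  have nn: "p k * (norm2 (L (\<psi> k)))\<^sup>2 \<ge> 0" if "k \<in> I" for k
    using sd_pos[OF sd that] by simp
  have nn': "q k * (norm2 (L (\<phi> k)))\<^sup>2 \<ge> 0" if "k \<in> J" for k
    using sd_pos[OF sd' that] by simp
  have "(\<Sum>k\<in>F. p k * (norm2 (L (\<psi> k)))\<^sup>2) \<le> (\<Sum>k\<in>F1. p k * (norm2 (L (\<psi> k)))\<^sup>2)"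
    by (rule sum_mono2[OF fin(1)]) (use F nn in \<open>auto simp: F1_def\<close>)
  also have "\<dots> = (\<Sum>l\<in>p ` F. \<Sum>k\<in>{k \<in> I. p k = l}. p k * (norm2 (L (\<psi> k)))\<^sup>2)"
    unfolding F1_def using F(1) finite_eigenspace[OF sd pos] by (intro sum.UNION_disjoint) auto
  also have "\<dots> = (\<Sum>l\<in>p ` F. \<Sum>j\<in>{j \<in> J. q j = l}. q j * (norm2 (L (\<phi> j)))\<^sup>2)"
    by (rule sum.cong[OF refl]) (rule block[OF pos])
  also have "\<dots> = (\<Sum>j\<in>F2. q j * (norm2 (L (\<phi> j)))\<^sup>2)"
    unfolding F2_def using F(1) finite_eigenspace[OF sd' pos] by (intro sum.UNION_disjoint[symmetric]) auto
  also have "\<dots> \<le> K'"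
    by (rule finite_sum_le_has_sum[OF K' fin(2)]) (use nn' in \<open>auto simp: F2_def\<close>)
  finally show "(\<Sum>k\<in>F. p k * (norm2 (L (\<psi> k)))\<^sup>2) \<le> K'" .
qed

theorem has_QFI_unique:
  assumes "has_QFI \<rho> G K" "has_QFI \<rho> G K'"
  shows "K = K'"
proof -
  obtain d D L I p \<psi> where d: "\<And>x y. ((\<lambda>g. \<rho> g x y) has_vector_derivative d x y) (at G)"
    and L: "is_SLD (\<rho> G) d D L" and sd: "spectral_decomposition (\<rho> G) I p \<psi>"
    and K: "((\<lambda>k. p k * (norm2 (L (\<psi> k)))\<^sup>2) has_sum K) I"
    using assms(1) unfolding has_QFI_def has_trace_square_def by blast
  obtain d' D' L' J q \<phi> where d': "\<And>x y. ((\<lambda>g. \<rho> g x y) has_vector_derivative d' x y) (at G)"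
    and L': "is_SLD (\<rho> G) d' D' L'" and sd': "spectral_decomposition (\<rho> G) J q \<phi>"
    and K': "((\<lambda>k. q k * (norm2 (L' (\<phi> k)))\<^sup>2) has_sum K') J"
    using assms(2) unfolding has_QFI_def has_trace_square_def by blast
  have "d' = d" using d d' vector_derivative_unique_at by blast
  then have "L' (\<phi> j) = L (\<phi> j)" if "j \<in> J" for j
    using SLD_unique_on_eigenvectors[OF sd' that _ L] L' by simp
  then have K'': "((\<lambda>k. q k * (norm2 (L (\<phi> k)))\<^sup>2) has_sum K') J"
    using K' by (simp cong: has_sum_cong)
  show ?thesis
    using trace_square_le[OF L sd sd' K K''] trace_square_le[OF L sd' sd K'' K] by simp
qed


section \<open>Bosonic modes and coherent states\<close>

text \<open>For a finite type \<open>'k\<close> of modes, the Fock basis consists of the occupation numbers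
  \<open>'k \<Rightarrow> nat\<close>, and the amplitudes of a multimode coherent state form a vector in \<open>complex ^ 'k\<close>.
  Where only the modes in a set \<open>S\<close> carry the signal, those outside \<open>S\<close> (possibly none) are the
  ancilla modes, and \<open>complex ^ 'k\<close> is the product of the ancilla and signal phase spaces.\<close>

definition coherent1 :: "complex \<Rightarrow> nat \<Rightarrow> complex" where
  "coherent1 \<alpha> n = complex_of_real (exp (- (cmod \<alpha>)\<^sup>2 / 2) / sqrt (fact n)) * \<alpha> ^ n"

definition coherent :: "complex ^ 'k::finite \<Rightarrow> ('k \<Rightarrow> nat) vec" where
  "coherent \<gamma> n = (\<Prod>i\<in>UNIV. coherent1 (\<gamma> $ i) (n i))"

definition pure :: "'x vec \<Rightarrow> 'x mat" where
  "pure v = (\<lambda>x y. v x * cnj (v y))"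

definition classical_state :: "(complex ^ 'k::finite \<Rightarrow> real) \<Rightarrow> ('k \<Rightarrow> nat) mat" where
  "classical_state P = (\<lambda>x y. LINT \<gamma>|lborel. complex_of_real (P \<gamma>) * pure (coherent \<gamma>) x y)"

definition probability_density :: "(complex ^ 'k::finite \<Rightarrow> real) \<Rightarrow> bool" where
  "probability_density P \<longleftrightarrow>
     P \<in> borel_measurable lborel \<and> (\<forall>\<gamma>. P \<gamma> \<ge> 0) \<and> (\<integral>\<^sup>+\<gamma>. ennreal (P \<gamma>) \<partial>lborel) = 1"

definition has_mean_photon_number :: "'k set \<Rightarrow> (complex ^ 'k::finite \<Rightarrow> real) \<Rightarrow> real \<Rightarrow> bool" where
  "has_mean_photon_number S P N \<longleftrightarrow>
     has_bochner_integral lborel (\<lambda>\<gamma>. P \<gamma> * (\<Sum>m\<in>S. (cmod (\<gamma> $ m))\<^sup>2)) N"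


section \<open>The quantum-limited amplifier\<close>

text \<open>Annihilation operators of the signal mode (first factor) and of the environment mode
  (second factor) in the two-mode Fock basis.\<close>

definition a_op :: "(nat \<times> nat) mat" where
  "a_op = (\<lambda>(x, y) (x', y'). of_bool (x' = Suc x \<and> y' = y) * complex_of_real (sqrt (real x')))"

definition e_op :: "(nat \<times> nat) mat" where
  "e_op = (\<lambda>(x, y) (x', y'). of_bool (x' = x \<and> y' = Suc y) * complex_of_real (sqrt (real y')))"

definition lincomb :: "real \<Rightarrow> 'x mat \<Rightarrow> real \<Rightarrow> 'x mat \<Rightarrow> 'x mat" where
  "lincomb s A t B = (\<lambda>x y. complex_of_real s * A x y + complex_of_real t * B x y)"

text \<open>The Heisenberg relations \<open>U\<^sup>\<dagger> a U = \<surd>G a + \<surd>(G - 1) e\<^sup>\<dagger>\<close> and \<open>U\<^sup>\<dagger> e U = \<surd>G e + \<surd>(G - 1) a\<^sup>\<dagger>\<close>, multiplied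
  by \<open>U\<close> from the left; they determine \<open>U\<close> up to a phase.  The second relation only fixes the
  output environment mode, which is traced out.\<close>

definition amplifier_unitary :: "real \<Rightarrow> (nat \<times> nat) mat \<Rightarrow> bool" where
  "amplifier_unitary G U \<longleftrightarrow> unitary U \<and>
     mult a_op U = mult U (lincomb (sqrt G) a_op (sqrt (G - 1)) (adj e_op)) \<and>
     mult e_op U = mult U (lincomb (sqrt G) e_op (sqrt (G - 1)) (adj a_op))"

definition amp_U :: "real \<Rightarrow> (nat \<times> nat) mat" where
  "amp_U G = (SOME U. amplifier_unitary G U)"

text \<open>\<open>U\<close> on each mode in \<open>S\<close> paired with its own environment mode.  The environment carries one
  mode per element of \<open>'k\<close>; those outside \<open>S\<close> stay idle.\<close>

definition amp_U_modes :: "real \<Rightarrow> 'k::finite set \<Rightarrow> (('k \<Rightarrow> nat) \<times> ('k \<Rightarrow> nat)) mat" where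
  "amp_U_modes G S = (\<lambda>(x, y) (x', y').
     (\<Prod>i\<in>UNIV. (if i \<in> S then amp_U G else one_mat) (x i, y i) (x' i, y' i)))"

definition vacuum :: "('k \<Rightarrow> nat) vec" where
  "vacuum = (\<lambda>n. of_bool (n = (\<lambda>_. 0)))"

text \<open>The amplifier of gain \<open>G\<close> on every mode in \<open>S\<close>, the identity channel on the other modes.\<close>

definition amplify :: "real \<Rightarrow> 'k::finite set \<Rightarrow> ('k \<Rightarrow> nat) mat \<Rightarrow> ('k \<Rightarrow> nat) mat" where
  "amplify G S \<rho> =
     (let U = amp_U_modes G S
      in trace_snd (mult (mult U (tensor \<rho> (pure vacuum))) (adj U)))"

end

theory Submission
  imports Defs
begin

text \<open>
  An amplified coherent state is \<open>\<Sum>\<^sub>y |f\<^sub>y\<rangle>\<langle>f\<^sub>y|\<close>, where \<open>y\<close> is the number of photons in the environment.  Its derivative in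
  the gain is \<open>(Y + Y\<^sup>\<dagger>) / 2\<close> with \<open>Y = \<Sum>\<^sub>y |\<xi>\<^sub>y\<rangle>\<langle>f\<^sub>y|\<close>, and the \<open>\<xi>\<^sub>y\<close> may be changed by mixing the \<open>f\<^sub>y\<close> with an
  antihermitian matrix.  For a suitable choice \<open>\<xi>\<^sub>y = L f\<^sub>y\<close> with a Hermitian \<open>L\<close> that is linear in the quadratures and
  the photon number, so that the quantum Fisher information is \<open>\<Sum>\<^sub>y \<parallel>\<xi>\<^sub>y\<parallel>\<^sup>2\<close>, a Poisson and negative binomial moment.

  For a mixture \<open>\<rho>\<close> of coherent states, averaging \<open>Y\<close> gives by the Cauchy-Schwarz inequality
  \<open>|(Yv)(x)|\<^sup>2 \<le> q(x) \<langle>v|\<rho>|v\<rangle>\<close>, where \<open>\<Sum>\<^sub>x q(x)\<close> is the average of \<open>\<Sum>\<^sub>y \<parallel>\<xi>\<^sub>y\<parallel>\<^sup>2\<close>, which is affine in the photon number.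
  Every \<open>Y\<close> with \<open>\<rho>' = (Y + Y\<^sup>\<dagger>) / 2\<close> and such a bound limits the quantum Fisher information by \<open>\<Sum>\<^sub>x q(x)\<close>.
\<close>

section \<open>Square-summable vectors\<close>

text \<open>The obstacle is existence. \<open>has_QFI\<close> asks for a logarithmic derivative that
  may be unbounded, and for a mixture there is no closed formula to offer; it has to be built in the
  eigenbasis of a state known only through its matrix elements, hence the spectral theorem for
  density matrices. The same pointwise bound on \<open>Y\<close> yields both existence and the upper
  estimate, and it survives averaging over the mixture.

  The freedom in \<xi> comes from tracing out the environment: an infinitesimal unitary acting there
  does not change the output state. Every choice gives an upper bound, and the one with \<xi> = L f
  is sharp for a single coherent state. The rotation achieving this is linear in the ladder
  operators of the environment and has one real coefficient, \<open>kappa\<close>, which is found by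
  requiring L to be Hermitian. Each L has mean zero, so the contributions of different modes are
  orthogonal and add up.\<close>

lemma cmod_sq_le_of_quadratic_nonneg:
  fixes a b :: real and z :: complex
  assumes nn: "\<And>t. 0 \<le> a + 2 * Re (t * z) + (cmod t)\<^sup>2 * b" and b: "b \<ge> 0"
  shows "(cmod z)\<^sup>2 \<le> a * b"
proof (cases "b = 0")
  case True
  show ?thesis
  proof (cases "z = 0")
    case False
    \<comment> \<open>For b = 0 the hypothesis is affine in t; this t makes it equal to -a - 2,
      against a >= 0.\<close>
    define t where "t = - complex_of_real ((a + 1) / (cmod z)\<^sup>2) * cnj z"
    have "t * z = - complex_of_real (a + 1)"
      using False unfolding t_def
      by (simp add: complex_norm_square[symmetric] mult.commute[of "cnj z"] mult.assoc)
    then have "0 \<le> a - 2 * (a + 1)" using nn[of t] True by simp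
    moreover have "0 \<le> a" using nn[of 0] by simp
    ultimately show ?thesis by simp
  qed (use nn[of 0] True in auto)
next
  case False
  then have b: "b > 0" using b by simp
  \<comment> \<open>The minimiser of the quadratic.\<close>
  define t where "t = - cnj z / complex_of_real b"
  have "t * z = - complex_of_real ((cmod z)\<^sup>2 / b)"
    unfolding t_def by (simp add: complex_norm_square mult.commute del: of_real_power)
  moreover have "(cmod t)\<^sup>2 * b = (cmod z)\<^sup>2 / b"
    using b unfolding t_def by (simp add: norm_divide power_divide power2_eq_square)
  ultimately have "0 \<le> a - (cmod z)\<^sup>2 / b" using nn[of t] by simp
  then show ?thesis using b by (simp add: field_simps)
qed

text \<open>The optimal t is sqrt (b / a), with value 2 sqrt (a b). Since a or b may vanish, both
  are first enlarged by a small d, chosen so that the product grows by at most e. This recovers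
  Cauchy-Schwarz from the weighted inequality between arithmetic and geometric means, which passes
  easily through sums and integrals.\<close>

lemma sq_le_of_weighted_bound:
  fixes w a b :: real
  assumes t: "\<And>t. t > 0 \<Longrightarrow> 2 * w \<le> t * a + b / t" and nn: "w \<ge> 0" "a \<ge> 0" "b \<ge> 0"
  shows "w\<^sup>2 \<le> a * b"
proof (rule field_le_epsilon)
  fix e :: real assume e: "e > 0"
  define d where "d = min 1 (e / (a + b + 1))"
  have d: "d > 0" "d \<le> 1" "d * (a + b + 1) \<le> e"
  proof -
    have "d * (a + b + 1) \<le> e / (a + b + 1) * (a + b + 1)"
      using nn by (intro mult_right_mono) (auto simp: d_def)
    then show "d * (a + b + 1) \<le> e" using nn by simp
  qed (use e nn in \<open>auto simp: d_def\<close>)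
  define a' b' where "a' = a + d" and "b' = b + d"
  have ab: "a' > 0" "b' > 0" using d nn by (auto simp: a'_def b'_def)
  define t where "t = sqrt (b' / a')"
  have tp: "t > 0" using ab by (simp add: t_def)
  have "2 * w \<le> t * a + b / t" by (rule t[OF tp])
  also have "\<dots> \<le> t * a' + b' / t"
    using tp d by (intro add_mono mult_left_mono divide_right_mono) (auto simp: a'_def b'_def)
  also have "\<dots> = 2 * sqrt (a' * b')"
    using ab by (simp add: t_def real_sqrt_divide real_sqrt_mult field_simps)
  finally have "w\<^sup>2 \<le> (sqrt (a' * b'))\<^sup>2" using nn by (intro power_mono) auto
  also have "\<dots> = a' * b'" using ab by simp
  also have "\<dots> = a * b + d * (a + b + d)" by (simp add: a'_def b'_def algebra_simps)
  also have "\<dots> \<le> a * b + d * (a + b + 1)" using d nn by (intro add_left_mono mult_left_mono) auto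
  finally show "w\<^sup>2 \<le> a * b + e" using d by simp
qed

lemma norm2_nonneg [simp]: "norm2 v \<ge> 0"
  by (simp add: norm2_def infsum_nonneg)

lemma norm2_sq: "(norm2 v)\<^sup>2 = (\<Sum>\<^sub>\<infinity>x. (cmod (v x))\<^sup>2)"
  by (simp add: norm2_def infsum_nonneg)

lemma ell2_has_sum: "ell2 v \<Longrightarrow> ((\<lambda>x. (cmod (v x))\<^sup>2) has_sum (norm2 v)\<^sup>2) UNIV"
  by (simp add: norm2_sq ell2_def)

lemma ell2_zero [simp]: "ell2 (\<lambda>x. 0)"
  by (simp add: ell2_def)

lemma ell2_add:
  assumes "ell2 u" "ell2 v" shows "ell2 (\<lambda>x. u x + v x)"
  using ell2_lin[OF assms(1) ell2_scale[OF assms(2), of "-1"]] by simp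

lemma ell2_sum:
  assumes "\<And>j. j \<in> F \<Longrightarrow> ell2 (v j)" shows "ell2 (\<lambda>x. \<Sum>j\<in>F. v j x)"
  using assms by (induction F rule: infinite_finite_induct) (auto intro: ell2_add)

lemma ell2_cnj: "ell2 v \<Longrightarrow> ell2 (\<lambda>x. cnj (v x))"
  by (simp add: ell2_def)

lemma ell2_comparison:
  assumes "g summable_on UNIV" "\<And>x. (cmod (v x))\<^sup>2 \<le> g x"
  shows "ell2 v"
  unfolding ell2_def by (rule summable_on_comparison_test[OF assms(1)]) (use assms(2) in auto)

lemma ell2_norm2_le:
  assumes "\<And>F. finite F \<Longrightarrow> (\<Sum>x\<in>F. (cmod (v x))\<^sup>2) \<le> C"
  shows "ell2 v" and "(norm2 v)\<^sup>2 \<le> C"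
proof -
  show "ell2 v"
    unfolding ell2_def by (rule nonneg_bdd_above_summable_on) (use assms in \<open>auto intro!: bdd_aboveI2\<close>)
  then show "(norm2 v)\<^sup>2 \<le> C"
    by (intro has_sum_le_finite_sums[OF ell2_has_sum]) (use assms in auto)
qed

lemma inner2_summable:
  assumes "ell2 u" "ell2 v" shows "(\<lambda>x. cnj (u x) * v x) summable_on UNIV"
  by (rule abs_summable_summable[OF ell2_cmult_abs_summable(1)[OF assms]])

lemma inner2_add_right:
  assumes "ell2 u" "ell2 v" "ell2 w"
  shows "inner2 u (\<lambda>x. v x + w x) = inner2 u v + inner2 u w"
  unfolding inner2_def distrib_left
  by (rule infsum_add) (use assms in \<open>auto intro: inner2_summable\<close>)

lemma inner2_diff_right:
  assumes "ell2 u" "ell2 v" "ell2 w"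
  shows "inner2 u (\<lambda>x. v x - w x) = inner2 u v - inner2 u w"
  unfolding inner2_def right_diff_distrib
  by (rule infsum_minus) (use assms in \<open>auto intro: inner2_summable\<close>)

lemma inner2_add_left:
  assumes "ell2 u" "ell2 v" "ell2 w"
  shows "inner2 (\<lambda>x. v x + w x) u = inner2 v u + inner2 w u"
  using inner2_add_right[OF assms] by (metis inner2_cnj complex_cnj_add)

lemma inner2_diff_left:
  assumes "ell2 u" "ell2 v" "ell2 w"
  shows "inner2 (\<lambda>x. v x - w x) u = inner2 v u - inner2 w u"
  using inner2_diff_right[OF assms] by (metis inner2_cnj complex_cnj_diff)

lemma inner2_scale_left: "inner2 (\<lambda>x. c * v x) u = cnj c * inner2 v u"
  by (metis inner2_cnj inner2_scale complex_cnj_mult)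

lemma norm2_scale_sq: "(norm2 (\<lambda>x. c * v x))\<^sup>2 = (cmod c)\<^sup>2 * (norm2 v)\<^sup>2"
  by (simp add: norm2_sq norm_mult power_mult_distrib infsum_cmult_right')

lemma norm2_add_scaled_sq:
  assumes "ell2 u" "ell2 v"
  shows "(norm2 (\<lambda>x. u x + c * v x))\<^sup>2 =
    (norm2 u)\<^sup>2 + 2 * Re (c * inner2 u v) + (cmod c)\<^sup>2 * (norm2 v)\<^sup>2"
proof -
  note e = assms ell2_scale[OF assms(2), of c]
  have "complex_of_real ((norm2 (\<lambda>x. u x + c * v x))\<^sup>2) =
      inner2 (\<lambda>x. u x + c * v x) (\<lambda>x. u x + c * v x)"
    using ell2_add[OF e(1,3)] by (simp add: inner2_self)
  also have "\<dots> = complex_of_real ((norm2 u)\<^sup>2) + (c * inner2 u v + cnj (c * inner2 u v)) +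
      complex_of_real ((cmod c)\<^sup>2 * (norm2 v)\<^sup>2)"
    using e ell2_add[OF e(1,3)]
    by (simp add: inner2_add_left inner2_add_right inner2_scale inner2_scale_left inner2_self
        inner2_cnj[of v u] complex_norm_square[of c] algebra_simps del: of_real_power)
  also have "\<dots> = complex_of_real ((norm2 u)\<^sup>2 + 2 * Re (c * inner2 u v) + (cmod c)\<^sup>2 * (norm2 v)\<^sup>2)"
    by (simp only: complex_add_cnj of_real_add of_real_mult of_real_numeral)
  finally show ?thesis using of_real_eq_iff by blast
qed

lemma norm2_add_sq:
  assumes "ell2 u" "ell2 v"
  shows "(norm2 (\<lambda>x. u x + v x))\<^sup>2 = (norm2 u)\<^sup>2 + 2 * Re (inner2 u v) + (norm2 v)\<^sup>2"
  using norm2_add_scaled_sq[OF assms, of 1] by simp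

lemma inner2_Cauchy_Schwarz:
  assumes "ell2 u" "ell2 v"
  shows "(cmod (inner2 u v))\<^sup>2 \<le> (norm2 u)\<^sup>2 * (norm2 v)\<^sup>2"
  by (rule cmod_sq_le_of_quadratic_nonneg)
    (simp_all add: norm2_add_scaled_sq[OF assms, symmetric] del: times_complex.sel)

lemma inner2_norm_le:
  assumes "ell2 u" "ell2 v"
  shows "cmod (inner2 u v) \<le> norm2 u * norm2 v"
  using inner2_Cauchy_Schwarz[OF assms] by (simp add: power_mult_distrib[symmetric] power2_le_iff_abs_le)

text \<open>The equality case of Cauchy-Schwarz: the given inner products make the norm of u - c w
  vanish. It turns overlaps between columns of the amplifier unitary into equations between
  columns.\<close>

lemma eq_scaled_if_inner2:
  assumes "ell2 u" "ell2 w" "inner2 u u = c\<^sup>2" "inner2 w u = c" "inner2 w w = 1" "c \<in> \<real>"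
  shows "u x = c * w x"
proof -
  obtain r where r: "c = complex_of_real r" using assms(6) by (auto elim: Reals_cases)
  note e = ell2_scale[OF assms(2), of "- c"]
  have n: "(norm2 u)\<^sup>2 = r\<^sup>2" "(norm2 w)\<^sup>2 = 1"
  proof -
    have "complex_of_real ((norm2 u)\<^sup>2) = complex_of_real (r\<^sup>2)"
      using inner2_self[OF assms(1)] assms(3) r by simp
    then show "(norm2 u)\<^sup>2 = r\<^sup>2" using of_real_eq_iff by blast
    have "complex_of_real ((norm2 w)\<^sup>2) = complex_of_real 1"
      using inner2_self[OF assms(2)] assms(5) by simp
    then show "(norm2 w)\<^sup>2 = 1" using of_real_eq_iff by blast
  qed
  have "inner2 u w = c" using inner2_cnj[of u w] assms(4) r by simp
  then have "(norm2 (\<lambda>x. u x + (- c) * w x))\<^sup>2 = 0"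
    unfolding norm2_add_scaled_sq[OF assms(1,2)] n r by (simp add: power2_eq_square)
  then have "u x + (- c) * w x = 0"
    using norm2_0_iff[OF ell2_add[OF assms(1) e]] by simp
  then show ?thesis by simp
qed


subsection \<open>Truncation and orthonormal expansions\<close>

definition trunc :: "'x set \<Rightarrow> 'x vec \<Rightarrow> 'x vec" where
  "trunc F v = (\<lambda>x. if x \<in> F then v x else 0)"

lemma ell2_trunc: "finite F \<Longrightarrow> ell2 (trunc F v)"
  unfolding ell2_def trunc_def
  by (rule has_sum_imp_summable, rule has_sum_finite_neutralI[of F]) auto

lemma norm2_trunc_sq: "finite F \<Longrightarrow> (norm2 (trunc F v))\<^sup>2 = (\<Sum>x\<in>F. (cmod (v x))\<^sup>2)"
  unfolding norm2_sq trunc_def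
  by (rule infsumI, rule has_sum_finite_neutralI[of F]) (auto intro!: sum.cong)

lemma inner2_trunc: "finite F \<Longrightarrow> inner2 (trunc F u) v = (\<Sum>x\<in>F. cnj (u x) * v x)"
  unfolding inner2_def trunc_def
  by (rule infsumI, rule has_sum_finite_neutralI[of F]) (auto intro!: sum.cong)

lemma norm2_minus_trunc_sq:
  assumes "ell2 v" "finite F"
  shows "(norm2 (\<lambda>x. v x - trunc F v x))\<^sup>2 = (norm2 v)\<^sup>2 - (\<Sum>x\<in>F. (cmod (v x))\<^sup>2)"
proof -
  have "((\<lambda>x. (cmod (v x))\<^sup>2 + - (cmod (trunc F v x))\<^sup>2) has_sum (norm2 v)\<^sup>2 + - (norm2 (trunc F v))\<^sup>2) UNIV"
    by (rule has_sum_add[OF ell2_has_sum[OF assms(1)] has_sum_uminusI[OF ell2_has_sum[OF ell2_trunc[OF assms(2)]]]])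
  moreover have "(\<lambda>x. (cmod (v x))\<^sup>2 + - (cmod (trunc F v x))\<^sup>2) = (\<lambda>x. (cmod (v x - trunc F v x))\<^sup>2)"
    by (auto simp: trunc_def fun_eq_iff)
  ultimately show ?thesis using assms(2) by (simp add: infsumI norm2_sq[of "\<lambda>x. v x - _ x"] norm2_trunc_sq)
qed

lemma norm2_minus_trunc_tendsto:
  assumes "ell2 v"
  shows "((\<lambda>F. norm2 (\<lambda>x. v x - trunc F v x)) \<longlongrightarrow> 0) (finite_subsets_at_top UNIV)"
proof -
  have "((\<lambda>F. (norm2 v)\<^sup>2 - (\<Sum>x\<in>F. (cmod (v x))\<^sup>2)) \<longlongrightarrow> (norm2 v)\<^sup>2 - (norm2 v)\<^sup>2) (finite_subsets_at_top UNIV)"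
    using ell2_has_sum[OF assms] unfolding has_sum_def by (intro tendsto_intros)
  then have "((\<lambda>F. sqrt ((norm2 v)\<^sup>2 - (\<Sum>x\<in>F. (cmod (v x))\<^sup>2))) \<longlongrightarrow> sqrt 0) (finite_subsets_at_top UNIV)"
    by (intro tendsto_real_sqrt) simp
  then show ?thesis
    unfolding real_sqrt_zero
    by (rule Lim_transform_eventually)
      (auto intro!: eventually_finite_subsets_at_top_weakI simp: norm2_minus_trunc_sq[OF assms, symmetric])
qed

definition orthonormal_family :: "'k set \<Rightarrow> ('k \<Rightarrow> 'x vec) \<Rightarrow> bool" where
  "orthonormal_family I e \<longleftrightarrow>
     (\<forall>k\<in>I. ell2 (e k)) \<and> (\<forall>j\<in>I. \<forall>k\<in>I. inner2 (e j) (e k) = of_bool (j = k))"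

context
  fixes I :: "'k set" and e :: "'k \<Rightarrow> 'x vec"
  assumes on: "orthonormal_family I e"
begin

lemma on_ell2: "k \<in> I \<Longrightarrow> ell2 (e k)"
  and on_inner: "j \<in> I \<Longrightarrow> k \<in> I \<Longrightarrow> inner2 (e j) (e k) = of_bool (j = k)"
  using on by (auto simp: orthonormal_family_def)

lemma inner2_finite_combination:
  assumes "finite F" "F \<subseteq> I" "j \<in> F"
  shows "inner2 (e j) (\<lambda>x. \<Sum>k\<in>F. c k * e k x) = c j"
proof -
  have "inner2 (e j) (\<lambda>x. \<Sum>k\<in>F. c k * e k x) = (\<Sum>k\<in>F. c k * inner2 (e j) (e k))"
    by (rule inner2_sum) (use assms on_ell2 in auto)
  also have "\<dots> = (\<Sum>k\<in>F. if k = j then c j else 0)"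
    by (rule sum.cong) (use assms on_inner[of j] in \<open>auto simp: subset_iff\<close>)
  finally show ?thesis using assms by simp
qed

lemma Bessel_finite:
  assumes F: "finite F" "F \<subseteq> I" and u: "ell2 u"
  shows "(\<Sum>k\<in>F. (cmod (inner2 (e k) u))\<^sup>2) \<le> (norm2 u)\<^sup>2"
proof -
  define c where "c k = inner2 (e k) u" for k
  define w where "w = (\<lambda>x. \<Sum>k\<in>F. c k * e k x)"
  have w: "ell2 w" unfolding w_def using F on_ell2 by (intro ell2_sum ell2_scale) auto
  have 1: "inner2 u w = complex_of_real (\<Sum>k\<in>F. (cmod (c k))\<^sup>2)"
    unfolding w_def using F on_ell2 u
    by (subst inner2_sum) (auto simp: c_def inner2_cnj[of u] complex_norm_square simp del: of_real_power intro!: sum.cong)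
  have "inner2 w w = (\<Sum>k\<in>F. c k * inner2 w (e k))"
    by (subst (2) w_def, rule inner2_sum) (use F on_ell2 w in auto)
  also have "\<dots> = complex_of_real (\<Sum>k\<in>F. (cmod (c k))\<^sup>2)"
    unfolding of_real_sum
  proof (rule sum.cong[OF refl])
    fix k assume k: "k \<in> F"
    have "inner2 w (e k) = cnj (c k)"
      using inner2_finite_combination[OF F k, of c] inner2_cnj[of w "e k"] by (simp add: w_def)
    then show "c k * inner2 w (e k) = complex_of_real ((cmod (c k))\<^sup>2)"
      by (simp only: complex_norm_square)
  qed
  finally have "complex_of_real ((norm2 w)\<^sup>2) = complex_of_real (\<Sum>k\<in>F. (cmod (c k))\<^sup>2)"
    using inner2_self[OF w] by simp
  then have 2: "(norm2 w)\<^sup>2 = (\<Sum>k\<in>F. (cmod (c k))\<^sup>2)" using of_real_eq_iff by blast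
  have "0 \<le> (norm2 (\<lambda>x. u x + (-1) * w x))\<^sup>2" by simp
  also have "\<dots> = (norm2 u)\<^sup>2 - (\<Sum>k\<in>F. (cmod (c k))\<^sup>2)"
    unfolding norm2_add_scaled_sq[OF u w] 1 2 by simp
  finally show ?thesis by (simp add: c_def)
qed

lemma Bessel:
  assumes "ell2 u"
  shows "(\<lambda>k. (cmod (inner2 (e k) u))\<^sup>2) summable_on I"
    and "(\<Sum>\<^sub>\<infinity>k\<in>I. (cmod (inner2 (e k) u))\<^sup>2) \<le> (norm2 u)\<^sup>2"
proof -
  show 1: "(\<lambda>k. (cmod (inner2 (e k) u))\<^sup>2) summable_on I"
    by (rule nonneg_bdd_above_summable_on) (use Bessel_finite assms in \<open>auto intro!: bdd_aboveI2\<close>)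
  show "(\<Sum>\<^sub>\<infinity>k\<in>I. (cmod (inner2 (e k) u))\<^sup>2) \<le> (norm2 u)\<^sup>2"
    by (rule infsum_le_finite_sums[OF 1]) (use Bessel_finite assms in auto)
qed

end

section \<open>Infinite orthonormal expansions\<close>

lemma has_sum_finite_sum:
  fixes f :: "'j \<Rightarrow> 'x \<Rightarrow> 'b::topological_comm_monoid_add"
  assumes "\<And>j. j \<in> F \<Longrightarrow> (f j has_sum s j) A"
  shows "((\<lambda>x. \<Sum>j\<in>F. f j x) has_sum (\<Sum>j\<in>F. s j)) A"
  using assms by (induction F rule: infinite_finite_induct) (auto intro!: has_sum_add)

lemma cauchy_schwarz_summable:
  fixes f g :: "'k \<Rightarrow> complex"
  assumes f: "(\<lambda>k. (cmod (f k))\<^sup>2) summable_on I" and g: "(\<lambda>k. (cmod (g k))\<^sup>2) summable_on I"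
  shows "(\<lambda>k. norm (f k * g k)) summable_on I" and "(\<lambda>k. f k * g k) summable_on I"
    and "cmod (\<Sum>\<^sub>\<infinity>k\<in>I. f k * g k) \<le>
      sqrt (\<Sum>\<^sub>\<infinity>k\<in>I. (cmod (f k))\<^sup>2) * sqrt (\<Sum>\<^sub>\<infinity>k\<in>I. (cmod (g k))\<^sup>2)"
proof -
  \<comment> \<open>Extension by zero moves the sums over \<open>I\<close> to a whole type, where
    \<open>inner2\<close> lives; the conjugate on f cancels the one in
    \<open>inner2\<close>.\<close>
  define u v where "u = (\<lambda>k. if k \<in> I then cnj (f k) else 0)" and "v = (\<lambda>k. if k \<in> I then g k else 0)"
  have s: "((\<lambda>k. (cmod (u k))\<^sup>2) summable_on UNIV) = ((\<lambda>k. (cmod (f k))\<^sup>2) summable_on I)"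
    "((\<lambda>k. (cmod (v k))\<^sup>2) summable_on UNIV) = ((\<lambda>k. (cmod (g k))\<^sup>2) summable_on I)"
    "((\<lambda>k. norm (cnj (u k) * v k)) summable_on UNIV) = ((\<lambda>k. norm (f k * g k)) summable_on I)"
    by (rule summable_on_cong_neutral; auto simp: u_def v_def)+
  have i: "(\<Sum>\<^sub>\<infinity>k. (cmod (u k))\<^sup>2) = (\<Sum>\<^sub>\<infinity>k\<in>I. (cmod (f k))\<^sup>2)"
    "(\<Sum>\<^sub>\<infinity>k. (cmod (v k))\<^sup>2) = (\<Sum>\<^sub>\<infinity>k\<in>I. (cmod (g k))\<^sup>2)"
    "inner2 u v = (\<Sum>\<^sub>\<infinity>k\<in>I. f k * g k)"
    unfolding inner2_def by (rule infsum_cong_neutral; auto simp: u_def v_def)+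
  have uv: "ell2 u" "ell2 v" using f g s by (auto simp: ell2_def)
  show 1: "(\<lambda>k. norm (f k * g k)) summable_on I"
    using ell2_cmult_abs_summable(1)[OF uv] s by simp
  then show "(\<lambda>k. f k * g k) summable_on I" by (rule abs_summable_summable)
  show "cmod (\<Sum>\<^sub>\<infinity>k\<in>I. f k * g k) \<le> sqrt (\<Sum>\<^sub>\<infinity>k\<in>I. (cmod (f k))\<^sup>2) * sqrt (\<Sum>\<^sub>\<infinity>k\<in>I. (cmod (g k))\<^sup>2)"
    using inner2_norm_le[OF uv] unfolding norm2_def i .
qed

text \<open>Since v is defined entry by entry, its square-summability needs an argument: by Bessel
  the antilinear functional \<open>T\<close> is bounded by C times the norm, and testing it on the
  truncations of v bounds the finite partial sums of its squared norm by the square of C.\<close>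

theorem Riesz_Fischer:
  fixes e :: "'k \<Rightarrow> 'x vec"
  assumes on: "orthonormal_family I e" and c: "(\<lambda>k. (cmod (c k))\<^sup>2) summable_on I"
  defines "v \<equiv> \<lambda>x. \<Sum>\<^sub>\<infinity>k\<in>I. c k * e k x"
  shows "ell2 v"
    and "((\<lambda>k. c k * e k x) has_sum v x) I"
    and "\<And>u. ell2 u \<Longrightarrow> ((\<lambda>k. c k * inner2 u (e k)) has_sum inner2 u v) I"
    and "\<And>j. j \<in> I \<Longrightarrow> inner2 (e j) v = c j"
    and "((\<lambda>k. (cmod (c k))\<^sup>2) has_sum (norm2 v)\<^sup>2) I"
proof -
  define C where "C = sqrt (\<Sum>\<^sub>\<infinity>k\<in>I. (cmod (c k))\<^sup>2)"
  define T where "T u = (\<Sum>\<^sub>\<infinity>k\<in>I. c k * inner2 u (e k))" for u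
  have sq: "(\<lambda>k. (cmod (inner2 u (e k)))\<^sup>2) = (\<lambda>k. (cmod (inner2 (e k) u))\<^sup>2)" for u
    by (subst inner2_cnj) simp
  have s: "(\<lambda>k. c k * inner2 u (e k)) summable_on I" if "ell2 u" for u
    by (rule cauchy_schwarz_summable(2)[OF c]) (use Bessel(1)[OF on that] sq[of u] in simp)
  have bd: "cmod (T u) \<le> C * norm2 u" if u: "ell2 u" for u
  proof -
    have "cmod (T u) \<le> C * sqrt (\<Sum>\<^sub>\<infinity>k\<in>I. (cmod (inner2 u (e k)))\<^sup>2)"
      unfolding T_def C_def
      by (rule cauchy_schwarz_summable(3)[OF c]) (use Bessel(1)[OF on u] sq[of u] in simp)
    also have "\<dots> \<le> C * norm2 u"
      unfolding sq using Bessel(2)[OF on u]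
      by (intro mult_left_mono real_le_lsqrt) (auto simp: C_def infsum_nonneg)
    finally show ?thesis .
  qed
  have Tket: "T (ket x) = v x" for x by (simp add: T_def v_def inner2_ket)
  show hs: "((\<lambda>k. c k * e k x) has_sum v x) I" for x
    using s[OF ell2_ket[of x]] by (simp add: inner2_ket v_def)
  have Ttr: "T (trunc F u) = (\<Sum>x\<in>F. cnj (u x) * v x)" if F: "finite F" for F u
  proof -
    have "((\<lambda>k. \<Sum>x\<in>F. cnj (u x) * (c k * e k x)) has_sum (\<Sum>x\<in>F. cnj (u x) * v x)) I"
      by (intro has_sum_finite_sum has_sum_cmult_right hs)
    moreover have "(\<Sum>x\<in>F. cnj (u x) * (c k * e k x)) = c k * inner2 (trunc F u) (e k)" for k
      by (simp add: inner2_trunc[OF F] sum_distrib_left mult_ac)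
    ultimately show ?thesis by (simp add: T_def infsumI)
  qed
  show v: "ell2 v"
  proof (rule ell2_norm2_le(1)[where C = "C\<^sup>2"])
    fix F :: "'x set" assume F: "finite F"
    let ?S = "\<Sum>x\<in>F. (cmod (v x))\<^sup>2"
    have "complex_of_real ?S = T (trunc F v)"
      unfolding Ttr[OF F] of_real_sum by (simp add: complex_norm_square mult.commute del: of_real_power)
    moreover have S: "?S \<ge> 0" by (simp add: sum_nonneg)
    ultimately have "?S = cmod (T (trunc F v))"
      by (metis norm_of_real abs_of_nonneg)
    also have "\<dots> \<le> C * norm2 (trunc F v)" by (rule bd[OF ell2_trunc[OF F]])
    also have "norm2 (trunc F v) = sqrt ?S"
      using norm2_trunc_sq[OF F, of v] using real_sqrt_unique[of "norm2 (trunc F v)"] by simp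
    finally have le: "sqrt ?S * sqrt ?S \<le> C * sqrt ?S" using S by simp
    have "sqrt ?S \<le> C"
    proof (cases "sqrt ?S > 0")
      case False
      have "C \<ge> 0" by (simp add: C_def infsum_nonneg)
      with False show ?thesis by linarith
    qed (use le in \<open>simp only: mult_le_cancel_right_pos\<close>)
    then have "(sqrt ?S)\<^sup>2 \<le> C\<^sup>2" using S by (intro power_mono) simp_all
    then show "?S \<le> C\<^sup>2" using S by simp
  qed
  \<comment> \<open>Both sides agree on truncations of u, and the bound on \<open>T\<close> controls
    the remainder, whose norm tends to 0.\<close>
  have TI: "T u = inner2 u v" if u: "ell2 u" for u
  proof -
    have "((\<lambda>F. C * norm2 (\<lambda>x. u x - trunc F u x)) \<longlongrightarrow> C * 0) (finite_subsets_at_top UNIV)"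
      by (intro tendsto_mult_left norm2_minus_trunc_tendsto u)
    then have lim0: "((\<lambda>F. C * norm2 (\<lambda>x. u x - trunc F u x)) \<longlongrightarrow> 0) (finite_subsets_at_top UNIV)" by simp
    have "((\<lambda>F. T u - (\<Sum>x\<in>F. cnj (u x) * v x)) \<longlongrightarrow> 0) (finite_subsets_at_top UNIV)"
    proof (rule Lim_null_comparison[OF _ lim0], rule eventually_finite_subsets_at_top_weakI)
      fix F :: "'x set" assume F: "finite F"
      have "T (\<lambda>x. u x - trunc F u x) = T u - T (trunc F u)"
        unfolding T_def using s[OF u] s[OF ell2_trunc[OF F, of u]] u ell2_trunc[OF F, of u] on_ell2[OF on]
        by (subst infsum_minus[symmetric]) (auto simp: inner2_diff_left right_diff_distrib intro!: infsum_cong)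
      then show "norm (T u - (\<Sum>x\<in>F. cnj (u x) * v x)) \<le> C * norm2 (\<lambda>x. u x - trunc F u x)"
        using bd[OF ell2_lin[OF u ell2_trunc[OF F, of u]]] by (simp add: Ttr[OF F])
    qed
    from tendsto_diff[OF tendsto_const[of "T u"] this]
    have "((\<lambda>x. cnj (u x) * v x) has_sum T u) UNIV" by (simp add: has_sum_def)
    then show ?thesis by (simp add: inner2_def infsumI)
  qed
  show hi: "((\<lambda>k. c k * inner2 u (e k)) has_sum inner2 u v) I" if "ell2 u" for u
    using s[OF that] TI[OF that] by (simp add: T_def has_sum_iff)
  show ej: "inner2 (e j) v = c j" if j: "j \<in> I" for j
  proof -
    have "((\<lambda>k. c k * inner2 (e j) (e k)) has_sum c j) I"
      by (rule has_sum_finite_neutralI[of "{j}"]) (use j on_inner[OF on] in auto)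
    then show ?thesis using hi[OF on_ell2[OF on j]] has_sum_unique by blast
  qed
  have "((\<lambda>k. c k * cnj (c k)) has_sum inner2 v v) I"
    by (rule has_sum_cong[THEN iffD1, OF _ hi[OF v]]) (use ej inner2_cnj in metis)
  then have "((\<lambda>k. Re (c k * cnj (c k))) has_sum Re (inner2 v v)) I" by (rule has_sum_Re)
  then show "((\<lambda>k. (cmod (c k))\<^sup>2) has_sum (norm2 v)\<^sup>2) I"
    by (simp add: inner2_self[OF v] complex_norm_square[symmetric] del: of_real_power) 
qed

lemma cauchy_schwarz_summable_real:
  fixes f g :: "'k \<Rightarrow> real"
  assumes f: "(\<lambda>k. (f k)\<^sup>2) summable_on I" and g: "(\<lambda>k. (g k)\<^sup>2) summable_on I"
  shows "(\<lambda>k. f k * g k) summable_on I"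
    and "(\<Sum>\<^sub>\<infinity>k\<in>I. f k * g k) \<le> sqrt (\<Sum>\<^sub>\<infinity>k\<in>I. (f k)\<^sup>2) * sqrt (\<Sum>\<^sub>\<infinity>k\<in>I. (g k)\<^sup>2)"
proof -
  have c: "(\<lambda>k. (cmod (complex_of_real (f k)))\<^sup>2) summable_on I"
    "(\<lambda>k. (cmod (complex_of_real (g k)))\<^sup>2) summable_on I"
    using f g by simp_all
  show s: "(\<lambda>k. f k * g k) summable_on I"
    using abs_summable_summable[OF cauchy_schwarz_summable(1)[OF c]]
    by (metis (mono_tags, lifting) of_real_mult summable_on_Re Re_complex_of_real summable_on_cong)
  have e: "(\<Sum>\<^sub>\<infinity>k\<in>I. complex_of_real (f k) * complex_of_real (g k)) = complex_of_real (\<Sum>\<^sub>\<infinity>k\<in>I. f k * g k)"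
    using has_sum_of_real[OF has_sum_infsum[OF s], where 'a = complex] by (intro infsumI) simp
  show "(\<Sum>\<^sub>\<infinity>k\<in>I. f k * g k) \<le> sqrt (\<Sum>\<^sub>\<infinity>k\<in>I. (f k)\<^sup>2) * sqrt (\<Sum>\<^sub>\<infinity>k\<in>I. (g k)\<^sup>2)"
    using cauchy_schwarz_summable(3)[OF c] unfolding e by simp
qed

lemma summable_on_product_nonneg:
  fixes f :: "'a \<Rightarrow> real" and g :: "'b \<Rightarrow> real"
  assumes "f summable_on A" "g summable_on B" "\<And>x. x \<in> A \<Longrightarrow> f x \<ge> 0" "\<And>y. y \<in> B \<Longrightarrow> g y \<ge> 0"
  shows "(\<lambda>(x, y). f x * g y) summable_on A \<times> B"
  by (rule summable_on_SigmaI[where g = "\<lambda>x. f x * infsum g B"])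
    (use assms in \<open>auto intro!: has_sum_cmult_right summable_on_cmult_left\<close>)

section \<open>Density matrices and their spectral decomposition\<close>

text \<open>Only finitely supported test vectors and diagonal entries occur, so the condition can be
  checked on matrix elements. Boundedness and positivity on all square-summable vectors are
  consequences.\<close>

definition density_matrix :: "'x mat \<Rightarrow> bool" where
  "density_matrix \<rho> \<longleftrightarrow>
     (\<forall>x y. \<rho> x y = cnj (\<rho> y x)) \<and>
     (\<forall>F v. finite F \<longrightarrow> 0 \<le> Re (\<Sum>x\<in>F. \<Sum>y\<in>F. cnj (v x) * \<rho> x y * v y)) \<and>
     ((\<lambda>x. Re (\<rho> x x)) has_sum 1) UNIV"

lemma app_add:
  assumes "\<And>x. ell2 (\<lambda>y. cnj (A x y))" "ell2 u" "ell2 v"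
  shows "app A (\<lambda>x. u x + c * v x) = (\<lambda>x. app A u x + c * app A v x)"
proof
  fix x
  have i: "app A w x = inner2 (\<lambda>y. cnj (A x y)) w" for w by (simp add: app_def inner2_def)
  show "app A (\<lambda>x. u x + c * v x) x = app A u x + c * app A v x"
    unfolding i using assms by (simp add: inner2_add_right ell2_scale inner2_scale)
qed

context
  fixes \<rho> :: "'x mat"
  assumes dm: "density_matrix \<rho>"
begin

lemma dm_hermitian: "\<rho> x y = cnj (\<rho> y x)"
  and dm_form_finite: "finite F \<Longrightarrow> 0 \<le> Re (\<Sum>x\<in>F. \<Sum>y\<in>F. cnj (v x) * \<rho> x y * v y)"
  and dm_trace: "((\<lambda>x. Re (\<rho> x x)) has_sum 1) UNIV"
  using dm unfolding density_matrix_def by blast+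

lemma dm_diag_nonneg: "Re (\<rho> x x) \<ge> 0"
  using dm_form_finite[of "{x}" "\<lambda>_. 1"] by simp

lemma dm_diag: "\<rho> x x = complex_of_real (Re (\<rho> x x))"
  using dm_hermitian[of x x] by (metis Reals_cnj_iff of_real_Re)

text \<open>Positivity of the two-by-two minor: the form is evaluated at the vector with entries 1
  at x and t at y.\<close>

lemma dm_entry_sq: "(cmod (\<rho> x y))\<^sup>2 \<le> Re (\<rho> x x) * Re (\<rho> y y)"
proof (cases "x = y")
  case True
  then show ?thesis
    using dm_diag[of y] dm_diag_nonneg[of y]
    by (metis norm_of_real abs_of_nonneg power2_eq_square order_refl)
next
  case False
  show ?thesis
  proof (rule cmod_sq_le_of_quadratic_nonneg)
    fix t :: complex
    define v where "v = (\<lambda>z. if z = x then 1 else t)"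
    have "cnj t * \<rho> y x = cnj (t * \<rho> x y)"
      using dm_hermitian[of y x] by simp
    then have "Re (cnj t * \<rho> y x) = Re (t * \<rho> x y)" by (simp only: cnj.simps(1))
    moreover have "Re (cnj t * \<rho> y y * t) = (cmod t)\<^sup>2 * Re (\<rho> y y)"
    proof -
      have "cnj t * \<rho> y y * t = complex_of_real ((cmod t)\<^sup>2 * Re (\<rho> y y))"
        using dm_diag[of y] by (simp add: complex_norm_square mult_ac del: of_real_power)
      then show ?thesis by (metis Re_complex_of_real)
    qed
    moreover have "(\<Sum>a\<in>{x, y}. \<Sum>b\<in>{x, y}. cnj (v a) * \<rho> a b * v b) =
        \<rho> x x + \<rho> x y * t + (cnj t * \<rho> y x + cnj t * \<rho> y y * t)"
      using False by (simp add: v_def)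
    ultimately have "Re (\<Sum>a\<in>{x, y}. \<Sum>b\<in>{x, y}. cnj (v a) * \<rho> a b * v b) =
        Re (\<rho> x x) + 2 * Re (t * \<rho> x y) + (cmod t)\<^sup>2 * Re (\<rho> y y)"
      by (simp only: plus_complex.sel mult.commute[of "\<rho> x y" t])
    then show "0 \<le> Re (\<rho> x x) + 2 * Re (t * \<rho> x y) + (cmod t)\<^sup>2 * Re (\<rho> y y)"
      using dm_form_finite[of "{x, y}" v] by simp
  qed (rule dm_diag_nonneg)
qed

text \<open>The entries of \<rho> are dominated by \<open>dm_root x * dm_root y\<close>, and
  \<open>dm_root\<close> is a unit vector. This domination by a rank-one kernel justifies the
  estimates and exchanges of summation below.\<close>

definition dm_root :: "'x \<Rightarrow> real" where "dm_root x = sqrt (Re (\<rho> x x))"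

lemma dm_root_nonneg [simp]: "dm_root x \<ge> 0"
  by (simp add: dm_root_def dm_diag_nonneg)

lemma dm_entry: "cmod (\<rho> x y) \<le> dm_root x * dm_root y"
  using real_sqrt_le_mono[OF dm_entry_sq[of x y]] by (simp add: dm_root_def real_sqrt_mult)

lemma dm_root_has_sum: "((\<lambda>x. (dm_root x)\<^sup>2) has_sum 1) UNIV"
  using dm_trace by (simp add: dm_root_def dm_diag_nonneg)

lemma dm_row_ell2: "ell2 (\<lambda>y. cnj (\<rho> x y))"
proof (rule ell2_comparison)
  show "(\<lambda>y. (dm_root x)\<^sup>2 * (dm_root y)\<^sup>2) summable_on UNIV"
    by (intro summable_on_cmult_right has_sum_imp_summable[OF dm_root_has_sum])
  show "(cmod (cnj (\<rho> x y)))\<^sup>2 \<le> (dm_root x)\<^sup>2 * (dm_root y)\<^sup>2" for y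
    using power_mono[OF dm_entry[of x y], of 2] by (simp add: power_mult_distrib)
qed

lemma dm_app_inner: "app \<rho> v x = inner2 (\<lambda>y. cnj (\<rho> x y)) v"
  by (simp add: app_def inner2_def)

lemma dm_app_lin:
  assumes "ell2 u" "ell2 v"
  shows "app \<rho> (\<lambda>x. u x + c * v x) = (\<lambda>x. app \<rho> u x + c * app \<rho> v x)"
  by (rule app_add[OF dm_row_ell2 assms])

lemma dm_weight_summable:
  assumes "ell2 v"
  shows "(\<lambda>x. dm_root x * cmod (v x)) summable_on UNIV"
    and "(\<Sum>\<^sub>\<infinity>x. dm_root x * cmod (v x)) \<le> norm2 v"
  using cauchy_schwarz_summable_real[OF has_sum_imp_summable[OF dm_root_has_sum] assms[unfolded ell2_def]]
    infsumI[OF dm_root_has_sum] by (simp_all add: norm2_def)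

lemma dm_row_abs_summable:
  assumes "ell2 v" shows "(\<lambda>y. norm (\<rho> x y * v y)) summable_on UNIV"
  using ell2_cmult_abs_summable(1)[OF dm_row_ell2[of x] assms] by simp

lemma dm_app_bound:
  assumes "ell2 v" shows "cmod (app \<rho> v x) \<le> dm_root x * norm2 v"
proof -
  have "cmod (app \<rho> v x) \<le> (\<Sum>\<^sub>\<infinity>y. norm (\<rho> x y * v y))"
    unfolding app_def by (rule norm_infsum_bound) (rule dm_row_abs_summable[OF assms])
  also have "\<dots> \<le> (\<Sum>\<^sub>\<infinity>y. dm_root x * (dm_root y * cmod (v y)))"
  proof (rule infsum_mono[OF dm_row_abs_summable[OF assms] summable_on_cmult_right[OF dm_weight_summable(1)[OF assms]]])
    fix y show "norm (\<rho> x y * v y) \<le> dm_root x * (dm_root y * cmod (v y))"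
      using mult_right_mono[OF dm_entry[of x y], of "cmod (v y)"] by (simp add: norm_mult mult.assoc)
  qed
  also have "\<dots> \<le> dm_root x * norm2 v"
    using dm_weight_summable(2)[OF assms] by (simp add: infsum_cmult_right' mult_left_mono)
  finally show ?thesis .
qed

lemma dm_app_ell2:
  assumes "ell2 v" shows "ell2 (app \<rho> v)"
proof (rule ell2_comparison)
  show "(\<lambda>x. (norm2 v)\<^sup>2 * (dm_root x)\<^sup>2) summable_on UNIV"
    by (intro summable_on_cmult_right has_sum_imp_summable[OF dm_root_has_sum])
  show "(cmod (app \<rho> v x))\<^sup>2 \<le> (norm2 v)\<^sup>2 * (dm_root x)\<^sup>2" for x
    using power_mono[OF dm_app_bound[OF assms, of x], of 2] by (simp add: power_mult_distrib mult.commute)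
qed

lemma dm_symmetric:
  assumes "ell2 u" "ell2 v"
  shows "inner2 (app \<rho> u) v = inner2 u (app \<rho> v)"
proof -
  have s: "(\<lambda>(x, y). cnj (u x) * \<rho> x y * v y) summable_on UNIV \<times> UNIV"
  proof (rule abs_summable_summable, rule Infinite_Sum.abs_summable_on_comparison_test')
    show "(\<lambda>(x, y). (dm_root x * cmod (u x)) * (dm_root y * cmod (v y))) summable_on UNIV \<times> UNIV"
      by (rule summable_on_product_nonneg) (use assms dm_weight_summable(1) in auto)
    fix z :: "'x \<times> 'x"
    obtain x y where z: "z = (x, y)" by force
    show "norm (case z of (x, y) \<Rightarrow> cnj (u x) * \<rho> x y * v y) \<le>
        (case z of (x, y) \<Rightarrow> dm_root x * cmod (u x) * (dm_root y * cmod (v y)))"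
      using mult_right_mono[OF dm_entry[of x y], of "cmod (u x) * cmod (v y)"]
      by (simp add: z norm_mult mult_ac)
  qed
  have "inner2 u (app \<rho> v) = (\<Sum>\<^sub>\<infinity>x. \<Sum>\<^sub>\<infinity>y. cnj (u x) * \<rho> x y * v y)"
    unfolding inner2_def app_def by (simp add: infsum_cmult_right'[symmetric] mult.assoc)
  also have "\<dots> = (\<Sum>\<^sub>\<infinity>y. \<Sum>\<^sub>\<infinity>x. cnj (u x) * \<rho> x y * v y)"
    by (rule infsum_swap_banach[OF s])
  also have "\<dots> = inner2 (app \<rho> u) v"
  proof -
    have "cnj (app \<rho> u y) = (\<Sum>\<^sub>\<infinity>x. cnj (u x) * \<rho> x y)" for y
      unfolding app_def infsum_cnj[symmetric] complex_cnj_mult dm_hermitian[of _ y, symmetric]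
      by (simp only: mult.commute)
    then show ?thesis
      unfolding inner2_def by (simp only: infsum_cmult_left'[symmetric])
  qed
  finally show ?thesis by simp
qed

lemma dm_form_bound:
  assumes "ell2 u" "ell2 v"
  shows "cmod (inner2 u (app \<rho> v)) \<le> (\<Sum>\<^sub>\<infinity>x. dm_root x * cmod (u x)) * norm2 v"
proof -
  have s: "(\<lambda>x. norm (cnj (u x) * app \<rho> v x)) summable_on UNIV"
    by (rule ell2_cmult_abs_summable(1)[OF assms(1) dm_app_ell2[OF assms(2)]])
  have "cmod (inner2 u (app \<rho> v)) \<le> (\<Sum>\<^sub>\<infinity>x. norm (cnj (u x) * app \<rho> v x))"
    unfolding inner2_def by (rule norm_infsum_bound[OF s])
  also have "\<dots> \<le> (\<Sum>\<^sub>\<infinity>x. dm_root x * cmod (u x) * norm2 v)"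
  proof (rule infsum_mono[OF s summable_on_cmult_left[OF dm_weight_summable(1)[OF assms(1)]]])
    fix x show "norm (cnj (u x) * app \<rho> v x) \<le> dm_root x * cmod (u x) * norm2 v"
      using mult_left_mono[OF dm_app_bound[OF assms(2), of x], of "cmod (u x)"]
      by (simp add: norm_mult mult_ac)
  qed
  finally show ?thesis by (simp add: infsum_cmult_left')
qed

text \<open>The norm of \<open>dm_root\<close> outside the finite set F.\<close>

definition dm_tail :: "'x set \<Rightarrow> real" where "dm_tail F = sqrt (1 - (\<Sum>x\<in>F. (dm_root x)\<^sup>2))"

lemma dm_tail_tendsto: "(dm_tail \<longlongrightarrow> 0) (finite_subsets_at_top UNIV)"
proof -
  have "((\<lambda>F. sqrt (1 - (\<Sum>x\<in>F. (dm_root x)\<^sup>2))) \<longlongrightarrow> sqrt (1 - 1)) (finite_subsets_at_top UNIV)"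
    using dm_root_has_sum unfolding has_sum_def by (intro tendsto_intros)
  then show ?thesis by (simp add: dm_tail_def[abs_def])
qed

lemma dm_weight_minus_trunc:
  assumes v: "ell2 v" and F: "finite F"
  shows "(\<Sum>\<^sub>\<infinity>x. dm_root x * cmod (v x - trunc F v x)) \<le> dm_tail F * norm2 v"
proof -
  have n: "(\<lambda>x. (dm_root x)\<^sup>2) summable_on A" for A
    by (rule summable_on_subset_banach[OF has_sum_imp_summable[OF dm_root_has_sum]]) auto
  have "(\<Sum>\<^sub>\<infinity>x\<in>UNIV. (dm_root x)\<^sup>2) = (\<Sum>\<^sub>\<infinity>x\<in>- F. (dm_root x)\<^sup>2) + (\<Sum>x\<in>F. (dm_root x)\<^sup>2)"
    using infsum_Un_disjoint[OF n n, of "- F" F] F by (simp add: Un_commute)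
  then have t: "(\<Sum>\<^sub>\<infinity>x\<in>- F. (dm_root x)\<^sup>2) = 1 - (\<Sum>x\<in>F. (dm_root x)\<^sup>2)"
    using infsumI[OF dm_root_has_sum] by simp
  have g: "(\<lambda>x. (cmod (v x))\<^sup>2) summable_on - F"
    by (rule summable_on_subset_banach[of _ UNIV]) (use v in \<open>auto simp: ell2_def\<close>)
  have "(\<Sum>\<^sub>\<infinity>x. dm_root x * cmod (v x - trunc F v x)) = (\<Sum>\<^sub>\<infinity>x\<in>-F. dm_root x * cmod (v x))"
    by (rule infsum_cong_neutral) (auto simp: trunc_def)
  also have "\<dots> \<le> sqrt (\<Sum>\<^sub>\<infinity>x\<in>- F. (dm_root x)\<^sup>2) * sqrt (\<Sum>\<^sub>\<infinity>x\<in>- F. (cmod (v x))\<^sup>2)"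
    by (rule cauchy_schwarz_summable_real(2)[OF n g])
  also have "\<dots> \<le> dm_tail F * norm2 v"
  proof -
    have "(\<Sum>\<^sub>\<infinity>x\<in>- F. (cmod (v x))\<^sup>2) \<le> (\<Sum>\<^sub>\<infinity>x. (cmod (v x))\<^sup>2)"
      by (rule infsum_mono_neutral[OF g]) (use v in \<open>auto simp: ell2_def\<close>)
    moreover have "0 \<le> 1 - (\<Sum>x\<in>F. (dm_root x)\<^sup>2)"
      unfolding t[symmetric] by (simp add: infsum_nonneg)
    ultimately show ?thesis
      unfolding t dm_tail_def norm2_def by (intro mult_left_mono real_sqrt_le_mono) simp_all
  qed
  finally show ?thesis by simp
qed

definition dm_form :: "'x vec \<Rightarrow> real" where "dm_form v = Re (inner2 v (app \<rho> v))"

lemma dm_form_trunc: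
  assumes F: "finite F"
  shows "dm_form (trunc F v) = Re (\<Sum>x\<in>F. \<Sum>y\<in>F. cnj (v x) * \<rho> x y * v y)"
proof -
  have "app \<rho> (trunc F v) x = (\<Sum>y\<in>F. \<rho> x y * v y)" for x
    unfolding app_def trunc_def
    by (rule infsumI, rule has_sum_finite_neutralI[of F]) (use F in \<open>auto intro!: sum.cong\<close>)
  then show ?thesis
    unfolding dm_form_def inner2_trunc[OF F] by (simp add: sum_distrib_left mult.assoc)
qed

text \<open>The error depends on v only through its norm and not through its tail, because the tail
  of \<rho> is small instead. This uniformity over bounded sets is what makes the form continuous
  for entrywise convergence.\<close>

lemma dm_form_trunc_diff:
  assumes v: "ell2 v" and F: "finite F"
  shows "\<bar>dm_form v - dm_form (trunc F v)\<bar> \<le> 2 * dm_tail F * (norm2 v)\<^sup>2"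
proof -
  define w where "w = (\<lambda>x. v x - trunc F v x)"
  have t: "ell2 (trunc F v)" by (rule ell2_trunc[OF F])
  have w: "ell2 w" unfolding w_def by (rule ell2_lin[OF v t])
  have vw: "v = (\<lambda>x. trunc F v x + 1 * w x)" by (simp add: w_def)
  have "app \<rho> v = (\<lambda>x. app \<rho> (trunc F v) x + 1 * app \<rho> w x)"
    by (subst vw) (rule dm_app_lin[OF t w])
  then have a: "inner2 u (app \<rho> v) = inner2 u (app \<rho> (trunc F v)) + inner2 u (app \<rho> w)" if "ell2 u" for u
    using that t w by (simp add: inner2_add_right dm_app_ell2)
  have "inner2 v (app \<rho> v) = inner2 (trunc F v) (app \<rho> v) + inner2 w (app \<rho> v)"
    using inner2_add_left[OF dm_app_ell2[OF v] t w] vw by simp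
  then have "inner2 v (app \<rho> v) - inner2 (trunc F v) (app \<rho> (trunc F v)) =
      inner2 (trunc F v) (app \<rho> w) + inner2 w (app \<rho> v)"
    using a[OF t] by simp
  moreover have "cmod (inner2 (trunc F v) (app \<rho> w)) \<le> dm_tail F * norm2 v * norm2 v"
  proof -
    have "cmod (inner2 (trunc F v) (app \<rho> w)) = cmod (inner2 w (app \<rho> (trunc F v)))"
      using dm_symmetric[OF t w] inner2_cnj by (metis complex_mod_cnj)
    also have "\<dots> \<le> (dm_tail F * norm2 v) * norm2 (trunc F v)"
      using dm_form_bound[OF w t] mult_right_mono[OF dm_weight_minus_trunc[OF v F] norm2_nonneg]
      unfolding w_def by (rule order_trans)
    also have "\<dots> \<le> (dm_tail F * norm2 v) * norm2 v"
    proof (rule mult_left_mono)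
      have "(norm2 (trunc F v))\<^sup>2 \<le> (norm2 v)\<^sup>2"
        unfolding norm2_trunc_sq[OF F] by (rule finite_sum_le_has_sum[OF ell2_has_sum[OF v] F]) auto
      then show "norm2 (trunc F v) \<le> norm2 v" by (simp add: power2_le_iff_abs_le)
      have "0 \<le> (\<Sum>\<^sub>\<infinity>x. dm_root x * cmod (v x - trunc F v x))" by (simp add: infsum_nonneg)
      then show "0 \<le> dm_tail F * norm2 v" using dm_weight_minus_trunc[OF v F] by linarith
    qed
    finally show ?thesis .
  qed
  moreover have "cmod (inner2 w (app \<rho> v)) \<le> dm_tail F * norm2 v * norm2 v"
    using dm_form_bound[OF w v] mult_right_mono[OF dm_weight_minus_trunc[OF v F] norm2_nonneg[of v]]
    by (simp add: w_def)
  ultimately have "cmod (inner2 v (app \<rho> v) - inner2 (trunc F v) (app \<rho> (trunc F v))) \<le>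
      2 * (dm_tail F * norm2 v * norm2 v)"
    using norm_triangle_ineq[of "inner2 (trunc F v) (app \<rho> w)" "inner2 w (app \<rho> v)"] by simp
  then have "\<bar>Re (inner2 v (app \<rho> v) - inner2 (trunc F v) (app \<rho> (trunc F v)))\<bar> \<le>
      2 * (dm_tail F * norm2 v * norm2 v)"
    using abs_Re_le_cmod order_trans by blast
  then show ?thesis by (simp add: dm_form_def power2_eq_square mult_ac)
qed

lemma dm_form_trunc_tendsto:
  assumes v: "ell2 v"
  shows "((\<lambda>F. dm_form (trunc F v)) \<longlongrightarrow> dm_form v) (finite_subsets_at_top UNIV)"
proof -
  have "((\<lambda>F. 2 * dm_tail F * (norm2 v)\<^sup>2) \<longlongrightarrow> 2 * 0 * (norm2 v)\<^sup>2) (finite_subsets_at_top UNIV)"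
    by (intro tendsto_intros dm_tail_tendsto)
  then have z: "((\<lambda>F. 2 * dm_tail F * (norm2 v)\<^sup>2) \<longlongrightarrow> 0) (finite_subsets_at_top UNIV)" by simp
  have "((\<lambda>F. dm_form (trunc F v) - dm_form v) \<longlongrightarrow> 0) (finite_subsets_at_top UNIV)"
  proof (rule Lim_null_comparison[OF _ z], rule eventually_finite_subsets_at_top_weakI)
    fix F :: "'x set" assume "finite F"
    from dm_form_trunc_diff[OF v this]
    show "norm (dm_form (trunc F v) - dm_form v) \<le> 2 * dm_tail F * (norm2 v)\<^sup>2"
      unfolding real_norm_def by (subst abs_minus_commute)
  qed
  then show ?thesis by (rule Lim_null[THEN iffD2])
qed

lemma dm_form_nonneg:
  assumes "ell2 v" shows "dm_form v \<ge> 0"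
  by (rule tendsto_lowerbound[OF dm_form_trunc_tendsto[OF assms]])
    (auto intro!: eventually_finite_subsets_at_top_weakI dm_form_finite simp only: dm_form_trunc
      finite_subsets_at_top_neq_bot)

lemma dm_form_add_scaled:
  assumes u: "ell2 u" and v: "ell2 v"
  shows "dm_form (\<lambda>x. u x + c * v x) =
    dm_form u + 2 * Re (c * inner2 u (app \<rho> v)) + (cmod c)\<^sup>2 * dm_form v"
proof -
  note e = u v dm_app_ell2[OF u] dm_app_ell2[OF v] ell2_scale[OF v, of c] ell2_scale[OF dm_app_ell2[OF v], of c]
  have "inner2 v (app \<rho> u) = cnj (inner2 u (app \<rho> v))"
    using dm_symmetric[OF u v] inner2_cnj by metis
  then have "inner2 (\<lambda>x. u x + c * v x) (app \<rho> (\<lambda>x. u x + c * v x)) =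
      inner2 u (app \<rho> u) + (c * inner2 u (app \<rho> v) + cnj (c * inner2 u (app \<rho> v))) +
      complex_of_real ((cmod c)\<^sup>2) * inner2 v (app \<rho> v)"
    unfolding dm_app_lin[OF u v] complex_norm_square
    using e ell2_add[OF e(3) e(6)]
    by (simp add: inner2_add_left inner2_add_right inner2_scale inner2_scale_left algebra_simps)
  then show ?thesis by (simp add: dm_form_def complex_add_cnj del: of_real_power)
qed

lemma dm_form_Cauchy_Schwarz:
  assumes "ell2 u" "ell2 v"
  shows "(cmod (inner2 u (app \<rho> v)))\<^sup>2 \<le> dm_form u * dm_form v"
  by (rule cmod_sq_le_of_quadratic_nonneg)
    (use dm_form_nonneg[OF ell2_add[OF assms(1) ell2_scale[OF assms(2)]]] dm_form_nonneg[OF assms(2)]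
     in \<open>simp_all add: dm_form_add_scaled[OF assms] del: times_complex.sel\<close>)

text \<open>Cauchy-Schwarz for the form, with \<open>app \<rho> v\<close> itself as the other
  vector.\<close>

lemma dm_form_0_app:
  assumes v: "ell2 v" and 0: "dm_form v = 0" shows "app \<rho> v = (\<lambda>x. 0)"
proof -
  have "(cmod (inner2 (app \<rho> v) (app \<rho> v)))\<^sup>2 \<le> 0"
    using dm_form_Cauchy_Schwarz[OF dm_app_ell2[OF v] v] 0 by simp
  then have "inner2 (app \<rho> v) (app \<rho> v) = 0" by simp
  then have "norm2 (app \<rho> v) = 0" using inner2_self[OF dm_app_ell2[OF v]] by simp
  then show ?thesis using norm2_0_iff[OF dm_app_ell2[OF v]] by auto
qed


end

section \<open>Weak compactness and existence of eigenvectors\<close>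

definition dm_ball :: "'x vec set \<Rightarrow> 'x vec set" where
  "dm_ball E = {v. ell2 v \<and> (norm2 v)\<^sup>2 \<le> 1 \<and> (\<forall>e\<in>E. inner2 e v = 0)}"

text \<open>Vectors are functions, so the topology is that of entrywise convergence. The norm bound
  is a family of closed conditions on finitely many entries, and the ball lies in a product of
  discs, which is compact by Tychonoff.\<close>

lemma unit_ball_compact:
  defines "B \<equiv> {v :: 'x vec. ell2 v \<and> (norm2 v)\<^sup>2 \<le> 1}"
  shows "closed B" "compact B"
proof -
  have B: "B = (\<Inter>F\<in>{F. finite F}. {v. (\<Sum>x\<in>F. (cmod (v x))\<^sup>2) \<le> 1})"
  proof (intro equalityI subsetI)
    fix v assume "v \<in> B"
    then show "v \<in> (\<Inter>F\<in>{F. finite F}. {v. (\<Sum>x\<in>F. (cmod (v x))\<^sup>2) \<le> 1})"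
      unfolding B_def by (auto intro!: order_trans[OF finite_sum_le_has_sum[OF ell2_has_sum]])
  next
    fix v :: "'x vec" assume "v \<in> (\<Inter>F\<in>{F. finite F}. {v. (\<Sum>x\<in>F. (cmod (v x))\<^sup>2) \<le> 1})"
    then show "v \<in> B" unfolding B_def using ell2_norm2_le[of v 1] by auto
  qed
  show "closed B"
    unfolding B
    by (intro closed_INT ballI closed_Collect_le continuous_intros continuous_on_product_coordinates)
  moreover have "compact (PiE UNIV (\<lambda>_::'x. cball (0::complex) 1))"
    using compactin_PiE[of "\<lambda>_::'x. euclidean :: complex topology" UNIV "\<lambda>_. cball 0 1"]
    by (simp add: euclidean_product_topology)
  moreover have "B \<subseteq> PiE UNIV (\<lambda>_. cball 0 1)"
  proof
    fix v assume "v \<in> B"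
    then have "(\<Sum>x\<in>{x}. (cmod (v x))\<^sup>2) \<le> 1" for x unfolding B by blast
    then show "v \<in> PiE UNIV (\<lambda>_. cball 0 1)" by (auto simp: power_le_one_iff abs_square_le_1)
  qed
  ultimately show "compact B"
    by (metis compact_Int_closed Int_absorb1)
qed

context
  fixes \<rho> :: "'x mat"
  assumes dm: "density_matrix \<rho>"
begin

text \<open>On the unit ball the functional \<open>inner2 e\<close> is a uniform limit of finite
  sums, with error at most the norm of the tail of e; hence the orthogonality conditions are
  closed.\<close>

lemma compact_dm_ball:
  fixes E :: "'x vec set"
  assumes E: "\<And>e. e \<in> E \<Longrightarrow> ell2 e"
  shows "compact (dm_ball E)"
proof -
  let ?B = "{v :: 'x vec. ell2 v \<and> (norm2 v)\<^sup>2 \<le> 1}"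
  note cB = unit_ball_compact(1)
  have "continuous_on ?B (inner2 e)" if e: "e \<in> E" for e
  proof (rule uniform_limit_theorem)
    show "\<forall>\<^sub>F F in finite_subsets_at_top UNIV. continuous_on ?B (\<lambda>v. \<Sum>x\<in>F. cnj (e x) * v x)"
      by (intro always_eventually allI continuous_intros continuous_on_product_coordinates[THEN continuous_on_subset]) auto
    show "uniform_limit ?B (\<lambda>F v. \<Sum>x\<in>F. cnj (e x) * v x) (inner2 e) (finite_subsets_at_top UNIV)"
      unfolding uniform_limit_iff
    proof (intro allI impI)
      fix r :: real assume r: "r > 0"
      have fin: "\<forall>\<^sub>F F in finite_subsets_at_top (UNIV :: 'x set). finite F"
        by (rule eventually_finite_subsets_at_top_weakI)
      have "\<forall>\<^sub>F F in finite_subsets_at_top UNIV. norm2 (\<lambda>x. e x - trunc F e x) < r"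
        using norm2_minus_trunc_tendsto[OF E[OF e]] r by (simp add: order_tendstoD(2))
      then show "\<forall>\<^sub>F F in finite_subsets_at_top UNIV. \<forall>v\<in>?B. dist (\<Sum>x\<in>F. cnj (e x) * v x) (inner2 e v) < r"
        using fin
      proof eventually_elim
        case (elim F)
        show ?case
        proof
          fix v :: "'x vec" assume "v \<in> ?B"
          then have v: "ell2 v" "norm2 v \<le> 1" by (auto simp: abs_square_le_1)
          note t = ell2_trunc[OF elim(2), of e]
          have "cmod (inner2 e v - inner2 (trunc F e) v) \<le> norm2 (\<lambda>x. e x - trunc F e x) * norm2 v"
            using inner2_norm_le[OF ell2_lin[OF E[OF e] t] v(1)] inner2_diff_left[OF v(1) E[OF e] t] by simp
          also have "\<dots> \<le> norm2 (\<lambda>x. e x - trunc F e x) * 1" by (intro mult_left_mono v) simp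
          finally show "dist (\<Sum>x\<in>F. cnj (e x) * v x) (inner2 e v) < r"
            using elim by (simp add: dist_norm norm_minus_commute inner2_trunc)
        qed
      qed
    qed
  qed simp
  then have "closed (?B \<inter> inner2 e -` {0})" if "e \<in> E" for e
    using that cB by (intro continuous_closed_preimage) auto
  then have "closed (\<Inter>e\<in>E. ?B \<inter> inner2 e -` {0})" by (intro closed_INT ballI)
  then have "compact (?B \<inter> (\<Inter>e\<in>E. ?B \<inter> inner2 e -` {0}))"
    using unit_ball_compact(2) by (rule compact_Int_closed[rotated])
  also have "?B \<inter> (\<Inter>e\<in>E. ?B \<inter> inner2 e -` {0}) = dm_ball E"
    by (auto simp: dm_ball_def)
  finally show ?thesis .
qed

text \<open>The norm is not continuous for entrywise convergence, but the form of \<rho> is: by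
  \<open>dm_form_trunc_diff\<close> it is a uniform limit on the ball of functions of finitely many
  entries.\<close>

lemma continuous_on_dm_form: "continuous_on (dm_ball E) (dm_form \<rho>)"
proof (rule uniform_limit_theorem)
  show "\<forall>\<^sub>F F in finite_subsets_at_top UNIV.
      continuous_on (dm_ball E) (\<lambda>v. Re (\<Sum>x\<in>F. \<Sum>y\<in>F. cnj (v x) * \<rho> x y * v y))"
    by (intro always_eventually allI continuous_intros continuous_on_product_coordinates[THEN continuous_on_subset]) auto
  show "uniform_limit (dm_ball E) (\<lambda>F v. Re (\<Sum>x\<in>F. \<Sum>y\<in>F. cnj (v x) * \<rho> x y * v y)) (dm_form \<rho>)
      (finite_subsets_at_top UNIV)"
    unfolding uniform_limit_iff
  proof (intro allI impI)
    fix r :: real assume r: "r > 0"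
    have fin: "\<forall>\<^sub>F F in finite_subsets_at_top (UNIV :: 'x set). finite F"
      by (rule eventually_finite_subsets_at_top_weakI)
    have "\<forall>\<^sub>F F in finite_subsets_at_top UNIV. dm_tail \<rho> F < r / 2"
      using order_tendstoD(2)[OF dm_tail_tendsto[OF dm], of "r / 2"] r by simp
    then show "\<forall>\<^sub>F F in finite_subsets_at_top UNIV. \<forall>v\<in>dm_ball E.
        dist (Re (\<Sum>x\<in>F. \<Sum>y\<in>F. cnj (v x) * \<rho> x y * v y)) (dm_form \<rho> v) < r"
      using fin
    proof eventually_elim
      case (elim F)
      show ?case
      proof
        fix v :: "'x vec" assume "v \<in> dm_ball E"
        then have v: "ell2 v" "(norm2 v)\<^sup>2 \<le> 1" by (auto simp: dm_ball_def)
        have "\<bar>dm_form \<rho> v - dm_form \<rho> (trunc F v)\<bar> \<le> 2 * dm_tail \<rho> F * (norm2 v)\<^sup>2"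
          by (rule dm_form_trunc_diff[OF dm v(1) elim(2)])
        \<comment> \<open>\<open>sqrt\<close> takes negative values at negative arguments, so both
          signs of \<open>dm_tail \<rho> F\<close> are treated.\<close>
        also have "\<dots> < r"
        proof (cases "dm_tail \<rho> F \<ge> 0")
          case True
          then have "2 * dm_tail \<rho> F * (norm2 v)\<^sup>2 \<le> 2 * dm_tail \<rho> F * 1"
            by (intro mult_left_mono v) simp
          then show ?thesis using elim(1) by simp
        next
          case False
          then have "2 * dm_tail \<rho> F * (norm2 v)\<^sup>2 \<le> 0" by (simp add: mult_nonpos_nonneg)
          then show ?thesis using r by simp
        qed
        finally show "dist (Re (\<Sum>x\<in>F. \<Sum>y\<in>F. cnj (v x) * \<rho> x y * v y)) (dm_form \<rho> v) < r"
          by (simp only: dm_form_trunc[OF dm elim(2), symmetric] dist_real_def abs_minus_commute)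
      qed
    qed
  qed
qed simp

text \<open>A maximiser of the quadratic form over the unit vectors orthogonal to the eigenvectors already
  found is a further eigenvector.\<close>

lemma eigenvector_exists:
  assumes E: "\<And>e. e \<in> E \<Longrightarrow> ell2 e" "\<And>e. e \<in> E \<Longrightarrow> \<exists>p::real. app \<rho> e = (\<lambda>x. complex_of_real p * e x)"
    and w: "ell2 w" "\<And>e. e \<in> E \<Longrightarrow> inner2 e w = 0" "dm_form \<rho> w > 0"
  shows "\<exists>v p. ell2 v \<and> inner2 v v = 1 \<and> (\<forall>e\<in>E. inner2 e v = 0) \<and> p > 0 \<and>
    app \<rho> v = (\<lambda>x. complex_of_real p * v x)"
proof -
  have scale: "dm_form \<rho> (\<lambda>x. c * u x) = (cmod c)\<^sup>2 * dm_form \<rho> u" if "ell2 u" for c u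
    using dm_form_add_scaled[OF dm ell2_zero that, of c] by (simp add: dm_form_def[OF dm] inner2_def)
  have "(\<lambda>x. 0) \<in> dm_ball E" by (auto simp: dm_ball_def inner2_def norm2_def)
  then obtain v where v: "v \<in> dm_ball E" "\<And>u. u \<in> dm_ball E \<Longrightarrow> dm_form \<rho> u \<le> dm_form \<rho> v"
    using continuous_attains_sup[OF compact_dm_ball[OF E(1)] _ continuous_on_dm_form] by blast
  have vl: "ell2 v" "(norm2 v)\<^sup>2 \<le> 1" "\<And>e. e \<in> E \<Longrightarrow> inner2 e v = 0"
    using v(1) by (auto simp: dm_ball_def)
  define m where "m = dm_form \<rho> v"
  \<comment> \<open>Homogeneity extends the maximum property from the ball to every vector
    orthogonal to E.\<close>
  have le: "dm_form \<rho> u \<le> m * (norm2 u)\<^sup>2" if u: "ell2 u" "\<And>e. e \<in> E \<Longrightarrow> inner2 e u = 0" for u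
  proof (cases "norm2 u = 0")
    case True
    then have "u = (\<lambda>x. 0)" using norm2_0_iff[OF u(1)] by auto
    then show ?thesis using True by (simp add: dm_form_def[OF dm] inner2_def)
  next
    case False
    define c where "c = complex_of_real (1 / norm2 u)"
    have c: "(cmod c)\<^sup>2 = 1 / (norm2 u)\<^sup>2" by (simp add: c_def norm_divide power_divide)
    have "(\<lambda>x. c * u x) \<in> dm_ball E"
      unfolding dm_ball_def using u False by (simp add: ell2_scale norm2_scale_sq inner2_scale c)
    from v(2)[OF this] show ?thesis
      unfolding scale[OF u(1)] c m_def[symmetric] using False by (simp add: field_simps)
  qed
  have m: "m > 0"
  proof -
    have "0 < m * (norm2 w)\<^sup>2" using le[OF w(1,2)] w(3) by simp
    then show ?thesis by (simp add: zero_less_mult_iff)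
  qed
  have "m \<le> m * (norm2 v)\<^sup>2" using le[OF vl(1,3)] by (simp add: m_def)
  then have n1: "(norm2 v)\<^sup>2 = 1" using m vl(2) by simp
  \<comment> \<open>First-order condition at the maximiser. Moving v to v + t u gives a nonnegative
    real quadratic in t with constant term 0, so its linear coefficient vanishes.\<close>
  have orth: "m * inner2 v u = inner2 v (app \<rho> u)" if u: "ell2 u" "\<And>e. e \<in> E \<Longrightarrow> inner2 e u = 0" for u
  proof -
    have "(cmod (m * inner2 v u - inner2 v (app \<rho> u)))\<^sup>2 \<le> 0 * (m * (norm2 u)\<^sup>2 - dm_form \<rho> u)"
    proof (rule cmod_sq_le_of_quadratic_nonneg)
      fix t
      have "dm_form \<rho> (\<lambda>x. v x + t * u x) \<le> m * (norm2 (\<lambda>x. v x + t * u x))\<^sup>2"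
        by (rule le) (use vl u in \<open>auto simp: ell2_add ell2_scale inner2_add_right inner2_scale E\<close>)
      then have "m + 2 * Re (t * inner2 v (app \<rho> u)) + (cmod t)\<^sup>2 * dm_form \<rho> u \<le>
          m * (1 + 2 * Re (t * inner2 v u) + (cmod t)\<^sup>2 * (norm2 u)\<^sup>2)"
        unfolding dm_form_add_scaled[OF dm vl(1) u(1)] norm2_add_scaled_sq[OF vl(1) u(1)] n1 m_def .
      moreover have "Re (t * (complex_of_real m * inner2 v u - inner2 v (app \<rho> u))) =
          m * Re (t * inner2 v u) - Re (t * inner2 v (app \<rho> u))"
        by (simp add: algebra_simps)
      ultimately show "0 \<le> 0 + 2 * Re (t * (complex_of_real m * inner2 v u - inner2 v (app \<rho> u))) +
          (cmod t)\<^sup>2 * (m * (norm2 u)\<^sup>2 - dm_form \<rho> u)"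
        by (simp only:) (simp add: algebra_simps del: times_complex.sel)
    qed (use le[OF u] in simp)
    then show ?thesis by simp
  qed
  \<comment> \<open>The residual of the eigenvalue equation. It is orthogonal to E because E
    consists of eigenvectors, so the first-order condition applies to u itself and gives norm
    0.\<close>
  define u where "u = (\<lambda>x. app \<rho> v x + (- complex_of_real m) * v x)"
  have u: "ell2 u" unfolding u_def by (intro ell2_add ell2_scale vl dm_app_ell2[OF dm])
  have uE: "inner2 e u = 0" if e: "e \<in> E" for e
  proof -
    obtain p where p: "app \<rho> e = (\<lambda>x. complex_of_real p * e x)" using E(2)[OF e] by blast
    have "inner2 e (app \<rho> v) = inner2 (app \<rho> e) v" using dm_symmetric[OF dm E(1)[OF e] vl(1)] by simp
    also have "\<dots> = 0" using vl(3)[OF e] by (simp add: p inner2_scale_left)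
    finally show ?thesis
      unfolding u_def
      by (simp only: inner2_add_right[OF E(1)[OF e] dm_app_ell2[OF dm vl(1)] ell2_scale[OF vl(1)]]
          inner2_scale vl(3)[OF e] mult_zero_right add_0)
  qed
  have "inner2 u u = inner2 (app \<rho> v) u + (- complex_of_real m) * inner2 v u"
    by (subst (1) u_def) (simp only: inner2_add_left[OF u dm_app_ell2[OF dm vl(1)] ell2_scale[OF vl(1)]]
        inner2_scale_left complex_cnj_minus complex_cnj_complex_of_real)
  also have "\<dots> = 0" using orth[OF u uE] dm_symmetric[OF dm vl(1) u] by simp
  finally have "norm2 u = 0" using inner2_self[OF u] by simp
  then have "u x = 0" for x using norm2_0_iff[OF u] by simp
  then have "app \<rho> v = (\<lambda>x. complex_of_real m * v x)" by (auto simp: u_def fun_eq_iff)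
  then show ?thesis using vl m n1 inner2_self[OF vl(1)] by auto
qed

definition eigen_system :: "'x vec set \<Rightarrow> bool" where
  "eigen_system E \<longleftrightarrow> orthonormal_family E id \<and>
     (\<forall>e\<in>E. \<exists>p::real. p > 0 \<and> app \<rho> e = (\<lambda>x. complex_of_real p * e x))"

text \<open>By Zorn. If the form did not vanish at some w orthogonal to a maximal system,
  \<open>eigenvector_exists\<close> would enlarge the system; and vanishing of the form means that w
  is in the kernel.\<close>

lemma maximal_eigen_system:
  obtains E where "eigen_system E"
    "\<And>w. ell2 w \<Longrightarrow> (\<And>e. e \<in> E \<Longrightarrow> inner2 e w = 0) \<Longrightarrow> app \<rho> w = (\<lambda>x. 0)"
proof -
  have "\<exists>M\<in>Collect eigen_system. \<forall>X\<in>Collect eigen_system. M \<subseteq> X \<longrightarrow> X = M"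
  proof (rule subset_Zorn')
    fix C assume C: "subset.chain (Collect eigen_system) C"
    have sub: "E \<in> C \<Longrightarrow> eigen_system E" for E
      using C by (auto simp: subset_chain_def)
    have "orthonormal_family (\<Union>C) id"
      unfolding orthonormal_family_def
    proof (intro conjI ballI)
      fix k assume "k \<in> \<Union>C"
      then show "ell2 (id k)"
        using sub by (auto simp: eigen_system_def orthonormal_family_def)
      fix j assume "j \<in> \<Union>C"
      with \<open>k \<in> \<Union>C\<close> obtain E1 E2 where "E1 \<in> C" "k \<in> E1" "E2 \<in> C" "j \<in> E2"
        by blast
      moreover from this have "E1 \<subseteq> E2 \<or> E2 \<subseteq> E1"
        using C unfolding subset_chain_def by blast
      ultimately obtain E where "E \<in> C" "k \<in> E" "j \<in> E" by blast
      then show "inner2 (id k) (id j) = of_bool (k = j)"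
        using sub[of E] by (auto simp: eigen_system_def orthonormal_family_def)
    qed
    then show "\<Union>C \<in> Collect eigen_system"
      using sub by (auto simp: eigen_system_def) 
  qed
  then obtain M where M: "eigen_system M" "\<And>X. eigen_system X \<Longrightarrow> M \<subseteq> X \<Longrightarrow> X = M" by auto
  have on: "orthonormal_family M id" using M(1) by (simp add: eigen_system_def)
  have "app \<rho> w = (\<lambda>x. 0)" if w: "ell2 w" "\<And>e. e \<in> M \<Longrightarrow> inner2 e w = 0" for w
  proof (rule dm_form_0_app[OF dm w(1)], rule ccontr)
    assume "dm_form \<rho> w \<noteq> 0"
    then have "dm_form \<rho> w > 0" using dm_form_nonneg[OF dm w(1)] by simp
    then obtain v p where v: "ell2 v" "inner2 v v = 1" "\<forall>e\<in>M. inner2 e v = 0" "p > 0"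
        "app \<rho> v = (\<lambda>x. complex_of_real p * v x)"
    proof -
      have "\<exists>v p. ell2 v \<and> inner2 v v = 1 \<and> (\<forall>e\<in>M. inner2 e v = 0) \<and> p > 0 \<and>
          app \<rho> v = (\<lambda>x. complex_of_real p * v x)"
      proof (rule eigenvector_exists)
        fix e assume e: "e \<in> M"
        show "ell2 e" using on_ell2[OF on e] by simp
        show "\<exists>p::real. app \<rho> e = (\<lambda>x. complex_of_real p * e x)"
          using M(1) e unfolding eigen_system_def by blast
      qed (use w \<open>dm_form \<rho> w > 0\<close> in auto)
      then show ?thesis using that by blast
    qed
    have "v \<notin> M" using v(2,3) by auto
    have "\<forall>e\<in>M. inner2 v e = 0" using v(3) inner2_cnj[of v] by simp
    then have "eigen_system (insert v M)"
      using M(1) v \<open>v \<notin> M\<close> unfolding eigen_system_def orthonormal_family_def by auto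
    then show False using M(2)[of "insert v M"] \<open>v \<notin> M\<close> by blast
  qed
  then show ?thesis using M(1) that by blast
qed

text \<open>The maximal system is a set of vectors, whereas \<open>spectral_decomposition\<close>
  indexes eigenvectors by basis elements. The eigenvalues are positive with sum 1, so the system is
  countable and embeds into the infinite basis type.\<close>

theorem spectral_theorem:
  assumes inf: "infinite (UNIV :: 'x set)"
  shows "\<exists>I p \<psi>. spectral_decomposition \<rho> I p \<psi>"
proof -
  obtain E where E: "eigen_system E"
    and ker: "\<And>w. ell2 w \<Longrightarrow> (\<And>e. e \<in> E \<Longrightarrow> inner2 e w = 0) \<Longrightarrow> app \<rho> w = (\<lambda>x. 0)"
    by (rule maximal_eigen_system) blast
  have on: "orthonormal_family E id" using E by (simp add: eigen_system_def)
  obtain p where p: "\<And>e. e \<in> E \<Longrightarrow> p e > (0::real)"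
      "\<And>e. e \<in> E \<Longrightarrow> app \<rho> e = (\<lambda>x. complex_of_real (p e) * e x)"
    using E unfolding eigen_system_def by metis
  have elE: "ell2 e" if "e \<in> E" for e using on_ell2[OF on that] by simp
  have ex: "((\<lambda>e. complex_of_real (p e) * e x * cnj (e y)) has_sum \<rho> x y) E" for x y
  proof -
    have c: "(\<lambda>e. (cmod (inner2 (id e) (ket y)))\<^sup>2) summable_on E"
      by (rule Bessel(1)[OF on ell2_ket])
    \<comment> \<open>The projection of \<open>ket y\<close> onto the span of E. The difference is
      in the kernel of \<rho>, so column y of \<rho> can be computed from v.\<close>
    define v where "v = (\<lambda>x. \<Sum>\<^sub>\<infinity>e\<in>E. inner2 (id e) (ket y) * id e x)"
    note RF = Riesz_Fischer[OF on c, folded v_def]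
    have "app \<rho> (\<lambda>x. ket y x + (-1) * v x) = (\<lambda>x. 0)"
    proof (rule ker)
      show "ell2 (\<lambda>x. ket y x + (-1) * v x)" by (intro ell2_add ell2_scale ell2_ket RF(1))
      fix e assume e: "e \<in> E"
      show "inner2 e (\<lambda>x. ket y x + (-1) * v x) = 0"
        using RF(4)[OF e]
        by (simp only: inner2_add_right[OF elE[OF e] ell2_ket ell2_scale[OF RF(1)]] inner2_scale id_apply) simp
    qed
    then have "app \<rho> (ket y) x = app \<rho> v x"
      unfolding dm_app_lin[OF dm ell2_ket RF(1)] by (simp add: fun_eq_iff)
    then have r: "\<rho> x y = inner2 (\<lambda>z. cnj (\<rho> x z)) v"
      by (simp add: app_ket dm_app_inner[OF dm])
    have "((\<lambda>e. inner2 (id e) (ket y) * inner2 (\<lambda>z. cnj (\<rho> x z)) (id e)) has_sum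
        inner2 (\<lambda>z. cnj (\<rho> x z)) v) E"
      by (rule RF(3)[OF dm_row_ell2[OF dm]])
    moreover have "inner2 (id e) (ket y) * inner2 (\<lambda>z. cnj (\<rho> x z)) (id e) =
        complex_of_real (p e) * e x * cnj (e y)" if "e \<in> E" for e
      using p(2)[OF that] inner2_cnj[of e "ket y"]
      by (simp add: dm_app_inner[OF dm, symmetric] inner2_ket mult_ac)
    ultimately have "((\<lambda>e. complex_of_real (p e) * e x * cnj (e y)) has_sum inner2 (\<lambda>z. cnj (\<rho> x z)) v) E"
      by (rule has_sum_cong[THEN iffD1, rotated])
    then show ?thesis unfolding r[symmetric] .
  qed
  \<comment> \<open>The double sum of p(e) |e(x)|^2 by rows is the trace of \<rho>, and by columns
    the sum of the eigenvalues.\<close>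
  have tr: "(p has_sum 1) E"
  proof -
    let ?f = "\<lambda>(x, e). p e * (cmod (e x))\<^sup>2"
    have row: "((\<lambda>e. p e * (cmod (e x))\<^sup>2) has_sum Re (\<rho> x x)) E" for x
    proof -
      have "((\<lambda>e. Re (complex_of_real (p e) * e x * cnj (e x))) has_sum Re (\<rho> x x)) E"
        by (rule has_sum_Re[OF ex])
      moreover have "Re (complex_of_real (p e) * e x * cnj (e x)) = p e * (cmod (e x))\<^sup>2" for e
        by (simp only: mult.assoc complex_norm_square[symmetric] of_real_mult[symmetric] Re_complex_of_real)
      ultimately show ?thesis by simp
    qed
    have col: "((\<lambda>x. p e * (cmod (e x))\<^sup>2) has_sum p e) UNIV" if "e \<in> E" for e
    proof -
      have "complex_of_real ((norm2 e)\<^sup>2) = 1"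
        using inner2_self[OF elE[OF that]] on_inner[OF on that that] by simp
      then have "(norm2 e)\<^sup>2 = 1" using of_real_eq_1_iff by blast
      then show ?thesis
        using has_sum_cmult_right[OF ell2_has_sum[OF elE[OF that]], of "p e"] by simp
    qed
    have nn: "p e * (cmod (e x))\<^sup>2 \<ge> 0" if "e \<in> E" for e x
      using p(1)[OF that] by simp
    have "?f summable_on UNIV \<times> E"
      by (rule summable_on_SigmaI[where g = "\<lambda>x. Re (\<rho> x x)"])
        (use row dm_trace[OF dm] nn in \<open>auto dest: has_sum_imp_summable\<close>)
    then have "(?f has_sum 1) (UNIV \<times> E)"
      by (intro has_sum_SigmaI[OF _ dm_trace[OF dm]]) (use row in auto)
    then have "((\<lambda>(e, x). p e * (cmod (e x))\<^sup>2) has_sum 1) (E \<times> UNIV)"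
      using has_sum_swap[of ?f UNIV E 1] by (simp add: case_prod_unfold)
    then show ?thesis
      by (rule has_sum_SigmaD) (use col in auto)
  qed
  have "countable E"
    by (rule countable_subset[OF _ summable_countable_real[OF has_sum_imp_summable[OF tr]]])
      (use p(1) in force)
  obtain h0 :: "nat \<Rightarrow> 'x" where h0: "inj h0"
    using infinite_countable_subset[OF inf] by blast
  define h where "h = h0 \<circ> to_nat_on E"
  have h: "inj_on h E"
    unfolding h_def using h0 \<open>countable E\<close> by (meson comp_inj_on inj_on_subset inj_on_to_nat_on subset_UNIV)
  then have bij: "bij_betw (inv_into E h) (h ` E) E"
    by (simp add: bij_betw_inv_into inj_on_imp_bij_betw)
  have mem: "inv_into E h k \<in> E" if "k \<in> h ` E" for k using that by (rule inv_into_into)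
  have "spectral_decomposition \<rho> (h ` E) (p \<circ> inv_into E h) (inv_into E h)"
    unfolding spectral_decomposition_def
  proof (intro conjI ballI allI)
    fix k assume k: "k \<in> h ` E"
    show "(p \<circ> inv_into E h) k > 0" "ell2 (inv_into E h k)" using mem[OF k] p elE by auto
    fix j assume j: "j \<in> h ` E"
    show "inner2 (inv_into E h k) (inv_into E h j) = of_bool (k = j)"
      using on_inner[OF on mem[OF k] mem[OF j]] inv_into_injective[OF _ k j] by auto
  next
    show "(p \<circ> inv_into E h has_sum 1) (h ` E)"
      using has_sum_reindex_bij_betw[OF bij, of p 1] tr by (simp add: comp_def)
    fix x y
    show "((\<lambda>k. complex_of_real ((p \<circ> inv_into E h) k) * inv_into E h k x * cnj (inv_into E h k y)) has_sum \<rho> x y) (h ` E)"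
      using has_sum_reindex_bij_betw[OF bij, of "\<lambda>e. complex_of_real (p e) * e x * cnj (e y)"] ex[of x y] by simp
  qed
  then show ?thesis by blast
qed

end

section \<open>Hilbert-Schmidt matrices\<close>

lemma hilbert_schmidt_iff: "hilbert_schmidt A \<longleftrightarrow> ell2 (\<lambda>(x, y). A x y)"
  by (simp add: hilbert_schmidt_def ell2_def case_prod_unfold)

lemma ell2_tensor:
  assumes "ell2 u" "ell2 v" shows "ell2 (\<lambda>(x, y). u x * v y)"
proof -
  have "(\<lambda>(x, y). (cmod (u x))\<^sup>2 * (cmod (v y))\<^sup>2) summable_on UNIV \<times> UNIV"
    by (rule summable_on_product_nonneg) (use assms in \<open>auto simp: ell2_def\<close>)
  then show ?thesis by (simp add: ell2_def case_prod_unfold norm_mult power_mult_distrib)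
qed

lemma inner2_pair:
  assumes "ell2 F" "ell2 G"
  shows "inner2 F G = (\<Sum>\<^sub>\<infinity>x. \<Sum>\<^sub>\<infinity>y. cnj (F (x, y)) * G (x, y))"
  using infsum_Sigma'_banach[of "\<lambda>x y. cnj (F (x, y)) * G (x, y)" UNIV "\<lambda>_. UNIV"]
    inner2_summable[OF assms] by (simp add: inner2_def case_prod_unfold)

lemma inner2_tensor:
  assumes "ell2 u" "ell2 v" "ell2 u'" "ell2 v'"
  shows "inner2 (\<lambda>(x, y). u x * v y) (\<lambda>(x, y). u' x * v' y) = inner2 u u' * inner2 v v'"
proof -
  have "inner2 (\<lambda>(x, y). u x * v y) (\<lambda>(x, y). u' x * v' y) =
      (\<Sum>\<^sub>\<infinity>x. \<Sum>\<^sub>\<infinity>y. (cnj (u x) * u' x) * (cnj (v y) * v' y))"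
    by (subst inner2_pair) (use assms in \<open>auto intro!: ell2_tensor simp: mult_ac\<close>)
  then show ?thesis by (simp only: infsum_cmult_right' infsum_cmult_left' inner2_def)
qed

lemma hilbert_schmidt_app_ell2:
  assumes A: "hilbert_schmidt A" and v: "ell2 v"
  shows "ell2 (app A v)"
proof (rule ell2_comparison)
  have s: "(\<lambda>(x, y). (cmod (A x y))\<^sup>2) summable_on UNIV \<times> UNIV"
    using A by (simp add: hilbert_schmidt_def)
  then show "(\<lambda>x. (\<Sum>\<^sub>\<infinity>y. (cmod (A x y))\<^sup>2) * (norm2 v)\<^sup>2) summable_on UNIV"
    using summable_on_Sigma_banach[OF s] by (intro summable_on_cmult_left) simp
  fix x
  have "app A v x = inner2 (\<lambda>y. cnj (A x y)) v" by (simp add: app_def inner2_def)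
  then show "(cmod (app A v x))\<^sup>2 \<le> (\<Sum>\<^sub>\<infinity>y. (cmod (A x y))\<^sup>2) * (norm2 v)\<^sup>2"
    using inner2_Cauchy_Schwarz[OF hilbert_schmidt_rows(1)[OF A, of x] v]
    by (simp add: norm2_sq[of "\<lambda>y. cnj (A x y)"])
qed

lemma hilbert_schmidt_adj: "hilbert_schmidt A \<Longrightarrow> hilbert_schmidt (adj A)"
  using summable_on_swap[of "\<lambda>(x, y). (cmod (A x y))\<^sup>2" UNIV UNIV]
  by (simp add: hilbert_schmidt_def adj_def)

text \<open>A Hilbert-Schmidt matrix is treated as a vector on pairs; its form is then an inner
  product with an elementary tensor, so that orthonormal expansions of pairs can be tested on
  it.\<close>

lemma hilbert_schmidt_form:
  assumes A: "hilbert_schmidt A" and w: "ell2 w" and v: "ell2 v"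
  shows "inner2 (\<lambda>(x, z). w x * cnj (v z)) (\<lambda>(x, z). A x z) = inner2 w (app A v)"
  by (subst inner2_pair)
    (use assms in \<open>auto intro: ell2_tensor ell2_cnj simp: hilbert_schmidt_iff inner2_def app_def
      infsum_cmult_right'[symmetric] mult_ac\<close>)

lemma hilbert_schmidt_adjoint:
  assumes A: "hilbert_schmidt A" and w: "ell2 w" and v: "ell2 v"
  shows "inner2 (app (adj A) w) v = inner2 w (app A v)"
proof -
  have e: "ell2 (\<lambda>(x, z). w x * cnj (v z))" "ell2 (\<lambda>(x, z). A x z)"
    using assms by (auto intro: ell2_tensor ell2_cnj simp: hilbert_schmidt_iff)
  have s: "(\<lambda>(x, z). cnj (w x) * A x z * v z) summable_on UNIV \<times> UNIV"
    using inner2_summable[OF e] by (simp add: case_prod_unfold mult_ac)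
  have "inner2 w (app A v) = (\<Sum>\<^sub>\<infinity>x. \<Sum>\<^sub>\<infinity>z. cnj (w x) * A x z * v z)"
    unfolding inner2_def app_def by (simp only: infsum_cmult_right'[symmetric] mult.assoc)
  also have "\<dots> = (\<Sum>\<^sub>\<infinity>z. \<Sum>\<^sub>\<infinity>x. cnj (w x) * A x z * v z)"
    by (rule infsum_swap_banach[OF s])
  also have "\<dots> = (\<Sum>\<^sub>\<infinity>z. cnj (app (adj A) w z) * v z)"
  proof (rule infsum_cong)
    fix z
    have "cnj (app (adj A) w z) = (\<Sum>\<^sub>\<infinity>x. cnj (w x) * A x z)"
      unfolding app_def adj_def infsum_cnj[symmetric] by (simp add: mult.commute)
    then show "(\<Sum>\<^sub>\<infinity>x. cnj (w x) * A x z * v z) = cnj (app (adj A) w z) * v z"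
      by (simp only: infsum_cmult_left')
  qed
  finally show ?thesis by (simp add: inner2_def)
qed

lemma orthonormal_family_tensor:
  assumes "orthonormal_family I e"
  shows "orthonormal_family (I \<times> I) (\<lambda>(j, k) (x, z). e j x * cnj (e k z))"
  unfolding orthonormal_family_def
proof (intro conjI ballI)
  have i: "inner2 (\<lambda>z. cnj (u z)) (\<lambda>z. cnj (v z)) = inner2 v u" for u v :: "'b vec"
    by (simp add: inner2_def mult.commute)
  fix a assume a: "a \<in> I \<times> I"
  then show "ell2 ((\<lambda>(j, k) (x, z). e j x * cnj (e k z)) a)"
    using on_ell2[OF assms] by (auto intro!: ell2_tensor ell2_cnj)
  fix b assume b: "b \<in> I \<times> I"
  obtain j k j' k' where ab: "a = (j, k)" "b = (j', k')" by (cases a, cases b)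
  show "inner2 ((\<lambda>(j, k) (x, z). e j x * cnj (e k z)) a) ((\<lambda>(j, k) (x, z). e j x * cnj (e k z)) b) = of_bool (a = b)"
    using a b on_ell2[OF assms] on_inner[OF assms] unfolding ab prod.case
    by (subst inner2_tensor) (auto intro: ell2_cnj simp: i)
qed


section \<open>Existence of the quantum Fisher information\<close>

text \<open>Suppose that \<open>\<rho>' = (Y + adj Y) / 2\<close>, where \<open>Y = Z\<surd>\<rho>\<close> with \<open>\<parallel>Z\<parallel>\<^sup>2 \<le> Q\<close> in Hilbert-Schmidt norm (this is
  what the bound on \<open>Y\<close> says, without square roots).  In the eigenbasis of \<open>\<rho>\<close> the logarithmic derivative
  has the entries \<open>(Y\<^sub>j\<^sub>k + cnj Y\<^sub>k\<^sub>j) / (p\<^sub>j + p\<^sub>k)\<close>, that is, \<open>L\<rho> = Y + R\<close> with the antihermitian \<open>R\<close> below.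
  The part of \<open>Y\<close> mapping out of the range of \<open>\<rho>\<close> is left unchanged.\<close>

context
  fixes \<rho> :: "'x mat" and I :: "'x set" and p :: "'x \<Rightarrow> real" and \<psi> :: "'x \<Rightarrow> 'x vec"
    and Y :: "'x mat" and q :: "'x \<Rightarrow> real" and Q :: real
  assumes dm: "density_matrix \<rho>" and sd: "spectral_decomposition \<rho> I p \<psi>"
    and Y_le: "\<And>v x. ell2 v \<Longrightarrow> (cmod (app Y v x))\<^sup>2 \<le> q x * dm_form \<rho> v"
    and q_nonneg: "\<And>x. q x \<ge> 0" and q_sum: "q summable_on UNIV" and Q: "(\<Sum>\<^sub>\<infinity>x. q x) \<le> Q"
begin

lemma qfi_on: "orthonormal_family I \<psi>"
  using sd by (auto simp: orthonormal_family_def spectral_decomposition_def)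

lemma qfi_p_nonneg: "k \<in> I \<Longrightarrow> p k \<ge> 0"
  using sd_pos[OF sd, of k] by simp

lemma qfi_p_le_1: "k \<in> I \<Longrightarrow> p k \<le> 1"
proof -
  assume k: "k \<in> I"
  have "(p has_sum 1) I" using sd by (simp add: spectral_decomposition_def)
  then have "sum p {k} \<le> 1"
    by (rule finite_sum_le_has_sum) (use k qfi_p_nonneg in auto)
  then show "p k \<le> 1" by simp
qed

lemma qfi_Y_hs: "hilbert_schmidt Y"
proof -
  have s: "(\<lambda>(x, z). q x * Re (\<rho> z z)) summable_on UNIV"
    unfolding UNIV_Times_UNIV[symmetric]
    using q_sum dm_trace[OF dm] dm_diag_nonneg[OF dm] q_nonneg
    by (intro summable_on_product_nonneg) (auto intro: has_sum_imp_summable)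
  \<comment> \<open>On \<open>ket z\<close> the matrix returns its column z, and the form is the
    diagonal entry of \<rho>.\<close>
  have "(cmod (Y x z))\<^sup>2 \<le> q x * Re (\<rho> z z)" for x z
    using Y_le[OF ell2_ket[of z], of x] by (simp add: app_ket dm_form_def[OF dm] inner2_ket)
  then show ?thesis
    unfolding hilbert_schmidt_def by (intro summable_on_comparison_test[OF s]) auto
qed

section \<open>Matrix elements in the eigenbasis\<close>

definition qfi_eta :: "'x \<Rightarrow> 'x vec" where "qfi_eta k = app Y (\<psi> k)"

definition qfi_Y :: "'x \<Rightarrow> 'x \<Rightarrow> complex" where "qfi_Y j k = inner2 (\<psi> j) (qfi_eta k)"

definition qfi_R :: "'x \<Rightarrow> 'x \<Rightarrow> complex" where
  "qfi_R j k = (p k * cnj (qfi_Y k j) - p j * qfi_Y j k) / complex_of_real (p j + p k)"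

lemma qfi_eta_ell2: "k \<in> I \<Longrightarrow> ell2 (qfi_eta k)"
  unfolding qfi_eta_def by (rule hilbert_schmidt_app_ell2[OF qfi_Y_hs sd_ell2[OF sd]])

text \<open>This bounds row x of \<open>Y\<close> times the inverse square root of \<rho>. The test
  vector with coefficients \<open>c k\<close> is extremal: both \<open>app Y v x\<close> and the
  form at v equal the left-hand side S, so the hypothesis reads S^2 <= q(x) S.\<close>

lemma qfi_Bessel:
  assumes F: "finite F" "F \<subseteq> I"
  shows "(\<Sum>k\<in>F. (cmod (qfi_eta k x))\<^sup>2 / p k) \<le> q x"
proof -
  have pos: "k \<in> F \<Longrightarrow> p k > 0" for k using F sd_pos[OF sd] by auto
  have el: "k \<in> F \<Longrightarrow> ell2 (\<psi> k)" for k using F sd_ell2[OF sd] by auto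
  define S where "S = (\<Sum>k\<in>F. (cmod (qfi_eta k x))\<^sup>2 / p k)"
  define c where "c k = cnj (qfi_eta k x) / complex_of_real (p k)" for k
  define v where "v = (\<lambda>x. \<Sum>k\<in>F. c k * \<psi> k x)"
  have v: "ell2 v" unfolding v_def using el by (intro ell2_sum ell2_scale) auto
  have lin: "app A v x = (\<Sum>k\<in>F. c k * app A (\<psi> k) x)" if "\<And>x. ell2 (\<lambda>y. cnj (A x y))" for A x
  proof -
    have "app A w x = inner2 (\<lambda>y. cnj (A x y)) w" for w by (simp add: app_def inner2_def)
    then show ?thesis unfolding v_def using inner2_sum[OF that[of x] el] by simp
  qed
  have "app Y v x = complex_of_real S"
    unfolding lin[OF hilbert_schmidt_rows(1)[OF qfi_Y_hs]] S_def of_real_sum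
    by (rule sum.cong) (simp_all add: c_def qfi_eta_def complex_norm_square mult.commute del: of_real_power)
  moreover have "dm_form \<rho> v = S"
  proof -
    have "app \<rho> v = (\<lambda>x. \<Sum>k\<in>F. (c k * p k) * \<psi> k x)"
      unfolding lin[OF dm_row_ell2[OF dm]]
      by (intro ext sum.cong refl) (use F in \<open>auto simp: sd_eigen[OF sd] subset_iff\<close>)
    then have "inner2 v (app \<rho> v) = (\<Sum>k\<in>F. (c k * p k) * inner2 v (\<psi> k))"
      using inner2_sum[OF v el] by simp
    also have "\<dots> = (\<Sum>k\<in>F. complex_of_real ((cmod (qfi_eta k x))\<^sup>2 / p k))"
    proof (rule sum.cong[OF refl])
      fix k assume k: "k \<in> F"
      have "inner2 v (\<psi> k) = cnj (c k)"
        using inner2_finite_combination[OF qfi_on F k, of c] inner2_cnj[of v "\<psi> k"] by (simp add: v_def)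
      then show "(c k * p k) * inner2 v (\<psi> k) = complex_of_real ((cmod (qfi_eta k x))\<^sup>2 / p k)"
        using pos[OF k] by (simp add: c_def complex_norm_square mult.commute del: of_real_power)
    qed
    finally show ?thesis by (simp add: dm_form_def[OF dm] S_def)
  qed
  ultimately have "S * S \<le> q x * S"
    using Y_le[OF v, of x] by (simp add: power2_eq_square[of S])
  moreover have "S \<ge> 0" unfolding S_def using pos by (auto intro!: sum_nonneg divide_nonneg_pos)
  ultimately have "S \<le> q x" using q_nonneg[of x] by (cases "S = 0") auto
  then show ?thesis by (simp add: S_def)
qed

text \<open>The sum over k is the squared Hilbert-Schmidt norm of \<open>Y\<close> times the inverse
  square root of \<rho>. It is estimated row by row and then summed in the other order.\<close>

lemma qfi_eta_sum:
  shows "(\<lambda>k. (norm2 (qfi_eta k))\<^sup>2 / p k) summable_on I"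
    and "(\<Sum>\<^sub>\<infinity>k\<in>I. (norm2 (qfi_eta k))\<^sup>2 / p k) \<le> Q"
proof -
  define f where "f = (\<lambda>(x, k). (cmod (qfi_eta k x))\<^sup>2 / p k)"
  have nn: "f (x, k) \<ge> 0" if "k \<in> I" for x k using sd_pos[OF sd that] by (simp add: f_def)
  have row: "(\<lambda>k. f (x, k)) summable_on I" for x
    by (rule nonneg_bdd_above_summable_on) (use nn qfi_Bessel[of _ x] in \<open>auto intro!: bdd_aboveI2 simp: f_def\<close>)
  have le: "(\<Sum>\<^sub>\<infinity>k\<in>I. f (x, k)) \<le> q x" for x
    by (rule infsum_le_finite_sums[OF row]) (use qfi_Bessel[of _ x] in \<open>auto simp: f_def\<close>)
  have b: "(\<lambda>x. \<Sum>\<^sub>\<infinity>k\<in>I. f (x, k)) summable_on UNIV"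
    by (rule summable_on_comparison_test[OF q_sum]) (use le nn in \<open>auto intro: infsum_nonneg\<close>)
  have s: "f summable_on UNIV \<times> I"
    by (rule summable_on_SigmaI[where g = "\<lambda>x. \<Sum>\<^sub>\<infinity>k\<in>I. f (x, k)"]) (use row b nn in auto)
  then have hs: "(f has_sum (\<Sum>\<^sub>\<infinity>x. \<Sum>\<^sub>\<infinity>k\<in>I. f (x, k))) (UNIV \<times> I)"
    by (intro has_sum_SigmaI[where g = "\<lambda>x. \<Sum>\<^sub>\<infinity>k\<in>I. f (x, k)"]) (use row b in auto)
  then have hs': "((\<lambda>(k, x). f (x, k)) has_sum (\<Sum>\<^sub>\<infinity>x. \<Sum>\<^sub>\<infinity>k\<in>I. f (x, k))) (I \<times> UNIV)"
    using has_sum_swap[of f UNIV I] by simp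
  have "((\<lambda>k. (norm2 (qfi_eta k))\<^sup>2 / p k) has_sum (\<Sum>\<^sub>\<infinity>x. \<Sum>\<^sub>\<infinity>k\<in>I. f (x, k))) I"
    by (rule has_sum_SigmaD[OF hs'])
      (auto simp: f_def intro!: has_sum_divide_const ell2_has_sum qfi_eta_ell2)
  moreover have "(\<Sum>\<^sub>\<infinity>x. \<Sum>\<^sub>\<infinity>k\<in>I. f (x, k)) \<le> (\<Sum>\<^sub>\<infinity>x. q x)"
    by (rule infsum_mono[OF b q_sum le])
  ultimately show "(\<lambda>k. (norm2 (qfi_eta k))\<^sup>2 / p k) summable_on I"
    "(\<Sum>\<^sub>\<infinity>k\<in>I. (norm2 (qfi_eta k))\<^sup>2 / p k) \<le> Q"
    using Q by (auto simp: has_sum_iff)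
qed

lemma qfi_Y_summable:
  shows "(\<lambda>(k, j). (cmod (qfi_Y j k))\<^sup>2 / p k) summable_on I \<times> I"
    and "(\<lambda>(j, k). (cmod (qfi_Y j k))\<^sup>2) summable_on I \<times> I"
    and "(\<lambda>(j, k). (cmod (qfi_Y k j))\<^sup>2) summable_on I \<times> I"
proof -
  have B: "(\<lambda>j. (cmod (qfi_Y j k))\<^sup>2) summable_on I" "(\<Sum>\<^sub>\<infinity>j\<in>I. (cmod (qfi_Y j k))\<^sup>2) \<le> (norm2 (qfi_eta k))\<^sup>2"
    if "k \<in> I" for k
    using Bessel[OF qfi_on qfi_eta_ell2[OF that]] by (auto simp: qfi_Y_def)
  show 1: "(\<lambda>(k, j). (cmod (qfi_Y j k))\<^sup>2 / p k) summable_on I \<times> I"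
  proof (rule summable_on_SigmaI[where g = "\<lambda>k. (\<Sum>\<^sub>\<infinity>j\<in>I. (cmod (qfi_Y j k))\<^sup>2) / p k"])
    show "(\<lambda>k. (\<Sum>\<^sub>\<infinity>j\<in>I. (cmod (qfi_Y j k))\<^sup>2) / p k) summable_on I"
      by (rule summable_on_comparison_test[OF qfi_eta_sum(1)])
        (use B qfi_p_nonneg in \<open>auto intro!: divide_right_mono divide_nonneg_nonneg infsum_nonneg\<close>)
  qed (use B qfi_p_nonneg in \<open>auto intro!: has_sum_divide_const\<close>)
  have 2: "(\<lambda>(k, j). (cmod (qfi_Y j k))\<^sup>2) summable_on I \<times> I"
  proof (rule summable_on_comparison_test[OF 1])
    fix z assume "z \<in> I \<times> I"
    then obtain k j where z: "z = (k, j)" "k \<in> I" by auto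
    have "1 \<le> 1 / p k" using qfi_p_le_1[OF z(2)] sd_pos[OF sd z(2)] by simp
    then have "(cmod (qfi_Y j k))\<^sup>2 * 1 \<le> (cmod (qfi_Y j k))\<^sup>2 * (1 / p k)"
      by (intro mult_left_mono) auto
    then show "(case z of (k, j) \<Rightarrow> (cmod (qfi_Y j k))\<^sup>2) \<le> (case z of (k, j) \<Rightarrow> (cmod (qfi_Y j k))\<^sup>2 / p k)"
      by (simp add: z)
  qed auto
  then show "(\<lambda>(j, k). (cmod (qfi_Y k j))\<^sup>2) summable_on I \<times> I" .
  show "(\<lambda>(j, k). (cmod (qfi_Y j k))\<^sup>2) summable_on I \<times> I"
    using summable_on_swap[of "\<lambda>(k, j). (cmod (qfi_Y j k))\<^sup>2" I I] 2 by simp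
qed

lemma qfi_R_norm:
  assumes "j \<in> I" "k \<in> I"
  shows "(cmod (qfi_R j k))\<^sup>2 \<le> 2 * (cmod (qfi_Y k j))\<^sup>2 + 2 * (cmod (qfi_Y j k))\<^sup>2"
proof -
  let ?a = "cmod (qfi_Y k j)" and ?b = "cmod (qfi_Y j k)"
  have pos: "p j > 0" "p k > 0" using assms sd_pos[OF sd] by auto
  have "cmod (qfi_R j k) = cmod (p k * cnj (qfi_Y k j) - p j * qfi_Y j k) / (p j + p k)"
    using pos by (simp add: qfi_R_def norm_divide del: of_real_add)
  also have "\<dots> \<le> (p k * ?a + p j * ?b) / (p j + p k)"
    using pos norm_triangle_ineq4[of "p k * cnj (qfi_Y k j)" "p j * qfi_Y j k"]
    by (intro divide_right_mono) (auto simp: norm_mult)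
  also have "\<dots> \<le> ((p j + p k) * (?a + ?b)) / (p j + p k)"
    using pos by (intro divide_right_mono) (auto simp: algebra_simps)
  also have "\<dots> = ?a + ?b" using pos by simp
  finally have "(cmod (qfi_R j k))\<^sup>2 \<le> (?a + ?b)\<^sup>2" by (intro power_mono) auto
  also have "\<dots> \<le> 2 * ?a\<^sup>2 + 2 * ?b\<^sup>2"
    using sum_squares_bound[of ?a ?b] by (simp add: power2_sum)
  finally show ?thesis .
qed

lemma qfi_R_summable: "(\<lambda>(j, k). (cmod (qfi_R j k))\<^sup>2) summable_on I \<times> I"
proof (rule summable_on_comparison_test)
  show "(\<lambda>z. 2 * (case z of (j, k) \<Rightarrow> (cmod (qfi_Y k j))\<^sup>2) + 2 * (case z of (j, k) \<Rightarrow> (cmod (qfi_Y j k))\<^sup>2)) summable_on I \<times> I"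
    by (intro summable_on_add summable_on_cmult_right qfi_Y_summable)
qed (use qfi_R_norm in auto)

lemma qfi_R_antihermitian:
  "cnj (qfi_R k j) = - qfi_R j k"
  by (simp add: qfi_R_def add.commute minus_divide_left del: of_real_add)

text \<open>The correction R in \<open>L\<rho> = Y + R\<close>, carried from the eigenbasis to the
  original basis. It is not the factor Z of the factorisation of \<open>Y\<close> through the square
  root of \<rho>.\<close>

definition qfi_Z :: "'x mat" where
  "qfi_Z x z = (\<Sum>\<^sub>\<infinity>a\<in>I \<times> I. (case a of (j, k) \<Rightarrow> qfi_R j k) * (case a of (j, k) \<Rightarrow> \<psi> j x * cnj (\<psi> k z)))"

lemma
  shows qfi_Z_hs: "hilbert_schmidt qfi_Z"
    and qfi_Z_form: "ell2 w \<Longrightarrow> ell2 v \<Longrightarrow>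
      ((\<lambda>(j, k). qfi_R j k * (inner2 w (\<psi> j) * inner2 (\<psi> k) v)) has_sum inner2 w (app qfi_Z v)) (I \<times> I)"
    and qfi_Z_has_sum: "((\<lambda>(j, k). qfi_R j k * (\<psi> j x * cnj (\<psi> k z))) has_sum qfi_Z x z) (I \<times> I)"
proof -
  have c: "(\<lambda>a. (cmod (case a of (j, k) \<Rightarrow> qfi_R j k))\<^sup>2) summable_on I \<times> I"
    using qfi_R_summable by (simp add: case_prod_unfold)
  note RF = Riesz_Fischer[OF orthonormal_family_tensor[OF qfi_on] c]
  have Z: "(\<lambda>y. \<Sum>\<^sub>\<infinity>a\<in>I \<times> I. (case a of (j, k) \<Rightarrow> qfi_R j k) * (case a of (j, k) \<Rightarrow> \<lambda>(x, z). \<psi> j x * cnj (\<psi> k z)) y) =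
      (\<lambda>(x, z). qfi_Z x z)"
    by (auto simp: fun_eq_iff qfi_Z_def case_prod_unfold)
  show hs: "hilbert_schmidt qfi_Z"
    using RF(1) unfolding Z hilbert_schmidt_iff .
  show "((\<lambda>(j, k). qfi_R j k * (\<psi> j x * cnj (\<psi> k z))) has_sum qfi_Z x z) (I \<times> I)"
    using RF(2)[of "(x, z)"] by (simp add: qfi_Z_def case_prod_unfold)
  assume w: "ell2 w" and v: "ell2 v"
  have u: "ell2 (\<lambda>(x, z). w x * cnj (v z))" using w v by (intro ell2_tensor ell2_cnj)
  have i: "inner2 (\<lambda>z. cnj (v z)) (\<lambda>z. cnj (w z)) = inner2 w v" for v w :: "'x vec"
    by (simp add: inner2_def mult.commute)
  show "((\<lambda>(j, k). qfi_R j k * (inner2 w (\<psi> j) * inner2 (\<psi> k) v)) has_sum inner2 w (app qfi_Z v)) (I \<times> I)"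
    using RF(3)[OF u, unfolded Z hilbert_schmidt_form[OF hs w v]]
  proof (rule has_sum_cong[THEN iffD1, rotated])
    fix a assume a: "a \<in> I \<times> I"
    then show "(case a of (j, k) \<Rightarrow> qfi_R j k) * inner2 (\<lambda>(x, z). w x * cnj (v z))
        (case a of (j, k) \<Rightarrow> \<lambda>(x, z). \<psi> j x * cnj (\<psi> k z)) =
        (case a of (j, k) \<Rightarrow> qfi_R j k * (inner2 w (\<psi> j) * inner2 (\<psi> k) v))"
      using w v sd_ell2[OF sd] by (auto simp: inner2_tensor ell2_cnj i)
  qed
qed

lemma qfi_Z_antihermitian: "adj qfi_Z x z = - qfi_Z x z"
proof -
  have "((\<lambda>(j, k). cnj (qfi_R j k * (\<psi> j z * cnj (\<psi> k x)))) has_sum adj qfi_Z x z) (I \<times> I)"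
    using has_sum_cnj_iff[THEN iffD2, OF qfi_Z_has_sum[of z x]] by (simp add: adj_def case_prod_unfold)
  then have 1: "((\<lambda>(k, j). cnj (qfi_R j k * (\<psi> j z * cnj (\<psi> k x)))) has_sum adj qfi_Z x z) (I \<times> I)"
    using has_sum_swap[of "\<lambda>(j, k). cnj (qfi_R j k * (\<psi> j z * cnj (\<psi> k x)))" I I] by simp
  have 2: "(\<lambda>(k, j). cnj (qfi_R j k * (\<psi> j z * cnj (\<psi> k x)))) =
      (\<lambda>a. - (case a of (j, k) \<Rightarrow> qfi_R j k * (\<psi> j x * cnj (\<psi> k z))))"
    by (auto simp: fun_eq_iff qfi_R_antihermitian mult_ac)
  have "((\<lambda>a. - (case a of (j, k) \<Rightarrow> qfi_R j k * (\<psi> j x * cnj (\<psi> k z)))) has_sum - qfi_Z x z) (I \<times> I)"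
    by (rule has_sum_uminusI[OF qfi_Z_has_sum])
  from has_sum_unique[OF 1[unfolded 2] this] show ?thesis .
qed

definition qfi_X :: "'x mat" where "qfi_X x z = Y x z + qfi_Z x z"

lemma qfi_X_hs: "hilbert_schmidt qfi_X"
  using ell2_add[OF qfi_Y_hs[unfolded hilbert_schmidt_iff] qfi_Z_hs[unfolded hilbert_schmidt_iff]]
  by (simp add: hilbert_schmidt_iff qfi_X_def case_prod_unfold)

lemma qfi_X_app: "ell2 v \<Longrightarrow> app qfi_X v = (\<lambda>x. app Y v x + app qfi_Z v x)"
  unfolding app_def qfi_X_def distrib_right
  by (intro ext infsum_add app_summable qfi_Y_hs qfi_Z_hs)

text \<open>This makes the assignment of \<open>app qfi_X v\<close> to \<open>app \<rho> v\<close>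
  well defined. \<open>Y\<close> vanishes on the kernel by its bound, and R because its right
  vectors lie in the range of \<rho>.\<close>

lemma qfi_X_kernel:
  assumes v: "ell2 v" and 0: "app \<rho> v = (\<lambda>x. 0)" shows "app qfi_X v = (\<lambda>x. 0)"
proof
  fix x
  have "dm_form \<rho> v = 0" by (simp add: dm_form_def[OF dm] 0 inner2_def)
  then have "app Y v x = 0" using Y_le[OF v, of x] by simp
  moreover have "inner2 (\<psi> k) v = 0" if k: "k \<in> I" for k
  proof -
    have "inner2 (app \<rho> (\<psi> k)) v = 0"
      using dm_symmetric[OF dm sd_ell2[OF sd k] v] by (simp add: 0 inner2_def)
    then show ?thesis using sd_pos[OF sd k] by (simp add: sd_eigen[OF sd k] inner2_scale_left)
  qed
  then have "((\<lambda>(j, k). qfi_R j k * (inner2 (ket x) (\<psi> j) * inner2 (\<psi> k) v)) has_sum 0) (I \<times> I)"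
    by (intro has_sum_0) auto
  then have "app qfi_Z v x = 0"
    using has_sum_unique[OF qfi_Z_form[OF ell2_ket[of x] v]] by (simp add: inner2_ket)
  ultimately show "app qfi_X v x = 0" by (simp add: qfi_X_app[OF v])
qed

text \<open>The eigenvectors need not span the space. The component d of v orthogonal to them is in
  the kernel of \<rho>, where \<open>Y\<close> vanishes by its bound, so v may be replaced by its
  projection w.\<close>

lemma qfi_Y_form:
  assumes j: "j \<in> I" and v: "ell2 v"
  shows "((\<lambda>k. qfi_Y j k * inner2 (\<psi> k) v) has_sum inner2 (\<psi> j) (app Y v)) I"
proof -
  have c: "(\<lambda>k. (cmod (inner2 (\<psi> k) v))\<^sup>2) summable_on I" by (rule Bessel(1)[OF qfi_on v])
  define w where "w = (\<lambda>x. \<Sum>\<^sub>\<infinity>k\<in>I. inner2 (\<psi> k) v * \<psi> k x)"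
  note RF = Riesz_Fischer[OF qfi_on c, folded w_def]
  define d where "d = (\<lambda>x. v x - w x)"
  have d: "ell2 d" unfolding d_def by (rule ell2_lin[OF v RF(1)])
  have "inner2 (\<psi> k) d = 0" if k: "k \<in> I" for k
    unfolding d_def using inner2_diff_right[OF sd_ell2[OF sd k] v RF(1)] RF(4)[OF k] by simp
  then have "((\<lambda>k. complex_of_real (p k) * (\<psi> k x * inner2 (\<psi> k) d)) has_sum 0) I" for x
    by (intro has_sum_0) auto
  then have "app \<rho> d x = 0" for x using sd_app[OF sd d, of x] has_sum_unique by blast
  then have "dm_form \<rho> d = 0" by (simp add: dm_form_def[OF dm] inner2_def)
  then have Yd: "app Y d x = 0" for x using Y_le[OF d, of x] by simp
  have "app Y d x = app Y v x - app Y w x" for x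
    unfolding app_def d_def right_diff_distrib by (intro infsum_minus app_summable qfi_Y_hs v RF(1))
  then have Yv: "app Y v = app Y w" using Yd by (simp add: fun_eq_iff)
  have a: "ell2 (app (adj Y) (\<psi> j))"
    by (intro hilbert_schmidt_app_ell2 hilbert_schmidt_adj qfi_Y_hs sd_ell2[OF sd j])
  have "((\<lambda>k. inner2 (\<psi> k) v * inner2 (app (adj Y) (\<psi> j)) (\<psi> k)) has_sum inner2 (app (adj Y) (\<psi> j)) w) I"
    by (rule RF(3)[OF a])
  then show ?thesis
    unfolding hilbert_schmidt_adjoint[OF qfi_Y_hs sd_ell2[OF sd j] RF(1)] Yv
    by (rule has_sum_cong[THEN iffD1, rotated])
      (simp add: hilbert_schmidt_adjoint[OF qfi_Y_hs sd_ell2[OF sd j] sd_ell2[OF sd]] qfi_Y_def qfi_eta_def mult.commute)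
qed

text \<open>The matrix of \<rho> L \<rho> in the eigenbasis; its hermiticity is the symmetry of L on
  the range of \<rho>.\<close>

definition qfi_T :: "'x \<Rightarrow> 'x \<Rightarrow> complex" where "qfi_T j k = p j * (qfi_Y j k + qfi_R j k)"

lemma qfi_YR: 
  assumes "j \<in> I" "k \<in> I"
  shows "qfi_Y j k + qfi_R j k = p k * (qfi_Y j k + cnj (qfi_Y k j)) / complex_of_real (p j + p k)"
proof -
  have "complex_of_real (p j + p k) \<noteq> 0" using assms sd_pos[OF sd, of j] sd_pos[OF sd, of k]
    by (metis add_pos_pos less_irrefl of_real_eq_0_iff)
  then show ?thesis by (simp add: qfi_R_def field_simps)
qed

lemma qfi_T_hermitian: "j \<in> I \<Longrightarrow> k \<in> I \<Longrightarrow> qfi_T j k = cnj (qfi_T k j)"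
  by (simp add: qfi_T_def qfi_YR add.commute mult_ac)

lemma qfi_form:
  assumes u: "ell2 u" and v: "ell2 v"
  shows "((\<lambda>(j, k). qfi_T j k * (inner2 u (\<psi> j) * inner2 (\<psi> k) v)) has_sum inner2 (app \<rho> u) (app qfi_X v)) (I \<times> I)"
proof -
  note ru = dm_app_ell2[OF dm u]
  have pu: "inner2 (app \<rho> u) (\<psi> j) = p j * inner2 u (\<psi> j)" if "j \<in> I" for j
    using dm_symmetric[OF dm u sd_ell2[OF sd that]] by (simp add: sd_eigen[OF sd that] inner2_scale)
  have yv: "ell2 (app Y v)" by (rule hilbert_schmidt_app_ell2[OF qfi_Y_hs v])
  have zv: "ell2 (app qfi_Z v)" by (rule hilbert_schmidt_app_ell2[OF qfi_Z_hs v])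
  have Zsum: "((\<lambda>(j, k). p j * qfi_R j k * (inner2 u (\<psi> j) * inner2 (\<psi> k) v)) has_sum inner2 (app \<rho> u) (app qfi_Z v)) (I \<times> I)"
    using qfi_Z_form[OF ru v] by (rule has_sum_cong[THEN iffD1, rotated]) (auto simp: pu mult_ac)
  have Ysum: "((\<lambda>(j, k). p j * qfi_Y j k * (inner2 u (\<psi> j) * inner2 (\<psi> k) v)) has_sum inner2 (app \<rho> u) (app Y v)) (I \<times> I)"
  proof (rule has_sum_SigmaI)
    fix j assume j: "j \<in> I"
    have "((\<lambda>k. (p j * inner2 u (\<psi> j)) * (qfi_Y j k * inner2 (\<psi> k) v)) has_sum
        (p j * inner2 u (\<psi> j)) * inner2 (\<psi> j) (app Y v)) I"
      by (rule has_sum_cmult_right[OF qfi_Y_form[OF j v]])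
    then show "((\<lambda>k. case (j, k) of (j, k) \<Rightarrow> p j * qfi_Y j k * (inner2 u (\<psi> j) * inner2 (\<psi> k) v)) has_sum
        (p j * (inner2 u (\<psi> j) * inner2 (\<psi> j) (app Y v)))) I"
      by (simp add: mult_ac)
  next
    show "((\<lambda>j. p j * (inner2 u (\<psi> j) * inner2 (\<psi> j) (app Y v))) has_sum inner2 (app \<rho> u) (app Y v)) I"
      using sd_form[OF sd u yv] dm_symmetric[OF dm u yv] by simp
    have b: "(\<lambda>j. (cmod (inner2 u (\<psi> j)))\<^sup>2) summable_on I"
      using Bessel(1)[OF qfi_on u] by (subst inner2_cnj) simp
    have "(\<lambda>(j, k). (cmod (inner2 u (\<psi> j)))\<^sup>2 * (cmod (inner2 (\<psi> k) v))\<^sup>2) summable_on I \<times> I"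
      by (rule summable_on_product_nonneg[OF b Bessel(1)[OF qfi_on v]]) auto
    then have 1: "(\<lambda>a. (cmod (case a of (j, k) \<Rightarrow> inner2 u (\<psi> j) * inner2 (\<psi> k) v))\<^sup>2) summable_on I \<times> I"
      by (simp add: case_prod_unfold norm_mult power_mult_distrib)
    have 2: "(\<lambda>a. (cmod (case a of (j, k) \<Rightarrow> p j * qfi_Y j k))\<^sup>2) summable_on I \<times> I"
    proof (rule summable_on_comparison_test[OF qfi_Y_summable(2)])
      fix a assume a: "a \<in> I \<times> I"
      then obtain j k where jk: "a = (j, k)" "j \<in> I" by auto
      have "p j * cmod (qfi_Y j k) \<le> 1 * cmod (qfi_Y j k)"
        using qfi_p_le_1[OF jk(2)] by (intro mult_right_mono) auto
      then show "(cmod (case a of (j, k) \<Rightarrow> p j * qfi_Y j k))\<^sup>2 \<le> (case a of (j, k) \<Rightarrow> (cmod (qfi_Y j k))\<^sup>2)"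
        using sd_pos[OF sd jk(2)] by (simp add: jk norm_mult power_mono)
    qed auto
    show "(\<lambda>(j, k). p j * qfi_Y j k * (inner2 u (\<psi> j) * inner2 (\<psi> k) v)) summable_on I \<times> I"
      using cauchy_schwarz_summable(2)[OF 2 1] by (simp add: case_prod_unfold)
  qed
  have "inner2 (app \<rho> u) (app qfi_X v) = inner2 (app \<rho> u) (app Y v) + inner2 (app \<rho> u) (app qfi_Z v)"
    unfolding qfi_X_app[OF v] by (rule inner2_add_right[OF ru yv zv])
  then show ?thesis
    using has_sum_add[OF Ysum Zsum] by (simp add: qfi_T_def case_prod_unfold algebra_simps)
qed

lemma qfi_symmetric:
  assumes u: "ell2 u" and v: "ell2 v"
  shows "inner2 (app qfi_X u) (app \<rho> v) = inner2 (app \<rho> u) (app qfi_X v)"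
proof -
  have "((\<lambda>a. cnj (case a of (j, k) \<Rightarrow> qfi_T j k * (inner2 v (\<psi> j) * inner2 (\<psi> k) u))) has_sum
      cnj (inner2 (app \<rho> v) (app qfi_X u))) (I \<times> I)"
    unfolding has_sum_cnj_iff by (rule qfi_form[OF v u])
  then have "((\<lambda>(k, j). cnj (qfi_T j k * (inner2 v (\<psi> j) * inner2 (\<psi> k) u))) has_sum
      inner2 (app qfi_X u) (app \<rho> v)) (I \<times> I)"
    using has_sum_swap[of "\<lambda>(j, k). cnj (qfi_T j k * (inner2 v (\<psi> j) * inner2 (\<psi> k) u))" I I]
    by (simp add: case_prod_unfold inner2_cnj[of "app qfi_X u"])
  then have "((\<lambda>(j, k). qfi_T j k * (inner2 u (\<psi> j) * inner2 (\<psi> k) v)) has_sum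
      inner2 (app qfi_X u) (app \<rho> v)) (I \<times> I)"
  proof (rule has_sum_cong[THEN iffD1, rotated])
    fix a assume "a \<in> I \<times> I"
    then obtain j k where a: "a = (j, k)" "j \<in> I" "k \<in> I" by auto
    show "(case a of (k, j) \<Rightarrow> cnj (qfi_T j k * (inner2 v (\<psi> j) * inner2 (\<psi> k) u))) =
      (case a of (j, k) \<Rightarrow> qfi_T j k * (inner2 u (\<psi> j) * inner2 (\<psi> k) v))"
      using qfi_T_hermitian[OF a(2,3)] inner2_cnj[of u "\<psi> j"] inner2_cnj[of "\<psi> k" v]
      by (simp add: a mult_ac)
  qed
  then show ?thesis using qfi_form[OF u v] has_sum_unique by blast
qed

section \<open>The logarithmic derivative on the range of the state\<close>

definition qfi_D :: "'x vec set" where "qfi_D = app \<rho> ` Collect ell2"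

text \<open>\<rho> may have a kernel; by \<open>qfi_X_kernel\<close> the result does not depend on
  the chosen preimage.\<close>

definition qfi_L :: "'x vec \<Rightarrow> 'x vec" where
  "qfi_L w = app qfi_X (SOME v. ell2 v \<and> app \<rho> v = w)"

lemma qfi_X_lin:
  "ell2 u \<Longrightarrow> ell2 v \<Longrightarrow> app qfi_X (\<lambda>x. u x + c * v x) = (\<lambda>x. app qfi_X u x + c * app qfi_X v x)"
  by (rule app_add[OF hilbert_schmidt_rows(1)[OF qfi_X_hs]])

lemma qfi_L_app:
  assumes v: "ell2 v" shows "qfi_L (app \<rho> v) = app qfi_X v"
proof -
  define u where "u = (SOME u. ell2 u \<and> app \<rho> u = app \<rho> v)"
  have u: "ell2 u" "app \<rho> u = app \<rho> v"
    using someI[of "\<lambda>u. ell2 u \<and> app \<rho> u = app \<rho> v" v] v by (auto simp: u_def)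
  have "app \<rho> (\<lambda>x. u x + (-1) * v x) = (\<lambda>x. 0)"
    unfolding dm_app_lin[OF dm u(1) v] using u(2) by simp
  then have "app qfi_X (\<lambda>x. u x + (-1) * v x) = (\<lambda>x. 0)"
    by (rule qfi_X_kernel[OF ell2_add[OF u(1) ell2_scale[OF v]]])
  then show ?thesis
    unfolding qfi_X_lin[OF u(1) v] qfi_L_def u_def[symmetric] by (auto simp: fun_eq_iff)
qed

lemma qfi_symmetric_operator: "symmetric_operator qfi_D qfi_L"
  unfolding symmetric_operator_def
proof (intro conjI ballI allI)
  show "qfi_D \<subseteq> Collect ell2" by (auto simp: qfi_D_def dm_app_ell2[OF dm])
  show "qfi_L ` qfi_D \<subseteq> Collect ell2"
    by (auto simp: qfi_D_def qfi_L_app hilbert_schmidt_app_ell2[OF qfi_X_hs])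
  fix u v c assume "u \<in> qfi_D" "v \<in> qfi_D"
  then obtain u' v' where u: "ell2 u'" "u = app \<rho> u'" and v: "ell2 v'" "v = app \<rho> v'"
    by (auto simp: qfi_D_def)
  have e: "(\<lambda>x. u x + c * v x) = app \<rho> (\<lambda>x. u' x + c * v' x)"
    unfolding u(2) v(2) dm_app_lin[OF dm u(1) v(1)] ..
  have l: "ell2 (\<lambda>x. u' x + c * v' x)" using u(1) v(1) by (intro ell2_add ell2_scale)
  show "(\<lambda>x. u x + c * v x) \<in> qfi_D" unfolding e qfi_D_def using l by simp
  show "qfi_L (\<lambda>x. u x + c * v x) = (\<lambda>x. qfi_L u x + c * qfi_L v x)"
    unfolding e qfi_L_app[OF l] unfolding u(2) v(2) qfi_L_app[OF u(1)] qfi_L_app[OF v(1)]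
    by (rule qfi_X_lin[OF u(1) v(1)])
  show "inner2 (qfi_L u) v = inner2 u (qfi_L v)"
    unfolding u(2) v(2) qfi_L_app[OF u(1)] qfi_L_app[OF v(1)] by (rule qfi_symmetric[OF u(1) v(1)])
qed

lemma qfi_is_SLD:
  assumes "\<And>x y. \<rho>' x y = (Y x y + adj Y x y) / 2"
  shows "is_SLD \<rho> \<rho>' qfi_D qfi_L"
  unfolding is_SLD_def
proof (intro conjI allI impI)
  show "symmetric_operator qfi_D qfi_L" by (rule qfi_symmetric_operator)
  show "\<And>v. ell2 v \<Longrightarrow> app \<rho> v \<in> qfi_D" by (auto simp: qfi_D_def)
  have "adj qfi_X x y = adj Y x y - qfi_Z x y" for x y
    using qfi_Z_antihermitian[of x y] by (simp add: adj_def qfi_X_def)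
  then have "\<rho>' x y = (qfi_X x y + adj qfi_X x y) / 2" for x y
    by (simp add: assms qfi_X_def)
  then show "\<exists>X. hilbert_schmidt X \<and> (\<forall>v. ell2 v \<longrightarrow> qfi_L (app \<rho> v) = app X v) \<and>
          (\<forall>x y. \<rho>' x y = (X x y + adj X x y) / 2)"
    using qfi_X_hs qfi_L_app by blast
qed

text \<open>The identity is about a difference because Y \<psi> may leave the closed span of the
  eigenvectors, and that part is invisible to the matrix elements with index in \<open>I\<close>. It
  is the same for \<open>qfi_X\<close> as for \<open>Y\<close>, so it cancels here.\<close>

lemma qfi_L_norm:
  assumes k: "k \<in> I"
  shows "((\<lambda>j. ((cmod (qfi_Y j k + qfi_R j k))\<^sup>2 - (cmod (qfi_Y j k))\<^sup>2) / p k) has_sum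
    p k * (norm2 (qfi_L (\<psi> k)))\<^sup>2 - (norm2 (qfi_eta k))\<^sup>2 / p k) I"
proof -
  note el = sd_ell2[OF sd k] and pos = sd_pos[OF sd k]
  have c: "(\<lambda>j. (cmod (qfi_R j k))\<^sup>2) summable_on I"
    using summable_on_SigmaD1[of "\<lambda>k j. (cmod (qfi_R j k))\<^sup>2" I "\<lambda>_. I" k] k
      summable_on_swap[of "\<lambda>(j, k). (cmod (qfi_R j k))\<^sup>2" I I] qfi_R_summable by simp
  define z where "z = (\<lambda>x. \<Sum>\<^sub>\<infinity>j\<in>I. qfi_R j k * \<psi> j x)"
  note RF = Riesz_Fischer[OF qfi_on c, folded z_def]
  have "app qfi_Z (\<psi> k) x = z x" for x
  proof -
    have "((\<lambda>(j, k'). qfi_R j k' * (inner2 (ket x) (\<psi> j) * inner2 (\<psi> k') (\<psi> k))) has_sum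
        app qfi_Z (\<psi> k) x) (I \<times> I)"
      using qfi_Z_form[OF ell2_ket[of x] el] by (simp add: inner2_ket)
    then have "((\<lambda>(j, k'). qfi_R j k' * \<psi> j x) has_sum app qfi_Z (\<psi> k) x) ((\<lambda>j. (j, k)) ` I)"
      by (rule has_sum_cong_neutral[THEN iffD1, rotated -1])
        (use k on_inner[OF qfi_on] in \<open>auto simp: inner2_ket\<close>)
    then have "((\<lambda>j. qfi_R j k * \<psi> j x) has_sum app qfi_Z (\<psi> k) x) I"
      by (subst (asm) has_sum_reindex) (auto simp: inj_on_def comp_def)
    from has_sum_unique[OF this RF(2)] show ?thesis by (simp add: z_def)
  qed
  then have X: "app qfi_X (\<psi> k) = (\<lambda>x. qfi_eta k x + z x)"
    unfolding qfi_X_app[OF el] qfi_eta_def by (simp add: fun_eq_iff)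
  have i: "((\<lambda>j. Re (qfi_R j k * inner2 (qfi_eta k) (\<psi> j))) has_sum Re (inner2 (qfi_eta k) z)) I"
    by (rule has_sum_Re[OF RF(3)[OF qfi_eta_ell2[OF k]]])
  have "((\<lambda>j. 2 * Re (qfi_R j k * inner2 (qfi_eta k) (\<psi> j)) + (cmod (qfi_R j k))\<^sup>2) has_sum
      2 * Re (inner2 (qfi_eta k) z) + (norm2 z)\<^sup>2) I"
    by (intro has_sum_add has_sum_cmult_right i RF(5))
  moreover have "2 * Re (qfi_R j k * inner2 (qfi_eta k) (\<psi> j)) + (cmod (qfi_R j k))\<^sup>2 =
      (cmod (qfi_Y j k + qfi_R j k))\<^sup>2 - (cmod (qfi_Y j k))\<^sup>2" for j
  proof -
    have "inner2 (qfi_eta k) (\<psi> j) = cnj (qfi_Y j k)" by (simp add: qfi_Y_def inner2_cnj[of "qfi_eta k" "\<psi> j"])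
    then show ?thesis unfolding cmod_power2 by (simp add: power2_eq_square algebra_simps)
  qed
  ultimately have "((\<lambda>j. (cmod (qfi_Y j k + qfi_R j k))\<^sup>2 - (cmod (qfi_Y j k))\<^sup>2) has_sum
      (norm2 (app qfi_X (\<psi> k)))\<^sup>2 - (norm2 (qfi_eta k))\<^sup>2) I"
    unfolding X norm2_add_sq[OF qfi_eta_ell2[OF k] RF(1)] by simp
  then have "((\<lambda>j. ((cmod (qfi_Y j k + qfi_R j k))\<^sup>2 - (cmod (qfi_Y j k))\<^sup>2) / p k) has_sum
      ((norm2 (app qfi_X (\<psi> k)))\<^sup>2 - (norm2 (qfi_eta k))\<^sup>2) / p k) I"
    by (rule has_sum_divide_const)
  moreover have "p k * (norm2 (qfi_L (\<psi> k)))\<^sup>2 = (norm2 (app qfi_X (\<psi> k)))\<^sup>2 / p k"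
  proof -
    have s: "app A (\<lambda>x. inverse (complex_of_real (p k)) * \<psi> k x) = (\<lambda>x. inverse (complex_of_real (p k)) * app A (\<psi> k) x)" for A
      unfolding app_def mult.left_commute[of _ "inverse _"] infsum_cmult_right' ..
    have "\<psi> k = app \<rho> (\<lambda>x. inverse (complex_of_real (p k)) * \<psi> k x)"
      unfolding s sd_eigen[OF sd k] using pos by (simp add: fun_eq_iff mult.assoc[symmetric])
    then have "qfi_L (\<psi> k) = (\<lambda>x. inverse (complex_of_real (p k)) * app qfi_X (\<psi> k) x)"
      using qfi_L_app[OF ell2_scale[OF el]] s by metis
    then have "(norm2 (qfi_L (\<psi> k)))\<^sup>2 = (inverse (p k))\<^sup>2 * (norm2 (app qfi_X (\<psi> k)))\<^sup>2"
      using pos by (simp only: norm2_scale_sq norm_inverse norm_of_real abs_of_pos)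
    then show ?thesis using pos by (simp add: power2_eq_square field_simps)
  qed
  ultimately show ?thesis by (simp add: diff_divide_distrib)
qed

text \<open>A single term with L can exceed the corresponding term with \<open>Y\<close>; only the
  sum over the pair (j, k), (k, j) is monotone. With a and b the two matrix elements and s, t the
  eigenvalues it is |a + b|^2 / (s + t) <= |a|^2 / t + |b|^2 / s. The part outside the span is the
  same on both sides, so the total is at most the norm bounded by Q in
  \<open>qfi_eta_sum\<close>.\<close>

lemma qfi_trace_square:
  obtains K where "has_trace_square \<rho> qfi_L K" "K \<le> Q"
proof -
  define y g where "y = (\<lambda>(k, j). (cmod (qfi_Y j k))\<^sup>2 / p k)"
    and "g = (\<lambda>(k, j). (cmod (qfi_Y j k + qfi_R j k))\<^sup>2 / p k)"
  have ys: "y summable_on I \<times> I" unfolding y_def by (rule qfi_Y_summable(1))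
  have ys': "(\<lambda>(k, j). y (j, k)) summable_on I \<times> I"
    using ys summable_on_swap[of y I I] by simp
  have gnn: "g (k, j) \<ge> 0" if "k \<in> I" for k j using sd_pos[OF sd that] by (simp add: g_def)
  have gy: "g (k, j) + g (j, k) \<le> y (k, j) + y (j, k)" if jk: "j \<in> I" "k \<in> I" for j k
  proof -
    define a b s t where "a = qfi_Y j k" and "b = cnj (qfi_Y k j)" and "s = p j" and "t = p k"
    have pos: "s > 0" "t > 0" using sd_pos[OF sd] jk by (auto simp: s_def t_def)
    have n: "(cmod (complex_of_real r * c / complex_of_real (s + t)))\<^sup>2 = r\<^sup>2 * (cmod c)\<^sup>2 / (s + t)\<^sup>2" for r c
      using pos by (simp add: norm_divide norm_mult power_divide power_mult_distrib del: of_real_add)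
    have g1: "g (k, j) = t * (cmod (a + b))\<^sup>2 / (s + t)\<^sup>2"
      unfolding g_def prod.case qfi_YR[OF jk] using pos
      by (simp only: a_def[symmetric] b_def[symmetric] s_def[symmetric] t_def[symmetric] n) (simp add: power2_eq_square)
    have "cmod (qfi_Y k j + cnj (qfi_Y j k)) = cmod (cnj (qfi_Y k j + cnj (qfi_Y j k)))" by (rule complex_mod_cnj[symmetric])
    also have "\<dots> = cmod (a + b)" by (simp add: a_def b_def add.commute)
    finally have ab: "cmod (qfi_Y k j + cnj (qfi_Y j k)) = cmod (a + b)" .
    have g2: "g (j, k) = s * (cmod (a + b))\<^sup>2 / (s + t)\<^sup>2"
      unfolding g_def prod.case qfi_YR[OF jk(2,1)] using pos
      by (simp only: s_def[symmetric] t_def[symmetric] add.commute[of t s] n ab) (simp add: power2_eq_square)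
    have y12: "y (k, j) = (cmod a)\<^sup>2 / t" "y (j, k) = (cmod b)\<^sup>2 / s"
      by (auto simp: y_def a_def b_def s_def t_def)
    have "(cmod (a + b))\<^sup>2 \<le> (cmod a + cmod b)\<^sup>2"
      by (intro power_mono norm_triangle_ineq) simp
    also have "\<dots> \<le> (s + t) * ((cmod a)\<^sup>2 / t + (cmod b)\<^sup>2 / s)"
    proof -
      have "(s + t) * ((cmod a)\<^sup>2 / t + (cmod b)\<^sup>2 / s) - (cmod a + cmod b)\<^sup>2 =
          (s * cmod a - t * cmod b)\<^sup>2 / (s * t)"
        using pos by (simp add: field_simps power2_eq_square)
      moreover have "(s * cmod a - t * cmod b)\<^sup>2 / (s * t) \<ge> 0" using pos by simp
      ultimately show ?thesis by linarith
    qed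
    finally have "(cmod (a + b))\<^sup>2 / (s + t) \<le> (cmod a)\<^sup>2 / t + (cmod b)\<^sup>2 / s"
      using pos by (simp add: pos_divide_le_eq mult.commute)
    moreover have "g (k, j) + g (j, k) = (cmod (a + b))\<^sup>2 / (s + t)"
      unfolding g1 g2 using pos by (simp add: power2_eq_square add_divide_distrib[symmetric] distrib_right[symmetric] add.commute)
    ultimately show ?thesis unfolding y12 by simp
  qed
  have gs: "g summable_on I \<times> I"
  proof (rule summable_on_comparison_test)
    show "(\<lambda>a. y a + (case a of (k, j) \<Rightarrow> y (j, k))) summable_on I \<times> I"
      by (rule summable_on_add[OF ys ys'])
    fix a assume "a \<in> I \<times> I"
    then obtain k j where a: "a = (k, j)" "k \<in> I" "j \<in> I" by auto
    show "g a \<le> y a + (case a of (k, j) \<Rightarrow> y (j, k))"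
      using gy[OF a(3,2)] gnn[OF a(3), of k] by (simp add: a)
    show "0 \<le> g a" using gnn a by simp
  qed
  have gs': "(\<lambda>(k, j). g (j, k)) summable_on I \<times> I"
    using gs summable_on_swap[of g I I] by simp
  have sw: "(\<Sum>\<^sub>\<infinity>a\<in>I \<times> I. case a of (k, j) \<Rightarrow> f (j, k)) = (\<Sum>\<^sub>\<infinity>a\<in>I \<times> I. f a)"
    if "f summable_on I \<times> I" for f :: "'x \<times> 'x \<Rightarrow> real"
    using has_sum_swap[of f I I "infsum f (I \<times> I)"] that by (auto intro!: infsumI)
  have "(\<Sum>\<^sub>\<infinity>a\<in>I \<times> I. g a + (case a of (k, j) \<Rightarrow> g (j, k))) \<le> (\<Sum>\<^sub>\<infinity>a\<in>I \<times> I. y a + (case a of (k, j) \<Rightarrow> y (j, k)))"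
    by (rule infsum_mono) (use gs gs' ys ys' gy in \<open>auto intro!: summable_on_add\<close>)
  then have le: "infsum g (I \<times> I) \<le> infsum y (I \<times> I)"
    unfolding infsum_add[OF gs gs'] infsum_add[OF ys ys'] sw[OF gs] sw[OF ys] by simp
  have h: "((\<lambda>a. g a + - y a) has_sum infsum g (I \<times> I) + - infsum y (I \<times> I)) (I \<times> I)"
    using gs ys by (intro has_sum_add has_sum_uminusI) auto
  have "((\<lambda>k. p k * (norm2 (qfi_L (\<psi> k)))\<^sup>2 - (norm2 (qfi_eta k))\<^sup>2 / p k) has_sum
      infsum g (I \<times> I) + - infsum y (I \<times> I)) I"
    by (rule has_sum_SigmaD[OF h]) (use qfi_L_norm in \<open>simp add: g_def y_def diff_divide_distrib\<close>)
  then have "((\<lambda>k. (p k * (norm2 (qfi_L (\<psi> k)))\<^sup>2 - (norm2 (qfi_eta k))\<^sup>2 / p k) + (norm2 (qfi_eta k))\<^sup>2 / p k) has_sum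
      (infsum g (I \<times> I) + - infsum y (I \<times> I)) + (\<Sum>\<^sub>\<infinity>k\<in>I. (norm2 (qfi_eta k))\<^sup>2 / p k)) I"
    using qfi_eta_sum(1) by (intro has_sum_add) auto
  then have "has_trace_square \<rho> qfi_L (infsum g (I \<times> I) + - infsum y (I \<times> I) + (\<Sum>\<^sub>\<infinity>k\<in>I. (norm2 (qfi_eta k))\<^sup>2 / p k))"
    unfolding has_trace_square_def using sd by auto
  then show ?thesis using that le qfi_eta_sum(2) by fastforce
qed

end

theorem QFI_exists_le:
  fixes \<sigma> :: "real \<Rightarrow> 'x mat"
  assumes dm: "density_matrix (\<sigma> G)" and inf: "infinite (UNIV :: 'x set)"
    and der: "\<And>x y. ((\<lambda>g. \<sigma> g x y) has_vector_derivative (Y x y + adj Y x y) / 2) (at G)"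
    and Y_le: "\<And>v x. ell2 v \<Longrightarrow> (cmod (app Y v x))\<^sup>2 \<le> q x * dm_form (\<sigma> G) v"
    and q: "\<And>x. q x \<ge> 0" "q summable_on UNIV" "(\<Sum>\<^sub>\<infinity>x. q x) \<le> Q"
  shows "\<exists>K. has_QFI \<sigma> G K \<and> K \<le> Q"
proof -
  obtain I p \<psi> where sd: "spectral_decomposition (\<sigma> G) I p \<psi>"
    using spectral_theorem[OF dm inf] by blast
  note c = dm sd Y_le q
  obtain K where "has_trace_square (\<sigma> G) (qfi_L (\<sigma> G) I p \<psi> Y) K" "K \<le> Q"
    by (rule qfi_trace_square[OF c]) auto
  moreover have "is_SLD (\<sigma> G) (\<lambda>x y. (Y x y + adj Y x y) / 2) (qfi_D (\<sigma> G)) (qfi_L (\<sigma> G) I p \<psi> Y)"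
    by (rule qfi_is_SLD[OF c]) auto
  ultimately have "has_QFI \<sigma> G K"
    unfolding has_QFI_def
    by (intro exI[of _ "\<lambda>x y. (Y x y + adj Y x y) / 2"] exI[of _ "qfi_D (\<sigma> G)"]
        exI[of _ "qfi_L (\<sigma> G) I p \<psi> Y"] conjI allI der)
  then show ?thesis using \<open>K \<le> Q\<close> by blast
qed

text \<open>If the logarithmic derivative is given explicitly by a matrix \<open>L\<close> with finite rows (supported in \<open>N x\<close>),
  then \<open>Tr[\<rho>L\<^sup>2]\<close> is the sum over \<open>x\<close> of the expectations of \<open>\<rho>\<close> in the rows of \<open>L\<close>.\<close>

theorem QFI_eq:
  fixes \<sigma> :: "real \<Rightarrow> 'x mat" and G :: real and L :: "'x mat" and N :: "'x \<Rightarrow> 'x set"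
  defines "Y \<equiv> \<lambda>x z. \<Sum>w\<in>N x. L x w * \<sigma> G w z"
  assumes dm: "density_matrix (\<sigma> G)" and inf: "infinite (UNIV :: 'x set)"
    and der: "\<And>x y. ((\<lambda>g. \<sigma> g x y) has_vector_derivative (Y x y + adj Y x y) / 2) (at G)"
    and N: "\<And>x. finite (N x)" "\<And>x w. w \<notin> N x \<Longrightarrow> L x w = 0"
    and herm: "\<And>x w. L w x = cnj (L x w)"
    and s: "(\<lambda>(x, w). Re (\<sigma> G x x) * cmod (L x w)) summable_on UNIV"
    and K: "((\<lambda>x. dm_form (\<sigma> G) (trunc (N x) (\<lambda>w. cnj (L x w)))) has_sum K) UNIV"
  shows "has_QFI \<sigma> G K"
proof -
  define \<rho> where "\<rho> = \<sigma> G"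
  note dm = dm[folded \<rho>_def]
  define l where "l x = trunc (N x) (\<lambda>w. cnj (L x w))" for x
  define A where "A v x = (\<Sum>w\<in>N x. L x w * v w)" for v x
  have l: "ell2 (l x)" for x unfolding l_def by (rule ell2_trunc[OF N(1)])
  have Al: "A v x = inner2 (l x) v" for v x
    unfolding l_def inner2_trunc[OF N(1)] A_def by simp
  have A_lin: "A (\<lambda>x. u x + c * v x) = (\<lambda>x. A u x + c * A v x)" for u v c
    by (simp add: A_def fun_eq_iff distrib_left sum.distrib sum_distrib_left mult.left_commute)
  have AY: "app Y v = A (app \<rho> v)" if v: "ell2 v" for v
  proof
    fix x
    have "app Y v x = (\<Sum>\<^sub>\<infinity>z. \<Sum>w\<in>N x. L x w * (\<rho> w z * v z))"
      by (simp add: app_def Y_def \<rho>_def sum_distrib_right mult.assoc)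
    also have "\<dots> = (\<Sum>w\<in>N x. \<Sum>\<^sub>\<infinity>z. L x w * (\<rho> w z * v z))"
      by (rule infsum_finite_sum)
        (rule summable_on_cmult_right[OF abs_summable_summable[OF dm_row_abs_summable[OF dm v]]])
    finally show "app Y v x = A (app \<rho> v) x" by (simp add: A_def app_def infsum_cmult_right')
  qed
  \<comment> \<open>Cauchy-Schwarz for the form, with the row of L as the other vector. It makes
    \<open>qfi_Y_hs\<close> applicable, which shows that \<open>Y\<close> is Hilbert-Schmidt
    although L may be unbounded.\<close>
  have Y_le: "(cmod (app Y v x))\<^sup>2 \<le> dm_form \<rho> (l x) * dm_form \<rho> v" if "ell2 v" for v x
    unfolding AY[OF that] Al by (rule dm_form_Cauchy_Schwarz[OF dm l that])
  have q: "\<And>x. dm_form \<rho> (l x) \<ge> 0" "(\<lambda>x. dm_form \<rho> (l x)) summable_on UNIV"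
    using dm_form_nonneg[OF dm l] K by (auto simp: \<rho>_def l_def dest: has_sum_imp_summable)
  obtain I p \<psi> where sd: "spectral_decomposition \<rho> I p \<psi>"
    using spectral_theorem[OF dm inf] by blast
  have Y_hs: "hilbert_schmidt Y"
    by (rule qfi_Y_hs[OF dm sd Y_le q order_refl])
  have A_ell2: "ell2 (A (app \<rho> v))" if "ell2 v" for v
    using hilbert_schmidt_app_ell2[OF Y_hs that] by (simp add: AY[OF that])
  \<comment> \<open>The entries of L may grow, so exchanging the two sums needs absolute
    summability. By \<open>dm_app_bound\<close> a vector in the range of \<rho> is at most a
    multiple of \<open>dm_root\<close>, and r(x) r(w) <= r(x)^2 + r(w)^2 reduces the double sum to
    the hypothesis \<open>s\<close> and its transpose.\<close>
  have sym: "inner2 (A (app \<rho> u)) (app \<rho> v) = inner2 (app \<rho> u) (A (app \<rho> v))"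
    if u: "ell2 u" and v: "ell2 v" for u v
  proof -
    define f g where "f = app \<rho> u" and "g = app \<rho> v"
    let ?r = "dm_root \<rho>"
    have r2: "(?r x)\<^sup>2 = Re (\<rho> x x)" for x
      by (simp add: dm_root_def[OF dm] dm_diag_nonneg[OF dm])
    have s1: "(\<lambda>(x, w). (?r x)\<^sup>2 * cmod (L x w)) summable_on UNIV \<times> UNIV"
      unfolding r2 using s by (simp add: \<rho>_def)
    have s2: "(\<lambda>(x, w). (?r w)\<^sup>2 * cmod (L x w)) summable_on UNIV \<times> UNIV"
      using summable_on_swap[of "\<lambda>(x, w). (?r x)\<^sup>2 * cmod (L x w)" UNIV UNIV] s1
      by (subst herm) (simp add: case_prod_unfold)
    have "(\<lambda>(x, w). cnj (f x) * L x w * g w) summable_on UNIV \<times> UNIV"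
    proof (rule abs_summable_summable, rule Infinite_Sum.abs_summable_on_comparison_test')
      show "(\<lambda>a. (norm2 u * norm2 v) * ((case a of (x, w) \<Rightarrow> (?r x)\<^sup>2 * cmod (L x w)) +
          (case a of (x, w) \<Rightarrow> (?r w)\<^sup>2 * cmod (L x w)))) summable_on UNIV \<times> UNIV"
        by (intro summable_on_cmult_right summable_on_add s1 s2)
      fix a :: "'x \<times> 'x"
      obtain x w where a: "a = (x, w)" by force
      have "cmod (f x) * cmod (g w) \<le> (?r x * norm2 u) * (?r w * norm2 v)"
        unfolding f_def g_def using dm_app_bound[OF dm u] dm_app_bound[OF dm v]
        by (intro mult_mono) (auto simp: dm_root_nonneg[OF dm])
      also have "\<dots> = (norm2 u * norm2 v) * (?r x * ?r w)" by simp
      also have "\<dots> \<le> (norm2 u * norm2 v) * ((?r x)\<^sup>2 + (?r w)\<^sup>2)"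
        using sum_squares_bound[of "?r x" "?r w"] mult_nonneg_nonneg[OF dm_root_nonneg[OF dm, of x] dm_root_nonneg[OF dm, of w]]
        by (intro mult_left_mono) auto
      finally have le: "cmod (f x) * cmod (g w) \<le> (norm2 u * norm2 v) * ((?r x)\<^sup>2 + (?r w)\<^sup>2)" .
      have "norm (case a of (x, w) \<Rightarrow> cnj (f x) * L x w * g w) = (cmod (f x) * cmod (g w)) * cmod (L x w)"
        by (simp add: a norm_mult)
      also have "\<dots> \<le> ((norm2 u * norm2 v) * ((?r x)\<^sup>2 + (?r w)\<^sup>2)) * cmod (L x w)"
        by (rule mult_right_mono[OF le]) simp
      finally show "norm (case a of (x, w) \<Rightarrow> cnj (f x) * L x w * g w) \<le> (norm2 u * norm2 v) *
          ((case a of (x, w) \<Rightarrow> (?r x)\<^sup>2 * cmod (L x w)) + (case a of (x, w) \<Rightarrow> (?r w)\<^sup>2 * cmod (L x w)))"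
        by (simp add: a algebra_simps)
    qed
    then have "(\<Sum>\<^sub>\<infinity>x. \<Sum>\<^sub>\<infinity>w. cnj (f x) * L x w * g w) = (\<Sum>\<^sub>\<infinity>w. \<Sum>\<^sub>\<infinity>x. cnj (f x) * L x w * g w)"
      by (rule infsum_swap_banach)
    moreover have "(\<Sum>\<^sub>\<infinity>w. cnj (f x) * L x w * g w) = cnj (f x) * A g x" for x
      unfolding A_def sum_distrib_left mult.assoc[symmetric]
      by (rule infsumI, rule has_sum_finite_neutralI[OF N(1)]) (use N(2) in auto)
    moreover have "(\<Sum>\<^sub>\<infinity>x. cnj (f x) * L x w * g w) = cnj (A f w) * g w" for w
      unfolding A_def cnj_sum sum_distrib_right
    proof (rule infsumI, rule has_sum_finite_neutralI[OF N(1)])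
      show "(\<Sum>x\<in>N w. cnj (L w x * f x) * g w) = (\<Sum>x\<in>N w. cnj (f x) * L x w * g w)"
        by (rule sum.cong) (simp_all add: herm[of _ w])
      show "cnj (f x) * L x w * g w = 0" if "x \<in> UNIV - N w" for x
        using N(2)[of x w] that by (simp add: herm[of x w])
    qed auto
    ultimately show ?thesis by (simp add: inner2_def f_def g_def)
  qed
  define D where "D = app \<rho> ` Collect ell2"
  have "symmetric_operator D A"
    unfolding symmetric_operator_def
  proof (intro conjI ballI allI)
    show "D \<subseteq> Collect ell2" "A ` D \<subseteq> Collect ell2"
      by (auto simp: D_def dm_app_ell2[OF dm] A_ell2)
    fix u v c assume "u \<in> D" "v \<in> D"
    then obtain u' v' where u: "ell2 u'" "u = app \<rho> u'" and v: "ell2 v'" "v = app \<rho> v'"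
      by (auto simp: D_def)
    have "(\<lambda>x. u x + c * v x) = app \<rho> (\<lambda>x. u' x + c * v' x)"
      unfolding u(2) v(2) dm_app_lin[OF dm u(1) v(1)] ..
    then show "(\<lambda>x. u x + c * v x) \<in> D"
      unfolding D_def using ell2_add[OF u(1) ell2_scale[OF v(1)]] by simp
    show "A (\<lambda>x. u x + c * v x) = (\<lambda>x. A u x + c * A v x)" by (rule A_lin)
    show "inner2 (A u) v = inner2 u (A v)" unfolding u(2) v(2) by (rule sym[OF u(1) v(1)])
  qed
  then have SLD: "is_SLD \<rho> (\<lambda>x y. (Y x y + adj Y x y) / 2) D A"
    unfolding is_SLD_def using Y_hs AY by (auto simp: D_def)
  have A\<psi>: "ell2 (A (\<psi> k))" if k: "k \<in> I" for k
  proof -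
    have "A (\<lambda>x. inverse (complex_of_real (p k)) * app \<rho> (\<psi> k) x) =
        (\<lambda>x. inverse (complex_of_real (p k)) * A (app \<rho> (\<psi> k)) x)"
      by (simp add: A_def fun_eq_iff sum_distrib_left mult.left_commute)
    moreover have "(\<lambda>x. inverse (complex_of_real (p k)) * app \<rho> (\<psi> k) x) = \<psi> k"
      using sd_pos[OF sd k] by (simp add: sd_eigen[OF sd k] fun_eq_iff mult.assoc[symmetric])
    ultimately have e: "A (\<psi> k) = (\<lambda>x. inverse (complex_of_real (p k)) * A (app \<rho> (\<psi> k)) x)"
      by simp
    show ?thesis unfolding e by (rule ell2_scale[OF A_ell2[OF sd_ell2[OF sd k]]])
  qed
  \<comment> \<open>Summed over k this is the expectation of \<rho> in row x of L; summed over x it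
    is the term of \<open>has_trace_square\<close>.\<close>
  let ?f = "\<lambda>(x, k). p k * (cmod (A (\<psi> k) x))\<^sup>2"
  have row: "((\<lambda>k. p k * (cmod (A (\<psi> k) x))\<^sup>2) has_sum dm_form \<rho> (l x)) I" for x
  proof -
    have "((\<lambda>k. Re (complex_of_real (p k) * (inner2 (l x) (\<psi> k) * inner2 (\<psi> k) (l x)))) has_sum dm_form \<rho> (l x)) I"
      unfolding dm_form_def[OF dm] by (rule has_sum_Re[OF sd_form[OF sd l l]])
    moreover have "Re (complex_of_real (p k) * (inner2 (l x) (\<psi> k) * inner2 (\<psi> k) (l x))) = p k * (cmod (A (\<psi> k) x))\<^sup>2" for k
      unfolding inner2_cnj[of "\<psi> k" "l x"] Al
      by (simp only: complex_norm_square[symmetric] of_real_mult[symmetric] Re_complex_of_real)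
    ultimately show ?thesis by (simp only:)
  qed
  have K': "((\<lambda>x. dm_form \<rho> (l x)) has_sum K) UNIV" using K by (simp add: \<rho>_def l_def)
  have nn: "p k * (cmod (A (\<psi> k) x))\<^sup>2 \<ge> 0" if "k \<in> I" for k x using sd_pos[OF sd that] by simp
  have "?f summable_on UNIV \<times> I"
    by (rule summable_on_SigmaI[where g = "\<lambda>x. dm_form \<rho> (l x)"]) (use row q(2) nn in auto)
  then have "(?f has_sum K) (UNIV \<times> I)"
    by (intro has_sum_SigmaI[OF _ K']) (use row in auto)
  then have "((\<lambda>(k, x). p k * (cmod (A (\<psi> k) x))\<^sup>2) has_sum K) (I \<times> UNIV)"
    using has_sum_swap[of ?f UNIV I K] by (simp add: case_prod_unfold)
  then have "((\<lambda>k. p k * (norm2 (A (\<psi> k)))\<^sup>2) has_sum K) I"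
    by (rule has_sum_SigmaD) (auto intro!: has_sum_cmult_right ell2_has_sum A\<psi>)
  then have "has_trace_square \<rho> A K" unfolding has_trace_square_def using sd by blast
  with SLD show ?thesis
    unfolding has_QFI_def \<rho>_def[symmetric]
    by (intro exI[of _ "\<lambda>x y. (Y x y + adj Y x y) / 2"] exI[of _ D] exI[of _ A] conjI allI der)
qed

section \<open>The amplifier unitary\<close>

subsection \<open>Ladder operators on two modes\<close>

definition rt :: "nat \<Rightarrow> complex" where "rt n = complex_of_real (sqrt (real n))"

definition lower_a :: "(nat \<times> nat) vec \<Rightarrow> (nat \<times> nat) vec" where
  "lower_a v = (\<lambda>(x, y). rt (Suc x) * v (Suc x, y))"

definition raise_a :: "(nat \<times> nat) vec \<Rightarrow> (nat \<times> nat) vec" where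
  "raise_a v = (\<lambda>(x, y). rt x * v (x - 1, y))"

definition lower_e :: "(nat \<times> nat) vec \<Rightarrow> (nat \<times> nat) vec" where
  "lower_e v = (\<lambda>(x, y). rt (Suc y) * v (x, Suc y))"

definition raise_e :: "(nat \<times> nat) vec \<Rightarrow> (nat \<times> nat) vec" where
  "raise_e v = (\<lambda>(x, y). rt y * v (x, y - 1))"

lemmas ladder_defs = lower_a_def raise_a_def lower_e_def raise_e_def

lemma rt_mult [simp]: "rt n * rt n = of_nat n" "rt n * (rt n * z) = of_nat n * z"
proof -
  show 1: "rt n * rt n = of_nat n" by (simp only: rt_def of_real_mult[symmetric]) simp
  show "rt n * (rt n * z) = of_nat n * z" by (simp only: mult.assoc[symmetric] 1)
qed

lemma rt_simps [simp]: "rt 0 = 0" "rt n = 0 \<longleftrightarrow> n = 0" "cnj (rt n) = rt n"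
  by (auto simp: rt_def)

lemma norm_rt_le: "n \<le> Suc m \<Longrightarrow> cmod (rt n) \<le> 1 + real m"
proof -
  assume "n \<le> Suc m"
  then have "real n \<le> 1 + real m" by simp
  also have "\<dots> \<le> (1 + real m)\<^sup>2" by (simp add: power2_eq_square algebra_simps)
  finally have "sqrt (real n) \<le> sqrt ((1 + real m)\<^sup>2)"
    by (rule real_sqrt_le_mono)
  then show ?thesis by (simp add: rt_def)
qed

text \<open>Valid for all vectors: both sides are the same infinite sum after reindexing, whether or
  not it converges.\<close>

lemma inner2_raise_a: "inner2 (raise_a u) v = inner2 u (lower_a v)"
proof -
  let ?f = "\<lambda>w. cnj (raise_a u w) * v w" and ?h = "\<lambda>(x, y). (Suc x, y :: nat)"
  have "inner2 (raise_a u) v = infsum ?f (range ?h)"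
    unfolding inner2_def
  proof (rule infsum_cong_neutral)
    fix w assume "w \<in> UNIV - range ?h"
    then have "fst w = 0" by (cases w, cases "fst w") (auto simp: image_iff)
    then show "?f w = 0" by (cases w) (simp add: raise_a_def)
  qed auto
  also have "\<dots> = infsum (?f \<circ> ?h) UNIV" by (rule infsum_reindex) (auto simp: inj_on_def)
  also have "?f \<circ> ?h = (\<lambda>w. cnj (u w) * lower_a v w)"
    by (auto simp: fun_eq_iff ladder_defs)
  finally show ?thesis by (simp add: inner2_def)
qed

lemma inner2_raise_e: "inner2 (raise_e u) v = inner2 u (lower_e v)"
proof -
  let ?f = "\<lambda>w. cnj (raise_e u w) * v w" and ?h = "\<lambda>(x :: nat, y). (x, Suc y)"
  have "inner2 (raise_e u) v = infsum ?f (range ?h)"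
    unfolding inner2_def
  proof (rule infsum_cong_neutral)
    fix w assume "w \<in> UNIV - range ?h"
    then have "snd w = 0" by (cases w, cases "snd w") (auto simp: image_iff)
    then show "?f w = 0" by (cases w) (simp add: raise_e_def)
  qed auto
  also have "\<dots> = infsum (?f \<circ> ?h) UNIV" by (rule infsum_reindex) (auto simp: inj_on_def)
  also have "?f \<circ> ?h = (\<lambda>w. cnj (u w) * lower_e v w)"
    by (auto simp: fun_eq_iff ladder_defs)
  finally show ?thesis by (simp add: inner2_def)
qed

lemma inner2_lower_a: "inner2 (lower_a u) v = inner2 u (raise_a v)"
  using inner2_raise_a[of v u] inner2_cnj[of "lower_a u" v] inner2_cnj[of u "raise_a v"] by simp

lemma inner2_lower_e: "inner2 (lower_e u) v = inner2 u (raise_e v)"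
  using inner2_raise_e[of v u] inner2_cnj[of "lower_e u" v] inner2_cnj[of u "raise_e v"] by simp

lemma mult_a_op: "mult a_op U (x, y) z = lower_a (\<lambda>w. U w z) (x, y)"
  unfolding mult_def lower_a_def
  by (subst infsum_single[of "(Suc x, y)"]) (auto simp: a_op_def rt_def)

lemma mult_e_op: "mult e_op U (x, y) z = lower_e (\<lambda>w. U w z) (x, y)"
  unfolding mult_def lower_e_def
  by (subst infsum_single[of "(x, Suc y)"]) (auto simp: e_op_def rt_def)

lemma mult_lincomb_a:
  "mult U (lincomb h a_op s (adj e_op)) w (p, q) = h * raise_a (U w) (p, q) + s * lower_e (U w) (p, q)"
proof -
  have e: "U w z * lincomb h a_op s (adj e_op) z (p, q) =
      (if z = (p - 1, q) then complex_of_real h * (rt p * U w z) else 0) + (if z = (p, Suc q) then complex_of_real s * (rt (Suc q) * U w z) else 0)" for z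
    by (cases z; cases p) (auto simp: lincomb_def a_op_def adj_def e_op_def rt_def)
  have 1: "((\<lambda>z. if z = a then f z else 0) has_sum f a) UNIV" for a and f :: "_ \<Rightarrow> complex"
    by (rule has_sum_finite_neutralI[of "{a}"]) auto
  show ?thesis
    unfolding mult_def e using has_sum_add[OF 1[of "(p - 1, q)" "\<lambda>z. complex_of_real h * (rt p * U w z)"] 1[of "(p, Suc q)" "\<lambda>z. complex_of_real s * (rt (Suc q) * U w z)"]]
    by (simp add: infsumI ladder_defs)
qed

lemma mult_lincomb_e:
  "mult U (lincomb h e_op s (adj a_op)) w (p, q) = h * raise_e (U w) (p, q) + s * lower_a (U w) (p, q)"
proof -
  have e: "U w z * lincomb h e_op s (adj a_op) z (p, q) =
      (if z = (p, q - 1) then complex_of_real h * (rt q * U w z) else 0) + (if z = (Suc p, q) then complex_of_real s * (rt (Suc p) * U w z) else 0)" for z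
    by (cases z; cases q) (auto simp: lincomb_def a_op_def adj_def e_op_def rt_def)
  have 1: "((\<lambda>z. if z = a then f z else 0) has_sum f a) UNIV" for a and f :: "_ \<Rightarrow> complex"
    by (rule has_sum_finite_neutralI[of "{a}"]) auto
  show ?thesis
    unfolding mult_def e using has_sum_add[OF 1[of "(p, q - 1)" "\<lambda>z. complex_of_real h * (rt q * U w z)"] 1[of "(Suc p, q)" "\<lambda>z. complex_of_real s * (rt (Suc p) * U w z)"]]
    by (simp add: infsumI ladder_defs)
qed

subsection \<open>Rapidly decaying vectors\<close>

text \<open>A class of square-summable vectors stable under all ladder operators, so that adjoints
  and linear combinations can be used freely. The rate may depend on the vector.\<close>

definition decaying :: "(nat \<times> nat) vec \<Rightarrow> bool" where
  "decaying v \<longleftrightarrow> (\<exists>K r. 0 < r \<and> r < 1 \<and> K \<ge> 0 \<and> (\<forall>x y. cmod (v (x, y)) \<le> K * r ^ (x + y)))"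

lemma decaying_ell2:
  assumes "decaying v" shows "ell2 v"
proof -
  obtain K r where r: "0 < r" "r < 1" "K \<ge> 0" "\<And>x y. cmod (v (x, y)) \<le> K * r ^ (x + y)"
    using assms unfolding decaying_def by blast
  have r2: "r\<^sup>2 < 1" using r(1,2) by (simp add: power_less_one_iff abs_square_less_1)
  have g: "(\<lambda>x. (r\<^sup>2) ^ x) summable_on (UNIV :: nat set)"
    by (rule summable_nonneg_imp_summable_on) (use r2 in auto)
  show ?thesis
  proof (rule ell2_comparison)
    show "(\<lambda>(x, y). K\<^sup>2 * (r\<^sup>2) ^ x * (r\<^sup>2) ^ y) summable_on UNIV"
      unfolding UNIV_Times_UNIV[symmetric] using g
      by (intro summable_on_product_nonneg summable_on_cmult_right) auto
    fix w :: "nat \<times> nat"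
    obtain x y where w: "w = (x, y)" by force
    have "(cmod (v w))\<^sup>2 \<le> (K * r ^ (x + y))\<^sup>2" unfolding w by (intro power_mono r) simp
    also have "\<dots> = K\<^sup>2 * (r\<^sup>2) ^ x * (r\<^sup>2) ^ y"
      by (simp add: power_mult_distrib power_add power_mult[symmetric] mult.commute)
    finally show "(cmod (v w))\<^sup>2 \<le> (case w of (x, y) \<Rightarrow> K\<^sup>2 * (r\<^sup>2) ^ x * (r\<^sup>2) ^ y)" by (simp add: w)
  qed
qed

lemma decaying_lin:
  assumes "decaying u" "decaying v" shows "decaying (\<lambda>w. a * u w + b * v w)"
proof -
  obtain K r where r: "0 < r" "r < 1" "K \<ge> 0" "\<And>x y. cmod (u (x, y)) \<le> K * r ^ (x + y)"
    using assms(1) unfolding decaying_def by blast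
  obtain K' r' where r': "0 < r'" "r' < 1" "K' \<ge> 0" "\<And>x y. cmod (v (x, y)) \<le> K' * r' ^ (x + y)"
    using assms(2) unfolding decaying_def by blast
  define m where "m = max r r'"
  have "cmod (a * u (x, y) + b * v (x, y)) \<le> (cmod a * K + cmod b * K') * m ^ (x + y)" for x y
  proof -
    have "cmod (a * u (x, y) + b * v (x, y)) \<le> cmod a * cmod (u (x, y)) + cmod b * cmod (v (x, y))"
      by (rule order_trans[OF norm_triangle_ineq]) (simp add: norm_mult)
    also have "\<dots> \<le> cmod a * (K * m ^ (x + y)) + cmod b * (K' * m ^ (x + y))"
      using r r' by (intro add_mono mult_left_mono order_trans[OF r(4)] order_trans[OF r'(4)] power_mono)
        (auto simp: m_def)
    finally show ?thesis by (simp add: algebra_simps)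
  qed
  then show ?thesis
    unfolding decaying_def using r r'
    by (intro exI[of _ "cmod a * K + cmod b * K'"] exI[of _ m]) (auto simp: m_def)
qed

lemma real_power_bound:
  assumes "0 < t" "t < (1 :: real)" obtains C where "C \<ge> 0" "\<And>n. real n * t ^ n \<le> C"
proof -
  have "(\<lambda>n. real n * t ^ n) \<longlonglongrightarrow> 0"
    using powser_times_n_limit_0[of t] assms by simp
  then have "Bseq (\<lambda>n. real n * t ^ n)" using convergent_imp_Bseq convergentI by blast
  then obtain C where "C > 0" "\<And>n. norm (real n * t ^ n) \<le> C" unfolding Bseq_def by blast
  then show ?thesis using that[of C] by (metis abs_le_D1 less_imp_le real_norm_def)
qed

text \<open>A ladder operator shifts one index and multiplies by a factor of at most linear growth.
  The shift costs a factor 1 / r, and the growth is absorbed by worsening the rate from r to its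
  square root.\<close>

lemma decaying_shift:
  assumes v: "decaying v"
    and u: "\<And>x y. cmod (u (x, y)) \<le> (1 + real (x + y)) * cmod (v (f x y))"
    and f: "\<And>x y. x + y \<le> Suc (case f x y of (x', y') \<Rightarrow> x' + y')"
  shows "decaying u"
proof -
  obtain K r where r: "0 < r" "r < 1" "K \<ge> 0" "\<And>x y. cmod (v (x, y)) \<le> K * r ^ (x + y)"
    using v unfolding decaying_def by blast
  define t where "t = sqrt r"
  have t: "0 < t" "t < 1" "t * t = r" using r by (auto simp: t_def)
  obtain C where C: "C \<ge> 0" "\<And>n. real n * t ^ n \<le> C" by (rule real_power_bound[OF t(1,2)]) blast
  have "cmod (u (x, y)) \<le> (K / r * (1 + C)) * t ^ (x + y)" for x y
  proof -
    obtain x' y' where f': "f x y = (x', y')" by force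
    have "r * r ^ (x' + y') \<le> r ^ (x + y)"
      using power_decreasing[of "x + y" "Suc (x' + y')" r] f[of x y] r by (simp add: f')
    then have "r ^ (x' + y') \<le> r ^ (x + y) / r" using r by (simp add: field_simps)
    then have "cmod (v (f x y)) \<le> K * (r ^ (x + y) / r)"
      unfolding f' using r by (intro order_trans[OF r(4)] mult_left_mono)
    then have "cmod (u (x, y)) \<le> (1 + real (x + y)) * (K * (r ^ (x + y) / r))"
      by (intro order_trans[OF u] mult_left_mono) auto
    also have "\<dots> = K / r * ((1 + real (x + y)) * t ^ (x + y)) * t ^ (x + y)"
      by (simp add: t(3)[symmetric] power_mult_distrib)
    also have "\<dots> \<le> K / r * (1 + C) * t ^ (x + y)"
    proof (intro mult_right_mono mult_left_mono)
      have "t ^ (x + y) \<le> 1" using t by (intro power_le_one) auto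
      then show "(1 + real (x + y)) * t ^ (x + y) \<le> 1 + C"
        using C(2)[of "x + y"] by (simp add: distrib_right)
    qed (use r t in auto)
    finally show ?thesis .
  qed
  then show ?thesis
    unfolding decaying_def using r t C by (intro exI[of _ "K / r * (1 + C)"] exI[of _ t]) auto
qed

lemma decaying_ladder:
  assumes "decaying v"
  shows "decaying (lower_a v)" "decaying (raise_a v)" "decaying (lower_e v)" "decaying (raise_e v)"
proof -
  show "decaying (lower_a v)"
    by (rule decaying_shift[OF assms, of _ "\<lambda>x y. (Suc x, y)"]) (auto simp: ladder_defs norm_mult simp del: of_nat_add intro!: mult_right_mono norm_rt_le)
  show "decaying (raise_a v)"
    by (rule decaying_shift[OF assms, of _ "\<lambda>x y. (x - 1, y)"]) (auto simp: ladder_defs norm_mult simp del: of_nat_add intro!: mult_right_mono norm_rt_le)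
  show "decaying (lower_e v)"
    by (rule decaying_shift[OF assms, of _ "\<lambda>x y. (x, Suc y)"]) (auto simp: ladder_defs norm_mult simp del: of_nat_add intro!: mult_right_mono norm_rt_le)
  show "decaying (raise_e v)"
    by (rule decaying_shift[OF assms, of _ "\<lambda>x y. (x, y - 1)"]) (auto simp: ladder_defs norm_mult simp del: of_nat_add intro!: mult_right_mono norm_rt_le)
qed


subsection \<open>Existence\<close>

text \<open>The row of \<open>U\<close> with index \<open>(x, y)\<close> is obtained from the two-mode squeezed vacuum by the creation
  operators \<open>B = h a\<^sup>\<dagger> + s e\<close> and \<open>C = h e\<^sup>\<dagger> + s a\<close> of the Bogoliubov-transformed modes, where \<open>h = \<surd>G\<close> and
  \<open>s = \<surd>(G - 1)\<close>.  Their annihilation operators are \<open>B'\<close> and \<open>C'\<close>.\<close>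

context
  fixes h s :: real
  assumes hs: "h\<^sup>2 = 1 + s\<^sup>2" "h > 0" "s > 0"
begin

definition opB :: "(nat \<times> nat) vec \<Rightarrow> (nat \<times> nat) vec" where
  "opB v = (\<lambda>w. complex_of_real h * raise_a v w + complex_of_real s * lower_e v w)"

definition opC :: "(nat \<times> nat) vec \<Rightarrow> (nat \<times> nat) vec" where
  "opC v = (\<lambda>w. complex_of_real h * raise_e v w + complex_of_real s * lower_a v w)"

definition opB' :: "(nat \<times> nat) vec \<Rightarrow> (nat \<times> nat) vec" where
  "opB' v = (\<lambda>w. complex_of_real h * lower_a v w + complex_of_real s * raise_e v w)"

definition opC' :: "(nat \<times> nat) vec \<Rightarrow> (nat \<times> nat) vec" where
  "opC' v = (\<lambda>w. complex_of_real h * lower_e v w + complex_of_real s * raise_a v w)"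

lemmas op_defs = opB_def opC_def opB'_def opC'_def ladder_defs

lemma hsc: "complex_of_real h * complex_of_real h = 1 + complex_of_real s * complex_of_real s"
  using arg_cong[OF hs(1), of complex_of_real] by (simp add: power2_eq_square)

lemma op_scale:
  "opB (\<lambda>w. c * v w) = (\<lambda>w. c * opB v w)" "opC (\<lambda>w. c * v w) = (\<lambda>w. c * opC v w)"
  "opB' (\<lambda>w. c * v w) = (\<lambda>w. c * opB' v w)" "opC' (\<lambda>w. c * v w) = (\<lambda>w. c * opC' v w)"
  by (auto simp: op_defs fun_eq_iff algebra_simps)

lemma op_zero: "opB (\<lambda>w. 0) = (\<lambda>w. 0)" "opC (\<lambda>w. 0) = (\<lambda>w. 0)"
  by (auto simp: op_defs fun_eq_iff)

lemma opB_opC: "opB (opC v) = opC (opB v)"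
proof
  fix w :: "nat \<times> nat"
  obtain x y where w: "w = (x, y)" by force
  show "opB (opC v) w = opC (opB v) w"
    unfolding w by (cases x; cases y) (simp_all add: op_defs algebra_simps)
qed

lemma opB'_opC: "opB' (opC v) = opC (opB' v)"
proof
  fix w :: "nat \<times> nat"
  obtain x y where w: "w = (x, y)" by force
  show "opB' (opC v) w = opC (opB' v) w"
    unfolding w by (cases x; cases y) (simp_all add: op_defs algebra_simps)
qed

lemma opC'_opB: "opC' (opB v) = opB (opC' v)"
proof
  fix w :: "nat \<times> nat"
  obtain x y where w: "w = (x, y)" by force
  show "opC' (opB v) w = opB (opC' v) w"
    unfolding w by (cases x; cases y) (simp_all add: op_defs algebra_simps)
qed

lemma commute_h: "complex_of_real h * (complex_of_real h * z) = z + complex_of_real s * (complex_of_real s * z)"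
  by (simp only: mult.assoc[symmetric] hsc distrib_right mult_1_left)

lemma opB'_opB: "opB' (opB v) = (\<lambda>w. opB (opB' v) w + v w)"
proof
  fix w :: "nat \<times> nat"
  obtain x y where w: "w = (x, y)" by force
  show "opB' (opB v) w = opB (opB' v) w + v w"
    unfolding w by (cases x; cases y) (simp_all add: op_defs algebra_simps commute_h)
qed

lemma opC'_opC: "opC' (opC v) = (\<lambda>w. opC (opC' v) w + v w)"
proof
  fix w :: "nat \<times> nat"
  obtain x y where w: "w = (x, y)" by force
  show "opC' (opC v) w = opC (opC' v) w + v w"
    unfolding w by (cases x; cases y) (simp_all add: op_defs algebra_simps commute_h)
qed

lemma ladder_of_op:
  "lower_a v = (\<lambda>w. h * opB' v w - s * opC v w)" "lower_e v = (\<lambda>w. h * opC' v w - s * opB v w)"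
  "raise_a v = (\<lambda>w. h * opB v w - s * opC' v w)" "raise_e v = (\<lambda>w. h * opC v w - s * opB' v w)"
  by (auto simp: fun_eq_iff opB_def opC_def opB'_def opC'_def algebra_simps commute_h)

text \<open>The unit vector annihilated by \<open>opB'\<close> and \<open>opC'\<close>: annihilation
  forces the ratio -s / h along the diagonal, and 1 / h is the normalisation since h^2 = 1 +
  s^2.\<close>

definition squeezed :: "(nat \<times> nat) vec" where
  "squeezed = (\<lambda>(p, q). if p = q then complex_of_real ((- s / h) ^ p / h) else 0)"

lemma op_squeezed: "opB' squeezed = (\<lambda>w. 0)" "opC' squeezed = (\<lambda>w. 0)"
proof -
  have 1: "h * ((- s / h) ^ Suc n / h) + s * ((- s / h) ^ n / h) = 0" for n
    using hs by (simp add: field_simps)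
  have 2: "complex_of_real h * (c * complex_of_real ((- s / h) ^ Suc n / h)) +
      complex_of_real s * (c * complex_of_real ((- s / h) ^ n / h)) = 0" for c n
  proof -
    have "c * complex_of_real (h * ((- s / h) ^ Suc n / h) + s * ((- s / h) ^ n / h)) = 0"
      by (simp only: 1 of_real_0 mult_zero_right)
    then show ?thesis by (simp only: of_real_add of_real_mult distrib_left mult.left_commute)
  qed
  show "opB' squeezed = (\<lambda>w. 0)"
  proof
    fix w :: "nat \<times> nat"
    obtain x y where w: "w = (x, y)" by force
    show "opB' squeezed w = 0"
      unfolding w using 2[of "rt (Suc x)" x] by (cases y) (auto simp: op_defs squeezed_def simp del: power_Suc)
  qed
  show "opC' squeezed = (\<lambda>w. 0)"
  proof
    fix w :: "nat \<times> nat"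
    obtain x y where w: "w = (x, y)" by force
    show "opC' squeezed w = 0"
      unfolding w using 2[of "rt (Suc y)" y] by (cases x) (auto simp: op_defs squeezed_def simp del: power_Suc)
  qed
qed

section \<open>The rows of the unitary\<close>

definition row0 :: "nat \<Rightarrow> nat \<Rightarrow> (nat \<times> nat) vec" where
  "row0 x y = (opB ^^ x) ((opC ^^ y) squeezed)"

lemma opB_row0: "opB (row0 x y) = row0 (Suc x) y" by (simp add: row0_def)

lemma opC_row0: "opC (row0 x y) = row0 x (Suc y)"
  by (induction x) (simp_all add: row0_def opB_opC[symmetric])

lemma opB'_row0: "opB' (row0 x y) = (\<lambda>w. of_nat x * row0 (x - 1) y w)"
proof (induction x)
  case 0
  show ?case
    by (induction y) (simp_all add: row0_def op_squeezed opB'_opC op_zero)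
next
  case (Suc x)
  have "opB' (row0 (Suc x) y) = (\<lambda>w. opB (opB' (row0 x y)) w + row0 x y w)"
    unfolding opB_row0[symmetric] by (rule opB'_opB)
  also have "\<dots> = (\<lambda>w. of_nat (Suc x) * row0 x y w)"
    unfolding Suc.IH op_scale opB_row0 by (cases x) (auto simp: fun_eq_iff algebra_simps)
  finally show ?case by simp
qed

lemma opC'_row0: "opC' (row0 x y) = (\<lambda>w. of_nat y * row0 x (y - 1) w)"
proof (induction y)
  case 0
  show ?case
    by (induction x) (simp_all add: row0_def op_squeezed opC'_opB op_zero)
next
  case (Suc y)
  have "opC' (row0 x (Suc y)) = (\<lambda>w. opC (opC' (row0 x y)) w + row0 x y w)"
    unfolding opC_row0[symmetric] by (rule opC'_opC)
  also have "\<dots> = (\<lambda>w. of_nat (Suc y) * row0 x y w)"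
    unfolding Suc.IH op_scale opC_row0 by (cases y) (auto simp: fun_eq_iff algebra_simps)
  finally show ?case by simp
qed

definition row :: "nat \<Rightarrow> nat \<Rightarrow> (nat \<times> nat) vec" where
  "row x y = (\<lambda>w. complex_of_real (1 / sqrt (fact x * fact y)) * row0 x y w)"

lemma sqrt_fact_Suc: "1 / sqrt (fact n * c) = sqrt (real (Suc n)) * (1 / sqrt (fact (Suc n) * c))"
proof -
  have "fact (Suc n) * c = real (Suc n) * (fact n * c)" by (simp add: mult.assoc)
  then show ?thesis by (simp only: real_sqrt_mult) (simp add: field_simps)
qed

lemma opB_row: "opB (row x y) = (\<lambda>w. rt (Suc x) * row (Suc x) y w)"
  unfolding row_def op_scale opB_row0
  by (subst sqrt_fact_Suc) (simp only: rt_def of_real_mult mult.assoc)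

lemma opC_row: "opC (row x y) = (\<lambda>w. rt (Suc y) * row x (Suc y) w)"
  unfolding row_def op_scale opC_row0
  by (subst mult.commute[of "fact x"], subst sqrt_fact_Suc) (simp only: rt_def of_real_mult mult.assoc mult.commute[of "fact x"])

lemma opB'_row: "opB' (row x y) = (\<lambda>w. rt x * row (x - 1) y w)"
  unfolding row_def op_scale opB'_row0
proof (cases x)
  case (Suc n)
  have "of_nat (Suc n) = rt (Suc n) * rt (Suc n)" by (simp only: rt_mult)
  then show "(\<lambda>w. complex_of_real (1 / sqrt (fact x * fact y)) * (of_nat x * row0 (x - 1) y w)) =
      (\<lambda>w. rt x * (complex_of_real (1 / sqrt (fact (x - 1) * fact y)) * row0 (x - 1) y w))"
    unfolding Suc diff_Suc_1 sqrt_fact_Suc[of n] by (simp only: of_real_mult rt_def mult_ac)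
qed simp

lemma opC'_row: "opC' (row x y) = (\<lambda>w. rt y * row x (y - 1) w)"
  unfolding row_def op_scale opC'_row0
proof (cases y)
  case (Suc n)
  have "of_nat (Suc n) = rt (Suc n) * rt (Suc n)" by (simp only: rt_mult)
  then show "(\<lambda>w. complex_of_real (1 / sqrt (fact x * fact y)) * (of_nat y * row0 x (y - 1) w)) =
      (\<lambda>w. rt y * (complex_of_real (1 / sqrt (fact x * fact (y - 1))) * row0 x (y - 1) w))"
    unfolding Suc diff_Suc_1 mult.commute[of "fact x"] sqrt_fact_Suc[of n] by (simp only: of_real_mult rt_def mult_ac)
qed simp

lemma decaying_op:
  assumes "decaying v" shows "decaying (opB v)" "decaying (opC v)" "decaying (opB' v)" "decaying (opC' v)"
  using decaying_ladder[OF assms] by (simp_all add: opB_def opC_def opB'_def opC'_def decaying_lin)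

lemma decaying_row: "decaying (row x y)"
proof -
  \<comment> \<open>The square root appears because the weight (s / h)^p sits at total photon number
    2p.\<close>
  define r where "r = sqrt (s / h)"
  have sh: "s < h"
    using hs by (intro power2_less_imp_less[of s h]) auto
  have r: "0 < r" "r < 1" "r * r = s / h" using hs sh by (auto simp: r_def)
  have sq: "decaying squeezed"
    unfolding decaying_def
  proof (rule exI[of _ "1 / h"], rule exI[of _ r], intro conjI allI)
    fix x y
    show "cmod (squeezed (x, y)) \<le> 1 / h * r ^ (x + y)"
      using hs r by (auto simp: squeezed_def norm_power norm_divide power_add power_mult_distrib[symmetric])
  qed (use r hs in auto)
  have "decaying (row0 x y)"
  proof (induction x)
    case 0
    show ?case by (induction y) (simp_all add: row0_def sq decaying_op)
  next
    case (Suc x)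
    then show ?case using decaying_op(1) by (simp only: opB_row0[symmetric])
  qed
  from decaying_lin[OF this this, of "complex_of_real (1 / sqrt (fact x * fact y))" 0]
  show ?thesis by (simp add: row_def)
qed

lemma inner2_opB:
  assumes "decaying u" "decaying v" shows "inner2 (opB u) v = inner2 u (opB' v)"
proof -
  note e = decaying_ladder[OF assms(1), THEN decaying_ell2] decaying_ladder[OF assms(2), THEN decaying_ell2]
    assms[THEN decaying_ell2]
  show ?thesis
    unfolding opB_def opB'_def using e
    by (simp add: inner2_add_left inner2_add_right ell2_scale inner2_scale inner2_scale_left inner2_raise_a inner2_lower_e)
qed

lemma inner2_opC:
  assumes "decaying u" "decaying v" shows "inner2 (opC u) v = inner2 u (opC' v)"
proof -
  note e = decaying_ladder[OF assms(1), THEN decaying_ell2] decaying_ladder[OF assms(2), THEN decaying_ell2]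
    assms[THEN decaying_ell2]
  show ?thesis
    unfolding opC_def opC'_def using e
    by (simp add: inner2_add_left inner2_add_right ell2_scale inner2_scale inner2_scale_left inner2_raise_e inner2_lower_a)
qed

lemma inner2_row_Suc_x:
  "rt (Suc x) * inner2 (row (Suc x) y) (row x' y') = rt x' * inner2 (row x y) (row (x' - 1) y')"
  using inner2_opB[OF decaying_row decaying_row, of x y x' y']
  by (simp only: opB_row opB'_row inner2_scale inner2_scale_left rt_simps)

lemma inner2_row_Suc_y:
  "rt (Suc y) * inner2 (row x (Suc y)) (row x' y') = rt y' * inner2 (row x y) (row x' (y' - 1))"
  using inner2_opC[OF decaying_row decaying_row, of x y x' y']
  by (simp only: opC_row opC'_row inner2_scale inner2_scale_left rt_simps)

lemma squeezed_norm: "inner2 (row 0 0) (row 0 0) = 1"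
proof -
  have r: "row 0 0 = squeezed" by (simp add: row_def row0_def)
  define l where "l = s\<^sup>2 / h\<^sup>2"
  have "1 - l = (h\<^sup>2 - s\<^sup>2) / h\<^sup>2" using hs(2) by (simp add: l_def diff_divide_distrib)
  then have l3: "1 - l = 1 / h\<^sup>2" using hs(1) by simp
  moreover have "1 / h\<^sup>2 > 0" using hs(2) by simp
  ultimately have "l < 1" by linarith
  with l3 have l: "0 \<le> l" "l < 1" "1 - l = 1 / h\<^sup>2" by (auto simp: l_def)
  have "(\<lambda>n. l ^ n * (1 / h\<^sup>2)) sums (1 / (1 - l) * (1 / h\<^sup>2))"
    using l by (intro sums_mult2 geometric_sums) simp
  then have "(\<lambda>n. l ^ n * (1 / h\<^sup>2)) sums 1" using hs(2) by (simp add: l(3))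
  then have "((\<lambda>n. l ^ n * (1 / h\<^sup>2)) has_sum 1) UNIV"
    by (rule sums_nonneg_imp_has_sum) (use l in auto)
  then have "((\<lambda>n. complex_of_real (l ^ n * (1 / h\<^sup>2))) has_sum 1) UNIV"
    using has_sum_of_real[where 'a = complex] by (metis of_real_1)
  also have "(\<lambda>n. complex_of_real (l ^ n * (1 / h\<^sup>2))) = (\<lambda>w. cnj (squeezed w) * squeezed w) \<circ> (\<lambda>n. (n, n))"
  proof
    fix n
    have "l ^ n * (1 / h\<^sup>2) = ((- s / h) ^ n / h) * ((- s / h) ^ n / h)"
    proof -
      have "l = (- s / h) * (- s / h)" by (simp add: l_def power2_eq_square)
      then have "l ^ n = (- s / h) ^ n * (- s / h) ^ n" by (simp only: power_mult_distrib)
      then show ?thesis by (simp add: power2_eq_square)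
    qed
    then show "complex_of_real (l ^ n * (1 / h\<^sup>2)) = ((\<lambda>w. cnj (squeezed w) * squeezed w) \<circ> (\<lambda>n. (n, n))) n"
      by (simp only: comp_def squeezed_def prod.case of_real_mult complex_cnj_complex_of_real if_True simp_thms)
  qed
  finally have "((\<lambda>w. cnj (squeezed w) * squeezed w) has_sum 1) (range (\<lambda>n. (n, n)))"
    by (subst has_sum_reindex) (auto simp: inj_on_def comp_def)
  then have "((\<lambda>w. cnj (squeezed w) * squeezed w) has_sum 1) UNIV"
    by (rule has_sum_cong_neutral[THEN iffD1, rotated -1]) (auto simp: squeezed_def image_iff)
  then show ?thesis by (simp add: r inner2_def infsumI)
qed

text \<open>As for Fock states: moving one creation operator to the other side as an annihilation
  operator lowers an index in both arguments. Equal indices end at the norm of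
  \<open>squeezed\<close>; unequal ones meet its annihilation.\<close>

lemma row_orthonormal: "inner2 (row x y) (row x' y') = of_bool (x = x' \<and> y = y')"
proof -
  have z: "inner2 (row (Suc x) y) (row 0 y') = 0" for x y y'
    using inner2_row_Suc_x[of x y 0 y'] by (simp del: of_nat_Suc)
  have z': "inner2 (row 0 y) (row (Suc x) y') = 0" for x y y'
    using z[of x y' y] inner2_cnj[of "row 0 y"] by simp
  have zy: "inner2 (row x (Suc y)) (row x' 0) = 0" for x y x'
    using inner2_row_Suc_y[of y x x' 0] by (simp del: of_nat_Suc)
  have zy': "inner2 (row x 0) (row x' (Suc y)) = 0" for x y x'
    using zy[of x' y x] inner2_cnj[of "row x 0"] by simp
  have sx: "inner2 (row (Suc x) y) (row (Suc x') y') = of_bool (Suc x = Suc x' \<and> y = y')"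
    if "inner2 (row x y) (row x' y') = of_bool (x = x' \<and> y = y')" for x y x' y'
    using inner2_row_Suc_x[of x y "Suc x'" y'] that by (auto simp del: of_nat_Suc)
  have sy: "inner2 (row x (Suc y)) (row x' (Suc y')) = of_bool (x = x' \<and> Suc y = Suc y')"
    if "inner2 (row x y) (row x' y') = of_bool (x = x' \<and> y = y')" for x y x' y'
    using inner2_row_Suc_y[of y x x' "Suc y'"] that by (auto simp del: of_nat_Suc)
  have base: "inner2 (row 0 y) (row 0 y') = of_bool (y = y')" for y y'
  proof (induction y arbitrary: y')
    case 0
    then show ?case by (cases y') (simp_all add: squeezed_norm zy')
  next
    case (Suc y)
    then show ?case using sy[of 0 y 0] by (cases y') (simp_all add: zy)
  qed
  show ?thesis
  proof (induction x arbitrary: x')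
    case 0
    then show ?case by (cases x') (simp_all add: base z')
  next
    case (Suc x)
    then show ?case using sx by (cases x') (simp_all add: z)
  qed
qed

text \<open>At (0, 0) the raising operators give 0, so \<open>ladder_of_op\<close> becomes a
  recursion in (p, q). The result is \<open>squeezed\<close> with -s replaced by s, the base case of
  the transposition symmetry.\<close>

lemma row_at_0: "row p q (0, 0) = (if p = q then complex_of_real ((s / h) ^ p / h) else 0)"
proof -
  have a: "h * rt (Suc p) * row (Suc p) q (0, 0) = s * rt q * row p (q - 1) (0, 0)" for p q
    using fun_cong[OF ladder_of_op(3)[of "row p q"], of "(0, 0)"]
    by (simp add: opB_row opC'_row raise_a_def mult.assoc)
  have e: "h * rt (Suc q) * row p (Suc q) (0, 0) = s * rt p * row (p - 1) q (0, 0)" for p q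
    using fun_cong[OF ladder_of_op(4)[of "row p q"], of "(0, 0)"]
    by (simp add: opC_row opB'_row raise_e_def mult.assoc)
  show ?thesis
  proof (induction p arbitrary: q)
    case 0
    show ?case
    proof (cases q)
      case 0
      then show ?thesis by (simp add: row_def row0_def squeezed_def)
    next
      case (Suc n)
      then show ?thesis using e[of n 0] hs by (simp del: of_nat_Suc)
    qed
  next
    case (Suc p)
    show ?case
    proof (cases q)
      case 0
      then show ?thesis using a[of p 0] hs by (simp del: of_nat_Suc)
    next
      case (Suc n)
      have "complex_of_real h * rt (Suc p) * row (Suc p) q (0, 0) =
          complex_of_real s * rt (Suc n) * row p n (0, 0)"
        using a[of p q] by (simp add: Suc del: of_nat_Suc)
      moreover have "complex_of_real h * rt (Suc p) \<noteq> 0" using hs by (simp del: of_nat_Suc)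
      ultimately have "row (Suc p) q (0, 0) = complex_of_real s * rt (Suc n) * row p n (0, 0) /
          (complex_of_real h * rt (Suc p))"
        by (simp add: eq_divide_eq mult.commute del: of_nat_Suc)
      then show ?thesis unfolding Suc.IH Suc by (simp del: of_nat_Suc)
    qed
  qed
qed

text \<open>Transposing \<open>U\<close> is the same as replacing \<open>s\<close> by \<open>-s\<close>, which is conjugation with the parity of the
  environment mode; so the orthonormality of the rows is also that of the columns.\<close>

lemma row_symmetric: "row x y (p, q) = (-1) ^ (y + q) * row p q (x, y)"
proof -
  \<comment> \<open>The claim is that this signed transpose is \<open>row\<close>. It satisfies the
    same recursions in x and y, whose factors \<open>rt (Suc x)\<close> and
    \<open>rt (Suc y)\<close> are nonzero, and it agrees at (0, 0).\<close>
  define T where "T x y = (\<lambda>(p, q). (-1) ^ (y + q) * row p q (x, y))" for x y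
  have B: "rt (Suc x) * T (Suc x) y w = opB (T x y) w" for x y w
  proof -
    obtain p q where w: "w = (p, q)" by force
    have "rt (Suc x) * row p q (Suc x, y) =
        h * (rt p * row (p - 1) q (x, y)) - s * (rt (Suc q) * row p (Suc q) (x, y))"
      using fun_cong[OF ladder_of_op(1)[of "row p q"], of "(x, y)"]
      by (simp only: opB'_row opC_row) (simp add: lower_a_def)
    then have "(-1) ^ (y + q) * (rt (Suc x) * row p q (Suc x, y)) =
        (-1) ^ (y + q) * (h * (rt p * row (p - 1) q (x, y)) - s * (rt (Suc q) * row p (Suc q) (x, y)))"
      by (rule arg_cong)
    then show ?thesis unfolding w by (simp add: T_def opB_def ladder_defs algebra_simps)
  qed
  have C: "rt (Suc y) * T x (Suc y) w = opC (T x y) w" for x y w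
  proof -
    obtain p q where w: "w = (p, q)" by force
    have "rt (Suc y) * row p q (x, Suc y) =
        h * (rt q * row p (q - 1) (x, y)) - s * (rt (Suc p) * row (Suc p) q (x, y))"
      using fun_cong[OF ladder_of_op(2)[of "row p q"], of "(x, y)"]
      by (simp only: opC'_row opB_row) (simp add: lower_e_def)
    then have "(-1) ^ (Suc y + q) * (rt (Suc y) * row p q (x, Suc y)) =
        (-1) ^ (Suc y + q) * (h * (rt q * row p (q - 1) (x, y)) - s * (rt (Suc p) * row (Suc p) q (x, y)))"
      by (rule arg_cong)
    then show ?thesis unfolding w by (cases q) (simp_all add: T_def opC_def ladder_defs algebra_simps)
  qed
  have 0: "T 0 0 = row 0 0"
  proof
    fix w :: "nat \<times> nat"
    obtain p q where w: "w = (p, q)" by force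
    have "row 0 0 = squeezed" by (simp add: row_def row0_def)
    moreover have "(- s / h) ^ q = (- 1) ^ q * (s / h) ^ q"
      by (simp only: power_mult_distrib[symmetric]) simp
    then have "complex_of_real ((- s / h) ^ q / h) = (- 1) ^ q * complex_of_real ((s / h) ^ q / h)" by simp
    ultimately show "T 0 0 w = row 0 0 w"
      unfolding w T_def prod.case row_at_0 by (cases "p = q") (simp_all only: squeezed_def prod.case simp_thms if_True if_False add_0 mult_zero_right)
  qed
  have 1: "T 0 y = row 0 y" for y
  proof (induction y)
    case (Suc y)
    have "rt (Suc y) * T 0 (Suc y) w = rt (Suc y) * row 0 (Suc y) w" for w
      unfolding C Suc.IH opC_row ..
    then show ?case by (simp add: fun_eq_iff del: of_nat_Suc)
  qed (rule 0)
  have "T x y = row x y"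
  proof (induction x)
    case (Suc x)
    have "rt (Suc x) * T (Suc x) y w = rt (Suc x) * row (Suc x) y w" for w
      unfolding B Suc.IH opB_row ..
    then show ?case by (simp add: fun_eq_iff del: of_nat_Suc)
  qed (rule 1)
  then show ?thesis by (simp add: T_def fun_eq_iff)
qed

end

lemma amplifier_unitary_exists:
  assumes "G > 1" shows "\<exists>U. amplifier_unitary G U"
proof -
  define h s where "h = sqrt G" and "s = sqrt (G - 1)"
  have hs: "h\<^sup>2 = 1 + s\<^sup>2" "h > 0" "s > 0" using assms by (auto simp: h_def s_def)
  define U where "U = (\<lambda>(x, y). row h s x y)"
  have on: "inner2 (U w) (U w') = of_bool (w = w')" for w w'
    using row_orthonormal[OF hs] by (cases w, cases w') (auto simp: U_def)
  have "mult U (adj U) w w' = one_mat w w'" for w w'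
    using on[of w' w] by (auto simp: mult_def adj_def one_mat_def inner2_def mult.commute)
  moreover have "mult (adj U) U z z' = one_mat z z'" for z z'
  proof -
    \<comment> \<open>The parity of the environment mode. Its signs square to 1, so orthonormal rows
      become orthonormal columns.\<close>
    define e where "e w = ((-1) ^ snd w :: complex)" for w :: "nat \<times> nat"
    have sym: "U w z = e w * e z * U z w" for w z
      using row_symmetric[OF hs, of "fst w" "snd w" "fst z" "snd z"]
      by (simp add: U_def e_def power_add case_prod_unfold)
    have ee: "cnj (e w) = e w" "e w * e w = 1" for w
      by (auto simp: e_def power_mult_distrib[symmetric])
    have "cnj (U w z) * U w z' = (e z * e z') * (cnj (U z w) * U z' w)" for w
    proof -
      have "cnj (U w z) * U w z' = (e w * e w) * (e z * e z') * (cnj (U z w) * U z' w)"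
        unfolding sym[of w z] sym[of w z'] by (simp only: complex_cnj_mult ee(1) mult_ac)
      then show ?thesis by (simp only: ee(2) mult_1_left)
    qed
    then have "mult (adj U) U z z' = (e z * e z') * inner2 (U z) (U z')"
      by (simp add: mult_def adj_def inner2_def infsum_cmult_right')
    then show ?thesis unfolding on by (auto simp: one_mat_def ee(2))
  qed
  moreover have "mult a_op U = mult U (lincomb h a_op s (adj e_op))"
  proof (intro ext)
    fix w z :: "nat \<times> nat"
    obtain x y p q where wz: "w = (x, y)" "z = (p, q)" by force
    show "mult a_op U w z = mult U (lincomb h a_op s (adj e_op)) w z"
      unfolding wz mult_a_op mult_lincomb_a
      using fun_cong[OF opB_row[OF hs, of x y], of "(p, q)"] by (simp add: U_def lower_a_def opB_def[OF hs])
  qed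
  moreover have "mult e_op U = mult U (lincomb h e_op s (adj a_op))"
  proof (intro ext)
    fix w z :: "nat \<times> nat"
    obtain x y p q where wz: "w = (x, y)" "z = (p, q)" by force
    show "mult e_op U w z = mult U (lincomb h e_op s (adj a_op)) w z"
      unfolding wz mult_e_op mult_lincomb_e
      using fun_cong[OF opC_row[OF hs, of x y], of "(p, q)"] by (simp add: U_def lower_e_def opC_def[OF hs])
  qed
  ultimately have "amplifier_unitary G U"
    unfolding amplifier_unitary_def unitary_def h_def s_def by (simp add: fun_eq_iff)
  then show ?thesis by blast
qed

subsection \<open>The columns needed for a vacuum environment\<close>

lemma has_sum_shift_fst:
  assumes "\<And>y. f (0, y) = 0" and "((\<lambda>(x, y). f (Suc x, y)) has_sum S) UNIV"
  shows "(f has_sum S) (UNIV :: (nat \<times> 'b) set)"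
proof -
  let ?h = "\<lambda>(x :: nat, y :: 'b). (Suc x, y)"
  have "(f \<circ> ?h has_sum S) UNIV" using assms(2) by (simp add: comp_def case_prod_unfold)
  then have "(f has_sum S) (range ?h)" by (subst has_sum_reindex) (auto simp: inj_on_def)
  then show ?thesis
  proof (rule has_sum_cong_neutral[THEN iffD1, rotated -1])
    fix w :: "nat \<times> 'b" assume "w \<in> UNIV - range ?h"
    then show "f w = 0" using assms(1) by (cases w, cases "fst w") (auto simp: image_iff)
  qed auto
qed

lemma has_sum_shift_snd:
  assumes "\<And>x. f (x, 0) = 0" and "((\<lambda>(x, y). f (x, Suc y)) has_sum S) UNIV"
  shows "(f has_sum S) (UNIV :: ('a \<times> nat) set)"
proof -
  let ?h = "\<lambda>(x :: 'a, y :: nat). (x, Suc y)"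
  have "(f \<circ> ?h has_sum S) UNIV" using assms(2) by (simp add: comp_def case_prod_unfold)
  then have "(f has_sum S) (range ?h)" by (subst has_sum_reindex) (auto simp: inj_on_def)
  then show ?thesis
  proof (rule has_sum_cong_neutral[THEN iffD1, rotated -1])
    fix w :: "'a \<times> nat" assume "w \<in> UNIV - range ?h"
    then show "f w = 0" using assms(1) by (cases w, cases "snd w") (auto simp: image_iff)
  qed auto
qed

lemma norm_rt_sq: "(cmod (rt n))\<^sup>2 = real n"
  by (simp add: rt_def)

lemma inner2_self_of_has_sum:
  assumes "((\<lambda>x. (cmod (v x))\<^sup>2) has_sum S) UNIV"
  shows "ell2 v" "inner2 v v = complex_of_real S"
proof -
  show "ell2 v" unfolding ell2_def using assms by (rule has_sum_imp_summable)
  then show "inner2 v v = complex_of_real S"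
    using inner2_self[of v] has_sum_unique[OF ell2_has_sum assms] by simp
qed

text \<open>The commutation relation in terms of norms. Columns of an arbitrary unitary satisfying
  the Heisenberg relations are not known to decay; square-summability of \<open>lower_a v\<close> is
  supplied by the relation itself.\<close>

lemma raise_a_ell2:
  assumes v: "ell2 v" "ell2 (lower_a v)"
  shows "ell2 (raise_a v)"
    and "inner2 (raise_a v) (raise_a v) = inner2 (lower_a v) (lower_a v) + inner2 v v"
proof -
  have 1: "((\<lambda>(x, y). real x * (cmod (v (x, y)))\<^sup>2) has_sum (norm2 (lower_a v))\<^sup>2) UNIV"
  proof (rule has_sum_shift_fst)
    show "((\<lambda>(x, y). case (Suc x, y) of (x, y) \<Rightarrow> real x * (cmod (v (x, y)))\<^sup>2) has_sum (norm2 (lower_a v))\<^sup>2) UNIV"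
      using ell2_has_sum[OF v(2)] by (simp add: lower_a_def case_prod_unfold norm_mult power_mult_distrib norm_rt_sq)
  qed simp
  have "((\<lambda>w. (cmod (raise_a v w))\<^sup>2) has_sum (norm2 (lower_a v))\<^sup>2 + (norm2 v)\<^sup>2) UNIV"
  proof (rule has_sum_shift_fst)
    show "((\<lambda>(x, y). (cmod (raise_a v (Suc x, y)))\<^sup>2) has_sum (norm2 (lower_a v))\<^sup>2 + (norm2 v)\<^sup>2) UNIV"
      using has_sum_add[OF 1 ell2_has_sum[OF v(1)]]
      by (simp add: raise_a_def case_prod_unfold norm_mult power_mult_distrib norm_rt_sq distrib_right add.commute)
  qed (simp add: raise_a_def)
  note r = inner2_self_of_has_sum[OF this]
  show "ell2 (raise_a v)" by (rule r)
  show "inner2 (raise_a v) (raise_a v) = inner2 (lower_a v) (lower_a v) + inner2 v v"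
    unfolding r inner2_self[OF v(1)] inner2_self[OF v(2)] by simp
qed

lemma raise_e_ell2:
  assumes v: "ell2 v" "ell2 (lower_e v)"
  shows "ell2 (raise_e v)"
    and "inner2 (raise_e v) (raise_e v) = inner2 (lower_e v) (lower_e v) + inner2 v v"
proof -
  have 1: "((\<lambda>(x, y). real y * (cmod (v (x, y)))\<^sup>2) has_sum (norm2 (lower_e v))\<^sup>2) UNIV"
  proof (rule has_sum_shift_snd)
    show "((\<lambda>(x, y). case (x, Suc y) of (x, y) \<Rightarrow> real y * (cmod (v (x, y)))\<^sup>2) has_sum (norm2 (lower_e v))\<^sup>2) UNIV"
      using ell2_has_sum[OF v(2)] by (simp add: lower_e_def case_prod_unfold norm_mult power_mult_distrib norm_rt_sq)
  qed simp
  have "((\<lambda>w. (cmod (raise_e v w))\<^sup>2) has_sum (norm2 (lower_e v))\<^sup>2 + (norm2 v)\<^sup>2) UNIV"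
  proof (rule has_sum_shift_snd)
    show "((\<lambda>(x, y). (cmod (raise_e v (x, Suc y)))\<^sup>2) has_sum (norm2 (lower_e v))\<^sup>2 + (norm2 v)\<^sup>2) UNIV"
      using has_sum_add[OF 1 ell2_has_sum[OF v(1)]]
      by (simp add: raise_e_def case_prod_unfold norm_mult power_mult_distrib norm_rt_sq distrib_right add.commute)
  qed (simp add: raise_e_def)
  note r = inner2_self_of_has_sum[OF this]
  show "ell2 (raise_e v)" by (rule r)
  show "inner2 (raise_e v) (raise_e v) = inner2 (lower_e v) (lower_e v) + inner2 v v"
    unfolding r inner2_self[OF v(1)] inner2_self[OF v(2)] by simp
qed

text \<open>The amplitude for the input (x - y, 0) to end in (x, y), up to a phase. For x < y the
  binomial coefficient makes it 0.\<close>

definition kk :: "real \<Rightarrow> nat \<Rightarrow> nat \<Rightarrow> real" where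
  "kk g x y = sqrt (real (x choose y)) * sqrt (g - 1) ^ y / sqrt g ^ Suc x"

context
  fixes G :: real and U :: "(nat \<times> nat) mat"
  assumes G: "G > 1" and U: "amplifier_unitary G U"
begin

definition col :: "nat \<Rightarrow> nat \<Rightarrow> (nat \<times> nat) vec" where "col p q = (\<lambda>w. U w (p, q))"

lemma col_orthonormal: "inner2 (col p q) (col p' q') = of_bool (p = p' \<and> q = q')"
proof -
  have "mult (adj U) U (p, q) (p', q') = one_mat (p, q) (p', q')"
    using U by (simp add: amplifier_unitary_def unitary_def)
  then show ?thesis by (simp add: col_def inner2_def mult_def adj_def one_mat_def)
qed

lemma col_ell2: "ell2 (col p q)"
proof -
  have "(\<lambda>w. cnj (col p q w) * col p q w) summable_on UNIV"
    \<comment> \<open>A divergent infinite sum has the default value 0; this one is 1, so it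
      converges.\<close>
    using col_orthonormal[of p q p q] infsum_not_exists unfolding inner2_def by fastforce
  then have "(\<lambda>w. Re (cnj (col p q w) * col p q w)) summable_on UNIV" by (rule summable_on_Re)
  moreover have "Re (cnj (col p q w) * col p q w) = (cmod (col p q w))\<^sup>2" for w
    by (simp only: mult.commute[of "cnj _"] complex_norm_square[symmetric] Re_complex_of_real)
  ultimately show ?thesis unfolding ell2_def by (simp only:)
qed

abbreviation (input) "sqG \<equiv> complex_of_real (sqrt G)"
abbreviation (input) "sqH \<equiv> complex_of_real (sqrt (G - 1))"

lemma hs_mult: "sqG * sqG = of_real G" "sqH * sqH = of_real (G - 1)"
  using G by (simp_all only: of_real_mult[symmetric]) simp_all

lemma lower_a_col: "lower_a (col p q) = (\<lambda>w. sqG * (rt p * col (p - 1) q w) + sqH * (rt (Suc q) * col p (Suc q) w))"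
proof
  fix w :: "nat \<times> nat"
  obtain x y where w: "w = (x, y)" by force
  have "mult a_op U (x, y) (p, q) = mult U (lincomb (sqrt G) a_op (sqrt (G - 1)) (adj e_op)) (x, y) (p, q)"
    using U by (simp add: amplifier_unitary_def)
  then show "lower_a (col p q) w = sqG * (rt p * col (p - 1) q w) + sqH * (rt (Suc q) * col p (Suc q) w)"
    unfolding w mult_a_op mult_lincomb_a by (simp add: col_def raise_a_def lower_e_def)
qed

lemma lower_e_col: "lower_e (col p q) = (\<lambda>w. sqG * (rt q * col p (q - 1) w) + sqH * (rt (Suc p) * col (Suc p) q w))"
proof
  fix w :: "nat \<times> nat"
  obtain x y where w: "w = (x, y)" by force
  have "mult e_op U (x, y) (p, q) = mult U (lincomb (sqrt G) e_op (sqrt (G - 1)) (adj a_op)) (x, y) (p, q)"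
    using U by (simp add: amplifier_unitary_def)
  then show "lower_e (col p q) w = sqG * (rt q * col p (q - 1) w) + sqH * (rt (Suc p) * col (Suc p) q w)"
    unfolding w mult_e_op mult_lincomb_e by (simp add: col_def raise_e_def lower_a_def)
qed


lemma col_norm_eqs:
  shows "inner2 (lower_a (col p 0)) (lower_a (col p 0)) = of_real (G * p + (G - 1))"
    and "inner2 (lower_e (col 0 0)) (lower_e (col 0 0)) = of_real (G - 1)"
    and "inner2 (col p 0) (lower_a (col (Suc p) 0)) = sqG * rt (Suc p)"
    and "inner2 (col 0 0) (lower_e (col 0 1)) = sqG"
proof -
  note e = col_ell2 ell2_scale ell2_add inner2_add_left inner2_add_right inner2_scale inner2_scale_left col_orthonormal
  have r1: "rt (Suc 0) = 1" by (simp add: rt_def)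
  have hs': "sqG * (rt p * (sqG * rt p)) = of_real (G * p)"
  proof -
    have "sqG * (rt p * (sqG * rt p)) = (sqG * sqG) * (rt p * rt p)" by (simp only: mult_ac)
    then show ?thesis unfolding hs_mult rt_mult by simp
  qed
  show "inner2 (lower_a (col p 0)) (lower_a (col p 0)) = of_real (G * p + (G - 1))"
    unfolding lower_a_col by (cases p) (simp_all add: e r1 hs_mult hs' mult_ac del: of_real_diff)
  show "inner2 (lower_e (col 0 0)) (lower_e (col 0 0)) = of_real (G - 1)"
    unfolding lower_e_col by (simp add: e r1 hs_mult del: of_real_diff)
  show "inner2 (col p 0) (lower_a (col (Suc p) 0)) = sqG * rt (Suc p)"
    unfolding lower_a_col by (simp add: e)
  show "inner2 (col 0 0) (lower_e (col 0 1)) = sqG"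
    unfolding lower_e_col by (simp add: e r1)
qed

lemma lower_col_ell2: "ell2 (lower_a (col p q))" "ell2 (lower_e (col p q))"
  unfolding lower_a_col lower_e_col by (intro ell2_add ell2_scale col_ell2)+

text \<open>The Heisenberg relations describe annihilation operators after U. For the creation
  operator one expects the image of \<open>sqrt G\<close> times a creation plus
  \<open>sqrt (G - 1)\<close> times an environment annihilation, and the latter gives 0 on an
  environment vacuum. This is confirmed by the equality case of Cauchy-Schwarz: the squared norm is
  G (p + 1), and the overlap with the unit column p + 1 is its square root.\<close>

lemma raise_a_col: "raise_a (col p 0) w = sqG * rt (Suc p) * col (Suc p) 0 w"
proof (rule eq_scaled_if_inner2[where u = "raise_a (col p 0)" and w = "col (Suc p) 0" and c = "sqG * rt (Suc p)"])
  note r = raise_a_ell2[OF col_ell2 lower_col_ell2(1), of p 0]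
  show "ell2 (raise_a (col p 0))" by (rule r)
  have "inner2 (raise_a (col p 0)) (raise_a (col p 0)) = of_real (G * p + (G - 1)) + 1"
    unfolding r col_norm_eqs(1) col_orthonormal by simp
  also have "\<dots> = of_real G * (rt (Suc p) * rt (Suc p))"
    by (simp only: rt_mult) (simp add: algebra_simps)
  also have "\<dots> = (sqG * rt (Suc p))\<^sup>2"
    unfolding hs_mult(1)[symmetric] by (simp only: power2_eq_square mult_ac)
  finally show "inner2 (raise_a (col p 0)) (raise_a (col p 0)) = (sqG * rt (Suc p))\<^sup>2" .
  have "inner2 (raise_a (col p 0)) (col (Suc p) 0) = sqG * rt (Suc p)"
    unfolding inner2_raise_a by (rule col_norm_eqs(3))
  then show "inner2 (col (Suc p) 0) (raise_a (col p 0)) = sqG * rt (Suc p)"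
    using inner2_cnj[of "col (Suc p) 0" "raise_a (col p 0)"] by simp
  show "sqG * rt (Suc p) \<in> \<real>" by (simp add: rt_def del: of_nat_Suc)
qed (auto simp: col_ell2 col_orthonormal)

lemma raise_e_col: "raise_e (col 0 0) w = sqG * col 0 1 w"
proof (rule eq_scaled_if_inner2[where u = "raise_e (col 0 0)" and w = "col 0 1" and c = sqG])
  note r = raise_e_ell2[OF col_ell2 lower_col_ell2(2), of 0 0]
  show "ell2 (raise_e (col 0 0))" by (rule r)
  have "inner2 (raise_e (col 0 0)) (raise_e (col 0 0)) = of_real (G - 1) + 1"
    unfolding r col_norm_eqs(2) col_orthonormal by simp
  then show "inner2 (raise_e (col 0 0)) (raise_e (col 0 0)) = sqG\<^sup>2"
    unfolding power2_eq_square hs_mult(1) by simp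
  have "inner2 (raise_e (col 0 0)) (col 0 1) = sqG"
    unfolding inner2_raise_e by (rule col_norm_eqs(4))
  then show "inner2 (col 0 1) (raise_e (col 0 0)) = sqG"
    using inner2_cnj[of "col 0 1" "raise_e (col 0 0)"] by simp
qed (auto simp: col_ell2 col_orthonormal)

lemma hs_pos: "sqrt G > 0" "sqrt (G - 1) > 0" "sqG \<noteq> 0"
  using G by auto

text \<open>Each Heisenberg relation expresses a lowered column (0, 0) by one neighbouring column,
  which is also a raised column (0, 0). Eliminating the neighbour leaves recursions for the column
  alone.\<close>

lemma col_00: "col 0 0 (x, y) = (if x = y then of_real ((sqrt (G - 1) / sqrt G) ^ x) * col 0 0 (0, 0) else 0)"
proof -
  have r1: "rt (Suc 0) = 1" by (simp add: rt_def)
  have A: "rt (Suc x) * col 0 0 (Suc x, y) = sqH / sqG * (rt y * col 0 0 (x, y - 1))" for x y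
    using fun_cong[OF lower_a_col[of 0 0], of "(x, y)"] raise_e_col[of "(x, y)"] hs_pos
    by (simp add: lower_a_def raise_e_def r1 field_simps)
  have E: "rt (Suc y) * col 0 0 (x, Suc y) = sqH / sqG * (rt x * col 0 0 (x - 1, y))" for x y
    using fun_cong[OF lower_e_col[of 0 0], of "(x, y)"] raise_a_col[of 0 "(x, y)"] hs_pos
    by (simp add: lower_e_def raise_a_def r1 field_simps)
  show ?thesis
  proof (induction x arbitrary: y)
    case 0
    show ?case
    proof (cases y)
      case (Suc n)
      then show ?thesis using E[of n 0] by simp
    qed simp
  next
    case (Suc x)
    show ?case
    proof (cases y)
      case 0
      then show ?thesis using A[of x 0] by simp
    next
      case (Suc n)
      have "rt (Suc x) * col 0 0 (Suc x, y) =
          rt (Suc x) * (if Suc x = y then of_real ((sqrt (G - 1) / sqrt G) ^ Suc x) * col 0 0 (0, 0) else 0)"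
        unfolding Suc A[of x "Suc n"] diff_Suc_1 Suc.IH by simp
      then show ?thesis by (simp only: mult_cancel_left rt_simps) simp
    qed
  qed
qed

lemma col_00_norm: "cmod (col 0 0 (0, 0)) = 1 / sqrt G"
proof -
  define c where "c = col 0 0 (0, 0)"
  define l where "l = (G - 1) / G"
  have l: "0 \<le> l" "l < 1" "1 - l = 1 / G" using G by (auto simp: l_def field_simps)
  have q: "(sqrt (G - 1) / sqrt G) ^ n * (sqrt (G - 1) / sqrt G) ^ n = l ^ n" for n
    using G by (simp add: power_mult_distrib[symmetric] l_def)
  have "(\<lambda>n. l ^ n * (cmod c)\<^sup>2) sums (1 / (1 - l) * (cmod c)\<^sup>2)"
    using l by (intro sums_mult2 geometric_sums) simp
  then have "((\<lambda>n. l ^ n * (cmod c)\<^sup>2) has_sum (1 / (1 - l) * (cmod c)\<^sup>2)) UNIV"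
    by (rule sums_nonneg_imp_has_sum) (use l in auto)
  moreover have "(\<lambda>n. l ^ n * (cmod c)\<^sup>2) = (\<lambda>w. (cmod (col 0 0 w))\<^sup>2) \<circ> (\<lambda>n. (n, n))"
  proof
    fix n
    have "cmod (col 0 0 (n, n)) = (sqrt (G - 1) / sqrt G) ^ n * cmod c"
      unfolding col_00[of n n] c_def[symmetric] using hs_pos by (simp add: norm_mult norm_power norm_divide)
    then show "l ^ n * (cmod c)\<^sup>2 = ((\<lambda>w. (cmod (col 0 0 w))\<^sup>2) \<circ> (\<lambda>n. (n, n))) n"
      unfolding q[symmetric] by (simp add: power2_eq_square)
  qed
  ultimately have "((\<lambda>w. (cmod (col 0 0 w))\<^sup>2) has_sum (1 / (1 - l) * (cmod c)\<^sup>2)) (range (\<lambda>n. (n, n)))"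
    by (subst has_sum_reindex) (auto simp: inj_on_def)
  then have A: "((\<lambda>w. (cmod (col 0 0 w))\<^sup>2) has_sum (1 / (1 - l) * (cmod c)\<^sup>2)) UNIV"
  proof (rule has_sum_cong_neutral[THEN iffD1, rotated -1])
    fix w :: "nat \<times> nat" assume "w \<in> UNIV - range (\<lambda>n. (n, n))"
    then show "(cmod (col 0 0 w))\<^sup>2 = 0"
      by (cases w) (auto simp: image_iff col_00)
  qed auto
  have B: "(norm2 (col 0 0))\<^sup>2 = 1"
  proof -
    have "complex_of_real ((norm2 (col 0 0))\<^sup>2) = 1" using inner2_self[OF col_ell2[of 0 0]] col_orthonormal[of 0 0 0 0] by simp
    then show ?thesis using of_real_eq_1_iff by blast
  qed
  have "1 / (1 - l) * (cmod c)\<^sup>2 = 1"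
    using has_sum_unique[OF A ell2_has_sum[OF col_ell2[of 0 0]]] by (simp only: B)
  then have "(cmod c)\<^sup>2 = (1 / sqrt G)\<^sup>2" using G by (simp add: l(3) field_simps power_divide)
  then show ?thesis using G unfolding c_def by (simp add: power2_eq_iff_nonneg)
qed

lemma col_0: "col p 0 (x, y) = (if x = p + y then of_real (sqrt G * kk G x y) * col 0 0 (0, 0) else 0)"
proof (induction p arbitrary: x)
  case 0
  have "sqrt G * kk G y y = (sqrt (G - 1) / sqrt G) ^ y"
    using hs_pos by (simp add: kk_def power_divide)
  then show ?case by (subst col_00) auto
next
  case (Suc p)
  have R: "sqG * rt (Suc p) * col (Suc p) 0 (x, y) = rt x * col p 0 (x - 1, y)"
    using raise_a_col[of p "(x, y)"] by (simp add: raise_a_def)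
  have nz: "sqG * rt (Suc p) \<noteq> 0" using hs_pos by simp
  show ?case
  proof (cases "x = Suc p + y")
    case False
    then have "rt x * col p 0 (x - 1, y) = 0" unfolding Suc.IH by (cases x) auto
    then show ?thesis using R nz False by (metis mult_eq_0_iff)
  next
    case True
    define n where "n = p + y"
    have x: "x = Suc n" using True by (simp add: n_def)
    \<comment> \<open>With n = p + y, the absorption identity; under the square root it is the
      recursion of \<open>kk\<close>.\<close>
    have ch: "real (Suc p) * real (Suc n choose y) = real (Suc n) * real (n choose y)"
      using arg_cong[OF binomial_absorb_comp[of "Suc n" y], of real]
      by (simp add: n_def Suc_diff_le algebra_simps del: binomial_Suc_Suc)
    have "sqrt (real (Suc p)) * sqrt (real (Suc n choose y)) = sqrt (real (Suc n)) * sqrt (real (n choose y))"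
      unfolding real_sqrt_mult[symmetric] ch ..
    then have k: "sqrt (real (Suc n)) * kk G n y = sqrt G * (sqrt (real (Suc p)) * kk G (Suc n) y)"
      using hs_pos by (simp add: kk_def field_simps del: binomial_Suc_Suc of_nat_Suc)
    have "sqG * rt (Suc p) * col (Suc p) 0 (x, y) = rt (Suc n) * (of_real (sqrt G * kk G n y) * col 0 0 (0, 0))"
      using R by (simp add: Suc.IH x n_def)
    also have "\<dots> = of_real (sqrt G * (sqrt (real (Suc n)) * kk G n y)) * col 0 0 (0, 0)"
      by (simp add: rt_def del: of_nat_Suc)
    also have "\<dots> = sqG * rt (Suc p) * (of_real (sqrt G * kk G x y) * col 0 0 (0, 0))"
      unfolding k x by (simp add: rt_def del: of_nat_Suc)
    finally show ?thesis using nz True by (simp only: mult_cancel_left) simp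
  qed
qed

end

text \<open>The Heisenberg relations determine the unitary up to a phase, so the choice made by \<open>amp_U\<close> does not matter.\<close>

lemma amp_U_column:
  assumes "G > 1"
  obtains c where "cmod c = 1"
    "\<And>x y p. amp_U G (x, y) (p, 0) = (if x = p + y then c * complex_of_real (kk G x y) else 0)"
proof -
  have U: "amplifier_unitary G (amp_U G)"
    unfolding amp_U_def using amplifier_unitary_exists[OF assms] by (rule someI_ex)
  define c where "c = complex_of_real (sqrt G) * col (amp_U G) 0 0 (0, 0)"
  have "cmod c = 1" using col_00_norm[OF assms U] assms by (simp add: c_def norm_mult)
  moreover have "amp_U G (x, y) (p, 0) = (if x = p + y then c * complex_of_real (kk G x y) else 0)" for x y p
    using col_0[OF assms U, of p x y] by (simp add: c_def col_def[OF assms U])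
  ultimately show ?thesis using that by blast
qed

subsection \<open>The amplifier channel in the Fock basis\<close>

text \<open>With \<open>y\<close> photons found in the environment, a signal input \<open>x - y\<close> is mapped to \<open>x\<close> with this amplitude
  (it vanishes unless \<open>y \<le> x\<close>).\<close>

definition kraus1 :: "real \<Rightarrow> 'k set \<Rightarrow> 'k \<Rightarrow> nat \<Rightarrow> nat \<Rightarrow> real" where
  "kraus1 g S i x y = (if i \<in> S then kk g x y else of_bool (y = 0))"

definition kraus :: "real \<Rightarrow> 'k::finite set \<Rightarrow> ('k \<Rightarrow> nat) \<Rightarrow> ('k \<Rightarrow> nat) \<Rightarrow> real" where
  "kraus g S x y = (\<Prod>i\<in>UNIV. kraus1 g S i (x i) (y i))"

lemma kk_eq_0: "x < y \<Longrightarrow> kk g x y = 0"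
  by (simp add: kk_def)

lemma kraus1_eq_0: "x < y \<Longrightarrow> kraus1 g S i x y = 0"
  by (simp add: kraus1_def kk_eq_0)

lemma kraus_eq_0: "x i < y i \<Longrightarrow> kraus g S x y = 0"
  unfolding kraus_def by (rule prod_zero) (auto intro!: bexI[of _ i] kraus1_eq_0)

lemma prod_of_bool_eq: "(\<Prod>i\<in>UNIV. of_bool (p i = q i)) = (of_bool (p = q) :: complex)"
  for p q :: "'k::finite \<Rightarrow> 'b"
proof (cases "p = q")
  case False
  then obtain i where "p i \<noteq> q i" by auto
  then have "(\<Prod>i\<in>UNIV. of_bool (p i = q i)) = (0 :: complex)"
    by (intro prod_zero bexI[of _ i]) auto
  then show ?thesis using False by simp
qed simp

text \<open>A may be any finite set containing all y <= x, so that several entries can share one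
  index set. Where y exceeds x the truncated subtraction is meaningless, but there the Kraus factor
  is 0.\<close>

lemma amplify_entry:
  fixes S :: "'k::finite set"
  assumes g: "g > 1" and A: "finite A" "\<And>y. (\<forall>i. y i \<le> x i) \<Longrightarrow> y \<in> A"
  shows "amplify g S \<rho> x x' = (\<Sum>y\<in>A. complex_of_real (kraus g S x y * kraus g S x' y) *
    \<rho> (\<lambda>i. x i - y i) (\<lambda>i. x' i - y i))"
proof -
  obtain c where c: "cmod c = 1"
    "\<And>x y p. amp_U g (x, y) (p, 0) = (if x = p + y then c * complex_of_real (kk g x y) else 0)"
    by (rule amp_U_column[OF g]) blast
  \<comment> \<open>The phase left open by the choice of \<open>amp_U\<close>, collected over the
    modes; it cancels against its conjugate.\<close>
  define D where "D = (\<Prod>i\<in>(UNIV :: 'k set). if i \<in> S then c else 1)"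
  have "cmod D = 1" unfolding D_def prod_norm[symmetric] by (rule prod.neutral) (auto simp: c)
  then have DD: "D * cnj D = 1" using complex_norm_square[of D] by simp
  define U where "U = amp_U_modes g S"
  let ?K = "\<lambda>x y. complex_of_real (kraus g S x y)"
  have U0: "U (x, y) (p, \<lambda>_. 0) = D * ?K x y * of_bool (p = (\<lambda>i. x i - y i))" for x y p
  proof -
    have "(if i \<in> S then amp_U g else one_mat) (x i, y i) (p i, 0) =
        (if i \<in> S then c else 1) * complex_of_real (kraus1 g S i (x i) (y i)) * of_bool (p i = x i - y i)" for i
      by (cases "y i \<le> x i") (auto simp: c(2) kraus1_def one_mat_def kk_eq_0)
    then have "U (x, y) (p, \<lambda>_. 0) = D * ?K x y * (\<Prod>i\<in>UNIV. of_bool (p i = x i - y i))"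
      by (simp add: U_def amp_U_modes_def D_def kraus_def prod.distrib)
    then show ?thesis using prod_of_bool_eq[of p "\<lambda>i. x i - y i"] by simp
  qed
  have 1: "mult U (tensor \<rho> (pure vacuum)) (x, y) (p', q') =
      D * ?K x y * \<rho> (\<lambda>i. x i - y i) p' * of_bool (q' = (\<lambda>_. 0))" for x y p' q'
    unfolding mult_def
    by (subst infsum_single[of "(\<lambda>i. x i - y i, \<lambda>_. 0)"])
      (auto simp: tensor_def pure_def vacuum_def U0)
  have 2: "mult (mult U (tensor \<rho> (pure vacuum))) (adj U) (x, y) (x', y') =
      ?K x y * ?K x' y' * \<rho> (\<lambda>i. x i - y i) (\<lambda>i. x' i - y' i)" for x y x' y'
  proof -
    have "mult (mult U (tensor \<rho> (pure vacuum))) (adj U) (x, y) (x', y') =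
        (D * ?K x y * \<rho> (\<lambda>i. x i - y i) (\<lambda>i. x' i - y' i)) * cnj (D * ?K x' y')"
      by (subst mult_def, subst infsum_single[of "(\<lambda>i. x' i - y' i, \<lambda>_. 0)"])
        (auto simp: 1 adj_def U0)
    also have "\<dots> = (D * cnj D) * (?K x y * ?K x' y' * \<rho> (\<lambda>i. x i - y i) (\<lambda>i. x' i - y' i))"
      by simp
    finally show ?thesis by (simp only: DD mult_1_left)
  qed
  have "amplify g S \<rho> x x' = (\<Sum>\<^sub>\<infinity>y. ?K x y * ?K x' y * \<rho> (\<lambda>i. x i - y i) (\<lambda>i. x' i - y i))"
    by (simp add: amplify_def Let_def U_def[symmetric] trace_snd_def 2)
  also have "\<dots> = (\<Sum>y\<in>A. ?K x y * ?K x' y * \<rho> (\<lambda>i. x i - y i) (\<lambda>i. x' i - y i))"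
  proof (rule infsumI, rule has_sum_finite_neutralI[OF A(1)])
    fix y assume "y \<in> UNIV - A"
    then obtain i where "\<not> y i \<le> x i" using A(2) by blast
    then show "?K x y * ?K x' y * \<rho> (\<lambda>i. x i - y i) (\<lambda>i. x' i - y i) = 0"
      using kraus_eq_0[of x i y g S] by simp
  qed auto
  finally show ?thesis by simp
qed

text \<open>Logarithmic derivatives written without division, since the factors may vanish.\<close>

lemma log_derivative_prod:
  fixes f :: "'i \<Rightarrow> real \<Rightarrow> real"
  assumes "\<And>i. i \<in> I \<Longrightarrow> (f i has_real_derivative d i * f i g) (at g)"
  shows "((\<lambda>g. \<Prod>i\<in>I. f i g) has_real_derivative (\<Sum>i\<in>I. d i) * (\<Prod>i\<in>I. f i g)) (at g)"
  using assms
proof (induction I rule: infinite_finite_induct)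
  case (insert i I)
  have "((\<lambda>g. f i g * (\<Prod>i\<in>I. f i g)) has_real_derivative
      (d i * f i g) * (\<Prod>i\<in>I. f i g) + ((\<Sum>i\<in>I. d i) * (\<Prod>i\<in>I. f i g)) * f i g) (at g)"
    using insert by (intro DERIV_mult) auto
  then show ?case using insert.hyps by (simp add: algebra_simps)
qed auto

lemma kk_derivative:
  assumes g: "g > 1"
  shows "((\<lambda>g. kk g x y) has_real_derivative (real y / (g - 1) - real (Suc x) / g) / 2 * kk g x y) (at g)"
proof -
  have 1: "((\<lambda>g. sqrt (g - 1)) has_real_derivative (1 / (2 * (g - 1))) * sqrt (g - 1)) (at g)"
  proof -
    have "((\<lambda>g. sqrt (g - 1)) has_real_derivative inverse (sqrt (g - 1)) / 2) (at g)"
      using g by (auto intro!: derivative_eq_intros)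
    moreover have "inverse (sqrt (g - 1)) / 2 = (1 / (2 * (g - 1))) * sqrt (g - 1)"
      using g real_sqrt_mult_self[of "g - 1"] by (simp add: field_simps)
    ultimately show ?thesis by simp
  qed
  have 2: "((\<lambda>g. 1 / sqrt g) has_real_derivative (- (1 / (2 * g))) * (1 / sqrt g)) (at g)"
  proof -
    have "((\<lambda>g. 1 / sqrt g) has_real_derivative - ((inverse (sqrt g) / 2) / (sqrt g * sqrt g))) (at g)"
      using g by (auto intro!: derivative_eq_intros)
    moreover have "- ((inverse (sqrt g) / 2) / (sqrt g * sqrt g)) = (- (1 / (2 * g))) * (1 / sqrt g)"
      using g by (simp add: field_simps)
    ultimately show ?thesis by simp
  qed
  \<comment> \<open>A power as a product of equal factors over \<open>{..<y}\<close>.\<close>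
  have a: "((\<lambda>g. sqrt (g - 1) ^ y) has_real_derivative (real y * (1 / (2 * (g - 1)))) * sqrt (g - 1) ^ y) (at g)"
    using log_derivative_prod[OF 1, of "{..<y}"] by simp
  have b: "((\<lambda>g. (1 / sqrt g) ^ Suc x) has_real_derivative (real (Suc x) * (- (1 / (2 * g)))) * (1 / sqrt g) ^ Suc x) (at g)"
    using log_derivative_prod[OF 2, of "{..<Suc x}"] by (simp del: of_nat_Suc power_Suc)
  have "((\<lambda>g. sqrt (real (x choose y)) * (sqrt (g - 1) ^ y * (1 / sqrt g) ^ Suc x)) has_real_derivative
      sqrt (real (x choose y)) * ((real y * (1 / (2 * (g - 1)))) * sqrt (g - 1) ^ y * (1 / sqrt g) ^ Suc x +
        (real (Suc x) * (- (1 / (2 * g)))) * (1 / sqrt g) ^ Suc x * sqrt (g - 1) ^ y)) (at g)"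
    by (intro DERIV_cmult DERIV_mult a b)
  moreover have "(\<lambda>g. sqrt (real (x choose y)) * (sqrt (g - 1) ^ y * (1 / sqrt g) ^ Suc x)) = (\<lambda>g. kk g x y)"
    by (simp add: kk_def fun_eq_iff power_inverse divide_inverse del: power_Suc)
  moreover have "sqrt (real (x choose y)) * ((real y * (1 / (2 * (g - 1)))) * sqrt (g - 1) ^ y * (1 / sqrt g) ^ Suc x +
        (real (Suc x) * (- (1 / (2 * g)))) * (1 / sqrt g) ^ Suc x * sqrt (g - 1) ^ y) =
      (real y / (g - 1) - real (Suc x) / g) / 2 * kk g x y"
    using g by (simp add: kk_def power_one_over divide_simps del: power_Suc) (simp add: algebra_simps del: power_Suc)
  ultimately show ?thesis by (simp only:)
qed

text \<open>Twice the logarithmic derivative of \<open>kraus\<close> in the gain; the factor 2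
  matches the half in (Y + adj Y) / 2.\<close>

definition kraus_slope :: "real \<Rightarrow> 'k::finite set \<Rightarrow> ('k \<Rightarrow> nat) \<Rightarrow> ('k \<Rightarrow> nat) \<Rightarrow> real" where
  "kraus_slope g S x y = (\<Sum>i\<in>S. real (y i) / (g - 1) - real (Suc (x i)) / g)"

lemma kraus_derivative:
  assumes g: "g > 1"
  shows "((\<lambda>g. kraus g S x y * kraus g S x' y) has_real_derivative
    (kraus_slope g S x y + kraus_slope g S x' y) / 2 * (kraus g S x y * kraus g S x' y)) (at g)"
proof -
  have k: "((\<lambda>g. kraus g S x y) has_real_derivative kraus_slope g S x y / 2 * kraus g S x y) (at g)" for x
  proof -
    define d where "d i = (if i \<in> S then (real (y i) / (g - 1) - real (Suc (x i)) / g) / 2 else 0)" for i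
    have "((\<lambda>g. kraus1 g S i (x i) (y i)) has_real_derivative d i * kraus1 g S i (x i) (y i)) (at g)" for i
      using kk_derivative[OF g, of "x i" "y i"] by (simp add: kraus1_def d_def)
    then have "((\<lambda>g. \<Prod>i\<in>UNIV. kraus1 g S i (x i) (y i)) has_real_derivative
        (\<Sum>i\<in>UNIV. d i) * (\<Prod>i\<in>UNIV. kraus1 g S i (x i) (y i))) (at g)"
      by (rule log_derivative_prod)
    moreover have "(\<Sum>i\<in>UNIV. d i) = kraus_slope g S x y / 2"
      unfolding d_def kraus_slope_def sum_divide_distrib by (simp add: sum.If_cases)
    ultimately show ?thesis unfolding kraus_def by simp
  qed
  show ?thesis
    using DERIV_mult[OF k[of x] k[of x']] by (simp add: algebra_simps add_divide_distrib)
qed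


section \<open>The amplified coherent state of one mode\<close>

context
  fixes g :: real and \<alpha> :: complex
  assumes g: "g > 1"
begin

definition ff :: "nat \<Rightarrow> nat \<Rightarrow> complex" where
  "ff x y = complex_of_real (kk g x y) * coherent1 \<alpha> (x - y)"

lemma ff_eq_0: "x < y \<Longrightarrow> ff x y = 0"
  by (simp add: ff_def kk_eq_0)

lemma hs_facts: "sqrt g > 0" "sqrt (g - 1) > 0" "sqrt g * sqrt g = g" "sqrt (g - 1) * sqrt (g - 1) = g - 1"
  using g by auto

lemma ff_eq: "ff (p + y) y = complex_of_real (exp (- (cmod \<alpha>)\<^sup>2 / 2) * sqrt (fact (p + y)) / (sqrt (fact y) * fact p) *
    sqrt (g - 1) ^ y / sqrt g ^ Suc (p + y)) * \<alpha> ^ p"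
proof -
  have "real (p + y choose y) * fact p = fact (p + y) / fact y"
    using binomial_fact[of y "p + y", where 'a = real] by simp
  then have "sqrt (real (p + y choose y)) * sqrt (fact p) = sqrt (fact (p + y)) / sqrt (fact y)"
    by (metis real_sqrt_divide real_sqrt_mult)
  moreover have "sqrt (real (p + y choose y)) / sqrt (fact p) =
      (sqrt (real (p + y choose y)) * sqrt (fact p)) / (sqrt (fact p) * sqrt (fact p))"
    by (rule mult_divide_mult_cancel_right[symmetric]) simp
  ultimately have "sqrt (real (p + y choose y)) / sqrt (fact p) = sqrt (fact (p + y)) / (sqrt (fact y) * fact p)"
    by simp
  then have "kk g (p + y) y * (exp (- (cmod \<alpha>)\<^sup>2 / 2) / sqrt (fact p)) =
      exp (- (cmod \<alpha>)\<^sup>2 / 2) * sqrt (fact (p + y)) / (sqrt (fact y) * fact p) * sqrt (g - 1) ^ y / sqrt g ^ Suc (p + y)"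
  proof -
    assume e: "sqrt (real (p + y choose y)) / sqrt (fact p) = sqrt (fact (p + y)) / (sqrt (fact y) * fact p)"
    have "kk g (p + y) y * (exp (- (cmod \<alpha>)\<^sup>2 / 2) / sqrt (fact p)) =
        (sqrt (real (p + y choose y)) / sqrt (fact p)) * (exp (- (cmod \<alpha>)\<^sup>2 / 2) * sqrt (g - 1) ^ y / sqrt g ^ Suc (p + y))"
      by (simp add: kk_def mult_ac del: power_Suc)
    then show ?thesis unfolding e by (simp del: power_Suc)
  qed
  then show ?thesis
    unfolding ff_def coherent1_def add_diff_cancel_right'
    by (simp only: of_real_mult[symmetric] mult.assoc[symmetric])
qed

lemma sqrt_fact_rt: "complex_of_real (sqrt (fact (Suc n))) = rt (Suc n) * complex_of_real (sqrt (fact n))"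
proof -
  have "fact (Suc n) = real (Suc n) * fact n" by simp
  then show ?thesis unfolding rt_def of_real_mult[symmetric] real_sqrt_mult[symmetric] by simp
qed

text \<open>This and the next two lemmas let operators on the environment be traded for operators on
  the signal: because the input is an eigenvector of annihilation, both the environment annihilation
  and the signal creation act as multiples of the input photon number x - y, and the environment
  creation is a combination of the signal annihilation and the identity.\<close>

lemma ff_raise_e: "\<alpha> * rt (Suc y) * ff x (Suc y) = sqrt (g - 1) * (real x - real y) * ff x y"
proof -
  consider "x < y" | "x = y" | p where "x = Suc p + y"
    by (metis add.commute less_imp_Suc_add nat_neq_iff add_Suc_right)
  then show ?thesis
  proof cases
    case 3
    define E where "E = complex_of_real (exp (- (cmod \<alpha>)\<^sup>2 / 2) * sqrt (fact x) * sqrt (g - 1) ^ y / sqrt g ^ Suc x)"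
    have 1: "ff x y = E / (complex_of_real (sqrt (fact y)) * fact (Suc p)) * \<alpha> ^ Suc p"
      unfolding 3 ff_eq E_def by simp
    have 2: "ff x (Suc y) = E * sqrt (g - 1) / (complex_of_real (sqrt (fact (Suc y))) * fact p) * \<alpha> ^ p"
      using ff_eq[of p "Suc y"] unfolding 3 E_def by (simp add: mult_ac)
    have d: "of_nat x = (of_nat (Suc p) + of_nat y :: complex)" using 3 by simp
    have "rt (Suc y) * complex_of_real (sqrt (fact y)) \<noteq> 0" "complex_of_real (sqrt (fact y)) \<noteq> 0" by auto
    then show ?thesis
      unfolding 1 2 sqrt_fact_rt by (simp add: d field_simps del: of_nat_Suc)
  qed (auto simp: ff_eq_0)
qed

lemma ff_raise_a: "\<alpha> * rt x * ff (x - 1) y = sqrt g * (real x - real y) * ff x y"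
proof -
  consider "x < y" | "x = y" | p where "x = Suc p + y"
    by (metis add.commute less_imp_Suc_add nat_neq_iff add_Suc_right)
  then show ?thesis
  proof cases
    case 2
    then show ?thesis by (cases x) (auto simp: ff_eq_0)
  next
    case 3
    define E where "E = complex_of_real (exp (- (cmod \<alpha>)\<^sup>2 / 2) * sqrt (g - 1) ^ y / (sqrt (fact y) * sqrt g ^ Suc (p + y)))"
    have x: "x = Suc (p + y)" using 3 by simp
    have 1: "ff x y = E * complex_of_real (sqrt (fact x)) / (sqrt g * fact (Suc p)) * \<alpha> ^ Suc p"
      unfolding 3 ff_eq E_def by (simp add: mult_ac)
    have 2: "ff (x - 1) y = E * complex_of_real (sqrt (fact (x - 1))) / fact p * \<alpha> ^ p"
      using ff_eq[of p y] unfolding 3 E_def by (simp add: mult_ac)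
    have d: "of_nat x = (of_nat (Suc p) + of_nat y :: complex)" using 3 by simp
    have "sqrt (fact x) = sqrt (real x) * sqrt (fact (x - 1))"
      unfolding x real_sqrt_mult[symmetric] by simp
    then have r: "complex_of_real (sqrt (fact x)) = rt x * complex_of_real (sqrt (fact (x - 1)))"
      by (simp only: rt_def of_real_mult)
    show ?thesis
      unfolding 1 2 r using hs_facts(1) by (simp add: d field_simps del: of_nat_Suc)
  qed (auto simp: ff_eq_0)
qed

lemma ff_lower_a: "rt (Suc x) * ff (Suc x) y = \<alpha> / sqrt g * ff x y + sqrt (g - 1) / sqrt g * rt y * ff x (y - 1)"
proof -
  consider "Suc x < y" | "y = Suc x" | p where "x = p + y"
    by (metis Suc_lessI add.commute le_add_diff_inverse not_less)
  then show ?thesis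
  proof cases
    case 1
    then show ?thesis by (cases y) (auto simp: ff_eq_0)
  next
    case 2
    \<comment> \<open>The boundary case: the left side survives at y = x + 1 although
      \<open>ff x y\<close> is already 0.\<close>
    have "ff (Suc x) (Suc x) = sqrt (g - 1) / sqrt g * ff x x"
      using ff_eq[of 0 "Suc x"] ff_eq[of 0 x] hs_facts(1) by simp
    then show ?thesis using 2 by (simp add: ff_eq_0)
  next
    case 3
    define E where "E = complex_of_real (exp (- (cmod \<alpha>)\<^sup>2 / 2) * sqrt (fact x) * sqrt (g - 1) ^ y / sqrt g ^ Suc x)"
    have ff0: "ff x y = E / (complex_of_real (sqrt (fact y)) * fact p) * \<alpha> ^ p"
      unfolding 3 ff_eq E_def by simp
    have 1: "rt (Suc x) * ff (Suc x) y = (of_nat (Suc x)) * E / (sqrt g * (complex_of_real (sqrt (fact y)) * fact (Suc p))) * \<alpha> ^ Suc p"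
    proof -
      have "ff (Suc x) y = rt (Suc x) * E / (sqrt g * (complex_of_real (sqrt (fact y)) * fact (Suc p))) * \<alpha> ^ Suc p"
        using ff_eq[of "Suc p" y] sqrt_fact_rt[of x] unfolding 3 E_def by (simp add: mult_ac)
      then show ?thesis by simp
    qed
    have e: "of_nat (Suc x) = of_nat (Suc p) + (of_nat y :: complex)" using 3 by simp
    show ?thesis
    proof (cases y)
      case 0
      then show ?thesis unfolding 1 unfolding ff0 using 3 hs_facts(1) by (simp add: field_simps del: of_nat_Suc)
    next
      case (Suc n)
      have "sqrt (g - 1) * ff x n = E / (complex_of_real (sqrt (fact n)) * fact (Suc p)) * \<alpha> ^ Suc p"
        using ff_eq[of "Suc p" n] unfolding E_def 3 Suc by (simp add: mult_ac)
      then have 2: "sqrt (g - 1) * (rt y * ff x (y - 1)) = of_nat y * (E / (complex_of_real (sqrt (fact y)) * fact (Suc p)) * \<alpha> ^ Suc p)"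
        unfolding Suc sqrt_fact_rt rt_mult(1)[of "Suc n", symmetric] diff_Suc_1
      proof -
        assume a: "sqrt (g - 1) * ff x n = E / (complex_of_real (sqrt (fact n)) * fact (Suc p)) * \<alpha> ^ Suc p"
        have "sqrt (g - 1) * (rt (Suc n) * ff x n) = rt (Suc n) * (sqrt (g - 1) * ff x n)" by (simp only: mult_ac)
        then show "sqrt (g - 1) * (rt (Suc n) * ff x n) = rt (Suc n) * rt (Suc n) *
            (E / (rt (Suc n) * complex_of_real (sqrt (fact n)) * fact (Suc p)) * \<alpha> ^ Suc p)"
          unfolding a by (simp add: field_simps del: rt_mult of_nat_Suc fact_Suc)
      qed
      have "\<alpha> / sqrt g * ff x y + sqrt (g - 1) / sqrt g * rt y * ff x (y - 1) = (\<alpha> * ff x y + sqrt (g - 1) * (rt y * ff x (y - 1))) / sqrt g"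
        by (simp add: add_divide_distrib)
      also have "\<dots> = rt (Suc x) * ff (Suc x) y"
        unfolding 1 2 unfolding ff0 e using hs_facts(1) by (simp add: field_simps del: of_nat_Suc)
      finally show ?thesis by simp
    qed
  qed
qed


subsection \<open>Moments\<close>

text \<open>With \<open>p = x - y\<close>, the squared moduli of \<open>ff\<close> form a Poisson distribution in \<open>p\<close> of mean \<open>\<mu>\<close> times a
  negative binomial distribution in \<open>y\<close>.\<close>

definition \<mu> :: real where "\<mu> = (cmod \<alpha>)\<^sup>2"

definition poisson :: "nat \<Rightarrow> real" where "poisson p = exp (- \<mu>) * \<mu> ^ p / fact p"

definition nbinomial :: "nat \<Rightarrow> nat \<Rightarrow> real" where
  "nbinomial p y = real (p + y choose y) * ((g - 1) / g) ^ y / g ^ Suc p"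

lemma \<mu>_nonneg: "\<mu> \<ge> 0" by (simp add: \<mu>_def)

lemma poisson_nonneg: "poisson p \<ge> 0" by (simp add: poisson_def \<mu>_nonneg)

lemma nbinomial_nonneg: "nbinomial p y \<ge> 0" using g by (simp add: nbinomial_def)

lemma coherent1_norm_sq: "(cmod (coherent1 \<alpha> p))\<^sup>2 = poisson p"
proof -
  have 2: "(exp (- (cmod \<alpha>)\<^sup>2 / 2))\<^sup>2 = exp (- \<mu>)"
    unfolding exp_double[symmetric] \<mu>_def by simp
  have 3: "(cmod \<alpha> ^ p)\<^sup>2 = \<mu> ^ p"
    unfolding \<mu>_def power_mult[symmetric] by (simp only: mult.commute)
  have "cmod (coherent1 \<alpha> p) = exp (- (cmod \<alpha>)\<^sup>2 / 2) / sqrt (fact p) * cmod \<alpha> ^ p"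
    unfolding coherent1_def by (simp add: norm_mult norm_power norm_divide)
  then have "(cmod (coherent1 \<alpha> p))\<^sup>2 = exp (- \<mu>) / (sqrt (fact p))\<^sup>2 * \<mu> ^ p"
    by (simp only: power_mult_distrib power_divide 2 3)
  then show ?thesis by (simp add: poisson_def)
qed

lemma norm_ff_sq: "(cmod (ff (p + y) y))\<^sup>2 = poisson p * nbinomial p y"
proof -
  have sq: "(x ^ n)\<^sup>2 = (x\<^sup>2) ^ n" for x :: real and n
    by (simp only: power_mult[symmetric] mult.commute)
  have "(kk g (p + y) y)\<^sup>2 = real (p + y choose y) * (g - 1) ^ y / g ^ Suc (p + y)"
    using g unfolding kk_def power_divide power_mult_distrib sq by (simp del: power_Suc)
  also have "\<dots> = nbinomial p y"
    using g by (simp add: nbinomial_def power_divide power_add field_simps)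
  finally have 1: "(kk g (p + y) y)\<^sup>2 = nbinomial p y" .
  show ?thesis
    unfolding ff_def add_diff_cancel_right' norm_mult power_mult_distrib coherent1_norm_sq norm_of_real power2_abs 1 by simp
qed

lemma poisson_sums:
  "(\<lambda>p. (a + b * real p + c * (real p * real p)) * poisson p) sums (a + b * \<mu> + c * (\<mu> * \<mu> + \<mu>))"
proof -
  have S: "real (Suc p) * poisson (Suc p) = \<mu> * poisson p" for p
    by (simp add: poisson_def field_simps del: of_nat_Suc)
  have 0: "poisson sums 1"
    using sums_mult[OF exp_converges[of \<mu>], of "exp (- \<mu>)"]
    by (simp add: poisson_def[abs_def] field_simps exp_minus)
  have 1: "(\<lambda>p. real p * poisson p) sums \<mu>"
  proof (rule sums_Suc_imp)
    show "(\<lambda>p. real (Suc p) * poisson (Suc p)) sums \<mu>"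
      unfolding S using sums_mult[OF 0, of \<mu>] by simp
  qed simp
  have 2: "(\<lambda>p. real p * real p * poisson p) sums (\<mu> * \<mu> + \<mu>)"
  proof (rule sums_Suc_imp)
    have "real (Suc p) * real (Suc p) * poisson (Suc p) = \<mu> * (real p * poisson p) + \<mu> * poisson p" for p
      unfolding mult.assoc S by (simp add: algebra_simps)
    then show "(\<lambda>p. real (Suc p) * real (Suc p) * poisson (Suc p)) sums (\<mu> * \<mu> + \<mu>)"
      using sums_add[OF sums_mult[OF 1, of \<mu>] sums_mult[OF 0, of \<mu>]] by (simp only: mult_1_right)
  qed simp
  show ?thesis
    using sums_add[OF sums_add[OF sums_mult[OF 0, of a] sums_mult[OF 1, of b]] sums_mult[OF 2, of c]]
    by (simp add: algebra_simps)
qed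

text \<open>The total mass is the binomial series with exponent -(p + 1) at -(g - 1) / g.\<close>

lemma nbinomial_sums:
  shows "nbinomial p sums 1"
    and "(\<lambda>y. real y * nbinomial p y) sums (real (Suc p) * (g - 1))"
    and "(\<lambda>y. real y * real y * nbinomial p y) sums (real (Suc p) * (g - 1) * (real (Suc (Suc p)) * (g - 1) + 1))"
proof -
  define l where "l = (g - 1) / g"
  have l: "0 < l" "l < 1" "1 - l = 1 / g" "l * g = g - 1" using g by (auto simp: l_def field_simps)
  show 0: "nbinomial p sums 1" for p
  proof -
    have "((- real (Suc p)) gchoose n) * (- l) ^ n = real (p + n choose n) * l ^ n" for n
    proof -
      have "real (Suc p) + real n - 1 = real (p + n)" by simp
      then have "((- real (Suc p)) gchoose n) = (-1) ^ n * real (p + n choose n)"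
        unfolding gbinomial_minus binomial_gbinomial by simp
      moreover have "(- l) ^ n = (-1) ^ n * l ^ n" by (simp add: power_mult_distrib[symmetric])
      moreover have "(-1) ^ n * (-1) ^ n = (1 :: real)" by (simp add: power_mult_distrib[symmetric])
      ultimately show ?thesis by (metis (no_types, lifting) mult.assoc mult.commute mult_1_left)
    qed
    moreover have "(1 + - l) powr (- real (Suc p)) = g ^ Suc p"
    proof -
      have "(1 + - l) powr (- real (Suc p)) = (1 / g) powr (- real (Suc p))" using l(3) by simp
      also have "\<dots> = g powr (real (Suc p))" using g by (simp add: powr_minus powr_divide del: of_nat_Suc)
      also have "\<dots> = g ^ Suc p" using g by (simp only: powr_realpow)
      finally show ?thesis .
    qed
    ultimately have "(\<lambda>n. real (p + n choose n) * l ^ n) sums (g ^ Suc p)"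
      using gen_binomial_real[of "- l" "- real (Suc p)"] l by (simp del: of_nat_Suc power_Suc)
    from sums_divide[OF this, of "g ^ Suc p"] show ?thesis
      using g by (simp add: nbinomial_def[abs_def] l_def del: power_Suc)
  qed
  \<comment> \<open>Weighting by y reproduces the family with p raised and y lowered by one, so each
    moment follows from the previous one.\<close>
  have S: "real (Suc y) * nbinomial p (Suc y) = (real (Suc p) * (g - 1)) * nbinomial (Suc p) y" for p y
  proof -
    have "Suc y * (p + Suc y choose Suc y) = Suc p * (Suc p + y choose y)"
      using binomial_absorption[of y "p + Suc y"] binomial_absorb_comp[of "p + Suc y" y] by (simp add: Suc_diff_le)
    then have "real (Suc y) * real (p + Suc y choose Suc y) = real (Suc p) * real (Suc p + y choose y)"
      by (metis of_nat_mult)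
    then have "real (Suc y) * nbinomial p (Suc y) = real (Suc p) * real (Suc p + y choose y) * l ^ Suc y / g ^ Suc p"
      by (simp only: nbinomial_def l_def mult.assoc[symmetric] times_divide_eq_right)
    also have "\<dots> = real (Suc p) * (l * g) * (real (Suc p + y choose y) * l ^ y / g ^ Suc (Suc p))"
      using g by (simp add: field_simps del: binomial_Suc_Suc of_nat_Suc)
    finally show ?thesis unfolding l(4) by (simp only: nbinomial_def l_def)
  qed
  show 1: "(\<lambda>y. real y * nbinomial p y) sums (real (Suc p) * (g - 1))" for p
  proof (rule sums_Suc_imp)
    show "(\<lambda>y. real (Suc y) * nbinomial p (Suc y)) sums (real (Suc p) * (g - 1))"
      unfolding S using sums_mult[OF 0[of "Suc p"], of "real (Suc p) * (g - 1)"] by (simp only: mult_1_right)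
  qed simp
  show "(\<lambda>y. real y * real y * nbinomial p y) sums (real (Suc p) * (g - 1) * (real (Suc (Suc p)) * (g - 1) + 1))"
  proof (rule sums_Suc_imp)
    have "real (Suc y) * real (Suc y) * nbinomial p (Suc y) =
        (real (Suc p) * (g - 1)) * (real y * nbinomial (Suc p) y + nbinomial (Suc p) y)" for y
      unfolding mult.assoc[of "real (Suc y)"] S by (simp add: algebra_simps)
    then show "(\<lambda>y. real (Suc y) * real (Suc y) * nbinomial p (Suc y)) sums
        (real (Suc p) * (g - 1) * (real (Suc (Suc p)) * (g - 1) + 1))"
      using sums_mult[OF sums_add[OF 1[of "Suc p"] 0[of "Suc p"]], of "real (Suc p) * (g - 1)"] by (simp only:)
  qed simp
qed

lemma moment_aux:
  assumes v: "\<And>p y. v p y \<ge> 0" and V: "\<And>p. (\<lambda>y. v p y * nbinomial p y) sums V p"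
    and T: "(\<lambda>p. V p * poisson p) sums T"
  shows "((\<lambda>(p, y). v p y * (poisson p * nbinomial p y)) has_sum T) UNIV"
proof -
  have row: "((\<lambda>y. v p y * (poisson p * nbinomial p y)) has_sum V p * poisson p) UNIV" for p
  proof (rule sums_nonneg_imp_has_sum)
    show "(\<lambda>y. v p y * (poisson p * nbinomial p y)) sums (V p * poisson p)"
      using sums_mult2[OF V[of p], of "poisson p"] by (simp add: mult_ac)
  qed (simp add: v poisson_nonneg nbinomial_nonneg)
  have "V p \<ge> 0" for p
    by (rule sums_le[OF _ sums_zero V]) (simp add: v nbinomial_nonneg)
  then have T': "((\<lambda>p. V p * poisson p) has_sum T) UNIV"
    by (intro sums_nonneg_imp_has_sum T) (simp add: poisson_nonneg)
  have "(\<lambda>(p, y). v p y * (poisson p * nbinomial p y)) summable_on UNIV \<times> UNIV"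
    by (rule summable_on_SigmaI[where g = "\<lambda>p. V p * poisson p"])
      (use row T' in \<open>auto simp: v poisson_nonneg nbinomial_nonneg dest: has_sum_imp_summable\<close>)
  then have "((\<lambda>(p, y). v p y * (poisson p * nbinomial p y)) has_sum T) (UNIV \<times> UNIV)"
    by (intro has_sum_SigmaI[OF _ T']) (use row in auto)
  then show ?thesis by simp
qed

text \<open>All moments of degree at most 2 at once, since \<open>xi_diag\<close> is affine in x - y
  and y and gets squared. The probability distribution is that of (p, y), moved to (x, y) by x = p +
  y.\<close>

lemma moments:
  "((\<lambda>(x, y). (a + b * (real x - real y) + c * real y + d * ((real x - real y) * (real x - real y)) +
      e * ((real x - real y) * real y) + f * (real y * real y)) * (cmod (ff x y))\<^sup>2) has_sum
    (a + b * \<mu> + c * ((\<mu> + 1) * (g - 1)) + d * (\<mu> * \<mu> + \<mu>) + e * ((\<mu> * \<mu> + 2 * \<mu>) * (g - 1)) +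
      f * ((\<mu> * \<mu> + 4 * \<mu> + 2) * (g - 1) * (g - 1) + (\<mu> + 1) * (g - 1)))) UNIV"
proof -
  let ?w = "\<lambda>p y. poisson p * nbinomial p y"
  note N = nbinomial_sums and P = poisson_sums
  have 1: "((\<lambda>(p, y). 1 * ?w p y) has_sum 1) UNIV"
    by (rule moment_aux[where V = "\<lambda>p. 1"]) (use N(1) P[of 1 0 0] in simp_all)
  have 2: "((\<lambda>(p, y). real p * ?w p y) has_sum \<mu>) UNIV"
    by (rule moment_aux[where V = "\<lambda>p. real p"]) (use sums_mult[OF N(1)] P[of 0 1 0] in simp_all)
  have 3: "((\<lambda>(p, y). real y * ?w p y) has_sum (\<mu> + 1) * (g - 1)) UNIV"
    by (rule moment_aux[where V = "\<lambda>p. real (Suc p) * (g - 1)"])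
      (use N(2) P[of "g - 1" "g - 1" 0] in \<open>simp_all add: algebra_simps\<close>)
  have 4: "((\<lambda>(p, y). (real p * real p) * ?w p y) has_sum (\<mu> * \<mu> + \<mu>)) UNIV"
    by (rule moment_aux[where V = "\<lambda>p. real p * real p"]) (use sums_mult[OF N(1)] P[of 0 0 1] in simp_all)
  have 5: "((\<lambda>(p, y). (real p * real y) * ?w p y) has_sum (\<mu> * \<mu> + 2 * \<mu>) * (g - 1)) UNIV"
  proof (rule moment_aux[where V = "\<lambda>p. real p * (real (Suc p) * (g - 1))"])
    show "(\<lambda>y. real p * real y * nbinomial p y) sums (real p * (real (Suc p) * (g - 1)))" for p
      using sums_mult[OF N(2), of "real p"] by (simp only: mult.assoc)
    show "(\<lambda>p. real p * (real (Suc p) * (g - 1)) * poisson p) sums ((\<mu> * \<mu> + 2 * \<mu>) * (g - 1))"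
      using P[of 0 "g - 1" "g - 1"] by (simp add: algebra_simps)
  qed simp
  have 6: "((\<lambda>(p, y). (real y * real y) * ?w p y) has_sum
      ((\<mu> * \<mu> + 4 * \<mu> + 2) * (g - 1) * (g - 1) + (\<mu> + 1) * (g - 1))) UNIV"
  proof (rule moment_aux[where V = "\<lambda>p. real (Suc p) * (g - 1) * (real (Suc (Suc p)) * (g - 1) + 1)"])
    show "(\<lambda>p. real (Suc p) * (g - 1) * (real (Suc (Suc p)) * (g - 1) + 1) * poisson p) sums
        ((\<mu> * \<mu> + 4 * \<mu> + 2) * (g - 1) * (g - 1) + (\<mu> + 1) * (g - 1))"
      using P[of "2 * (g - 1) * (g - 1) + (g - 1)" "3 * (g - 1) * (g - 1) + (g - 1)" "(g - 1) * (g - 1)"]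
      by (simp add: algebra_simps)
  qed (use N(3) in simp_all)
  let ?F = "\<lambda>(x, y). (a + b * (real x - real y) + c * real y + d * ((real x - real y) * (real x - real y)) +
      e * ((real x - real y) * real y) + f * (real y * real y)) * (cmod (ff x y))\<^sup>2"
  let ?T = "a + b * \<mu> + c * ((\<mu> + 1) * (g - 1)) + d * (\<mu> * \<mu> + \<mu>) + e * ((\<mu> * \<mu> + 2 * \<mu>) * (g - 1)) +
      f * ((\<mu> * \<mu> + 4 * \<mu> + 2) * (g - 1) * (g - 1) + (\<mu> + 1) * (g - 1))"
  let ?h = "\<lambda>(p :: nat, y :: nat). (p + y, y)"
  have "((\<lambda>z. a * (case z of (p, y) \<Rightarrow> 1 * ?w p y) + b * (case z of (p, y) \<Rightarrow> real p * ?w p y) +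
      c * (case z of (p, y) \<Rightarrow> real y * ?w p y) + d * (case z of (p, y) \<Rightarrow> (real p * real p) * ?w p y) +
      e * (case z of (p, y) \<Rightarrow> (real p * real y) * ?w p y) +
      f * (case z of (p, y) \<Rightarrow> (real y * real y) * ?w p y)) has_sum (a * 1 + b * \<mu> + c * ((\<mu> + 1) * (g - 1)) +
      d * (\<mu> * \<mu> + \<mu>) + e * ((\<mu> * \<mu> + 2 * \<mu>) * (g - 1)) +
      f * ((\<mu> * \<mu> + 4 * \<mu> + 2) * (g - 1) * (g - 1) + (\<mu> + 1) * (g - 1)))) UNIV"
    by (intro has_sum_add has_sum_cmult_right 1 2 3 4 5 6)
  also have "(\<lambda>z. a * (case z of (p, y) \<Rightarrow> 1 * ?w p y) + b * (case z of (p, y) \<Rightarrow> real p * ?w p y) +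
      c * (case z of (p, y) \<Rightarrow> real y * ?w p y) + d * (case z of (p, y) \<Rightarrow> (real p * real p) * ?w p y) +
      e * (case z of (p, y) \<Rightarrow> (real p * real y) * ?w p y) +
      f * (case z of (p, y) \<Rightarrow> (real y * real y) * ?w p y)) = ?F \<circ> ?h"
    by (auto simp: fun_eq_iff norm_ff_sq algebra_simps)
  finally have "(?F has_sum ?T) (range ?h)"
    unfolding mult_1_right by (rule has_sum_reindex[THEN iffD2, rotated]) (auto simp: inj_on_def)
  then show ?thesis
  proof (rule has_sum_cong_neutral[THEN iffD1, rotated -1])
    fix z :: "nat \<times> nat" assume z: "z \<in> UNIV - range ?h"
    obtain x y where xy: "z = (x, y)" by force
    have "x < y"
    proof (rule ccontr)
      assume "\<not> x < y"
      then have "z = ?h (x - y, y)" by (simp add: xy)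
      then show False using z by blast
    qed
    then show "?F z = 0" by (simp add: xy ff_eq_0)
  qed auto
qed

text \<open>\<open>xi\<close> is the symmetric logarithmic derivative applied to \<open>ff\<close>.  It differs from \<open>2\<partial>\<^sub>g ff\<close> by
  \<open>\<kappa> (\<alpha> e - cnj \<alpha> e\<^sup>\<dagger>) ff\<close> with the environment ladder operator \<open>e\<close>; this antihermitian term
  does not contribute to the derivative of the output state.\<close>

definition kappa :: real where "kappa = 1 / (sqrt (g - 1) * (2 * g - 1))"

definition xi_diag :: "nat \<Rightarrow> nat \<Rightarrow> real" where
  "xi_diag x y = real y / (g - 1) - real (Suc x) / g + (real x - real y) / (2 * g - 1)"

definition xi_off :: "nat \<Rightarrow> nat \<Rightarrow> complex" where
  "xi_off x y = complex_of_real kappa * cnj \<alpha> * rt y * ff x (y - 1)"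

definition xi :: "nat \<Rightarrow> nat \<Rightarrow> complex" where
  "xi x y = complex_of_real (xi_diag x y) * ff x y - xi_off x y"

lemma xi_eq_0: "Suc x < y \<Longrightarrow> xi x y = 0"
  by (simp add: xi_def xi_off_def ff_eq_0)

text \<open>The definition of \<open>xi\<close> has the term with the environment annihilation
  already evaluated, by \<open>ff_raise_e\<close>; here it is restored. In this form the gain
  derivative and the antihermitian term are separate.\<close>

lemma xi_eq_slope: "xi x y = complex_of_real (real y / (g - 1) - real (Suc x) / g) * ff x y +
    complex_of_real kappa * (\<alpha> * rt (Suc y) * ff x (Suc y) - cnj \<alpha> * rt y * ff x (y - 1))"
proof -
  have k: "kappa * sqrt (g - 1) = 1 / (2 * g - 1)" using g by (simp add: kappa_def)
  have "complex_of_real kappa * (\<alpha> * rt (Suc y) * ff x (Suc y)) =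
      complex_of_real ((kappa * sqrt (g - 1)) * (real x - real y)) * ff x y"
    unfolding ff_raise_e by simp
  then have "complex_of_real kappa * (\<alpha> * rt (Suc y) * ff x (Suc y)) = complex_of_real ((real x - real y) / (2 * g - 1)) * ff x y"
    unfolding k by simp
  then show ?thesis
    unfolding xi_def xi_diag_def xi_off_def of_real_add distrib_right right_diff_distrib
    by (simp only: mult.assoc) (simp only: add_diff_eq)
qed

text \<open>The term with the environment creation overlaps \<open>ff\<close> one step higher in y;
  shifted back, it is real and diagonal, hence a moment.\<close>

lemma cross_term:
  "ff x (Suc y) * cnj (xi_off x (Suc y)) = complex_of_real ((real x - real y) / (2 * g - 1) * (cmod (ff x y))\<^sup>2)"
proof -
  have k: "kappa * sqrt (g - 1) = 1 / (2 * g - 1)" using g by (simp add: kappa_def)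
  have "ff x (Suc y) * cnj (xi_off x (Suc y)) = complex_of_real kappa * (\<alpha> * rt (Suc y) * ff x (Suc y)) * cnj (ff x y)"
    by (simp add: xi_off_def)
  also have "\<dots> = complex_of_real (kappa * sqrt (g - 1) * (real x - real y)) * (ff x y * cnj (ff x y))"
    unfolding ff_raise_e by simp
  finally show ?thesis unfolding k complex_norm_square[symmetric] by simp
qed

lemma ff_total: "((\<lambda>(x, y). (cmod (ff x y))\<^sup>2) has_sum 1) UNIV"
  using moments[of 1 0 0 0 0 0] by simp

lemma ff_mean_photons: "((\<lambda>(x, y). real x * (cmod (ff x y))\<^sup>2) has_sum \<mu> + (\<mu> + 1) * (g - 1)) UNIV"
  using moments[of 0 1 1 0 0 0] by simp

lemma xi_diag_Suc: "xi_diag x (Suc y) = (1 / (g - 1) - 1 / g - 1 / (2 * g - 1)) +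
    (1 / (2 * g - 1) - 1 / g) * (real x - real y) + (1 / (g - 1) - 1 / g) * real y"
  and xi_diag_eq: "xi_diag x y = - 1 / g + (1 / (2 * g - 1) - 1 / g) * (real x - real y) + (1 / (g - 1) - 1 / g) * real y"
  by (simp_all add: xi_diag_def algebra_simps add_divide_distrib diff_divide_distrib)

text \<open>The expectation of the logarithmic derivative, which is zero because the trace is
  preserved. It makes different modes contribute orthogonally.\<close>

lemma xi_mean: "((\<lambda>(x, y). xi x y * cnj (ff x y)) has_sum 0) UNIV"
proof -
  define B where "B = (\<lambda>(x, y). Re (ff x y * cnj (xi_off x y)))"
  have Bs: "(B has_sum \<mu> / (2 * g - 1)) UNIV"
  proof (rule has_sum_shift_snd)
    show "((\<lambda>(x, y). B (x, Suc y)) has_sum \<mu> / (2 * g - 1)) UNIV"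
      unfolding B_def prod.case cross_term Re_complex_of_real
      using moments[of 0 "1 / (2 * g - 1)" 0 0 0 0] by simp
  qed (simp add: B_def xi_off_def)
  have "((\<lambda>z. (case z of (x, y) \<Rightarrow> xi_diag x y * (cmod (ff x y))\<^sup>2) - B z) has_sum
      (- 1 / g + (1 / (2 * g - 1) - 1 / g) * \<mu> + (1 / (g - 1) - 1 / g) * ((\<mu> + 1) * (g - 1)) - \<mu> / (2 * g - 1))) UNIV"
    using has_sum_add[OF moments[of "- 1 / g" "1 / (2 * g - 1) - 1 / g" "1 / (g - 1) - 1 / g" 0 0 0] has_sum_uminusI[OF Bs]]
    by (simp add: xi_diag_eq case_prod_unfold)
  also have "(- 1 / g + (1 / (2 * g - 1) - 1 / g) * \<mu> + (1 / (g - 1) - 1 / g) * ((\<mu> + 1) * (g - 1)) - \<mu> / (2 * g - 1)) = 0"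
  proof -
    define i j k where "i = 1 / g" and "j = 1 / (g - 1)" and "k = 1 / (2 * g - 1)"
    have "g * i = 1" "(g - 1) * j = 1" using g by (auto simp: i_def j_def)
    then have "- i + (k - i) * \<mu> + (j - i) * ((\<mu> + 1) * (g - 1)) - \<mu> * k = 0" by algebra
    then show ?thesis by (simp add: i_def j_def k_def)
  qed
  finally have "((\<lambda>z. complex_of_real ((case z of (x, y) \<Rightarrow> xi_diag x y * (cmod (ff x y))\<^sup>2) - B z)) has_sum complex_of_real 0) UNIV"
    by (rule has_sum_of_real)
  moreover have "complex_of_real ((case z of (x, y) \<Rightarrow> xi_diag x y * (cmod (ff x y))\<^sup>2) - B z) =
      (case z of (x, y) \<Rightarrow> xi x y * cnj (ff x y))" for z
  proof -
    obtain x y where z: "z = (x, y)" by force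
    have "ff x y * cnj (xi_off x y) \<in> \<real>"
      using cross_term[of x "y - 1"] by (cases y) (simp_all add: xi_off_def)
    then have "complex_of_real (B z) = ff x y * cnj (xi_off x y)" by (simp add: z B_def del: times_complex.sel)
    then have "complex_of_real (B z) = xi_off x y * cnj (ff x y)"
      by (metis complex_cnj_cnj complex_cnj_complex_of_real complex_cnj_mult mult.commute)
    then show ?thesis by (simp add: z xi_def left_diff_distrib complex_norm_square mult.assoc del: of_real_power)
  qed
  ultimately show ?thesis by (simp only: of_real_0)
qed

text \<open>The quantum Fisher information of one mode. Expanding the square gives the diagonal
  part, the cross term and the shifted part, each a combination of \<open>moments\<close>. The terms
  quadratic in \<mu> cancel, so the result is affine in the photon number.\<close>

lemma xi_norm: "((\<lambda>(x, y). (cmod (xi x y))\<^sup>2) has_sum \<mu> / (g * (2 * g - 1)) + 1 / (g * (g - 1))) UNIV"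
proof -
  define i j k where "i = 1 / g" and "j = 1 / (g - 1)" and "k = 1 / (2 * g - 1)"
  define A where "A = (\<lambda>(x, y). (xi_diag x y)\<^sup>2 * (cmod (ff x y))\<^sup>2)"
  define B where "B = (\<lambda>(x, y). xi_diag x y * Re (ff x y * cnj (xi_off x y)))"
  define C where "C = (\<lambda>(x, y). (cmod (xi_off x y))\<^sup>2)"
  have kap: "kappa\<^sup>2 = j * k\<^sup>2" using g by (simp add: kappa_def j_def k_def power_divide power_mult_distrib)
  let ?b = "k - i" and ?c = "j - i"
  have "(xi_diag x y)\<^sup>2 = i * i + (- 2 * i * ?b) * (real x - real y) + (- 2 * i * ?c) * real y + (?b * ?b) * ((real x - real y) * (real x - real y)) +
      (2 * ?b * ?c) * ((real x - real y) * real y) + (?c * ?c) * (real y * real y)" for x y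
    unfolding xi_diag_eq i_def[symmetric] j_def[symmetric] k_def[symmetric] power2_eq_square
    by (simp add: i_def[symmetric] algebra_simps)
  then have As: "(A has_sum (i * i + (- 2 * i * ?b) * \<mu> + (- 2 * i * ?c) * ((\<mu> + 1) * (g - 1)) + (?b * ?b) * (\<mu> * \<mu> + \<mu>) +
      (2 * ?b * ?c) * ((\<mu> * \<mu> + 2 * \<mu>) * (g - 1)) +
      (?c * ?c) * ((\<mu> * \<mu> + 4 * \<mu> + 2) * (g - 1) * (g - 1) + (\<mu> + 1) * (g - 1)))) UNIV" (is "(_ has_sum ?SA) _")
    unfolding A_def using moments by (simp only:)
  have Bs: "(B has_sum ((j - i - k) * k * \<mu> + ?b * k * (\<mu> * \<mu> + \<mu>) + ?c * k * ((\<mu> * \<mu> + 2 * \<mu>) * (g - 1)))) UNIV" (is "(_ has_sum ?SB) _")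
  proof (rule has_sum_shift_snd)
    have "B (x, Suc y) = (0 + ((j - i - k) * k) * (real x - real y) + 0 * real y + (?b * k) * ((real x - real y) * (real x - real y)) +
        (?c * k) * ((real x - real y) * real y) + 0 * (real y * real y)) * (cmod (ff x y))\<^sup>2" for x y
      unfolding B_def prod.case cross_term Re_complex_of_real xi_diag_Suc i_def[symmetric] j_def[symmetric] k_def[symmetric]
      by (simp add: divide_inverse k_def algebra_simps)
    then show "((\<lambda>(x, y). B (x, Suc y)) has_sum ?SB) UNIV"
      using moments[of 0 "(j - i - k) * k" 0 "?b * k" "?c * k" 0] by simp
  qed (simp add: B_def xi_off_def)
  have Cs: "(C has_sum (j * k\<^sup>2 * \<mu> + j * k\<^sup>2 * \<mu> * ((\<mu> + 1) * (g - 1)))) UNIV" (is "(_ has_sum ?SC) _")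
  proof (rule has_sum_shift_snd)
    have "C (x, Suc y) = (j * k\<^sup>2 * \<mu> + 0 * (real x - real y) + (j * k\<^sup>2 * \<mu>) * real y + 0 * ((real x - real y) * (real x - real y)) +
        0 * ((real x - real y) * real y) + 0 * (real y * real y)) * (cmod (ff x y))\<^sup>2" for x y
      unfolding C_def prod.case xi_off_def norm_mult power_mult_distrib norm_rt_sq
      by (simp add: \<mu>_def kap algebra_simps)
    then show "((\<lambda>(x, y). C (x, Suc y)) has_sum ?SC) UNIV"
      using moments[of "j * k\<^sup>2 * \<mu>" 0 "j * k\<^sup>2 * \<mu>" 0 0 0] by simp
  qed (simp add: C_def xi_off_def)
  have "(\<lambda>(x, y). (cmod (xi x y))\<^sup>2) = (\<lambda>z. A z + (- 2) * B z + C z)"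
  proof
    fix z :: "nat \<times> nat"
    obtain x y where z: "z = (x, y)" by force
    have "(cmod (xi x y))\<^sup>2 = (cmod (complex_of_real (xi_diag x y) * ff x y))\<^sup>2 -
        2 * Re (complex_of_real (xi_diag x y) * ff x y * cnj (xi_off x y)) + (cmod (xi_off x y))\<^sup>2"
      unfolding xi_def cmod_power2 by (simp add: power2_eq_square algebra_simps)
    then show "(case z of (x, y) \<Rightarrow> (cmod (xi x y))\<^sup>2) = A z + (- 2) * B z + C z"
      by (simp add: z A_def B_def C_def norm_mult power_mult_distrib algebra_simps)
  qed
  moreover have "((\<lambda>z. A z + (- 2) * B z + C z) has_sum ?SA + (- 2) * ?SB + ?SC) UNIV"
    by (intro has_sum_add has_sum_cmult_right As Bs Cs)
  moreover have "?SA + (- 2) * ?SB + ?SC = \<mu> / (g * (2 * g - 1)) + 1 / (g * (g - 1))"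
  proof -
    \<comment> \<open>With the reciprocals as variables bound by these relations, the rational
      identity in g is polynomial.\<close>
    have e: "g * i = 1" "(g - 1) * j = 1" "(2 * g - 1) * k = 1" using g by (auto simp: i_def j_def k_def)
    have "\<mu> / (g * (2 * g - 1)) + 1 / (g * (g - 1)) = \<mu> * i * k + i * j"
      by (simp add: i_def j_def k_def)
    moreover have "?SA + (- 2) * ?SB + ?SC = \<mu> * i * k + i * j"
      using e by algebra
    ultimately show ?thesis by simp
  qed
  ultimately show ?thesis by simp
qed

end

section \<open>Amplified coherent states of several modes\<close>

text \<open>Absolute convergence of the product sum: a finite set of configurations lies in the
  product of its projections, where the sum factorises. A pair of functions is identified with a
  function to pairs.\<close>

lemma has_sum_prod_modes:
  fixes t :: "'k::finite \<Rightarrow> nat \<times> nat \<Rightarrow> complex"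
  assumes t: "\<And>i. (t i has_sum c i) UNIV"
  shows "((\<lambda>(x, y). \<Prod>i\<in>UNIV. t i (x i, y i)) has_sum (\<Prod>i\<in>UNIV. c i)) UNIV"
proof -
  have ab: "(\<lambda>z. norm (t i z)) summable_on UNIV" for i
    using has_sum_imp_summable[OF t[of i]] summable_on_iff_abs_summable_on_complex by blast
  let ?P = "\<lambda>z. \<Prod>i\<in>UNIV. t i (z i)"
  have "(\<lambda>z. norm (?P z)) summable_on UNIV"
  proof (rule nonneg_bdd_above_summable_on)
    show "bdd_above (sum (\<lambda>z. norm (?P z)) ` {F. F \<subseteq> UNIV \<and> finite F})"
    proof (rule bdd_aboveI2)
      fix F :: "('k \<Rightarrow> nat \<times> nat) set" assume "F \<in> {F. F \<subseteq> UNIV \<and> finite F}"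
      then have F: "finite F" by simp
      define B where "B i = (\<lambda>z. z i) ` F" for i
      have B: "finite (B i)" for i using F by (simp add: B_def)
      have "(\<Sum>z\<in>F. norm (?P z)) \<le> (\<Sum>z\<in>PiE UNIV B. norm (?P z))"
        by (rule sum_mono2) (use B in \<open>auto simp: B_def intro!: finite_PiE\<close>)
      also have "\<dots> = (\<Prod>i\<in>UNIV. \<Sum>w\<in>B i. norm (t i w))"
        unfolding prod_norm[symmetric] by (rule prod_sum_PiE[symmetric]) (use B in auto)
      also have "\<dots> \<le> (\<Prod>i\<in>UNIV. \<Sum>\<^sub>\<infinity>w. norm (t i w))"
        using B ab by (intro prod_mono conjI sum_nonneg finite_sum_le_infsum) auto
      finally show "(\<Sum>z\<in>F. norm (?P z)) \<le> (\<Prod>i\<in>UNIV. \<Sum>\<^sub>\<infinity>w. norm (t i w))" .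
    qed
  qed auto
  then have "?P summable_on UNIV" by (rule abs_summable_summable)
  moreover have "infsum ?P UNIV = (\<Prod>i\<in>UNIV. c i)"
    using infsum_prod_PiE_abs[of UNIV t "\<lambda>_. UNIV"] ab by (simp add: infsumI[OF t])
  ultimately have P: "(?P has_sum (\<Prod>i\<in>UNIV. c i)) UNIV" by (simp add: has_sum_iff)
  have "bij_betw (\<lambda>(x, y) i. (x i, y i)) UNIV (UNIV :: ('k \<Rightarrow> nat \<times> nat) set)"
    by (rule bij_betwI[where g = "\<lambda>z. (fst \<circ> z, snd \<circ> z)"]) auto
  from has_sum_reindex_bij_betw[OF this, of ?P] P show ?thesis
    by (simp add: case_prod_unfold)
qed

definition mode :: "real \<Rightarrow> 'k set \<Rightarrow> complex ^ 'k::finite \<Rightarrow> 'k \<Rightarrow> nat \<Rightarrow> nat \<Rightarrow> complex" where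
  "mode g S \<gamma> i x y = complex_of_real (kraus1 g S i x y) * coherent1 (\<gamma> $ i) (x - y)"

text \<open>The factors of one term of the Leibniz rule, in which the logarithmic derivative acts on
  mode m only.\<close>

definition xi_mode :: "real \<Rightarrow> 'k set \<Rightarrow> complex ^ 'k::finite \<Rightarrow> 'k \<Rightarrow> 'k \<Rightarrow> nat \<Rightarrow> nat \<Rightarrow> complex" where
  "xi_mode g S \<gamma> m i = (if i = m then xi g (\<gamma> $ i) else mode g S \<gamma> i)"

text \<open>The unnormalised output vectors: \<open>out x y\<close> is the amplitude of the output \<open>x\<close> with \<open>y\<close> photons in the environment,
  and \<open>Xi\<close> is the image of \<open>out\<close> under the logarithmic derivative of the amplified coherent state.\<close>

definition out :: "real \<Rightarrow> 'k set \<Rightarrow> complex ^ 'k::finite \<Rightarrow> ('k \<Rightarrow> nat) \<Rightarrow> ('k \<Rightarrow> nat) \<Rightarrow> complex" where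
  "out g S \<gamma> x y = (\<Prod>i\<in>UNIV. mode g S \<gamma> i (x i) (y i))"

definition Xi :: "real \<Rightarrow> 'k set \<Rightarrow> complex ^ 'k::finite \<Rightarrow> ('k \<Rightarrow> nat) \<Rightarrow> ('k \<Rightarrow> nat) \<Rightarrow> complex" where
  "Xi g S \<gamma> x y = (\<Sum>m\<in>S. \<Prod>i\<in>UNIV. xi_mode g S \<gamma> m i (x i) (y i))"

text \<open>The bound is x + 1 and not x, because \<open>xi\<close> contains an environment creation
  operator and may be nonzero there.\<close>

definition env_box :: "('k::finite \<Rightarrow> nat) \<Rightarrow> ('k \<Rightarrow> nat) set" where
  "env_box x = {y. \<forall>i. y i \<le> Suc (x i)}"

lemma finite_env_box: "finite (env_box x)"
proof -
  have "env_box x = PiE UNIV (\<lambda>i. {..Suc (x i)})" by (auto simp: env_box_def)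
  then show ?thesis by (simp add: finite_PiE)
qed

lemma out_eq: "out g S \<gamma> x y = complex_of_real (kraus g S x y) * coherent \<gamma> (\<lambda>i. x i - y i)"
  by (simp add: out_def mode_def kraus_def coherent_def prod.distrib)

context
  fixes g :: real and S :: "'k::finite set"
  assumes g: "g > 1"
begin

lemma mode_in: "i \<in> S \<Longrightarrow> mode g S \<gamma> i = ff g (\<gamma> $ i)"
  by (simp add: fun_eq_iff mode_def kraus1_def ff_def[OF g])

lemma mode_eq_0: "x < y \<Longrightarrow> mode g S \<gamma> i x y = 0"
  by (simp add: mode_def kraus1_eq_0)

lemma xi_mode_eq_0: "Suc x < y \<Longrightarrow> xi_mode g S \<gamma> m i x y = 0"
  by (simp add: xi_mode_def xi_eq_0[OF g] mode_eq_0)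

lemma out_eq_0:
  assumes "y \<notin> env_box x" shows "out g S \<gamma> x y = 0"
proof -
  obtain i where "Suc (x i) < y i" using assms by (auto simp: env_box_def not_le)
  then have "mode g S \<gamma> i (x i) (y i) = 0" by (intro mode_eq_0) simp
  then show ?thesis unfolding out_def by (intro prod_zero) auto
qed

lemma Xi_eq_0:
  assumes "y \<notin> env_box x" shows "Xi g S \<gamma> x y = 0"
proof -
  obtain i where i: "Suc (x i) < y i" using assms by (auto simp: env_box_def not_le)
  have "(\<Prod>i\<in>UNIV. xi_mode g S \<gamma> m i (x i) (y i)) = 0" for m
    by (rule prod_zero) (use xi_mode_eq_0[OF i] in auto)
  then show ?thesis unfolding Xi_def by (simp only: sum.neutral_const)
qed

lemma mode_total: "((\<lambda>(x, y). complex_of_real ((cmod (mode g S \<gamma> i x y))\<^sup>2)) has_sum 1) UNIV"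
proof -
  have "((\<lambda>(x, y). (cmod (mode g S \<gamma> i x y))\<^sup>2) has_sum 1) UNIV"
  proof (cases "i \<in> S")
    case True
    then show ?thesis using ff_total[OF g] by (simp add: mode_in)
  next
    case False
    have "((\<lambda>x. (cmod (coherent1 (\<gamma> $ i) x))\<^sup>2) has_sum 1) UNIV"
      unfolding coherent1_norm_sq[OF g]
      by (rule sums_nonneg_imp_has_sum) (use poisson_sums[OF g, of 1 0 0] poisson_nonneg[OF g] in auto)
    also have "(\<lambda>x. (cmod (coherent1 (\<gamma> $ i) x))\<^sup>2) = (\<lambda>(x, y). (cmod (mode g S \<gamma> i x y))\<^sup>2) \<circ> (\<lambda>x. (x, 0))"
      using False by (auto simp: fun_eq_iff mode_def kraus1_def)
    finally have "((\<lambda>(x, y). (cmod (mode g S \<gamma> i x y))\<^sup>2) has_sum 1) (range (\<lambda>x. (x, 0)))"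
      by (rule has_sum_reindex[THEN iffD2, rotated]) (auto simp: inj_on_def)
    then show ?thesis
      by (rule has_sum_cong_neutral[THEN iffD1, rotated -1])
        (use False in \<open>auto simp: mode_def kraus1_def image_iff\<close>)
  qed
  from has_sum_of_real[OF this, where 'a = complex] show ?thesis by (simp add: case_prod_unfold)
qed

lemma out_total: "((\<lambda>(x, y). (cmod (out g S \<gamma> x y))\<^sup>2) has_sum 1) UNIV"
proof -
  have "((\<lambda>(x, y). \<Prod>i\<in>UNIV. complex_of_real ((cmod (mode g S \<gamma> i (x i) (y i)))\<^sup>2)) has_sum (\<Prod>i\<in>(UNIV :: 'k set). 1)) UNIV"
    using has_sum_prod_modes[OF mode_total[where \<gamma> = \<gamma>]] by simp
  then have "((\<lambda>z. Re (case z of (x, y) \<Rightarrow> \<Prod>i\<in>UNIV. complex_of_real ((cmod (mode g S \<gamma> i (x i) (y i)))\<^sup>2))) has_sum 1) UNIV"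
    using has_sum_Re by fastforce
  moreover have "Re (case z of (x, y) \<Rightarrow> \<Prod>i\<in>UNIV. complex_of_real ((cmod (mode g S \<gamma> i (x i) (y i)))\<^sup>2)) =
      (case z of (x, y) \<Rightarrow> (cmod (out g S \<gamma> x y))\<^sup>2)" for z
    unfolding out_def prod_norm[symmetric] prod_power_distrib of_real_prod[symmetric]
    by (cases z) (simp add: of_real_prod[symmetric] del: of_real_prod of_real_power)
  ultimately show ?thesis by simp
qed

lemma out_mean_photons: "(\<lambda>(x, y). real (x m) * (cmod (out g S \<gamma> x y))\<^sup>2) summable_on UNIV" if m: "m \<in> S"
proof -
  let ?w = "\<lambda>i x. if i = m then real x else 1"
  define t where "t i = (\<lambda>(x, y). complex_of_real (?w i x * (cmod (mode g S \<gamma> i x y))\<^sup>2))" for i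
  have "\<exists>c. (t i has_sum c) UNIV" for i
  proof (cases "i = m")
    case True
    have "((\<lambda>(x, y). complex_of_real (real x * (cmod (mode g S \<gamma> i x y))\<^sup>2)) has_sum
        complex_of_real (\<mu> (\<gamma> $ i) + (\<mu> (\<gamma> $ i) + 1) * (g - 1))) UNIV"
      using has_sum_of_real[OF ff_mean_photons[OF g, of "\<gamma> $ i"], where 'a = complex] m True
      by (simp add: mode_in case_prod_unfold)
    then show ?thesis using True unfolding t_def by auto
  next
    case False
    then show ?thesis using mode_total[of \<gamma> i] unfolding t_def by auto
  qed
  then obtain c where "\<And>i. (t i has_sum c i) UNIV" by metis
  from has_sum_prod_modes[of t c, OF this]
  have "(\<lambda>z. Re (case z of (x, y) \<Rightarrow> \<Prod>i\<in>UNIV. t i (x i, y i))) summable_on UNIV"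
    by (intro summable_on_Re has_sum_imp_summable)
  moreover have "Re (case z of (x, y) \<Rightarrow> \<Prod>i\<in>UNIV. t i (x i, y i)) =
      (case z of (x, y) \<Rightarrow> real (x m) * (cmod (out g S \<gamma> x y))\<^sup>2)" for z
  proof -
    obtain x y where z: "z = (x, y)" by force
    have "(\<Prod>i\<in>UNIV. t i (x i, y i)) = complex_of_real (\<Prod>i\<in>UNIV. ?w i (x i) * (cmod (mode g S \<gamma> i (x i) (y i)))\<^sup>2)"
      by (simp only: t_def prod.case of_real_prod)
    moreover have "(\<Prod>i\<in>UNIV. ?w i (x i)) = real (x m)" by simp
    ultimately show ?thesis
      unfolding z prod.case out_def prod_norm[symmetric] prod_power_distrib
      by (simp only: prod.distrib Re_complex_of_real)
  qed
  ultimately show ?thesis by simp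
qed

text \<open>In the overlap of the terms for two different modes, each of these modes contributes a
  factor \<open>xi_mean\<close>, so the cross terms vanish. The untouched modes contribute their
  total mass 1.\<close>

lemma Xi_norm:
  "((\<lambda>(x, y). (cmod (Xi g S \<gamma> x y))\<^sup>2) has_sum
    (\<Sum>m\<in>S. (cmod (\<gamma> $ m))\<^sup>2) / (g * (2 * g - 1)) + real (card S) / (g * (g - 1))) UNIV"
proof -
  define N where "N m = \<mu> (\<gamma> $ m) / (g * (2 * g - 1)) + 1 / (g * (g - 1))" for m
  have off: "((\<lambda>(x, y). mode g S \<gamma> i x y * cnj (mode g S \<gamma> i x y)) has_sum 1) UNIV" for i
    using mode_total[of \<gamma> i] by (simp only: complex_norm_square)
  have xm: "((\<lambda>(x, y). xi g (\<gamma> $ i) x y * cnj (mode g S \<gamma> i x y)) has_sum 0) UNIV"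
    "((\<lambda>(x, y). mode g S \<gamma> i x y * cnj (xi g (\<gamma> $ i) x y)) has_sum 0) UNIV" if "i \<in> S" for i
  proof -
    show 1: "((\<lambda>(x, y). xi g (\<gamma> $ i) x y * cnj (mode g S \<gamma> i x y)) has_sum 0) UNIV"
      using xi_mean[OF g, of "\<gamma> $ i"] that by (simp add: mode_in)
    have "((\<lambda>z. cnj (case z of (x, y) \<Rightarrow> xi g (\<gamma> $ i) x y * cnj (mode g S \<gamma> i x y))) has_sum cnj 0) UNIV"
      unfolding has_sum_cnj_iff by (rule 1)
    then show "((\<lambda>(x, y). mode g S \<gamma> i x y * cnj (xi g (\<gamma> $ i) x y)) has_sum 0) UNIV"
      by (simp add: case_prod_unfold mult.commute)
  qed
  have xx: "((\<lambda>(x, y). xi g (\<gamma> $ i) x y * cnj (xi g (\<gamma> $ i) x y)) has_sum complex_of_real (N i)) UNIV" for i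
    using has_sum_of_real[OF xi_norm[OF g, of "\<gamma> $ i"], where 'a = complex]
    by (simp add: N_def case_prod_unfold complex_norm_square del: of_real_power)
  have mn: "((\<lambda>(x, y). \<Prod>i\<in>UNIV. xi_mode g S \<gamma> m i (x i) (y i) * cnj (xi_mode g S \<gamma> n i (x i) (y i))) has_sum
      (if m = n then complex_of_real (N m) else 0)) UNIV" if mnS: "m \<in> S" "n \<in> S" for m n
  proof -
    define c where "c i = (if i = m \<and> i = n then complex_of_real (N m) else if i = m \<or> i = n then 0 else 1)" for i
    have "((\<lambda>(x, y). xi_mode g S \<gamma> m i x y * cnj (xi_mode g S \<gamma> n i x y)) has_sum c i) UNIV" for i
      using off[of i] xx[of i] xm[of i] mnS by (auto simp: c_def xi_mode_def)
    then have "((\<lambda>(x, y). \<Prod>i\<in>UNIV. xi_mode g S \<gamma> m i (x i) (y i) * cnj (xi_mode g S \<gamma> n i (x i) (y i))) has_sum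
        (\<Prod>i\<in>UNIV. c i)) UNIV"
      using has_sum_prod_modes[of "\<lambda>i (x, y). xi_mode g S \<gamma> m i x y * cnj (xi_mode g S \<gamma> n i x y)" c] by simp
    moreover have "(\<Prod>i\<in>UNIV. c i) = (if m = n then complex_of_real (N m) else 0)"
    proof (cases "m = n")
      case True
      have "(\<Prod>i\<in>UNIV. c i) = c m * (\<Prod>i\<in>UNIV - {m}. c i)" by (rule prod.remove) auto
      also have "(\<Prod>i\<in>UNIV - {m}. c i) = 1" by (rule prod.neutral) (use True in \<open>auto simp: c_def\<close>)
      finally show ?thesis using True by (simp add: c_def)
    next
      case False
      then have "c m = 0" by (simp add: c_def)
      then have "(\<Prod>i\<in>UNIV. c i) = 0" by (intro prod_zero) auto
      then show ?thesis using False by simp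
    qed
    ultimately show ?thesis by simp
  qed
  have "((\<lambda>z. \<Sum>m\<in>S. \<Sum>n\<in>S. case z of (x, y) \<Rightarrow>
      \<Prod>i\<in>UNIV. xi_mode g S \<gamma> m i (x i) (y i) * cnj (xi_mode g S \<gamma> n i (x i) (y i))) has_sum
      (\<Sum>m\<in>S. \<Sum>n\<in>S. if m = n then complex_of_real (N m) else 0)) UNIV"
    by (intro has_sum_finite_sum mn)
  also have "(\<Sum>m\<in>S. \<Sum>n\<in>S. if m = n then complex_of_real (N m) else 0) = complex_of_real (\<Sum>m\<in>S. N m)"
    by simp
  finally have "((\<lambda>z. Re (\<Sum>m\<in>S. \<Sum>n\<in>S. case z of (x, y) \<Rightarrow>
      \<Prod>i\<in>UNIV. xi_mode g S \<gamma> m i (x i) (y i) * cnj (xi_mode g S \<gamma> n i (x i) (y i)))) has_sum (\<Sum>m\<in>S. N m)) UNIV"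
    using has_sum_Re by fastforce
  moreover have "Re (\<Sum>m\<in>S. \<Sum>n\<in>S. case z of (x, y) \<Rightarrow>
      \<Prod>i\<in>UNIV. xi_mode g S \<gamma> m i (x i) (y i) * cnj (xi_mode g S \<gamma> n i (x i) (y i))) =
      (case z of (x, y) \<Rightarrow> (cmod (Xi g S \<gamma> x y))\<^sup>2)" for z
  proof -
    obtain x y where z: "z = (x, y)" by force
    have "Xi g S \<gamma> x y * cnj (Xi g S \<gamma> x y) = (\<Sum>m\<in>S. \<Sum>n\<in>S.
        \<Prod>i\<in>UNIV. xi_mode g S \<gamma> m i (x i) (y i) * cnj (xi_mode g S \<gamma> n i (x i) (y i)))"
      by (simp only: Xi_def cnj_sum cnj_prod sum_product prod.distrib)
    from this[symmetric] show ?thesis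
      by (simp only: z prod.case complex_norm_square[symmetric] Re_complex_of_real)
  qed
  moreover have "(\<Sum>m\<in>S. N m) = (\<Sum>m\<in>S. (cmod (\<gamma> $ m))\<^sup>2) / (g * (2 * g - 1)) + real (card S) / (g * (g - 1))"
    by (simp add: N_def sum.distrib sum_divide_distrib \<mu>_def[OF g])
  ultimately show ?thesis by simp
qed

text \<open>The terms with \<open>kappa\<close> telescope in y, which expresses the invariance of
  the traced-out environment under a unitary. N is above both photon numbers, so the boundary terms
  vanish.\<close>

lemma xi_slope_sum:
  assumes N: "a < N" "b < N"
  shows "(\<Sum>y\<le>N. xi g \<alpha> a y * cnj (ff g \<alpha> b y)) + (\<Sum>y\<le>N. ff g \<alpha> a y * cnj (xi g \<alpha> b y)) =
    (\<Sum>y\<le>N. complex_of_real ((real y / (g - 1) - real (Suc a) / g) + (real y / (g - 1) - real (Suc b) / g)) *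
      (ff g \<alpha> a y * cnj (ff g \<alpha> b y)))"
proof -
  define u v where "u y = \<alpha> * rt y * ff g \<alpha> a y * cnj (ff g \<alpha> b (y - 1))"
    and "v y = cnj \<alpha> * rt y * ff g \<alpha> a (y - 1) * cnj (ff g \<alpha> b y)" for y
  let ?l = "\<lambda>a y. real y / (g - 1) - real (Suc a) / g"
  have tel: "(\<Sum>y\<le>N. w (Suc y) - w y) = w (Suc N) - w 0" for w :: "nat \<Rightarrow> complex"
    by (induction N) simp_all
  have uv: "u (Suc N) = 0" "v (Suc N) = 0" "u 0 = 0" "v 0 = 0"
    using N by (auto simp: u_def v_def ff_eq_0[OF g])
  have "xi g \<alpha> a y * cnj (ff g \<alpha> b y) + ff g \<alpha> a y * cnj (xi g \<alpha> b y) =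
      complex_of_real (?l a y + ?l b y) * (ff g \<alpha> a y * cnj (ff g \<alpha> b y)) +
      complex_of_real (kappa g) * ((u (Suc y) - u y) + (v (Suc y) - v y))" for y
    unfolding xi_eq_slope[OF g] u_def v_def
    by (simp add: algebra_simps)
  then have "(\<Sum>y\<le>N. xi g \<alpha> a y * cnj (ff g \<alpha> b y)) + (\<Sum>y\<le>N. ff g \<alpha> a y * cnj (xi g \<alpha> b y)) =
      (\<Sum>y\<le>N. complex_of_real (?l a y + ?l b y) * (ff g \<alpha> a y * cnj (ff g \<alpha> b y))) +
      complex_of_real (kappa g) * ((\<Sum>y\<le>N. u (Suc y) - u y) + (\<Sum>y\<le>N. v (Suc y) - v y))"
    by (simp only: sum.distrib[symmetric] sum_distrib_left)
  then show ?thesis unfolding tel uv by simp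
qed

lemma sum_env_box:
  assumes "finite A" "\<And>y. y \<in> env_box x \<Longrightarrow> y \<in> A" "\<And>y. y \<notin> env_box x \<Longrightarrow> f y = 0"
  shows "(\<Sum>y\<in>env_box x. f y) = (\<Sum>y\<in>A. f y)"
  by (rule sum.mono_neutral_left) (use assms in auto)

text \<open>This is Y + adj Y against twice the derivative of the output. Over a common box the sum
  over y factorises; all modes but m give equal factors on both sides, and mode m is
  \<open>xi_slope_sum\<close>.\<close>

lemma Xi_slope:
  "(\<Sum>y\<in>env_box x. Xi g S \<gamma> x y * cnj (out g S \<gamma> x' y)) + cnj (\<Sum>y\<in>env_box x'. Xi g S \<gamma> x' y * cnj (out g S \<gamma> x y)) =
    (\<Sum>y\<in>env_box x. complex_of_real (kraus_slope g S x y + kraus_slope g S x' y) * (out g S \<gamma> x y * cnj (out g S \<gamma> x' y)))"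
proof -
  \<comment> \<open>Above every entry of x and x', so that both environment boxes fit below N and
    the boundary terms of \<open>xi_slope_sum\<close> vanish.\<close>
  define N where "N = Suc (Max (range x) + Max (range x'))"
  have N: "x i < N" "x' i < N" for i
  proof -
    have "x i \<le> Max (range x)" "x' i \<le> Max (range x')" by (intro Max_ge; simp)+
    then show "x i < N" "x' i < N" unfolding N_def by linarith+
  qed
  define B where "B = PiE (UNIV :: 'k set) (\<lambda>_. {..N})"
  have B: "finite B" "y \<in> env_box x \<Longrightarrow> y \<in> B" "y \<in> env_box x' \<Longrightarrow> y \<in> B" for y
    using N by (auto simp: B_def env_box_def finite_PiE) (meson Suc_leI le_trans)+
  have pr: "(\<Sum>y\<in>B. \<Prod>i\<in>UNIV. f i (y i)) = (\<Prod>i\<in>UNIV. \<Sum>b\<le>N. f i b)" for f :: "'k \<Rightarrow> nat \<Rightarrow> complex"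
    unfolding B_def by (rule prod_sum_PiE[symmetric]) auto
  let ?r = "\<lambda>i. \<Sum>b\<le>N. mode g S \<gamma> i (x i) b * cnj (mode g S \<gamma> i (x' i) b)"
  let ?w = "\<lambda>m. \<Sum>b\<le>N. xi g (\<gamma> $ m) (x m) b * cnj (mode g S \<gamma> m (x' m) b)"
  let ?w' = "\<lambda>m. \<Sum>b\<le>N. mode g S \<gamma> m (x m) b * cnj (xi g (\<gamma> $ m) (x' m) b)"
  let ?l = "\<lambda>m b. (real b / (g - 1) - real (Suc (x m)) / g) + (real b / (g - 1) - real (Suc (x' m)) / g)"
  let ?s = "\<lambda>m. \<Sum>b\<le>N. complex_of_real (?l m b) * (mode g S \<gamma> m (x m) b * cnj (mode g S \<gamma> m (x' m) b))"
  have split: "(\<Prod>i\<in>UNIV. \<Sum>b\<le>N. f i b) = (\<Sum>b\<le>N. f m b) * (\<Prod>i\<in>UNIV - {m}. ?r i)"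
    if "\<And>i b. i \<noteq> m \<Longrightarrow> f i b = mode g S \<gamma> i (x i) b * cnj (mode g S \<gamma> i (x' i) b)" for f m
  proof -
    have "(\<Prod>i\<in>UNIV. \<Sum>b\<le>N. f i b) = (\<Sum>b\<le>N. f m b) * (\<Prod>i\<in>UNIV - {m}. \<Sum>b\<le>N. f i b)"
      by (rule prod.remove) auto
    also have "(\<Prod>i\<in>UNIV - {m}. \<Sum>b\<le>N. f i b) = (\<Prod>i\<in>UNIV - {m}. ?r i)"
      by (rule prod.cong[OF refl]) (simp add: that)
    finally show ?thesis .
  qed
  have 1: "(\<Sum>y\<in>env_box x. Xi g S \<gamma> x y * cnj (out g S \<gamma> x' y)) = (\<Sum>m\<in>S. ?w m * (\<Prod>i\<in>UNIV - {m}. ?r i))"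
  proof -
    have "(\<Sum>y\<in>env_box x. Xi g S \<gamma> x y * cnj (out g S \<gamma> x' y)) = (\<Sum>y\<in>B. Xi g S \<gamma> x y * cnj (out g S \<gamma> x' y))"
      by (rule sum_env_box) (use B in \<open>auto simp: Xi_eq_0\<close>)
    also have "\<dots> = (\<Sum>m\<in>S. \<Sum>y\<in>B. \<Prod>i\<in>UNIV. xi_mode g S \<gamma> m i (x i) (y i) * cnj (mode g S \<gamma> i (x' i) (y i)))"
      unfolding Xi_def out_def sum_distrib_right cnj_prod prod.distrib by (rule sum.swap)
    also have "\<dots> = (\<Sum>m\<in>S. ?w m * (\<Prod>i\<in>UNIV - {m}. ?r i))"
      unfolding pr[of "\<lambda>i b. xi_mode g S \<gamma> m i (x i) b * cnj (mode g S \<gamma> i (x' i) b)" for m]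
      by (intro sum.cong refl, subst split) (auto simp: xi_mode_def)
    finally show ?thesis .
  qed
  have 2: "cnj (\<Sum>y\<in>env_box x'. Xi g S \<gamma> x' y * cnj (out g S \<gamma> x y)) = (\<Sum>m\<in>S. ?w' m * (\<Prod>i\<in>UNIV - {m}. ?r i))"
  proof -
    have "(\<Sum>y\<in>env_box x'. Xi g S \<gamma> x' y * cnj (out g S \<gamma> x y)) = (\<Sum>y\<in>B. Xi g S \<gamma> x' y * cnj (out g S \<gamma> x y))"
      by (rule sum_env_box) (use B in \<open>auto simp: Xi_eq_0\<close>)
    then have "cnj (\<Sum>y\<in>env_box x'. Xi g S \<gamma> x' y * cnj (out g S \<gamma> x y)) =
        (\<Sum>y\<in>B. \<Sum>m\<in>S. \<Prod>i\<in>UNIV. mode g S \<gamma> i (x i) (y i) * cnj (xi_mode g S \<gamma> m i (x' i) (y i)))"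
      by (simp add: Xi_def out_def sum_distrib_left prod.distrib mult.commute)
    also have "\<dots> = (\<Sum>m\<in>S. \<Sum>y\<in>B. \<Prod>i\<in>UNIV. mode g S \<gamma> i (x i) (y i) * cnj (xi_mode g S \<gamma> m i (x' i) (y i)))"
      by (rule sum.swap)
    also have "\<dots> = (\<Sum>m\<in>S. ?w' m * (\<Prod>i\<in>UNIV - {m}. ?r i))"
      unfolding pr[of "\<lambda>i b. mode g S \<gamma> i (x i) b * cnj (xi_mode g S \<gamma> m i (x' i) b)" for m]
      by (intro sum.cong refl, subst split) (auto simp: xi_mode_def)
    finally show ?thesis .
  qed
  have 3: "(\<Sum>y\<in>env_box x. complex_of_real (kraus_slope g S x y + kraus_slope g S x' y) * (out g S \<gamma> x y * cnj (out g S \<gamma> x' y))) =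
      (\<Sum>m\<in>S. ?s m * (\<Prod>i\<in>UNIV - {m}. ?r i))"
  proof -
    have "(\<Sum>y\<in>env_box x. complex_of_real (kraus_slope g S x y + kraus_slope g S x' y) * (out g S \<gamma> x y * cnj (out g S \<gamma> x' y))) =
        (\<Sum>y\<in>B. complex_of_real (kraus_slope g S x y + kraus_slope g S x' y) * (out g S \<gamma> x y * cnj (out g S \<gamma> x' y)))"
      by (rule sum_env_box) (use B in \<open>auto simp: out_eq_0\<close>)
    also have "\<dots> = (\<Sum>y\<in>B. \<Sum>m\<in>S. complex_of_real (?l m (y m)) * (out g S \<gamma> x y * cnj (out g S \<gamma> x' y)))"
      unfolding kraus_slope_def sum.distrib[symmetric] of_real_sum sum_distrib_right ..
    also have "\<dots> = (\<Sum>m\<in>S. \<Sum>y\<in>B. complex_of_real (?l m (y m)) * (out g S \<gamma> x y * cnj (out g S \<gamma> x' y)))"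
      by (rule sum.swap)
    also have "\<dots> = (\<Sum>m\<in>S. \<Sum>y\<in>B. \<Prod>i\<in>UNIV. (if i = m then complex_of_real (?l m (y i)) else 1) *
        (mode g S \<gamma> i (x i) (y i) * cnj (mode g S \<gamma> i (x' i) (y i))))"
      unfolding out_def cnj_prod prod.distrib by simp
    also have "\<dots> = (\<Sum>m\<in>S. ?s m * (\<Prod>i\<in>UNIV - {m}. ?r i))"
      unfolding pr[of "\<lambda>i b. (if i = m then complex_of_real (?l m b) else 1) * (mode g S \<gamma> i (x i) b * cnj (mode g S \<gamma> i (x' i) b))" for m]
      by (intro sum.cong refl, subst split) auto
    finally show ?thesis .
  qed
  have "?w m + ?w' m = ?s m" if "m \<in> S" for m
    using xi_slope_sum[OF N] that by (simp add: mode_in)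
  then show ?thesis
    unfolding 1 2 3 sum.distrib[symmetric] distrib_right[symmetric] by (intro sum.cong refl) simp
qed

end

section \<open>Mixtures of coherent states\<close>

text \<open>The integral of s bounds all finite sums and gives convergence; enumerating the
  countable type then identifies the value through the theorem on integrals of series.\<close>

lemma has_sum_integral_nonneg:
  fixes f :: "'x::countable \<Rightarrow> 'w \<Rightarrow> real"
  assumes inf: "infinite (UNIV :: 'x set)"
    and f: "\<And>x. integrable \<nu> (f x)" "\<And>x w. f x w \<ge> 0"
    and s: "integrable \<nu> s" "\<And>w. ((\<lambda>x. f x w) has_sum s w) UNIV"
  shows "((\<lambda>x. \<integral>w. f x w \<partial>\<nu>) has_sum (\<integral>w. s w \<partial>\<nu>)) UNIV"
proof -
  define e where "e = from_nat_into (UNIV :: 'x set)"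
  have e: "bij_betw e UNIV UNIV"
    unfolding e_def by (rule bij_betw_from_nat_into) (use inf in auto)
  have nn: "(\<integral>w. f x w \<partial>\<nu>) \<ge> 0" for x by (rule Bochner_Integration.integral_nonneg) (rule f(2))
  have "(\<lambda>x. \<integral>w. f x w \<partial>\<nu>) summable_on UNIV"
  proof (rule nonneg_bdd_above_summable_on[OF nn], rule bdd_aboveI2)
    fix F :: "'x set" assume "F \<in> {F. F \<subseteq> UNIV \<and> finite F}"
    then have F: "finite F" by simp
    have "(\<Sum>x\<in>F. \<integral>w. f x w \<partial>\<nu>) = (\<integral>w. (\<Sum>x\<in>F. f x w) \<partial>\<nu>)"
      by (rule Bochner_Integration.integral_sum[symmetric]) (rule f)
    also have "\<dots> \<le> (\<integral>w. s w \<partial>\<nu>)"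
      by (intro Bochner_Integration.integral_mono Bochner_Integration.integrable_sum f s finite_sum_le_has_sum[OF s(2) F]) auto
    finally show "(\<Sum>x\<in>F. \<integral>w. f x w \<partial>\<nu>) \<le> (\<integral>w. s w \<partial>\<nu>)" .
  qed
  then obtain t where t: "((\<lambda>x. \<integral>w. f x w \<partial>\<nu>) has_sum t) UNIV" by (auto simp: summable_on_def)
  have sums: "(\<lambda>i. \<integral>w. f (e i) w \<partial>\<nu>) sums t" "(\<lambda>i. f (e i) w) sums s w" for w
    using t s(2)[of w] unfolding has_sum_reindex_bij_betw[OF e, symmetric]
    by (auto intro: has_sum_imp_sums)
  have n: "norm (f x w) = f x w" for x w using f(2)[of x w] by simp
  have "(\<lambda>i. \<integral>w. f (e i) w \<partial>\<nu>) sums (\<integral>w. (\<Sum>i. f (e i) w) \<partial>\<nu>)"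
    by (rule sums_integral)
      (use f sums[THEN sums_summable] in \<open>auto simp: n\<close>)
  also have "(\<lambda>w. \<Sum>i. f (e i) w) = s" using sums(2)[THEN sums_unique] by (simp add: fun_eq_iff)
  finally show ?thesis using t sums(1) sums_unique2 by blast
qed

lemma infinite_UNIV_modes: "infinite (UNIV :: ('k::finite \<Rightarrow> nat) set)"
proof
  assume "finite (UNIV :: ('k \<Rightarrow> nat) set)"
  from finite_fun_UNIVD2[OF this] show False by simp
qed

lemma app_le_of_finite:
  assumes dm: "density_matrix \<rho>" and v: "ell2 v" and q: "q \<ge> 0"
    and F: "\<And>F. finite F \<Longrightarrow> (cmod (\<Sum>z\<in>F. Y x z * v z))\<^sup>2 \<le> q * dm_form \<rho> (trunc F v)"
  shows "(cmod (app Y v x))\<^sup>2 \<le> q * dm_form \<rho> v"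
proof (cases "(\<lambda>z. Y x z * v z) summable_on UNIV")
  case True
  then have "((\<lambda>F. \<Sum>z\<in>F. Y x z * v z) \<longlongrightarrow> app Y v x) (finite_subsets_at_top UNIV)"
    unfolding app_def using has_sum_infsum has_sum_def by blast
  then have l: "((\<lambda>F. (cmod (\<Sum>z\<in>F. Y x z * v z))\<^sup>2) \<longlongrightarrow> (cmod (app Y v x))\<^sup>2) (finite_subsets_at_top UNIV)"
    by (intro tendsto_intros)
  have r: "((\<lambda>F. q * dm_form \<rho> (trunc F v)) \<longlongrightarrow> q * dm_form \<rho> v) (finite_subsets_at_top UNIV)"
    by (intro tendsto_intros dm_form_trunc_tendsto[OF dm v])
  show ?thesis
    by (rule tendsto_le[OF _ r l]) (auto intro!: eventually_finite_subsets_at_top_weakI F)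
next
  case False
  \<comment> \<open>The default value of a divergent sum, for which the bound is trivial.\<close>
  then have "app Y v x = 0" unfolding app_def by (rule infsum_not_exists)
  then show ?thesis using q dm_form_nonneg[OF dm v] by simp
qed

definition photon_QFI :: "real \<Rightarrow> 'k::finite set \<Rightarrow> complex ^ 'k \<Rightarrow> real" where
  "photon_QFI g S \<gamma> = (\<Sum>m\<in>S. (cmod (\<gamma> $ m))\<^sup>2) / (g * (2 * g - 1)) + real (card S) / (g * (g - 1))"

lemma coherent1_continuous [continuous_intros]:
  "continuous_on UNIV (\<lambda>\<gamma> :: complex ^ 'k::finite. coherent1 (\<gamma> $ i) n)"
  unfolding coherent1_def by (intro continuous_intros) auto

lemma coherent_continuous: "continuous_on UNIV (\<lambda>\<gamma> :: complex ^ 'k::finite. coherent \<gamma> x)"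
  unfolding coherent_def by (intro continuous_intros)

lemma out_continuous: "continuous_on UNIV (\<lambda>\<gamma>. out g S \<gamma> x y)"
  unfolding out_def mode_def by (intro continuous_intros)

lemma Xi_continuous:
  assumes g: "g > 1" shows "continuous_on UNIV (\<lambda>\<gamma>. Xi g S \<gamma> x y)"
proof -
  have "continuous_on UNIV (\<lambda>\<gamma>. xi_mode g S \<gamma> m i a b)" for m i a b
    unfolding xi_mode_def mode_def
    by (cases "i = m") (auto simp: xi_def[OF g] xi_off_def[OF g] ff_def[OF g] intro!: continuous_intros)
  then show ?thesis unfolding Xi_def by (intro continuous_intros)
qed

lemma has_sum_box_rows:
  fixes f :: "('k::finite \<Rightarrow> nat) \<Rightarrow> ('k \<Rightarrow> nat) \<Rightarrow> real"
  assumes s: "((\<lambda>(x, y). f x y) has_sum s) UNIV" and z: "\<And>x y. y \<notin> env_box x \<Longrightarrow> f x y = 0"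
  shows "((\<lambda>x. \<Sum>y\<in>env_box x. f x y) has_sum s) UNIV"
proof (rule has_sum_SigmaD[where f = "\<lambda>(x, y). f x y" and B = "\<lambda>_. UNIV"])
  show "((\<lambda>(x, y). f x y) has_sum s) (UNIV \<times> UNIV)" using s by simp
  show "((\<lambda>y. case (x, y) of (x, y) \<Rightarrow> f x y) has_sum (\<Sum>y\<in>env_box x. f x y)) UNIV" for x
    by (rule has_sum_finite_neutralI[OF finite_env_box]) (use z in auto)
qed

lemma out_norm_le:
  assumes "g > 1" shows "cmod (out g S \<gamma> x y) \<le> 1"
proof -
  have "(\<Sum>(x, y)\<in>{(x, y)}. (cmod (out g S \<gamma> x y))\<^sup>2) \<le> 1"
    by (rule finite_sum_le_has_sum[OF out_total[OF assms]]) auto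
  then show ?thesis by (simp add: power_le_one_iff)
qed

lemma Xi_norm_le:
  assumes "g > 1" shows "(cmod (Xi g S \<gamma> x y))\<^sup>2 \<le> photon_QFI g S \<gamma>"
proof -
  have "(\<Sum>(x, y)\<in>{(x, y)}. (cmod (Xi g S \<gamma> x y))\<^sup>2) \<le> photon_QFI g S \<gamma>"
    unfolding photon_QFI_def by (rule finite_sum_le_has_sum[OF Xi_norm[OF assms]]) auto
  then show ?thesis by simp
qed

text \<open>The probability measure \<open>\<nu>\<close> is \<open>density lborel P\<close> for a classical state and lives on a single point for a pure
  coherent state.\<close>

context
  fixes \<nu> :: "'w measure" and \<Gamma> :: "'w \<Rightarrow> complex ^ 'k::finite" and G :: real and S :: "'k set"
  assumes G: "G > 1" and \<Gamma>: "\<Gamma> \<in> borel_measurable \<nu>" and mass: "emeasure \<nu> (space \<nu>) = 1"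
    and photons: "integrable \<nu> (\<lambda>w. \<Sum>m\<in>S. (cmod (\<Gamma> w $ m))\<^sup>2)"
begin

definition mixture :: "('k \<Rightarrow> nat) mat" where
  "mixture = (\<lambda>x x'. \<integral>w. pure (coherent (\<Gamma> w)) x x' \<partial>\<nu>)"

definition mix_Y :: "('k \<Rightarrow> nat) mat" where
  "mix_Y = (\<lambda>x x'. \<integral>w. (\<Sum>y\<in>env_box x. Xi G S (\<Gamma> w) x y * cnj (out G S (\<Gamma> w) x' y)) \<partial>\<nu>)"

definition mix_q :: "('k \<Rightarrow> nat) \<Rightarrow> real" where
  "mix_q x = (\<integral>w. (\<Sum>y\<in>env_box x. (cmod (Xi G S (\<Gamma> w) x y))\<^sup>2) \<partial>\<nu>)"

lemma const_integrable: "integrable \<nu> (\<lambda>_. c :: 'b::{banach, second_countable_topology})"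
  by (rule finite_measure.integrable_const) (rule finite_measureI, simp add: mass)

lemma const_integral: "(\<integral>w. c \<partial>\<nu>) = (c :: real)"
  by (simp add: measure_def mass)

lemma comp_measurable:
  fixes f :: "complex ^ 'k \<Rightarrow> complex"
  assumes "continuous_on UNIV f" shows "(\<lambda>w. f (\<Gamma> w)) \<in> borel_measurable \<nu>"
  by (rule measurable_compose[OF \<Gamma> borel_measurable_continuous_onI[OF assms]])

lemmas kernel_measurable = comp_measurable[OF out_continuous[of G S]] comp_measurable[OF Xi_continuous[OF G, of S]]

lemma QFI_integrable: "integrable \<nu> (\<lambda>w. photon_QFI G S (\<Gamma> w))"
  unfolding photon_QFI_def by (intro Bochner_Integration.integrable_add const_integrable Bochner_Integration.integrable_divide photons)

lemma out_out_integrable: "integrable \<nu> (\<lambda>w. out G S (\<Gamma> w) x y * cnj (out G S (\<Gamma> w) x' y'))"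
proof (rule Bochner_Integration.integrable_bound[OF const_integrable[of 1]])
  show "(\<lambda>w. out G S (\<Gamma> w) x y * cnj (out G S (\<Gamma> w) x' y')) \<in> borel_measurable \<nu>"
    by (rule comp_measurable) (intro continuous_intros out_continuous)
  show "AE w in \<nu>. norm (out G S (\<Gamma> w) x y * cnj (out G S (\<Gamma> w) x' y')) \<le> norm (1 :: real)"
    using out_norm_le[OF G] by (auto simp: norm_mult intro!: AE_I2 mult_le_one)
qed

lemma Xi_sq_integrable: "integrable \<nu> (\<lambda>w. (cmod (Xi G S (\<Gamma> w) x y))\<^sup>2)"
proof (rule Bochner_Integration.integrable_bound[OF QFI_integrable])
  show "(\<lambda>w. (cmod (Xi G S (\<Gamma> w) x y))\<^sup>2) \<in> borel_measurable \<nu>"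
    by (intro borel_measurable_power measurable_compose[OF kernel_measurable(2) borel_measurable_norm])
  show "AE w in \<nu>. norm ((cmod (Xi G S (\<Gamma> w) x y))\<^sup>2) \<le> norm (photon_QFI G S (\<Gamma> w))"
    using order_trans[OF Xi_norm_le[OF G] abs_ge_self] by (auto intro!: AE_I2)
qed

lemma Xi_out_integrable: "integrable \<nu> (\<lambda>w. Xi G S (\<Gamma> w) x y * cnj (out G S (\<Gamma> w) x' y'))"
proof (rule Bochner_Integration.integrable_bound[OF Bochner_Integration.integrable_add[OF const_integrable[of 1] Xi_sq_integrable[of x y]]])
  show "(\<lambda>w. Xi G S (\<Gamma> w) x y * cnj (out G S (\<Gamma> w) x' y')) \<in> borel_measurable \<nu>"
    by (rule comp_measurable) (intro continuous_intros out_continuous Xi_continuous[OF G])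
  have le: "a * b \<le> 1 + a\<^sup>2" if "0 \<le> a" "0 \<le> b" "b \<le> 1" for a b :: real
  proof -
    have "a * b \<le> a" using that mult_left_mono[of b 1 a] by simp
    moreover have "0 \<le> (a - 1)\<^sup>2" "0 \<le> a\<^sup>2" by simp_all
    ultimately show ?thesis using that(1) by (simp add: power2_eq_square algebra_simps)
  qed
  show "AE w in \<nu>. norm (Xi G S (\<Gamma> w) x y * cnj (out G S (\<Gamma> w) x' y')) \<le> norm (1 + (cmod (Xi G S (\<Gamma> w) x y))\<^sup>2)"
    using out_norm_le[OF G] by (auto simp: norm_mult intro!: AE_I2 le)
qed

text \<open>The Kraus factors do not depend on the integration variable. All dependence on the gain
  therefore sits in a finite sum outside the integral, and nothing has to be differentiated under
  it.\<close>

lemma mix_out: "(\<integral>w. out G S (\<Gamma> w) x y * cnj (out G S (\<Gamma> w) x' y) \<partial>\<nu>) =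
    complex_of_real (kraus G S x y * kraus G S x' y) * mixture (\<lambda>i. x i - y i) (\<lambda>i. x' i - y i)"
proof -
  have "out G S (\<Gamma> w) x y * cnj (out G S (\<Gamma> w) x' y) = complex_of_real (kraus G S x y * kraus G S x' y) *
      pure (coherent (\<Gamma> w)) (\<lambda>i. x i - y i) (\<lambda>i. x' i - y i)" for w
    by (simp add: out_eq pure_def)
  then show ?thesis unfolding mixture_def by (simp del: of_real_mult)
qed

lemma amplify_mixture:
  assumes A: "finite A" "env_box x \<subseteq> A"
  shows "amplify G S mixture x x' = (\<integral>w. (\<Sum>y\<in>A. out G S (\<Gamma> w) x y * cnj (out G S (\<Gamma> w) x' y)) \<partial>\<nu>)"
proof -
  have "amplify G S mixture x x' = (\<Sum>y\<in>A. \<integral>w. out G S (\<Gamma> w) x y * cnj (out G S (\<Gamma> w) x' y) \<partial>\<nu>)"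
    unfolding mix_out by (rule amplify_entry[OF G A(1)]) (use A(2) in \<open>auto simp: env_box_def le_SucI\<close>)
  then show ?thesis by (simp only: Bochner_Integration.integral_sum[OF out_out_integrable])
qed

lemma mix_Y_eq:
  assumes A: "finite A" "env_box x \<subseteq> A"
  shows "mix_Y x x' = (\<integral>w. (\<Sum>y\<in>A. Xi G S (\<Gamma> w) x y * cnj (out G S (\<Gamma> w) x' y)) \<partial>\<nu>)"
proof -
  have "(\<Sum>y\<in>env_box x. Xi G S (\<Gamma> w) x y * cnj (out G S (\<Gamma> w) x' y)) =
      (\<Sum>y\<in>A. Xi G S (\<Gamma> w) x y * cnj (out G S (\<Gamma> w) x' y))" for w
    by (rule sum_env_box[OF G A(1)]) (use A(2) in \<open>auto simp: Xi_eq_0[OF G]\<close>)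
  then show ?thesis by (simp only: mix_Y_def)
qed

text \<open>The output as an average of sums of projections, which makes the form a manifestly
  nonnegative integral of squares.\<close>

lemma mix_form:
  assumes F: "finite F" and A: "finite A" "\<And>x. x \<in> F \<Longrightarrow> env_box x \<subseteq> A"
  shows "(\<Sum>x\<in>F. \<Sum>z\<in>F. cnj (v x) * amplify G S mixture x z * v z) =
    complex_of_real (\<integral>w. (\<Sum>y\<in>A. (cmod (\<Sum>x\<in>F. cnj (v x) * out G S (\<Gamma> w) x y))\<^sup>2) \<partial>\<nu>)"
proof -
  have "(\<Sum>x\<in>F. \<Sum>z\<in>F. cnj (v x) * amplify G S mixture x z * v z) =
      (\<Sum>x\<in>F. \<Sum>z\<in>F. \<integral>w. cnj (v x) * (\<Sum>y\<in>A. out G S (\<Gamma> w) x y * cnj (out G S (\<Gamma> w) z y)) * v z \<partial>\<nu>)"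
    using amplify_mixture[OF A(1) A(2)] by (intro sum.cong refl) simp
  also have "\<dots> = (\<integral>w. (\<Sum>x\<in>F. \<Sum>z\<in>F. cnj (v x) * (\<Sum>y\<in>A. out G S (\<Gamma> w) x y * cnj (out G S (\<Gamma> w) z y)) * v z) \<partial>\<nu>)"
    by (simp only: Bochner_Integration.integral_sum Bochner_Integration.integrable_sum Bochner_Integration.integrable_mult_left Bochner_Integration.integrable_mult_right out_out_integrable)
  also have "\<dots> = (\<integral>w. complex_of_real (\<Sum>y\<in>A. (cmod (\<Sum>x\<in>F. cnj (v x) * out G S (\<Gamma> w) x y))\<^sup>2) \<partial>\<nu>)"
  proof (rule Bochner_Integration.integral_cong[OF refl])
    fix w
    have "complex_of_real (\<Sum>y\<in>A. (cmod (\<Sum>x\<in>F. cnj (v x) * out G S (\<Gamma> w) x y))\<^sup>2) =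
        (\<Sum>y\<in>A. (\<Sum>x\<in>F. cnj (v x) * out G S (\<Gamma> w) x y) * (\<Sum>z\<in>F. cnj (out G S (\<Gamma> w) z y) * v z))"
      unfolding of_real_sum by (intro sum.cong refl) (simp add: complex_norm_square mult.commute del: of_real_power)
    also have "\<dots> = (\<Sum>y\<in>A. \<Sum>x\<in>F. \<Sum>z\<in>F. cnj (v x) * (out G S (\<Gamma> w) x y * cnj (out G S (\<Gamma> w) z y)) * v z)"
      unfolding sum_product by (intro sum.cong refl) (simp only: mult.assoc)
    also have "\<dots> = (\<Sum>x\<in>F. \<Sum>z\<in>F. \<Sum>y\<in>A. cnj (v x) * (out G S (\<Gamma> w) x y * cnj (out G S (\<Gamma> w) z y)) * v z)"
      by (rule trans[OF sum.swap]) (rule sum.cong[OF refl], rule sum.swap)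
    finally show "(\<Sum>x\<in>F. \<Sum>z\<in>F. cnj (v x) * (\<Sum>y\<in>A. out G S (\<Gamma> w) x y * cnj (out G S (\<Gamma> w) z y)) * v z) =
        complex_of_real (\<Sum>y\<in>A. (cmod (\<Sum>x\<in>F. cnj (v x) * out G S (\<Gamma> w) x y))\<^sup>2)"
      by (simp only: sum_distrib_left sum_distrib_right)
  qed
  finally show ?thesis by (simp only: integral_complex_of_real)
qed

lemma finite_env_boxes: "finite F \<Longrightarrow> finite (\<Union>x\<in>F. env_box x)"
  by (simp add: finite_env_box)

lemma mix_density: "density_matrix (amplify G S mixture)"
  unfolding density_matrix_def
proof (intro conjI allI impI)
  show "amplify G S mixture x y = cnj (amplify G S mixture y x)" for x y
  proof -
    have A: "finite (env_box x \<union> env_box y)" by (simp add: finite_env_box)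
    show ?thesis
      unfolding amplify_mixture[OF A Un_upper1] amplify_mixture[OF A Un_upper2] Bochner_Integration.integral_cnj[symmetric]
      by (simp add: mult.commute)
  qed
  show "0 \<le> Re (\<Sum>x\<in>F. \<Sum>y\<in>F. cnj (v x) * amplify G S mixture x y * v y)" if "finite F" for F v
    using mix_form[OF that finite_env_boxes[OF that], of v]
    by (simp add: UN_upper sum_nonneg del: Re_sum)
  have "((\<lambda>x. \<integral>w. (\<Sum>y\<in>env_box x. (cmod (out G S (\<Gamma> w) x y))\<^sup>2) \<partial>\<nu>) has_sum (\<integral>w. 1 \<partial>\<nu>)) UNIV"
  proof (rule has_sum_integral_nonneg[OF infinite_UNIV_modes])
    have "integrable \<nu> (\<lambda>w. Re (out G S (\<Gamma> w) x y * cnj (out G S (\<Gamma> w) x y)))" for x y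
      by (intro integrable_Re out_out_integrable)
    then show "integrable \<nu> (\<lambda>w. \<Sum>y\<in>env_box x. (cmod (out G S (\<Gamma> w) x y))\<^sup>2)" for x
      by (intro Bochner_Integration.integrable_sum) (simp only: complex_norm_square[symmetric] Re_complex_of_real)
    show "((\<lambda>x. \<Sum>y\<in>env_box x. (cmod (out G S (\<Gamma> w) x y))\<^sup>2) has_sum 1) UNIV" for w
      by (rule has_sum_box_rows[OF out_total[OF G]]) (simp add: out_eq_0[OF G])
  qed (auto intro: sum_nonneg const_integrable)
  moreover have "Re (amplify G S mixture x x) = (\<integral>w. (\<Sum>y\<in>env_box x. (cmod (out G S (\<Gamma> w) x y))\<^sup>2) \<partial>\<nu>)" for x
    unfolding amplify_mixture[OF finite_env_box order_refl] complex_norm_square[symmetric] of_real_sum[symmetric]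
    by (simp only: integral_complex_of_real Re_complex_of_real)
  ultimately show "((\<lambda>x. Re (amplify G S mixture x x)) has_sum 1) UNIV" unfolding const_integral by (simp only:)
qed

lemma mix_derivative:
  "((\<lambda>g. amplify g S mixture x x') has_vector_derivative (mix_Y x x' + adj mix_Y x x') / 2) (at G)"
proof -
  let ?c = "\<lambda>y. mixture (\<lambda>i. x i - y i) (\<lambda>i. x' i - y i)"
  let ?l = "\<lambda>y. kraus_slope G S x y + kraus_slope G S x' y"
  let ?k = "\<lambda>g y. kraus g S x y * kraus g S x' y"
  let ?p = "\<lambda>w y. out G S (\<Gamma> w) x y * cnj (out G S (\<Gamma> w) x' y)"
  have "((\<lambda>g. \<Sum>y\<in>env_box x. complex_of_real (?k g y) * ?c y) has_vector_derivative
      (\<Sum>y\<in>env_box x. complex_of_real (?l y / 2 * ?k G y) * ?c y)) (at G)"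
    by (intro has_vector_derivative_sum has_vector_derivative_mult_left has_vector_derivative_of_real
        kraus_derivative[OF G])
  moreover have "(\<Sum>y\<in>env_box x. complex_of_real (?l y / 2 * ?k G y) * ?c y) = (mix_Y x x' + adj mix_Y x x') / 2"
  proof -
    have "mix_Y x x' + adj mix_Y x x' =
        (\<integral>w. (\<Sum>y\<in>env_box x. Xi G S (\<Gamma> w) x y * cnj (out G S (\<Gamma> w) x' y)) +
          cnj (\<Sum>y\<in>env_box x'. Xi G S (\<Gamma> w) x' y * cnj (out G S (\<Gamma> w) x y)) \<partial>\<nu>)"
      unfolding adj_def mix_Y_def Bochner_Integration.integral_cnj[symmetric]
      by (rule Bochner_Integration.integral_add[symmetric]) (intro integrable_cnj Bochner_Integration.integrable_sum Xi_out_integrable)+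
    also have "\<dots> = (\<Sum>y\<in>env_box x. complex_of_real (?l y) * (\<integral>w. ?p w y \<partial>\<nu>))"
      unfolding Xi_slope[OF G] by (subst Bochner_Integration.integral_sum) (auto intro: out_out_integrable)
    finally show ?thesis
      unfolding mix_out by (simp add: sum_divide_distrib mult.assoc)
  qed
  \<comment> \<open>The formula holds for gains above 1, an open set around G, which suffices for
    the derivative.\<close>
  moreover have "(\<Sum>y\<in>env_box x. complex_of_real (?k g y) * ?c y) = amplify g S mixture x x'" if "g \<in> {1<..}" for g
    using that by (intro amplify_entry[symmetric] finite_env_box) (auto simp: env_box_def le_SucI)
  ultimately show ?thesis
    using has_vector_derivative_transform_within_open[of _ _ G "{1<..}"] G
    by (metis (lifting) open_greaterThan greaterThan_iff)
qed

text \<open>Cauchy-Schwarz jointly in the mixture variable w and the environment index y, with the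
  vectors \<open>Xi\<close> and B: their squared norms are \<open>mix_q x\<close> and the form of
  the output state. It is run with the weight t, so that only integrals of squares occur.\<close>

lemma mix_Y_le:
  assumes v: "ell2 v"
  shows "(cmod (app mix_Y v x))\<^sup>2 \<le> mix_q x * dm_form (amplify G S mixture) v"
proof (rule app_le_of_finite[OF mix_density v])
  show q: "mix_q x \<ge> 0" unfolding mix_q_def by (simp add: sum_nonneg Bochner_Integration.integral_nonneg)
  fix F :: "('k \<Rightarrow> nat) set" assume F: "finite F"
  define A where "A = env_box x \<union> (\<Union>z\<in>F. env_box z)"
  have A: "finite A" "env_box x \<subseteq> A" "\<And>z. z \<in> F \<Longrightarrow> env_box z \<subseteq> A"
    unfolding A_def using F by (auto simp: finite_env_box)
  define B where "B w y = (\<Sum>z\<in>F. cnj (v z) * out G S (\<Gamma> w) z y)" for w y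
  define f where "f = (\<integral>w. (\<Sum>y\<in>A. (cmod (B w y))\<^sup>2) \<partial>\<nu>)"
  have form: "dm_form (amplify G S mixture) (trunc F v) = f"
    using mix_form[OF F A(1), of v] A(3) unfolding dm_form_trunc[OF mix_density F] f_def B_def by simp
  have f: "f \<ge> 0" unfolding f_def by (simp add: sum_nonneg Bochner_Integration.integral_nonneg)
  have qA: "mix_q x = (\<integral>w. (\<Sum>y\<in>A. (cmod (Xi G S (\<Gamma> w) x y))\<^sup>2) \<partial>\<nu>)"
    unfolding mix_q_def
    by (intro Bochner_Integration.integral_cong refl sum_env_box[OF G A(1)]) (use A(2) in \<open>auto simp: Xi_eq_0[OF G]\<close>)
  have YF: "(\<Sum>z\<in>F. mix_Y x z * v z) = (\<integral>w. (\<Sum>y\<in>A. Xi G S (\<Gamma> w) x y * cnj (B w y)) \<partial>\<nu>)"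
  proof -
    have "(\<Sum>z\<in>F. mix_Y x z * v z) =
        (\<Sum>z\<in>F. \<integral>w. (\<Sum>y\<in>A. Xi G S (\<Gamma> w) x y * cnj (out G S (\<Gamma> w) z y)) * v z \<partial>\<nu>)"
      unfolding mix_Y_eq[OF A(1,2)] by simp
    also have "\<dots> = (\<integral>w. (\<Sum>z\<in>F. (\<Sum>y\<in>A. Xi G S (\<Gamma> w) x y * cnj (out G S (\<Gamma> w) z y)) * v z) \<partial>\<nu>)"
      by (rule Bochner_Integration.integral_sum[symmetric]) (intro Bochner_Integration.integrable_mult_left Bochner_Integration.integrable_sum Xi_out_integrable)
    also have "\<dots> = (\<integral>w. (\<Sum>y\<in>A. Xi G S (\<Gamma> w) x y * cnj (B w y)) \<partial>\<nu>)"
    proof (rule Bochner_Integration.integral_cong[OF refl])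
      fix w
      show "(\<Sum>z\<in>F. (\<Sum>y\<in>A. Xi G S (\<Gamma> w) x y * cnj (out G S (\<Gamma> w) z y)) * v z) =
          (\<Sum>y\<in>A. Xi G S (\<Gamma> w) x y * cnj (B w y))"
        unfolding B_def sum_distrib_right cnj_sum sum_distrib_left
        by (subst sum.swap) (simp add: mult_ac)
    qed
    finally show ?thesis .
  qed
  have B_int: "integrable \<nu> (\<lambda>w. (cmod (B w y))\<^sup>2)" for y
  proof -
    have "integrable \<nu> (\<lambda>w. Re (\<Sum>z\<in>F. \<Sum>z'\<in>F. (cnj (v z) * v z') * (out G S (\<Gamma> w) z y * cnj (out G S (\<Gamma> w) z' y))))"
      by (intro integrable_Re Bochner_Integration.integrable_sum Bochner_Integration.integrable_mult_right out_out_integrable)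
    moreover have "(\<Sum>z\<in>F. \<Sum>z'\<in>F. (cnj (v z) * v z') * (out G S (\<Gamma> w) z y * cnj (out G S (\<Gamma> w) z' y))) =
        complex_of_real ((cmod (B w y))\<^sup>2)" for w
      unfolding complex_norm_square B_def cnj_sum sum_product by (simp add: mult_ac)
    ultimately show ?thesis by (simp only: Re_complex_of_real)
  qed
  have "(cmod (\<Sum>z\<in>F. mix_Y x z * v z))\<^sup>2 \<le> mix_q x * f"
  proof (rule sq_le_of_weighted_bound[OF _ norm_ge_zero q f])
    fix t :: real assume t: "t > 0"
    have "2 * cmod (\<Sum>z\<in>F. mix_Y x z * v z) \<le> 2 * (\<integral>w. cmod (\<Sum>y\<in>A. Xi G S (\<Gamma> w) x y * cnj (B w y)) \<partial>\<nu>)"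
      unfolding YF by (simp add: integral_norm_bound)
    also have "\<dots> = (\<integral>w. 2 * cmod (\<Sum>y\<in>A. Xi G S (\<Gamma> w) x y * cnj (B w y)) \<partial>\<nu>)" by simp
    also have "\<dots> \<le> (\<integral>w. t * (\<Sum>y\<in>A. (cmod (Xi G S (\<Gamma> w) x y))\<^sup>2) + (\<Sum>y\<in>A. (cmod (B w y))\<^sup>2) / t \<partial>\<nu>)"
    proof (rule integral_mono_AE')
      show "integrable \<nu> (\<lambda>w. t * (\<Sum>y\<in>A. (cmod (Xi G S (\<Gamma> w) x y))\<^sup>2) + (\<Sum>y\<in>A. (cmod (B w y))\<^sup>2) / t)"
        by (intro Bochner_Integration.integrable_add Bochner_Integration.integrable_mult_right Bochner_Integration.integrable_divide Bochner_Integration.integrable_sum Xi_sq_integrable B_int)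
      have am: "2 * (a * b) \<le> t * a\<^sup>2 + b\<^sup>2 / t" for a b :: real
      proof -
        have "0 \<le> (t * a - b)\<^sup>2 / t" using t by simp
        also have "\<dots> = t * a\<^sup>2 + b\<^sup>2 / t - 2 * (a * b)"
          using t by (simp add: power2_eq_square field_simps)
        finally show ?thesis by simp
      qed
      have "2 * cmod (\<Sum>y\<in>A. Xi G S (\<Gamma> w) x y * cnj (B w y)) \<le>
          t * (\<Sum>y\<in>A. (cmod (Xi G S (\<Gamma> w) x y))\<^sup>2) + (\<Sum>y\<in>A. (cmod (B w y))\<^sup>2) / t" for w
      proof -
        have "2 * cmod (\<Sum>y\<in>A. Xi G S (\<Gamma> w) x y * cnj (B w y)) \<le>
            (\<Sum>y\<in>A. 2 * (cmod (Xi G S (\<Gamma> w) x y) * cmod (B w y)))"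
          using norm_sum[of "\<lambda>y. Xi G S (\<Gamma> w) x y * cnj (B w y)" A]
          by (simp add: norm_mult sum_distrib_left[symmetric])
        also have "\<dots> \<le> (\<Sum>y\<in>A. t * (cmod (Xi G S (\<Gamma> w) x y))\<^sup>2 + (cmod (B w y))\<^sup>2 / t)"
          by (intro sum_mono am)
        finally show ?thesis by (simp add: sum.distrib sum_distrib_left sum_divide_distrib)
      qed
      then show "AE w in \<nu>. 2 * cmod (\<Sum>y\<in>A. Xi G S (\<Gamma> w) x y * cnj (B w y)) \<le>
          t * (\<Sum>y\<in>A. (cmod (Xi G S (\<Gamma> w) x y))\<^sup>2) + (\<Sum>y\<in>A. (cmod (B w y))\<^sup>2) / t" by simp
    qed (use t in \<open>auto intro!: AE_I2 add_nonneg_nonneg mult_nonneg_nonneg divide_nonneg_pos sum_nonneg\<close>)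
    also have "\<dots> = t * mix_q x + f / t"
      unfolding qA f_def
      by (subst Bochner_Integration.integral_add) (auto intro!: Bochner_Integration.integrable_add Bochner_Integration.integrable_mult_right Bochner_Integration.integrable_divide Bochner_Integration.integrable_sum Xi_sq_integrable B_int)
    finally show "2 * cmod (\<Sum>z\<in>F. mix_Y x z * v z) \<le> t * mix_q x + f / t" .
  qed
  then show "(cmod (\<Sum>z\<in>F. mix_Y x z * v z))\<^sup>2 \<le> mix_q x * dm_form (amplify G S mixture) (trunc F v)"
    unfolding form .
qed

lemma mix_q_has_sum: "(mix_q has_sum (\<integral>w. photon_QFI G S (\<Gamma> w) \<partial>\<nu>)) UNIV"
  unfolding mix_q_def[abs_def]
proof (rule has_sum_integral_nonneg[OF infinite_UNIV_modes])
  show "integrable \<nu> (\<lambda>w. \<Sum>y\<in>env_box x. (cmod (Xi G S (\<Gamma> w) x y))\<^sup>2)" for x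
    by (intro Bochner_Integration.integrable_sum Xi_sq_integrable)
  show "((\<lambda>x. \<Sum>y\<in>env_box x. (cmod (Xi G S (\<Gamma> w) x y))\<^sup>2) has_sum photon_QFI G S (\<Gamma> w)) UNIV" for w
    unfolding photon_QFI_def by (rule has_sum_box_rows[OF Xi_norm[OF G]]) (simp add: Xi_eq_0[OF G])
qed (auto intro: sum_nonneg QFI_integrable)

theorem mixture_QFI_le:
  "\<exists>K. has_QFI (\<lambda>g. amplify g S mixture) G K \<and> K \<le> (\<integral>w. photon_QFI G S (\<Gamma> w) \<partial>\<nu>)"
proof (rule QFI_exists_le[OF mix_density infinite_UNIV_modes mix_derivative mix_Y_le])
  show "mix_q x \<ge> 0" for x unfolding mix_q_def by (simp add: sum_nonneg Bochner_Integration.integral_nonneg)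
  show "mix_q summable_on UNIV" by (rule has_sum_imp_summable[OF mix_q_has_sum])
  show "(\<Sum>\<^sub>\<infinity>x. mix_q x) \<le> (\<integral>w. photon_QFI G S (\<Gamma> w) \<partial>\<nu>)" by (simp add: infsumI[OF mix_q_has_sum])
qed

end

section \<open>A single coherent state\<close>

text \<open>For a pure coherent state the logarithmic derivative of each amplified mode is explicit: it is
  \<open>c (cnj \<alpha> a + \<alpha> a\<^sup>\<dagger>) + d (a\<^sup>\<dagger> a)\<close> with \<open>c = sld_c g\<close> and \<open>d = sld_d g \<alpha>\<close>, a tridiagonal matrix.\<close>

definition sld_c :: "real \<Rightarrow> real" where
  "sld_c g = - sqrt g / ((2 * g - 1) * (g - 1))"

definition sld_d :: "real \<Rightarrow> complex \<Rightarrow> nat \<Rightarrow> real" where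
  "sld_d g \<alpha> a = real a / (g * (g - 1)) - 1 / g + (cmod \<alpha>)\<^sup>2 / ((2 * g - 1) * (g - 1))"

text \<open>The origin of \<open>kappa\<close>. In twice the gain derivative of \<open>ff\<close>,
  replacing y by x - (x - y) and using \<open>ff_raise_a\<close> gives the signal creation the
  coefficient -1 / (sqrt g (g - 1)). With a multiple k of the antihermitian term,
  \<open>ff_raise_e\<close> adds k sqrt (g - 1) / sqrt g to it, and \<open>ff_lower_a\<close> gives
  the annihilation the coefficient -k sqrt g / sqrt (g - 1). Equality of both, that is hermiticity,
  forces k = \<open>kappa\<close>; the common value is \<open>sld_c\<close>, and the remaining
  diagonal terms form \<open>sld_d\<close>.\<close>

lemma xi_tridiagonal:
  assumes g: "g > 1"
  shows "xi g \<alpha> a y = complex_of_real (sld_c g) * cnj \<alpha> * rt (Suc a) * ff g \<alpha> (Suc a) y +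
    complex_of_real (sld_c g) * \<alpha> * rt a * ff g \<alpha> (a - 1) y + complex_of_real (sld_d g \<alpha> a) * ff g \<alpha> a y"
proof -
  define i j k where "i = 1 / g" and "j = 1 / (g - 1)" and "k = 1 / (2 * g - 1)"
  define F where "F = ff g \<alpha> a y"
  define F' where "F' = rt y * ff g \<alpha> a (y - 1)"
  have s: "sqrt g \<noteq> 0" "sqrt (g - 1) \<noteq> 0" "sqrt g * sqrt g = g" "sqrt (g - 1) * sqrt (g - 1) = g - 1" using g by auto
  \<comment> \<open>Partial fractions, used as rewrite rules that reduce products of reciprocals to
    linear terms.\<close>
  have ij: "g * i = 1" "g * j = 1 + j" "2 * (g * k) = 1 + k" "i * j = j - i" "k * j = j - 2 * k"
    using g by (simp_all add: i_def j_def k_def divide_simps) (simp_all add: algebra_simps)?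
  have c1: "sld_c g / sqrt g = - (k * j)" "sld_c g * (sqrt (g - 1) / sqrt g) = - kappa g" "sld_c g * sqrt g = - (g * (k * j))"
    using g s by (simp_all add: sld_c_def kappa_def[OF g] k_def j_def divide_simps)
  have 1: "complex_of_real (sld_c g) * cnj \<alpha> * rt (Suc a) * ff g \<alpha> (Suc a) y =
      complex_of_real (sld_c g / sqrt g) * (cnj \<alpha> * \<alpha>) * F + complex_of_real (sld_c g * (sqrt (g - 1) / sqrt g)) * cnj \<alpha> * F'"
    using arg_cong[OF ff_lower_a[OF g, of a \<alpha> y], of "\<lambda>z. complex_of_real (sld_c g) * cnj \<alpha> * z"]
    by (simp add: F_def F'_def algebra_simps)
  have 2: "complex_of_real (sld_c g) * \<alpha> * rt a * ff g \<alpha> (a - 1) y =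
      complex_of_real ((sld_c g * sqrt g) * (real a - real y)) * F"
    using arg_cong[OF ff_raise_a[OF g, of \<alpha> a y], of "\<lambda>z. complex_of_real (sld_c g) * z"]
    by (simp add: F_def algebra_simps)
  have 3: "cnj \<alpha> * \<alpha> = complex_of_real ((cmod \<alpha>)\<^sup>2)"
    by (simp only: complex_norm_square mult.commute)
  have 4: "xi g \<alpha> a y = complex_of_real (xi_diag g a y) * F - complex_of_real (kappa g) * cnj \<alpha> * F'"
    by (simp add: xi_def[OF g] xi_off_def[OF g] F_def F'_def)
  have 5: "xi_diag g a y = - (k * j) * (cmod \<alpha>)\<^sup>2 + - (g * (k * j)) * (real a - real y) + sld_d g \<alpha> a"
  proof -
    have d: "sld_d g \<alpha> a = real a * (i * j) - i + (cmod \<alpha>)\<^sup>2 * (k * j)"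
      by (simp add: sld_d_def i_def j_def k_def)
    have "xi_diag g a y = real y * j - (real a + 1) * i + (real a - real y) * k"
      by (simp add: xi_diag_def[OF g] i_def j_def k_def)
    moreover have gkj: "g * (k * j) = j - k"
    proof -
      have "g * (k * j) = g * j - 2 * (g * k)" unfolding ij(5) by (simp add: algebra_simps)
      then show ?thesis using ij by simp
    qed
    ultimately show ?thesis unfolding d ij(4) gkj by (simp add: algebra_simps)
  qed
  show ?thesis
    unfolding 1 2 3 4 5 c1 F_def[symmetric] by (simp add: algebra_simps)
qed

context
  fixes \<gamma> :: "complex ^ 'k::finite" and G :: real and S :: "'k set"
  assumes G: "G > 1"
begin

definition nbrs :: "('k \<Rightarrow> nat) \<Rightarrow> ('k \<Rightarrow> nat) set" where
  "nbrs x = insert x ((\<lambda>m. x(m := Suc (x m))) ` S \<union> (\<lambda>m. x(m := x m - 1)) ` S)"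

definition sld_up :: "'k \<Rightarrow> ('k \<Rightarrow> nat) \<Rightarrow> ('k \<Rightarrow> nat) \<Rightarrow> complex" where
  "sld_up m x w = (if w = x(m := Suc (x m)) then complex_of_real (sld_c G) * cnj (\<gamma> $ m) * rt (Suc (x m)) else 0)"

text \<open>For x(m) = 0 the truncated subtraction returns x itself, and the factor
  \<open>rt 0 = 0\<close> removes the entry.\<close>

definition sld_down :: "'k \<Rightarrow> ('k \<Rightarrow> nat) \<Rightarrow> ('k \<Rightarrow> nat) \<Rightarrow> complex" where
  "sld_down m x w = (if w = x(m := x m - 1) then complex_of_real (sld_c G) * \<gamma> $ m * rt (x m) else 0)"

definition sld_diag :: "'k \<Rightarrow> ('k \<Rightarrow> nat) \<Rightarrow> ('k \<Rightarrow> nat) \<Rightarrow> complex" where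
  "sld_diag m x w = (if w = x then complex_of_real (sld_d G (\<gamma> $ m) (x m)) else 0)"

definition sld :: "('k \<Rightarrow> nat) mat" where
  "sld x w = (\<Sum>m\<in>S. sld_up m x w + sld_down m x w + sld_diag m x w)"

lemma finite_nbrs: "finite (nbrs x)" by (simp add: nbrs_def)

lemma nbrs_in: "x \<in> nbrs x" "m \<in> S \<Longrightarrow> x(m := Suc (x m)) \<in> nbrs x" "m \<in> S \<Longrightarrow> x(m := x m - 1) \<in> nbrs x"
  by (auto simp: nbrs_def)

lemma sld_eq_0: "w \<notin> nbrs x \<Longrightarrow> sld x w = 0"
  unfolding sld_def by (rule sum.neutral) (auto simp: sld_up_def sld_down_def sld_diag_def nbrs_def)

lemma sld_down_adjoint: "sld_down m w x = cnj (sld_up m x w)"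
proof (cases "w = x(m := Suc (x m))")
  case True
  then show ?thesis by (simp add: sld_down_def sld_up_def)
next
  case False
  then show ?thesis by (cases "w m") (auto simp: sld_down_def sld_up_def)
qed

lemma sld_hermitian: "sld w x = cnj (sld x w)"
proof -
  have "sld_up m w x = cnj (sld_down m x w)" for m by (simp add: sld_down_adjoint)
  moreover have "sld_diag m w x = cnj (sld_diag m x w)" for m by (simp add: sld_diag_def)
  ultimately show ?thesis by (simp add: sld_def sld_down_adjoint add_ac)
qed

lemma sum_single_neighbour:
  fixes f :: "('k \<Rightarrow> nat) \<Rightarrow> 'a::semiring_0"
  assumes "a \<in> nbrs x" shows "(\<Sum>w\<in>nbrs x. (if w = a then c else 0) * f w) = c * f a"
proof -
  have "(\<Sum>w\<in>nbrs x. (if w = a then c else 0) * f w) = (\<Sum>w\<in>nbrs x. if w = a then c * f a else 0)"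
    by (rule sum.cong) auto
  then show ?thesis using assms finite_nbrs by simp
qed

lemma sld_apply: "(\<Sum>w\<in>nbrs x. sld x w * f w) =
    (\<Sum>m\<in>S. complex_of_real (sld_c G) * cnj (\<gamma> $ m) * rt (Suc (x m)) * f (x(m := Suc (x m))) +
      complex_of_real (sld_c G) * \<gamma> $ m * rt (x m) * f (x(m := x m - 1)) +
      complex_of_real (sld_d G (\<gamma> $ m) (x m)) * f x)"
proof -
  have "(\<Sum>w\<in>nbrs x. sld x w * f w) =
      (\<Sum>m\<in>S. \<Sum>w\<in>nbrs x. sld_up m x w * f w + sld_down m x w * f w + sld_diag m x w * f w)"
    unfolding sld_def sum_distrib_right distrib_right by (rule sum.swap)
  also have "\<dots> = (\<Sum>m\<in>S. complex_of_real (sld_c G) * cnj (\<gamma> $ m) * rt (Suc (x m)) * f (x(m := Suc (x m))) +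
      complex_of_real (sld_c G) * \<gamma> $ m * rt (x m) * f (x(m := x m - 1)) +
      complex_of_real (sld_d G (\<gamma> $ m) (x m)) * f x)"
    unfolding sum.distrib sld_up_def sld_down_def sld_diag_def
    by (intro arg_cong2[of _ _ _ _ "(+)"] sum.cong refl sum_single_neighbour nbrs_in)
  finally show ?thesis .
qed

text \<open>The logarithmic derivative is unbounded but grows at most linearly in the photon number,
  so a finite mean photon number of the output supplies the summability required by
  \<open>QFI_eq\<close>.\<close>

lemma sld_row_norm:
  "(\<Sum>w\<in>nbrs x. cmod (sld x w)) \<le>
    (\<Sum>m\<in>S. (2 * \<bar>sld_c G\<bar> * cmod (\<gamma> $ m) + (1 / (G * (G - 1)) + 1 / G + (cmod (\<gamma> $ m))\<^sup>2 / ((2 * G - 1) * (G - 1)))) *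
      (1 + real (x m)))"
proof -
  have "(\<Sum>w\<in>nbrs x. cmod (sld x w)) \<le>
      (\<Sum>w\<in>nbrs x. \<Sum>m\<in>S. cmod (sld_up m x w) + cmod (sld_down m x w) + cmod (sld_diag m x w))"
    unfolding sld_def
    by (intro sum_mono order_trans[OF norm_sum] order_trans[OF norm_triangle_ineq] add_mono order_refl norm_triangle_ineq)
  also have "\<dots> = (\<Sum>m\<in>S. \<Sum>w\<in>nbrs x. cmod (sld_up m x w) + cmod (sld_down m x w) + cmod (sld_diag m x w))"
    by (rule sum.swap)
  also have "\<dots> \<le> (\<Sum>m\<in>S. (2 * \<bar>sld_c G\<bar> * cmod (\<gamma> $ m) +
      (1 / (G * (G - 1)) + 1 / G + (cmod (\<gamma> $ m))\<^sup>2 / ((2 * G - 1) * (G - 1)))) * (1 + real (x m)))"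
  proof (rule sum_mono)
    fix m assume m: "m \<in> S"
    let ?c = "\<bar>sld_c G\<bar> * cmod (\<gamma> $ m)"
    let ?e = "(cmod (\<gamma> $ m))\<^sup>2 / ((2 * G - 1) * (G - 1))"
    have n: "cmod (if P then c else 0) = (if P then cmod c else 0) * 1" for P c by simp
    have "(\<Sum>w\<in>nbrs x. cmod (sld_up m x w)) = ?c * cmod (rt (Suc (x m)))"
      unfolding sld_up_def n by (subst sum_single_neighbour) (use m in \<open>auto simp: nbrs_in norm_mult\<close>)
    moreover have "(\<Sum>w\<in>nbrs x. cmod (sld_down m x w)) = ?c * cmod (rt (x m))"
      unfolding sld_down_def n by (subst sum_single_neighbour[OF nbrs_in(3)[OF m]]) (simp add: norm_mult)
    moreover have "(\<Sum>w\<in>nbrs x. cmod (sld_diag m x w)) = \<bar>sld_d G (\<gamma> $ m) (x m)\<bar>"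
      unfolding sld_diag_def n by (subst sum_single_neighbour) (auto simp: nbrs_in)
    moreover have "sqrt (real a) \<le> 1 + real b" if "a \<le> Suc b" for a b
    proof (rule real_le_lsqrt)
      have "real a \<le> (1 + real b) * 1" using that by simp
      also have "\<dots> \<le> (1 + real b) * (1 + real b)" by (intro mult_left_mono) auto
      finally show "real a \<le> (1 + real b)\<^sup>2" by (simp only: power2_eq_square)
    qed auto
    then have "cmod (rt (Suc (x m))) \<le> 1 + real (x m)" "cmod (rt (x m)) \<le> 1 + real (x m)"
      by (simp_all add: rt_def del: of_nat_Suc)
    then have "?c * cmod (rt (Suc (x m))) \<le> ?c * (1 + real (x m))" "?c * cmod (rt (x m)) \<le> ?c * (1 + real (x m))"
      by (intro mult_left_mono; simp)+
    moreover have "\<bar>sld_d G (\<gamma> $ m) (x m)\<bar> \<le> (1 / (G * (G - 1)) + 1 / G + ?e) * (1 + real (x m))"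
    proof -
      have p: "1 / (G * (G - 1)) \<ge> 0" "1 / G \<ge> 0" "?e \<ge> 0" using G by auto
      have "\<bar>sld_d G (\<gamma> $ m) (x m)\<bar> \<le> 1 / (G * (G - 1)) * real (x m) + 1 / G + ?e"
        using p mult_nonneg_nonneg[OF p(1), of "real (x m)"] by (simp add: sld_d_def abs_le_iff)
      also have "\<dots> \<le> (1 / (G * (G - 1)) + 1 / G + ?e) * (1 + real (x m))"
        using p mult_nonneg_nonneg[OF p(2), of "real (x m)"] mult_nonneg_nonneg[OF p(3), of "real (x m)"]
        by (simp add: distrib_left distrib_right)
      finally show ?thesis .
    qed
    ultimately show "(\<Sum>w\<in>nbrs x. cmod (sld_up m x w) + cmod (sld_down m x w) + cmod (sld_diag m x w)) \<le>
        (2 * \<bar>sld_c G\<bar> * cmod (\<gamma> $ m) + (1 / (G * (G - 1)) + 1 / G + ?e)) * (1 + real (x m))"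
      unfolding sum.distrib distrib_right[of "2 * _ * _"] by linarith
  qed
  finally show ?thesis .
qed

lemma Xi_eq_sld: "Xi G S \<gamma> x y = (\<Sum>w\<in>nbrs x. sld x w * out G S \<gamma> w y)"
proof -
  have split: "(\<Prod>i\<in>UNIV. f i) = f m * (\<Prod>i\<in>UNIV - {m}. f i)" for f :: "'k \<Rightarrow> complex" and m
    by (rule prod.remove) auto
  let ?r = "\<lambda>m. \<Prod>i\<in>UNIV - {m}. mode G S \<gamma> i (x i) (y i)"
  have out_upd: "out G S \<gamma> (x(m := a)) y = ff G (\<gamma> $ m) a (y m) * ?r m" if "m \<in> S" for m a
    unfolding out_def by (subst split[of _ m]) (use that in \<open>auto simp: mode_in[OF G] intro!: prod.cong\<close>)
  have out_upd': "out G S \<gamma> x y = ff G (\<gamma> $ m) (x m) (y m) * ?r m" if "m \<in> S" for m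
    using out_upd[OF that, of "x m"] by simp
  have "(\<Prod>i\<in>UNIV. xi_mode G S \<gamma> m i (x i) (y i)) = xi G (\<gamma> $ m) (x m) (y m) * ?r m" for m
    by (subst split[of _ m]) (auto simp: xi_mode_def intro!: prod.cong)
  then have "Xi G S \<gamma> x y = (\<Sum>m\<in>S. xi G (\<gamma> $ m) (x m) (y m) * ?r m)" by (simp add: Xi_def)
  also have "\<dots> = (\<Sum>w\<in>nbrs x. sld x w * out G S \<gamma> w y)"
    unfolding sld_apply
  proof (rule sum.cong[OF refl])
    fix m assume m: "m \<in> S"
    show "xi G (\<gamma> $ m) (x m) (y m) * ?r m =
        complex_of_real (sld_c G) * cnj (\<gamma> $ m) * rt (Suc (x m)) * out G S \<gamma> (x(m := Suc (x m))) y +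
        complex_of_real (sld_c G) * \<gamma> $ m * rt (x m) * out G S \<gamma> (x(m := x m - 1)) y +
        complex_of_real (sld_d G (\<gamma> $ m) (x m)) * out G S \<gamma> x y"
      unfolding xi_tridiagonal[OF G] out_upd[OF m] out_upd'[OF m] distrib_right by (simp only: mult.assoc)
  qed
  finally show ?thesis .
qed

theorem coherent_QFI: "has_QFI (\<lambda>g. amplify g S (pure (coherent \<gamma>))) G (photon_QFI G S \<gamma>)"
proof -
  let ?u = "count_space (UNIV :: unit set)" and ?C = "\<lambda>_ :: unit. \<gamma>"
  let ?\<rho> = "amplify G S (pure (coherent \<gamma>))"
  have int1: "(\<integral>w. f w \<partial>?u) = f ()" for f :: "unit \<Rightarrow> 'b::{banach, second_countable_topology}"
    by (simp add: lebesgue_integral_count_space_finite UNIV_unit)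
  have u: "?C \<in> borel_measurable ?u" "emeasure ?u (space ?u) = 1"
    "integrable ?u (\<lambda>w. \<Sum>m\<in>S. (cmod (?C w $ m))\<^sup>2)"
    by (auto intro: integrable_count_space)
  note u = G u
  have mix: "mixture ?u ?C = pure (coherent \<gamma>)"
    by (simp add: mixture_def[OF u] int1 fun_eq_iff)
  have \<rho>: "?\<rho> x x' = (\<Sum>y\<in>A. out G S \<gamma> x y * cnj (out G S \<gamma> x' y))" if "finite A" "env_box x \<subseteq> A" for x x' A
    using amplify_mixture[OF u that, of x'] unfolding mix int1 .
  note dm = mix_density[OF u, unfolded mix]
  have boxes: "finite (\<Union>w\<in>nbrs x. env_box w)" "env_box x \<subseteq> (\<Union>w\<in>nbrs x. env_box w)" for x
    using finite_nbrs nbrs_in(1) by (auto simp: finite_env_box)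
  have Y: "mix_Y ?u ?C G S x z = (\<Sum>w\<in>nbrs x. sld x w * ?\<rho> w z)" for x z
  proof -
    let ?A = "\<Union>w\<in>nbrs x. env_box w"
    have "mix_Y ?u ?C G S x z = (\<Sum>y\<in>?A. Xi G S \<gamma> x y * cnj (out G S \<gamma> z y))"
      using mix_Y_eq[OF u boxes, of x z] unfolding int1 .
    also have "\<dots> = (\<Sum>w\<in>nbrs x. \<Sum>y\<in>?A. sld x w * (out G S \<gamma> w y * cnj (out G S \<gamma> z y)))"
      unfolding Xi_eq_sld sum_distrib_right mult.assoc by (rule sum.swap)
    also have "\<dots> = (\<Sum>w\<in>nbrs x. sld x w * ?\<rho> w z)"
      unfolding sum_distrib_left[symmetric]
      by (intro sum.cong refl arg_cong2[of _ _ _ _ "(*)"] \<rho>[symmetric] boxes) auto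
    finally show ?thesis .
  qed
  \<comment> \<open>For a single coherent state \<open>Xi\<close> is L applied to the output
    vectors, so the row of the upper bound is exactly the expectation of \<rho> in the row of L;
    this is why the bound is attained.\<close>
  have row: "dm_form ?\<rho> (trunc (nbrs x) (\<lambda>w. cnj (sld x w))) = mix_q ?u ?C G S x" for x
  proof -
    let ?A = "\<Union>w\<in>nbrs x. env_box w"
    have "dm_form ?\<rho> (trunc (nbrs x) (\<lambda>w. cnj (sld x w))) = (\<Sum>y\<in>?A. (cmod (Xi G S \<gamma> x y))\<^sup>2)"
    proof -
      have "(\<Sum>w\<in>nbrs x. \<Sum>z\<in>nbrs x. cnj (cnj (sld x w)) * ?\<rho> w z * cnj (sld x z)) =
          complex_of_real (\<Sum>y\<in>?A. (cmod (Xi G S \<gamma> x y))\<^sup>2)"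
        using mix_form[OF u finite_nbrs boxes(1), of x x "\<lambda>w. cnj (sld x w)"]
        unfolding mix int1 Xi_eq_sld complex_cnj_cnj by (simp add: UN_upper del: of_real_sum of_real_power)
      then show ?thesis unfolding dm_form_trunc[OF dm finite_nbrs] by (simp only: Re_complex_of_real)
    qed
    also have "\<dots> = (\<Sum>y\<in>env_box x. (cmod (Xi G S \<gamma> x y))\<^sup>2)"
      by (rule sum_env_box[OF G boxes(1), symmetric]) (use boxes(2) in \<open>auto simp: Xi_eq_0[OF G]\<close>)
    finally show ?thesis by (simp add: mix_q_def[OF u] int1)
  qed
  have diag: "Re (?\<rho> x x) = (\<Sum>y\<in>env_box x. (cmod (out G S \<gamma> x y))\<^sup>2)" for x
    unfolding \<rho>[OF finite_env_box order_refl] complex_norm_square[symmetric] by simp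
  \<comment> \<open>Together with \<open>sld_row_norm\<close>, the finite photon number of each
    amplified mode gives the absolute summability \<open>s\<close>.\<close>
  have moment: "(\<lambda>x. Re (?\<rho> x x) * (1 + real (x m))) summable_on UNIV" if m: "m \<in> S" for m
  proof -
    have "(\<lambda>x. \<Sum>y\<in>env_box x. real (x m) * (cmod (out G S \<gamma> x y))\<^sup>2) summable_on UNIV"
      by (rule has_sum_imp_summable, rule has_sum_box_rows, rule has_sum_infsum, rule out_mean_photons[OF G m])
        (simp add: out_eq_0[OF G])
    then have "(\<lambda>x. Re (?\<rho> x x) * real (x m)) summable_on UNIV"
      by (simp add: diag sum_distrib_left mult.commute)
    from summable_on_add[OF has_sum_imp_summable[OF dm_trace[OF dm]] this] show ?thesis
      by (simp add: distrib_left)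
  qed
  have s: "(\<lambda>(x, w). Re (?\<rho> x x) * cmod (sld x w)) summable_on UNIV"
  proof -
    have "(\<lambda>(x, w). Re (?\<rho> x x) * cmod (sld x w)) summable_on Sigma UNIV (\<lambda>_. UNIV)"
    proof (rule summable_on_SigmaI[where g = "\<lambda>x. Re (?\<rho> x x) * (\<Sum>w\<in>nbrs x. cmod (sld x w))"])
      show "((\<lambda>w. case (x, w) of (x, w) \<Rightarrow> Re (?\<rho> x x) * cmod (sld x w)) has_sum
          Re (?\<rho> x x) * (\<Sum>w\<in>nbrs x. cmod (sld x w))) UNIV" for x
        unfolding prod.case
        by (intro has_sum_cmult_right has_sum_finite_neutralI[OF finite_nbrs]) (auto simp: sld_eq_0)
      let ?C = "\<lambda>m. 2 * \<bar>sld_c G\<bar> * cmod (\<gamma> $ m) + (1 / (G * (G - 1)) + 1 / G + (cmod (\<gamma> $ m))\<^sup>2 / ((2 * G - 1) * (G - 1)))"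
      have "(\<lambda>x. \<Sum>m\<in>S. ?C m * (Re (?\<rho> x x) * (1 + real (x m)))) summable_on UNIV"
        by (rule has_sum_imp_summable, rule has_sum_finite_sum, rule has_sum_infsum)
          (intro summable_on_cmult_right moment)
      then show "(\<lambda>x. Re (?\<rho> x x) * (\<Sum>w\<in>nbrs x. cmod (sld x w))) summable_on UNIV"
      proof (rule summable_on_comparison_test)
        fix x
        have "Re (?\<rho> x x) * (\<Sum>w\<in>nbrs x. cmod (sld x w)) \<le> Re (?\<rho> x x) * (\<Sum>m\<in>S. ?C m * (1 + real (x m)))"
          by (rule mult_left_mono[OF sld_row_norm dm_diag_nonneg[OF dm]])
        then show "Re (?\<rho> x x) * (\<Sum>w\<in>nbrs x. cmod (sld x w)) \<le> (\<Sum>m\<in>S. ?C m * (Re (?\<rho> x x) * (1 + real (x m))))"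
          by (simp only: sum_distrib_left mult.left_commute)
      qed (auto intro!: mult_nonneg_nonneg sum_nonneg dm_diag_nonneg[OF dm])
    qed (auto intro!: mult_nonneg_nonneg dm_diag_nonneg[OF dm])
    then show ?thesis by simp
  qed
  have "(mix_q ?u ?C G S has_sum photon_QFI G S \<gamma>) UNIV"
    using mix_q_has_sum[OF u] unfolding int1 .
  then have K: "((\<lambda>x. dm_form ?\<rho> (trunc (nbrs x) (\<lambda>w. cnj (sld x w)))) has_sum photon_QFI G S \<gamma>) UNIV"
    unfolding row .
  have Y': "mix_Y ?u ?C G S = (\<lambda>x z. \<Sum>w\<in>nbrs x. sld x w * ?\<rho> w z)"
    by (intro ext Y)
  show ?thesis
    by (rule QFI_eq[OF dm infinite_UNIV_modes mix_derivative[OF u, unfolded mix Y'] finite_nbrs sld_eq_0 sld_hermitian s K])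
qed

end

theorem mainTheorem6:
  fixes M :: nat and N G :: real
  assumes "M \<ge> 1" and "N \<ge> 0" and "G > 1"
  shows
    "(\<forall>n :: 'm::finite \<Rightarrow> real.
        CARD('m) = M \<and> (\<forall>m. n m \<ge> 0) \<and> (\<Sum>m\<in>UNIV. n m) = N \<longrightarrow>
        has_QFI (\<lambda>g. amplify g UNIV (pure (coherent (\<chi> m. complex_of_real (sqrt (n m))))))
          G (N / (G * (2 * G - 1)) + real M / (G * (G - 1)))) \<and>
     (\<forall>(S :: 'k::finite set) (P :: complex ^ 'k \<Rightarrow> real).
        card S = M \<and> probability_density P \<and> has_mean_photon_number S P N \<longrightarrow>
        (\<exists>K. has_QFI (\<lambda>g. amplify g S (classical_state P)) G K \<and>
             K \<le> N / (G * (2 * G - 1)) + real M / (G * (G - 1))))"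
proof (intro conjI allI impI; elim conjE)
  fix n :: "'m \<Rightarrow> real"
  assume n: "CARD('m) = M" "\<forall>m. n m \<ge> 0" "(\<Sum>m\<in>UNIV. n m) = N"
  let ?\<gamma> = "\<chi> m. complex_of_real (sqrt (n m))"
  have "photon_QFI G UNIV ?\<gamma> = N / (G * (2 * G - 1)) + real M / (G * (G - 1))"
    using n by (simp add: photon_QFI_def)
  with coherent_QFI[OF assms(3), of UNIV ?\<gamma>]
  show "has_QFI (\<lambda>g. amplify g UNIV (pure (coherent ?\<gamma>))) G (N / (G * (2 * G - 1)) + real M / (G * (G - 1)))"
    by simp
next
  fix S :: "'k set" and P :: "complex ^ 'k \<Rightarrow> real"
  assume S: "card S = M" and P: "probability_density P" and m: "has_mean_photon_number S P N"
  have P': "P \<in> borel_measurable lborel" "AE \<gamma> in lborel. 0 \<le> P \<gamma>" "(\<integral>\<^sup>+\<gamma>. ennreal (P \<gamma>) \<partial>lborel) = 1"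
    using P unfolding probability_density_def by auto
  let ?\<nu> = "density lborel P"
  have photons_meas: "(\<lambda>\<gamma> :: complex ^ 'k. \<Sum>m\<in>S. (cmod (\<gamma> $ m))\<^sup>2) \<in> borel_measurable lborel"
    by (simp, rule borel_measurable_continuous_onI) (intro continuous_intros)
  have photons: "has_bochner_integral ?\<nu> (\<lambda>\<gamma>. \<Sum>m\<in>S. (cmod (\<gamma> $ m))\<^sup>2) N"
    using m integrable_real_density[OF P'(1,2) photons_meas] integral_real_density[OF P'(1,2) photons_meas]
    by (simp add: has_mean_photon_number_def has_bochner_integral_iff)
  have u: "(\<lambda>\<gamma>. \<gamma>) \<in> borel_measurable ?\<nu>" "emeasure ?\<nu> (space ?\<nu>) = 1"
    "integrable ?\<nu> (\<lambda>\<gamma>. \<Sum>m\<in>S. (cmod (\<gamma> $ m))\<^sup>2)"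
    using P' photons by (auto simp: emeasure_density has_bochner_integral_iff)
  note u = assms(3) u
  have "(\<lambda>\<gamma>. pure (coherent \<gamma>) x x') \<in> borel_measurable (lborel :: (complex ^ 'k) measure)" for x x'
    unfolding pure_def
    by (simp, rule borel_measurable_continuous_onI) (intro continuous_intros coherent_continuous)
  then have mix: "mixture ?\<nu> (\<lambda>\<gamma>. \<gamma>) = classical_state P"
    unfolding mixture_def[OF u] classical_state_def
    by (intro ext) (simp add: integral_density[OF _ P'(1,2)] scaleR_conv_of_real)
  \<comment> \<open>The integrand is affine in the total signal photon number, so only its mean N
    enters.\<close>
  have "(\<integral>\<gamma>. photon_QFI G S \<gamma> \<partial>?\<nu>) = N / (G * (2 * G - 1)) + real M / (G * (G - 1))"
  proof -
    have "(\<integral>\<gamma>. photon_QFI G S \<gamma> \<partial>?\<nu>) =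
        (\<integral>\<gamma>. (\<Sum>m\<in>S. (cmod (\<gamma> $ m))\<^sup>2) / (G * (2 * G - 1)) \<partial>?\<nu>) + (\<integral>\<gamma>. real (card S) / (G * (G - 1)) \<partial>?\<nu>)"
      unfolding photon_QFI_def
      by (intro Bochner_Integration.integral_add Bochner_Integration.integrable_divide u(4) const_integrable[OF u])
    also have "\<dots> = N / (G * (2 * G - 1)) + real M / (G * (G - 1))"
      using photons by (simp only: const_integral[OF u] S has_bochner_integral_iff integral_divide_zero)
    finally show ?thesis .
  qed
  then show "\<exists>K. has_QFI (\<lambda>g. amplify g S (classical_state P)) G K \<and> K \<le> N / (G * (2 * G - 1)) + real M / (G * (G - 1))"
    using mixture_QFI_le[OF u] unfolding mix by simp
qed

end
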